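(* Let $X$ be a Hausdorff filtered space of dimension $n$, let $\bar p$ be a traditional perversity or a superperversity, and let $\mathcal G$ be a local coefficient system of $R$-modules on $X-X^{n-1}$. Then the sheaf complex $\mathcal{IS}^*$ of intersection chains on $X$ with coefficients in $\mathcal G_0$ is homotopically fine.
   Context: Filtered spaces. A filtered space of dimension $n$ is a space $X$ with closed subspaces $\emptyset=X^{-1}\subset X^0\subset\cdots\subset X^n=X$ (equalities allowed); the strata are the sets $X^j-X^{j-1}$. Perversities. A perversity is $\bar p:\mathbb Z^{\ge 1}\to\mathbb Z$ with $\bar p(k)\le\bar p(k+1)\le\bar p(k)+1$; it is traditional if $\bar p(1)=\bar p(2)=0$ and a superperversity if $\bar p(2)>0$. Coefficients $\mathcal G_0$ and intersection chains. For a local coefficient system (bundle of $R$-modules) $\mathcal G$ on $X-X^{n-1}$, $\mathcal G_0$ denotes the pair consisting of $\mathcal G$ on $X-X^{n-1}$ and the zero system on $X^{n-1}$. A coefficient in $\mathcal G_0$ of a singular simplex $\sigma:\Delta^i\to X$ is a continuous lift $n$ of $\sigma|_{\sigma^{-1}(X-X^{n-1})}$ to $\mathcal G$ (points of $\sigma^{-1}(X^{n-1})$ carry $0$), with stalkwise operations; it is the zero coefficient if it is zero everywhere. Locally-finite chains are possibly infinite formal sums $\sum n_j\sigma_j$ such that each point of $X$ has a neighborhood meeting the images of only finitely many $\sigma_j$ with $n_j\ne0$. Simplices with zero coefficient are discarded; the support $|\xi|$ of a chain is the union of the images of its simplices with nonzero coefficient. The boundary is $\partial(n\sigma)=\sum_j(-1)^j(n\circ\mathfrak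 i_j)(\sigma\circ\mathfrak i_j)$, $\mathfrak i_j$ the face maps, the coefficient being restricted to the face. $\sigma:\Delta^i\to X$ is $\bar p$ allowable if for each $k\ge1$ the set $\sigma^{-1}(X^{n-k}-X^{n-k-1})$ lies in the $(i-k+\bar p(k))$-skeleton of $\Delta^i$. A chain $\xi$ is allowable if every simplex with nonzero coefficient in $\xi$ and in $\partial\xi$ is allowable. $I^{\bar p}C^\infty_*(X;\mathcal G_0)$ is the complex of locally-finite allowable chains. For a subspace $U\subset X$, $I^{\bar p}C^\infty_*(X,U;\mathcal G_0)$ is the quotient of $I^{\bar p}C^\infty_*(X;\mathcal G_0)$ by the subcomplex of allowable chains of $X$ with support in $U$. The sheaf $\mathcal{IS}^*$. $IS^*$ is the differential graded presheaf $U\mapsto IS^j(U)=I^{\bar p}C^\infty_{n-j}(X,X-\bar U;\mathcal G_0)$, with restriction maps the quotient maps and differential induced by $\partial$; $\mathcal{IS}^*$ is its sheafification. Homotopically fine. A differential graded sheaf $\mathcal L^*$ on $X$ is homotopically fine if for every locally-finite open covering $\{U_k\}$ of $X$ there exist endomorphisms $1_k$ of $\mathcal L^*$ of degree $0$ (not necessarily chain maps) and an endomorphism $D$ of $\mathcal L^*$ of degree $-1$ such that the support of $1_k$ is contained in $\bar U_k$ (i.e. $1_k$ is zero on stalks outside $\bar U_k$) and $\sum_k 1_k=\mathrm{id}-\partial D-D\partial$, where $\partial$ is the differential of $\mathcal L^*$. *)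

theory Defs
  imports "HOL-Homology.Simplices" "HOL-Algebra.Module" "HOL-Algebra.AbelCoset"
begin

section \<open>Modules\<close>

text \<open>The axioms of \<^locale>\<open>module\<close>, but over a ring that need not be commutative.\<close>

locale left_module = R?: ring R + M?: abelian_group M
  for R :: "'r ring" (structure) and M :: "('r, 'm) module" (structure) +
  assumes smult_closed:
      "\<lbrakk>a \<in> carrier R; x \<in> carrier M\<rbrakk> \<Longrightarrow> a \<odot>\<^bsub>M\<^esub> x \<in> carrier M"
    and smult_l_distr:
      "\<lbrakk>a \<in> carrier R; b \<in> carrier R; x \<in> carrier M\<rbrakk>
        \<Longrightarrow> (a \<oplus>\<^bsub>R\<^esub> b) \<odot>\<^bsub>M\<^esub> x = a \<odot>\<^bsub>M\<^esub> x \<oplus>\<^bsub>M\<^esub> b \<odot>\<^bsub>M\<^esub> x"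
    and smult_r_distr:
      "\<lbrakk>a \<in> carrier R; x \<in> carrier M; y \<in> carrier M\<rbrakk>
        \<Longrightarrow> a \<odot>\<^bsub>M\<^esub> (x \<oplus>\<^bsub>M\<^esub> y) = a \<odot>\<^bsub>M\<^esub> x \<oplus>\<^bsub>M\<^esub> a \<odot>\<^bsub>M\<^esub> y"
    and smult_assoc:
      "\<lbrakk>a \<in> carrier R; b \<in> carrier R; x \<in> carrier M\<rbrakk>
        \<Longrightarrow> (a \<otimes>\<^bsub>R\<^esub> b) \<odot>\<^bsub>M\<^esub> x = a \<odot>\<^bsub>M\<^esub> (b \<odot>\<^bsub>M\<^esub> x)"
    and smult_one: "x \<in> carrier M \<Longrightarrow> \<one>\<^bsub>R\<^esub> \<odot>\<^bsub>M\<^esub> x = x"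

definition linear_maps :: "'r ring \<Rightarrow> ('r, 'm) module \<Rightarrow> ('r, 'k) module \<Rightarrow> ('m \<Rightarrow> 'k) set" where
  "linear_maps R M N =
    {f. f \<in> carrier M \<rightarrow> carrier N
      \<and> (\<forall>x\<in>carrier M. \<forall>y\<in>carrier M. f (x \<oplus>\<^bsub>M\<^esub> y) = f x \<oplus>\<^bsub>N\<^esub> f y)
      \<and> (\<forall>r\<in>carrier R. \<forall>x\<in>carrier M. f (r \<odot>\<^bsub>M\<^esub> x) = r \<odot>\<^bsub>N\<^esub> f x)}"

text \<open>A \<^type>\<open>module\<close> record has (irrelevant) fields for a ring multiplication and its unit.\<close>

definition mk_module ::
    "'m set \<Rightarrow> 'm \<Rightarrow> ('m \<Rightarrow> 'm \<Rightarrow> 'm) \<Rightarrow> ('r \<Rightarrow> 'm \<Rightarrow> 'm) \<Rightarrow> ('r, 'm) module" where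
  "mk_module C z a s =
    \<lparr>carrier = C, monoid.mult = undefined, monoid.one = undefined,
      ring.zero = z, ring.add = a, module.smult = s\<rparr>"

definition quotient_module :: "('r, 'm) module \<Rightarrow> 'm set \<Rightarrow> ('r, 'm set) module" where
  "quotient_module M N =
    mk_module (a_rcosets\<^bsub>M\<^esub> N) N (\<lambda>A B. A <+>\<^bsub>M\<^esub> B)
      (\<lambda>r A. \<Union>x\<in>A. N +>\<^bsub>M\<^esub> (r \<odot>\<^bsub>M\<^esub> x))"

text \<open>The map \<open>M/N \<rightarrow> M'/N'\<close> induced by \<open>f : M \<rightarrow> M'\<close> with \<open>f N \<subseteq> N'\<close>: all cosets in the union
  coincide.\<close>

definition quotient_map_to ::
    "('r, 'k) module \<Rightarrow> 'k set \<Rightarrow> ('m \<Rightarrow> 'k) \<Rightarrow> 'm set \<Rightarrow> 'k set" where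
  "quotient_map_to M' N' f A = (\<Union>x\<in>A. N' +>\<^bsub>M'\<^esub> f x)"


section \<open>Filtered spaces, perversities, local coefficient systems\<close>

text \<open>\<open>F j\<close> is \<open>X\<^sup>j\<close>; it is indexed by the integers, with \<open>X\<^sup>j\<close> empty for all \<open>j < 0\<close>, so
  that \<open>X\<^sup>n\<^sup>-\<^sup>k\<close> makes sense for every \<open>k\<close>. Values \<open>F j\<close> with \<open>j > n\<close> are never used.\<close>

definition filtered_space :: "'a topology \<Rightarrow> nat \<Rightarrow> (int \<Rightarrow> 'a set) \<Rightarrow> bool" where
  "filtered_space X n F \<longleftrightarrow>
    (\<forall>j<0. F j = {}) \<and> F (int n) = topspace X
    \<and> (\<forall>j. 0 \<le> j \<and> j \<le> int n \<longrightarrow> closedin X (F j) \<and> F (j - 1) \<subseteq> F j)"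

abbreviation regular_part :: "'a topology \<Rightarrow> nat \<Rightarrow> (int \<Rightarrow> 'a set) \<Rightarrow> 'a set" where
  "regular_part X n F \<equiv> topspace X - F (int n - 1)"

text \<open>Only the values at \<open>k \<ge> 1\<close> matter.\<close>

definition perversity :: "(nat \<Rightarrow> int) \<Rightarrow> bool" where
  "perversity p \<longleftrightarrow> (\<forall>k\<ge>1. p k \<le> p (k + 1) \<and> p (k + 1) \<le> p k + 1)"

definition traditional_perversity :: "(nat \<Rightarrow> int) \<Rightarrow> bool" where
  "traditional_perversity p \<longleftrightarrow> perversity p \<and> p 1 = 0 \<and> p 2 = 0"

definition superperversity :: "(nat \<Rightarrow> int) \<Rightarrow> bool" where
  "superperversity p \<longleftrightarrow> perversity p \<and> p 2 > 0"

record ('a, 'e, 'r) local_system =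
  total :: "'e topology"
  proj :: "'e \<Rightarrow> 'a"
  fiber :: "'a \<Rightarrow> ('r, 'e) module"

text \<open>Bundles of \<open>R\<close>-modules with discrete fibers over \<open>Y\<close>. Taking the model fiber \<open>M\<close> in the type
  of the total space is no restriction, since it can be replaced by an actual fiber.\<close>

definition local_coefficient_system ::
    "'r ring \<Rightarrow> 'a topology \<Rightarrow> ('a, 'e, 'r) local_system \<Rightarrow> bool" where
  "local_coefficient_system R Y G \<longleftrightarrow>
    continuous_map (total G) Y (proj G)
    \<and> (\<forall>y\<in>topspace Y. left_module R (fiber G y)
          \<and> carrier (fiber G y) = {e \<in> topspace (total G). proj G e = y})
    \<and> (\<forall>y\<in>topspace Y. \<exists>V (M :: ('r, 'e) module) \<phi>.
          openin Y V \<and> y \<in> V \<and> left_module R M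
          \<and> homeomorphic_map (subtopology (total G) {e \<in> topspace (total G). proj G e \<in> V})
               (prod_topology (subtopology Y V) (discrete_topology (carrier M))) \<phi>
          \<and> (\<forall>e\<in>topspace (total G). proj G e \<in> V \<longrightarrow> fst (\<phi> e) = proj G e)
          \<and> (\<forall>z\<in>V. (\<lambda>e. snd (\<phi> e)) \<in> linear_maps R (fiber G z) M))"


section \<open>Locally-finite intersection chains with coefficients in \<open>G\<^sub>0\<close>\<close>

text \<open>Chain degrees are integers, and there are no simplices in negative degrees; as chains
  are extensional functions on simplices, the chain modules in negative degrees are zero.\<close>

definition simplices :: "'a topology \<Rightarrow> int \<Rightarrow> ((nat \<Rightarrow> real) \<Rightarrow> 'a) set" where
  "simplices X i = {\<sigma>. 0 \<le> i \<and> singular_simplex (nat i) X \<sigma>}"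

text \<open>In the following \<open>S\<close> is the subset of the space over which \<open>G\<close> lives. A coefficient in
  \<open>G\<^sub>0\<close> is encoded by its values on the preimage of \<open>S\<close> (it carries 0 elsewhere) and is made
  canonical by extensionality.\<close>

definition lift_domain :: "'a set \<Rightarrow> int \<Rightarrow> ((nat \<Rightarrow> real) \<Rightarrow> 'a) \<Rightarrow> (nat \<Rightarrow> real) set" where
  "lift_domain S i \<sigma> = {t \<in> standard_simplex (nat i). \<sigma> t \<in> S}"

definition coefficients ::
    "'a set \<Rightarrow> ('a, 'e, 'r) local_system \<Rightarrow> int \<Rightarrow> ((nat \<Rightarrow> real) \<Rightarrow> 'a)
      \<Rightarrow> ('r, (nat \<Rightarrow> real) \<Rightarrow> 'e) module" where
  "coefficients S G i \<sigma> =
    mk_module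
      {m \<in> extensional (lift_domain S i \<sigma>).
        continuous_map (subtopology (powertop_real UNIV) (lift_domain S i \<sigma>)) (total G) m
        \<and> (\<forall>t\<in>lift_domain S i \<sigma>. proj G (m t) = \<sigma> t)}
      (\<lambda>t\<in>lift_domain S i \<sigma>. \<zero>\<^bsub>fiber G (\<sigma> t)\<^esub>)
      (\<lambda>m m'. \<lambda>t\<in>lift_domain S i \<sigma>. m t \<oplus>\<^bsub>fiber G (\<sigma> t)\<^esub> m' t)
      (\<lambda>r m. \<lambda>t\<in>lift_domain S i \<sigma>. r \<odot>\<^bsub>fiber G (\<sigma> t)\<^esub> m t)"

type_synonym ('a, 'e) coeff_chain = "((nat \<Rightarrow> real) \<Rightarrow> 'a) \<Rightarrow> ((nat \<Rightarrow> real) \<Rightarrow> 'e)"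

definition chain_simplices ::
    "'a topology \<Rightarrow> 'a set \<Rightarrow> ('a, 'e, 'r) local_system \<Rightarrow> int \<Rightarrow> ('a, 'e) coeff_chain
      \<Rightarrow> ((nat \<Rightarrow> real) \<Rightarrow> 'a) set" where
  "chain_simplices X S G i c = {\<sigma> \<in> simplices X i. c \<sigma> \<noteq> \<zero>\<^bsub>coefficients S G i \<sigma>\<^esub>}"

definition chain_support ::
    "'a topology \<Rightarrow> 'a set \<Rightarrow> ('a, 'e, 'r) local_system \<Rightarrow> int \<Rightarrow> ('a, 'e) coeff_chain \<Rightarrow> 'a set" where
  "chain_support X S G i c = (\<Union>\<sigma>\<in>chain_simplices X S G i c. \<sigma> ` standard_simplex (nat i))"

definition locally_finite_chains ::
    "'a topology \<Rightarrow> 'a set \<Rightarrow> ('a, 'e, 'r) local_system \<Rightarrow> int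
      \<Rightarrow> ('r, ('a, 'e) coeff_chain) module" where
  "locally_finite_chains X S G i =
    mk_module
      {c \<in> (\<Pi>\<^sub>E \<sigma>\<in>simplices X i. carrier (coefficients S G i \<sigma>)).
        \<forall>x\<in>topspace X. \<exists>V. openin X V \<and> x \<in> V
          \<and> finite {\<sigma> \<in> chain_simplices X S G i c. \<sigma> ` standard_simplex (nat i) \<inter> V \<noteq> {}}}
      (\<lambda>\<sigma>\<in>simplices X i. \<zero>\<^bsub>coefficients S G i \<sigma>\<^esub>)
      (\<lambda>c c'. \<lambda>\<sigma>\<in>simplices X i. c \<sigma> \<oplus>\<^bsub>coefficients S G i \<sigma>\<^esub> c' \<sigma>)
      (\<lambda>r c. \<lambda>\<sigma>\<in>simplices X i. r \<odot>\<^bsub>coefficients S G i \<sigma>\<^esub> c \<sigma>)"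

text \<open>The summand \<open>(-1)\<^sup>k (m \<circ> \<i>\<^sub>k)\<close> contributed by the \<open>k\<close>-th face of a simplex \<open>\<sigma>\<close> with
  coefficient \<open>m\<close> to the coefficient of \<open>\<tau> = \<sigma> \<circ> \<i>\<^sub>k\<close>.\<close>

definition face_coefficient ::
    "'a set \<Rightarrow> ('a, 'e, 'r) local_system \<Rightarrow> int \<Rightarrow> ((nat \<Rightarrow> real) \<Rightarrow> 'a) \<Rightarrow> nat
      \<Rightarrow> ((nat \<Rightarrow> real) \<Rightarrow> 'e) \<Rightarrow> ((nat \<Rightarrow> real) \<Rightarrow> 'e)" where
  "face_coefficient S G i \<tau> k m =
    (let m' = restrict (m \<circ> simplical_face k) (lift_domain S (i - 1) \<tau>)
     in if even k then m' else \<ominus>\<^bsub>coefficients S G (i - 1) \<tau>\<^esub> m')"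

text \<open>For a locally-finite chain the sums are finite, because the image of \<open>\<tau>\<close> is nonempty.\<close>

definition boundary ::
    "'a topology \<Rightarrow> 'a set \<Rightarrow> ('a, 'e, 'r) local_system \<Rightarrow> int
      \<Rightarrow> ('a, 'e) coeff_chain \<Rightarrow> ('a, 'e) coeff_chain" where
  "boundary X S G i c =
    (\<lambda>\<tau>\<in>simplices X (i - 1).
      finsum (coefficients S G (i - 1) \<tau>) (\<lambda>(\<sigma>, k). face_coefficient S G i \<tau> k (c \<sigma>))
        {(\<sigma>, k). \<sigma> \<in> chain_simplices X S G i c \<and> k \<le> nat i \<and> singular_face (nat i) k \<sigma> = \<tau>})"

text \<open>A point of the simplex lies in the \<open>m\<close>-skeleton iff it has at most \<open>m + 1\<close> nonzero
  barycentric coordinates; the skeleton is empty for \<open>m < 0\<close>.\<close>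

definition simplex_skeleton :: "int \<Rightarrow> int \<Rightarrow> (nat \<Rightarrow> real) set" where
  "simplex_skeleton i m = {t \<in> standard_simplex (nat i). int (card {l. t l \<noteq> 0}) \<le> m + 1}"

definition allowable_simplex ::
    "nat \<Rightarrow> (int \<Rightarrow> 'a set) \<Rightarrow> (nat \<Rightarrow> int) \<Rightarrow> int \<Rightarrow> ((nat \<Rightarrow> real) \<Rightarrow> 'a) \<Rightarrow> bool" where
  "allowable_simplex n F p i \<sigma> \<longleftrightarrow>
    (\<forall>k\<ge>1. {t \<in> standard_simplex (nat i). \<sigma> t \<in> F (int n - int k) - F (int n - int k - 1)}
      \<subseteq> simplex_skeleton i (i - int k + p k))"

definition allowable_chain ::
    "'a topology \<Rightarrow> nat \<Rightarrow> (int \<Rightarrow> 'a set) \<Rightarrow> (nat \<Rightarrow> int) \<Rightarrow> ('a, 'e, 'r) local_system \<Rightarrow> int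
      \<Rightarrow> ('a, 'e) coeff_chain \<Rightarrow> bool" where
  "allowable_chain X n F p G i c \<longleftrightarrow>
    (let S = regular_part X n F in
      (\<forall>\<sigma>\<in>chain_simplices X S G i c. allowable_simplex n F p i \<sigma>)
      \<and> (\<forall>\<tau>\<in>chain_simplices X S G (i - 1) (boundary X S G i c). allowable_simplex n F p (i - 1) \<tau>))"

definition intersection_chains ::
    "'a topology \<Rightarrow> nat \<Rightarrow> (int \<Rightarrow> 'a set) \<Rightarrow> (nat \<Rightarrow> int) \<Rightarrow> ('a, 'e, 'r) local_system \<Rightarrow> int
      \<Rightarrow> ('r, ('a, 'e) coeff_chain) module" where
  "intersection_chains X n F p G i =
    (let C = locally_finite_chains X (regular_part X n F) G i
     in C\<lparr>carrier := {c \<in> carrier C. allowable_chain X n F p G i c}\<rparr>)"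

definition intersection_chains_in ::
    "'a topology \<Rightarrow> nat \<Rightarrow> (int \<Rightarrow> 'a set) \<Rightarrow> (nat \<Rightarrow> int) \<Rightarrow> ('a, 'e, 'r) local_system \<Rightarrow> int
      \<Rightarrow> 'a set \<Rightarrow> ('a, 'e) coeff_chain set" where
  "intersection_chains_in X n F p G i U =
    {c \<in> carrier (intersection_chains X n F p G i).
      chain_support X (regular_part X n F) G i c \<subseteq> U}"


section \<open>Differential graded presheaves and sheafification\<close>

text \<open>\<open>sections L j U\<close> is \<open>L\<^sup>j(U)\<close>, \<open>restr L j U V\<close> is the restriction \<open>L\<^sup>j(U) \<rightarrow> L\<^sup>j(V)\<close>, and
  \<open>differential L j U\<close> is the differential \<open>L\<^sup>j(U) \<rightarrow> L\<^sup>j\<^sup>+\<^sup>1(U)\<close>.\<close>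

record ('a, 'r, 'm) dg_presheaf =
  sections :: "int \<Rightarrow> 'a set \<Rightarrow> ('r, 'm) module"
  restr :: "int \<Rightarrow> 'a set \<Rightarrow> 'a set \<Rightarrow> 'm \<Rightarrow> 'm"
  differential :: "int \<Rightarrow> 'a set \<Rightarrow> 'm \<Rightarrow> 'm"

definition germ ::
    "'a topology \<Rightarrow> ('a, 'r, 'm) dg_presheaf \<Rightarrow> int \<Rightarrow> 'a \<Rightarrow> 'a set \<Rightarrow> 'm \<Rightarrow> ('a set \<times> 'm) set" where
  "germ X L j x U s =
    {(V, t). openin X V \<and> x \<in> V \<and> t \<in> carrier (sections L j V)
      \<and> (\<exists>W. openin X W \<and> x \<in> W \<and> W \<subseteq> U \<inter> V \<and> restr L j U W s = restr L j V W t)}"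

text \<open>As for quotient modules, the unions below are over representatives and all members coincide.\<close>

definition stalk ::
    "'a topology \<Rightarrow> ('a, 'r, 'm) dg_presheaf \<Rightarrow> int \<Rightarrow> 'a \<Rightarrow> ('r, ('a set \<times> 'm) set) module" where
  "stalk X L j x =
    mk_module
      {germ X L j x U s | U s. openin X U \<and> x \<in> U \<and> s \<in> carrier (sections L j U)}
      (germ X L j x (topspace X) \<zero>\<^bsub>sections L j (topspace X)\<^esub>)
      (\<lambda>A B. \<Union>(U, s)\<in>A. \<Union>(V, t)\<in>B. germ X L j x (U \<inter> V)
         (restr L j U (U \<inter> V) s \<oplus>\<^bsub>sections L j (U \<inter> V)\<^esub> restr L j V (U \<inter> V) t))
      (\<lambda>r A. \<Union>(U, s)\<in>A. germ X L j x U (r \<odot>\<^bsub>sections L j U\<^esub> s))"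

text \<open>The map \<open>L\<^sup>j\<^sub>x \<rightarrow> L\<^sup>j\<^sup>+\<^sup>d\<^sub>x\<close> on stalks induced by maps \<open>f j U : L\<^sup>j(U) \<rightarrow> L\<^sup>j\<^sup>+\<^sup>d(U)\<close>.\<close>

definition stalk_map ::
    "'a topology \<Rightarrow> ('a, 'r, 'm) dg_presheaf \<Rightarrow> int \<Rightarrow> (int \<Rightarrow> 'a set \<Rightarrow> 'm \<Rightarrow> 'm) \<Rightarrow> int \<Rightarrow> 'a
      \<Rightarrow> ('a set \<times> 'm) set \<Rightarrow> ('a set \<times> 'm) set" where
  "stalk_map X L d f j x A = (\<Union>(U, s)\<in>A. germ X L (j + d) x U (f j U s))"

definition sheafification ::
    "'a topology \<Rightarrow> ('a, 'r, 'm) dg_presheaf \<Rightarrow> ('a, 'r, 'a \<Rightarrow> ('a set \<times> 'm) set) dg_presheaf" where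
  "sheafification X P =
    \<lparr>sections = (\<lambda>j U. mk_module
        {f \<in> (\<Pi>\<^sub>E x\<in>U. carrier (stalk X P j x)).
          \<forall>x\<in>U. \<exists>V s. openin X V \<and> x \<in> V \<and> V \<subseteq> U \<and> s \<in> carrier (sections P j V)
            \<and> (\<forall>y\<in>V. f y = germ X P j y V s)}
        (\<lambda>x\<in>U. \<zero>\<^bsub>stalk X P j x\<^esub>)
        (\<lambda>f g. \<lambda>x\<in>U. f x \<oplus>\<^bsub>stalk X P j x\<^esub> g x)
        (\<lambda>r f. \<lambda>x\<in>U. r \<odot>\<^bsub>stalk X P j x\<^esub> f x)),
     restr = (\<lambda>j U V f. restrict f V),
     differential = (\<lambda>j U f. \<lambda>x\<in>U. stalk_map X P 1 (differential P) j x (f x))\<rparr>"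

definition graded_endomorphism ::
    "'r ring \<Rightarrow> 'a topology \<Rightarrow> ('a, 'r, 'm) dg_presheaf \<Rightarrow> int \<Rightarrow> (int \<Rightarrow> 'a set \<Rightarrow> 'm \<Rightarrow> 'm) \<Rightarrow> bool" where
  "graded_endomorphism R X L d f \<longleftrightarrow>
    (\<forall>j U. openin X U \<longrightarrow> f j U \<in> linear_maps R (sections L j U) (sections L (j + d) U))
    \<and> (\<forall>j U V. openin X U \<and> openin X V \<and> V \<subseteq> U \<longrightarrow>
        (\<forall>s\<in>carrier (sections L j U). restr L (j + d) U V (f j U s) = f j V (restr L j U V s)))"

definition locally_finite_open_cover :: "'a topology \<Rightarrow> 'i set \<Rightarrow> ('i \<Rightarrow> 'a set) \<Rightarrow> bool" where
  "locally_finite_open_cover X I U \<longleftrightarrow>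
    (\<forall>k\<in>I. openin X (U k)) \<and> (\<Union>k\<in>I. U k) = topspace X
    \<and> (\<forall>x\<in>topspace X. \<exists>V. openin X V \<and> x \<in> V \<and> finite {k \<in> I. U k \<inter> V \<noteq> {}})"

text \<open>To be applied to differential graded sheaves. The first argument only supplies the type
  from which the index sets of coverings are taken. The identity of sheaf maps
  \<open>\<Sum>\<^sub>k 1\<^sub>k = id - \<partial>D - D\<partial>\<close> is expressed on stalks: at \<open>x\<close> the only \<open>1\<^sub>k\<close> that can be nonzero are
  those with \<open>x\<close> in the closure of \<open>U\<^sub>k\<close>, of which there are finitely many.\<close>

definition homotopically_fine ::
    "'i itself \<Rightarrow> 'r ring \<Rightarrow> 'a topology \<Rightarrow> ('a, 'r, 'm) dg_presheaf \<Rightarrow> bool" where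
  "homotopically_fine _ R X L \<longleftrightarrow>
    (\<forall>(I :: 'i set) U. locally_finite_open_cover X I U \<longrightarrow>
      (\<exists>e D.
        (\<forall>k\<in>I. graded_endomorphism R X L 0 (e k))
        \<and> graded_endomorphism R X L (-1) D
        \<and> (\<forall>k\<in>I. \<forall>j. \<forall>x\<in>topspace X - X closure_of U k. \<forall>a\<in>carrier (stalk X L j x).
              stalk_map X L 0 (e k) j x a = \<zero>\<^bsub>stalk X L j x\<^esub>)
        \<and> (\<forall>j. \<forall>x\<in>topspace X. \<forall>a\<in>carrier (stalk X L j x).
              finsum (stalk X L j x) (\<lambda>k. stalk_map X L 0 (e k) j x a) {k \<in> I. x \<in> X closure_of U k}
              = a \<ominus>\<^bsub>stalk X L j x\<^esub>
                  stalk_map X L 1 (differential L) (j - 1) x (stalk_map X L (-1) D j x a)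
                \<ominus>\<^bsub>stalk X L j x\<^esub>
                  stalk_map X L (-1) D (j + 1) x (stalk_map X L 1 (differential L) j x a))))"


section \<open>The intersection chain sheaf\<close>

definition IS_presheaf ::
    "'a topology \<Rightarrow> nat \<Rightarrow> (int \<Rightarrow> 'a set) \<Rightarrow> (nat \<Rightarrow> int) \<Rightarrow> ('a, 'e, 'r) local_system
      \<Rightarrow> ('a, 'r, ('a, 'e) coeff_chain set) dg_presheaf" where
  "IS_presheaf X n F p G =
    (let C = (\<lambda>j. intersection_chains X n F p G (int n - j));
         N = (\<lambda>j U. intersection_chains_in X n F p G (int n - j) (topspace X - X closure_of U))
     in \<lparr>sections = (\<lambda>j U. quotient_module (C j) (N j U)),
         restr = (\<lambda>j U V. quotient_map_to (C j) (N j V) (\<lambda>c. c)),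
         differential = (\<lambda>j U. quotient_map_to (C (j + 1)) (N (j + 1) U)
           (boundary X (regular_part X n F) G (int n - j)))\<rparr>)"

definition IS_sheaf ::
    "'a topology \<Rightarrow> nat \<Rightarrow> (int \<Rightarrow> 'a set) \<Rightarrow> (nat \<Rightarrow> int) \<Rightarrow> ('a, 'e, 'r) local_system
      \<Rightarrow> ('a, 'r, 'a \<Rightarrow> ('a set \<times> ('a, 'e) coeff_chain set) set) dg_presheaf" where
  "IS_sheaf X n F p G = sheafification X (IS_presheaf X n F p G)"

end

theory Submission
  imports Defs
begin

text \<open>Chains are cut into pieces subordinate to the covering by natural operators. By induction on the
  dimension, every singular simplex \<open>\<sigma>\<close> receives an integral chain \<open>c(\<sigma>)\<close> of affine simplices in the
  standard simplex, compatibly with faces, whose vertices are labelled by members of the covering so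
  that each piece lies in \<open>\<sigma>\<^sup>-\<^sup>1(U\<^sub>k)\<close> for each of its labels \<open>k\<close>; the inductive step fills a labelled
  cycle. In the barycentric subdivision of \<open>c(\<sigma>)\<close>, the star of the vertices of \<open>c(\<sigma>)\<close> with label \<open>k\<close> then
  defines \<open>1\<^sub>k\<close>, and a cone construction gives a homotopy \<open>D\<close> from the sum of these to the identity.

  All new vertices are interior, so a piece of \<open>1\<^sub>k\<close> or \<open>D\<close> pulls the \<open>m\<close>-skeleton back into the
  \<open>m\<close>-skeleton or the \<open>(m+1)\<close>-skeleton respectively. Moreover \<open>1\<^sub>k\<close> commutes with the boundary up to
  pieces that pull it back into the \<open>(m-1)\<close>-skeleton. Hence the operators preserve intersection
  chains, whatever the perversity. They do not enlarge supports, so they act on the sheaf, where near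
  a point only finitely many \<open>1\<^sub>k\<close> survive.\<close>

section \<open>Augmented chains of ordered simplices\<close>

text \<open>Iterated barycentric subdivision alone would not do: the number of rounds needed depends
  on the simplex, a locally finite chain has no common bound, and a face shared by simplices with
  different bounds would be cut in different ways. So the pieces on the faces are fixed beforehand
  and each simplex only extends them, which is a filling problem.

  Cutting \<sigma> along the simplices of its filling would create new boundary pieces of one
  dimension less that could meet a stratum in as large a set as before, and allowability could fail.
  The stars in the barycentric subdivision avoid this: their new boundary consists of links of the
  original vertices. A link contains no original vertex, so inside a face with s vertices its
  simplices have at most s - 1. Thus the part in each skeleton drops by one together with the
  dimension.

  The operators have integer coefficients. Their identities are proved for formal chains of affine
  simplices and carried over to chains with coefficients by functoriality of the action. Formal
  chains are augmented by the empty list, so that vertices and edges need hardly any separate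
  treatment.\<close>

lemma frag_extend_frag_extend:
  "frag_extend f (frag_extend g c) = frag_extend (\<lambda>x. frag_extend f (g x)) c"
  by (induction c rule: frag_induction[OF subset_UNIV]) (auto simp: frag_extend_diff)

lemma frag_extend_plus_fun: "frag_extend (\<lambda>x. f x + g x) c = frag_extend f c + frag_extend g c"
  by (simp add: frag_extend_def frag_cmul_distrib2 sum.distrib)

lemma frag_extend_uminus_fun: "frag_extend (\<lambda>x. - f x) c = - frag_extend f c"
  by (induction c rule: frag_induction[OF subset_UNIV]) (auto simp: frag_extend_diff)

lemma frag_extend_minus_fun: "frag_extend (\<lambda>x. f x - g x) c = frag_extend f c - frag_extend g c"
  using frag_extend_plus_fun[of f "\<lambda>x. - g x" c] by (simp add: frag_extend_uminus_fun)

lemma frag_extend_cmul_fun: "frag_extend (\<lambda>x. frag_cmul k (f x)) c = frag_cmul k (frag_extend f c)"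
  by (simp add: frag_extend_def frag_cmul_sum mult.commute)

lemma frag_extend_zero_fun: "frag_extend (\<lambda>x. 0) c = 0"
  by (simp add: frag_extend_eq_0)

lemma frag_extend_single_fun: "frag_extend frag_of c = c"
  using frag_expansion by metis

lemma frag_extend_sum_fun:
  "finite J \<Longrightarrow> frag_extend (\<lambda>x. \<Sum>j\<in>J. f j x) c = (\<Sum>j\<in>J. frag_extend (f j) c)"
  by (induction J rule: finite_induct) (auto simp: frag_extend_plus_fun frag_extend_zero_fun)

section \<open>Cones, boundary and vertex maps in the augmented complex\<close>

definition vcone :: "'v \<Rightarrow> ('v list \<Rightarrow>\<^sub>0 int) \<Rightarrow> ('v list \<Rightarrow>\<^sub>0 int)" where
  "vcone v = frag_extend (\<lambda>xs. frag_of (v # xs))"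

text \<open>The recursion is the cone formula itself; \<open>list_bd_eq_sum\<close> recovers the
  alternating sum. A singleton has boundary \<open>[]\<close>, which is the augmentation.\<close>

primrec list_bd :: "'v list \<Rightarrow> ('v list \<Rightarrow>\<^sub>0 int)" where
  "list_bd [] = 0"
| "list_bd (x # xs) = frag_of xs - vcone x (list_bd xs)"

definition bd :: "('v list \<Rightarrow>\<^sub>0 int) \<Rightarrow> ('v list \<Rightarrow>\<^sub>0 int)" where
  "bd = frag_extend list_bd"

definition vmap :: "('v \<Rightarrow> 'w) \<Rightarrow> ('v list \<Rightarrow>\<^sub>0 int) \<Rightarrow> ('w list \<Rightarrow>\<^sub>0 int)" where
  "vmap f = frag_extend (\<lambda>xs. frag_of (map f xs))"

lemma vcone_simps [simp]:
  "vcone v 0 = 0" "vcone v (frag_of xs) = frag_of (v # xs)"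
  "vcone v (a + b) = vcone v a + vcone v b" "vcone v (a - b) = vcone v a - vcone v b"
  "vcone v (- a) = - vcone v a" "vcone v (frag_cmul k a) = frag_cmul k (vcone v a)"
  by (auto simp: vcone_def frag_extend_add frag_extend_diff frag_extend_minus frag_extend_cmul)

lemma bd_simps [simp]:
  "bd 0 = 0" "bd (frag_of xs) = list_bd xs"
  "bd (a + b) = bd a + bd b" "bd (a - b) = bd a - bd b" "bd (- a) = - bd a"
  "bd (frag_cmul k a) = frag_cmul k (bd a)"
  by (auto simp: bd_def frag_extend_add frag_extend_diff frag_extend_minus frag_extend_cmul)

lemma vmap_simps [simp]:
  "vmap f 0 = 0" "vmap f (frag_of xs) = frag_of (map f xs)"
  "vmap f (a + b) = vmap f a + vmap f b" "vmap f (a - b) = vmap f a - vmap f b"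
  "vmap f (- a) = - vmap f a" "vmap f (frag_cmul k a) = frag_cmul k (vmap f a)"
  by (auto simp: vmap_def frag_extend_add frag_extend_diff frag_extend_minus frag_extend_cmul)

text \<open>Exact in every degree: for a vertex, the empty list supplies the term that would
  otherwise appear as a correction.\<close>

lemma bd_cone: "bd (vcone v c) = c - vcone v (bd c)"
  by (induction c rule: frag_induction[OF subset_UNIV]) (auto)

lemma bd_list_bd: "bd (list_bd xs) = 0"
  by (induction xs) (auto simp: bd_cone)

lemma vmap_cone: "vmap f (vcone v c) = vcone (f v) (vmap f c)"
  by (induction c rule: frag_induction[OF subset_UNIV]) auto

lemma list_bd_map: "list_bd (map f xs) = vmap f (list_bd xs)"
  by (induction xs) (auto simp: vmap_cone)

lemma bd_vmap: "bd (vmap f c) = vmap f (bd c)"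
  by (induction c rule: frag_induction[OF subset_UNIV]) (auto simp: list_bd_map)

lemma vmap_vmap: "vmap f (vmap g c) = vmap (\<lambda>x. f (g x)) c"
  by (induction c rule: frag_induction[OF subset_UNIV]) (auto simp: o_def)

lemma vmap_cong:
  "(\<And>xs x. xs \<in> Poly_Mapping.keys c \<Longrightarrow> x \<in> set xs \<Longrightarrow> f x = g x) \<Longrightarrow> vmap f c = vmap g c"
  unfolding vmap_def by (intro frag_extend_eq) (auto cong: map_cong)

lemma vmap_id: "(\<And>xs x. xs \<in> Poly_Mapping.keys c \<Longrightarrow> x \<in> set xs \<Longrightarrow> f x = x) \<Longrightarrow> vmap f c = c"
  using vmap_cong[of c f id] by (simp add: vmap_def frag_extend_single_fun)

lemma keys_cone: "Poly_Mapping.keys (vcone v c) \<subseteq> (#) v ` Poly_Mapping.keys c"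
  unfolding vcone_def by (rule order_trans[OF keys_frag_extend]) auto

lemma keys_vmap: "Poly_Mapping.keys (vmap f c) \<subseteq> map f ` Poly_Mapping.keys c"
  unfolding vmap_def by (rule order_trans[OF keys_frag_extend]) auto

lemma keys_frag_extend_ex:
  "y \<in> Poly_Mapping.keys (frag_extend f c) \<Longrightarrow> \<exists>x\<in>Poly_Mapping.keys c. y \<in> Poly_Mapping.keys (f x)"
  by (drule subsetD[OF keys_frag_extend]) simp

lemma keys_cone_ex:
  "ys \<in> Poly_Mapping.keys (vcone v c) \<Longrightarrow> \<exists>xs\<in>Poly_Mapping.keys c. ys = v # xs"
  by (drule subsetD[OF keys_cone]) auto

lemma keys_vmap_ex:
  "ys \<in> Poly_Mapping.keys (vmap f c) \<Longrightarrow> \<exists>xs\<in>Poly_Mapping.keys c. ys = map f xs"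
  by (drule subsetD[OF keys_vmap]) auto

lemma keys_diff': "x \<in> Poly_Mapping.keys (a - b) \<Longrightarrow> x \<in> Poly_Mapping.keys a \<or> x \<in> Poly_Mapping.keys b"
  using keys_diff by fastforce

definition del :: "nat \<Rightarrow> 'v list \<Rightarrow> 'v list" where
  "del j xs = take j xs @ drop (Suc j) xs"

lemma keys_list_bd:
  "ys \<in> Poly_Mapping.keys (list_bd xs) \<Longrightarrow> \<exists>j<length xs. ys = del j xs"
proof (induction xs arbitrary: ys)
  case (Cons x xs)
  from Cons.prems consider "ys = xs" | "ys \<in> Poly_Mapping.keys (vcone x (list_bd xs))"
    by (auto dest: keys_diff')
  then show ?case
  proof cases
    case 1
    then show ?thesis by (intro exI[of _ 0]) (auto simp: del_def)
  next
    case 2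
    then obtain zs where "zs \<in> Poly_Mapping.keys (list_bd xs)" "ys = x # zs"
      using keys_cone by fastforce
    with Cons.IH obtain j where "j < length xs" "zs = del j xs" by blast
    with \<open>ys = x # zs\<close> show ?thesis by (intro exI[of _ "Suc j"]) (auto simp: del_def)
  qed
qed auto

lemma length_del [simp]: "j < length xs \<Longrightarrow> length (del j xs) = length xs - 1"
  by (auto simp: del_def)

lemma set_del: "set (del j xs) \<subseteq> set xs"
  by (auto simp: del_def dest: in_set_takeD in_set_dropD)

lemma length_keys_list_bd: "ys \<in> Poly_Mapping.keys (list_bd xs) \<Longrightarrow> length ys = length xs - 1"
  using keys_list_bd by fastforce

lemma list_bd_eq_sum:
  "list_bd xs = (\<Sum>j<length xs. frag_cmul ((-1) ^ j) (frag_of (del j xs)))"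
proof (induction xs)
  case (Cons x xs)
  have "vcone x (list_bd xs) = (\<Sum>j<length xs. frag_cmul ((-1) ^ j) (frag_of (x # del j xs)))"
    unfolding Cons.IH unfolding vcone_def
    by (subst frag_extend_sum) (auto simp: frag_extend_cmul o_def)
  moreover have "(\<Sum>j<length (x#xs). frag_cmul ((-1) ^ j) (frag_of (del j (x#xs))))
      = frag_of xs + (\<Sum>j<length xs. frag_cmul ((-1) ^ Suc j) (frag_of (del (Suc j) (x#xs))))"
    unfolding length_Cons sum.lessThan_Suc_shift by (simp add: del_def)
  moreover have "(\<Sum>j<length xs. frag_cmul ((-1) ^ Suc j) (frag_of (del (Suc j) (x#xs))))
     = - (\<Sum>j<length xs. frag_cmul ((-1) ^ j) (frag_of (x # del j xs)))"
    by (simp add: del_def sum_negf[symmetric])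
  ultimately show ?case by simp
qed auto

text \<open>The prism operator between two vertex maps, obtained by viewing \<open>x # xs\<close> as
  a cone. Each piece runs along \<open>f\<close> up to some vertex, repeats that vertex under
  \<open>g\<close> and continues along \<open>g\<close>. Degenerate pieces are harmless, since
  simplices are ordered lists.\<close>

primrec list_prism :: "('v \<Rightarrow> 'w) \<Rightarrow> ('v \<Rightarrow> 'w) \<Rightarrow> 'v list \<Rightarrow> ('w list \<Rightarrow>\<^sub>0 int)" where
  "list_prism f g [] = 0"
| "list_prism f g (x # xs) = frag_of (f x # g x # map g xs) - vcone (f x) (list_prism f g xs)"

definition prism :: "('v \<Rightarrow> 'w) \<Rightarrow> ('v \<Rightarrow> 'w) \<Rightarrow> ('v list \<Rightarrow>\<^sub>0 int) \<Rightarrow> ('w list \<Rightarrow>\<^sub>0 int)" where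
  "prism f g = frag_extend (list_prism f g)"

lemma prism_cone: "prism f g (vcone v c) = vcone (f v) (vcone (g v) (vmap g c) - prism f g c)"
  by (induction c rule: frag_induction[OF subset_UNIV]) (auto simp: prism_def frag_extend_diff)

lemma bd_list_prism: "bd (list_prism f g xs) = frag_of (map g xs) - frag_of (map f xs) - prism f g (list_bd xs)"
proof (induction xs)
  case (Cons x xs)
  have "prism f g (list_bd (x # xs)) = list_prism f g xs - prism f g (vcone x (list_bd xs))"
    by (simp add: prism_def frag_extend_diff)
  then show ?case
    by (simp add: bd_cone Cons.IH prism_cone list_bd_map algebra_simps)
qed (auto simp: prism_def)

lemma bd_prism: "bd (prism f g c) = vmap g c - vmap f c - prism f g (bd c)"
  by (induction c rule: frag_induction[OF subset_UNIV])
     (auto simp: prism_def frag_extend_diff bd_list_prism)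

lemma keys_list_prism:
  "ys \<in> Poly_Mapping.keys (list_prism f g xs) \<Longrightarrow>
    \<exists>k<length xs. ys = map f (take (Suc k) xs) @ map g (drop k xs)"
proof (induction xs arbitrary: ys)
  case (Cons x xs)
  from Cons.prems consider "ys = f x # g x # map g xs" | "ys \<in> Poly_Mapping.keys (vcone (f x) (list_prism f g xs))"
    by (auto dest: keys_diff')
  then show ?case
  proof cases
    case 1
    then show ?thesis by (intro exI[of _ 0]) auto
  next
    case 2
    then obtain zs where "zs \<in> Poly_Mapping.keys (list_prism f g xs)" "ys = f x # zs"
      using keys_cone by fastforce
    with Cons.IH obtain j where "j < length xs" "zs = map f (take (Suc j) xs) @ map g (drop j xs)" by blast
    with \<open>ys = f x # zs\<close> show ?thesis by (intro exI[of _ "Suc j"]) auto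
  qed
qed auto

text \<open>Barycentric subdivision and its variants: cone off the boundary from \<open>b xs\<close>, starting from
  \<open>\<beta>\<close> on lists of length at most one.\<close>

primrec bar_n :: "('v list \<Rightarrow> 'w) \<Rightarrow> ('v list \<Rightarrow> ('w list \<Rightarrow>\<^sub>0 int)) \<Rightarrow> nat \<Rightarrow> 'v list \<Rightarrow> ('w list \<Rightarrow>\<^sub>0 int)" where
  "bar_n b \<beta> 0 xs = \<beta> xs"
| "bar_n b \<beta> (Suc n) xs =
    (if n = 0 then \<beta> xs else vcone (b xs) (frag_extend (bar_n b \<beta> n) (list_bd xs)))"

definition bar :: "('v list \<Rightarrow> 'w) \<Rightarrow> ('v list \<Rightarrow> ('w list \<Rightarrow>\<^sub>0 int)) \<Rightarrow> 'v list \<Rightarrow> ('w list \<Rightarrow>\<^sub>0 int)" where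
  "bar b \<beta> xs = bar_n b \<beta> (length xs) xs"

lemma bar_short: "length xs \<le> 1 \<Longrightarrow> bar b \<beta> xs = \<beta> xs"
  by (cases xs) (auto simp: bar_def)

lemma bar_long: "2 \<le> length xs \<Longrightarrow> bar b \<beta> xs = vcone (b xs) (frag_extend (bar b \<beta>) (list_bd xs))"
proof -
  assume *: "2 \<le> length xs"
  then obtain n where n: "length xs = Suc n" "n \<noteq> 0" by (cases "length xs") auto
  have "frag_extend (bar_n b \<beta> n) (list_bd xs) = frag_extend (bar b \<beta>) (list_bd xs)"
    by (intro frag_extend_eq) (use n in \<open>auto simp: bar_def dest: length_keys_list_bd\<close>)
  then show ?thesis using n by (simp add: bar_def)
qed

lemma bar_induct [case_names short long]:
  assumes short: "\<And>xs. length xs \<le> 1 \<Longrightarrow> P xs"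
    and long: "\<And>xs. 2 \<le> length xs \<Longrightarrow> (\<And>ys. ys \<in> Poly_Mapping.keys (list_bd xs) \<Longrightarrow> P ys) \<Longrightarrow> P xs"
  shows "P xs"
proof (induction "length xs" arbitrary: xs rule: less_induct)
  case less
  show ?case
  proof (cases "length xs \<le> 1")
    case True
    then show ?thesis by (rule short)
  next
    case False
    show ?thesis
      by (rule long) (use False in \<open>auto intro!: less dest!: length_keys_list_bd\<close>)
  qed
qed

text \<open>\<open>bar\<close> uses only the apexes and the start values, so compatibility of these
  with the vertex maps suffices. Applied to face inclusions, this makes the pieces of a simplex
  agree with those of its faces.\<close>

lemma vmap_bar:
  assumes "\<And>ys. set ys \<subseteq> A \<Longrightarrow> 2 \<le> length ys \<Longrightarrow> g (b ys) = b' (map f ys)"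
    and "\<And>ys. set ys \<subseteq> A \<Longrightarrow> vmap g (\<beta> ys) = \<beta>' (map f ys)" and "set xs \<subseteq> A"
  shows "vmap g (bar b \<beta> xs) = bar b' \<beta>' (map f xs)"
  using assms(3)
proof (induction xs rule: bar_induct)
  case (short xs)
  then show ?case by (simp add: bar_short assms)
next
  case (long xs)
  have "vmap g (frag_extend (bar b \<beta>) (list_bd xs)) = frag_extend (\<lambda>ys. vmap g (bar b \<beta> ys)) (list_bd xs)"
    unfolding vmap_def frag_extend_frag_extend ..
  also have "\<dots> = frag_extend (\<lambda>ys. bar b' \<beta>' (map f ys)) (list_bd xs)"
    by (intro frag_extend_eq long) (use long set_del in \<open>fastforce dest!: keys_list_bd\<close>)+
  also have "\<dots> = frag_extend (bar b' \<beta>') (list_bd (map f xs))"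
    unfolding list_bd_map by (simp add: vmap_def frag_extend_frag_extend)
  finally show ?case using long by (simp add: bar_long vmap_cone assms)
qed

section \<open>Barycentric subdivision and its homotopy to the identity\<close>

definition sd :: "('v list \<Rightarrow> 'v) \<Rightarrow> ('v list \<Rightarrow>\<^sub>0 int) \<Rightarrow> ('v list \<Rightarrow>\<^sub>0 int)" where
  "sd b = frag_extend (bar b (\<lambda>xs. frag_of (if xs = [] then [] else [b xs])))"

lemma sd_simps [simp]:
  "sd b 0 = 0" "sd b (x + y) = sd b x + sd b y" "sd b (x - y) = sd b x - sd b y"
  by (auto simp: sd_def frag_extend_add frag_extend_diff)

lemma sd_Nil [simp]: "sd b (frag_of []) = frag_of []"
  by (simp add: sd_def bar_short)

text \<open>Also valid for a single vertex, whose boundary \<open>[]\<close> is fixed by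
  \<open>sd\<close>; this saves the degree-zero case in the inductions that follow.\<close>

lemma sd_frag_of: "xs \<noteq> [] \<Longrightarrow> sd b (frag_of xs) = vcone (b xs) (sd b (list_bd xs))"
proof -
  assume "xs \<noteq> []"
  then consider "2 \<le> length xs" | x where "xs = [x]"
    by (cases xs; cases "tl xs") (auto simp: numeral_2_eq_2)
  then show ?thesis by cases (auto simp: sd_def bar_short bar_long)
qed

lemma frag_lin_eqI:
  assumes "\<And>xs. xs \<in> Poly_Mapping.keys c \<Longrightarrow> f (frag_of xs) = g (frag_of xs)"
    and "f 0 = g 0" "\<And>a b. f (a - b) = f a - f b" "\<And>a b. g (a - b) = g a - g b"
  shows "f c = g (c :: 'x \<Rightarrow>\<^sub>0 int)"
  by (rule frag_induction[OF order_refl, where P = "\<lambda>c. f c = g c"]) (use assms in auto)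

lemma bd_sd: "bd (sd b c) = sd b (bd c)"
proof -
  have *: "bd (sd b (frag_of xs)) = sd b (list_bd xs)" for xs
  proof (induction "length xs" arbitrary: xs)
    case (Suc n)
    have "bd (sd b (list_bd xs)) = sd b (bd (list_bd xs))"
      by (rule frag_lin_eqI) (use Suc in \<open>auto dest!: length_keys_list_bd\<close>)
    moreover have "xs \<noteq> []" using Suc by auto
    ultimately show ?case by (simp add: sd_frag_of bd_cone bd_list_bd)
  qed auto
  show ?thesis by (rule frag_lin_eqI) (use * in auto)
qed

text \<open>The classical recursion T x = b(x - T(\<partial>x)), started with 0 on the empty
  list.\<close>

primrec sd_htpy_n :: "('v list \<Rightarrow> 'v) \<Rightarrow> nat \<Rightarrow> 'v list \<Rightarrow> ('v list \<Rightarrow>\<^sub>0 int)" where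
  "sd_htpy_n b 0 xs = 0"
| "sd_htpy_n b (Suc n) xs = vcone (b xs) (frag_of xs - frag_extend (sd_htpy_n b n) (list_bd xs))"

definition sd_htpy :: "('v list \<Rightarrow> 'v) \<Rightarrow> ('v list \<Rightarrow>\<^sub>0 int) \<Rightarrow> ('v list \<Rightarrow>\<^sub>0 int)" where
  "sd_htpy b = frag_extend (\<lambda>xs. sd_htpy_n b (length xs) xs)"

lemma sd_htpy_simps [simp]:
  "sd_htpy b 0 = 0" "sd_htpy b (x + y) = sd_htpy b x + sd_htpy b y" "sd_htpy b (x - y) = sd_htpy b x - sd_htpy b y"
  "sd_htpy b (frag_of []) = 0"
  by (auto simp: sd_htpy_def frag_extend_add frag_extend_diff)

lemma sd_htpy_frag_of:
  "xs \<noteq> [] \<Longrightarrow> sd_htpy b (frag_of xs) = vcone (b xs) (frag_of xs - sd_htpy b (list_bd xs))"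
proof -
  assume *: "xs \<noteq> []"
  then obtain n where n: "length xs = Suc n" by (cases xs) auto
  have "frag_extend (sd_htpy_n b n) (list_bd xs) = sd_htpy b (list_bd xs)"
    unfolding sd_htpy_def by (intro frag_extend_eq) (use n in \<open>auto dest: length_keys_list_bd\<close>)
  then show ?thesis using n by (simp add: sd_htpy_def)
qed

lemma bd_sd_htpy: "bd (sd_htpy b c) = c - sd b c - sd_htpy b (bd c)"
proof -
  have *: "bd (sd_htpy b (frag_of xs)) = frag_of xs - sd b (frag_of xs) - sd_htpy b (list_bd xs)" for xs
  proof (induction "length xs" arbitrary: xs)
    case (Suc n)
    have "bd (sd_htpy b (list_bd xs)) = list_bd xs - sd b (list_bd xs) - sd_htpy b (bd (list_bd xs))"
      by (rule frag_lin_eqI[where g = "\<lambda>c. c - sd b c - sd_htpy b (bd c)"])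
         (use Suc in \<open>auto dest!: length_keys_list_bd simp: algebra_simps\<close>)
    moreover have "xs \<noteq> []" using Suc by auto
    ultimately show ?case by (auto simp: sd_frag_of sd_htpy_frag_of bd_cone bd_list_bd)
  qed auto
  show ?thesis
    by (rule frag_lin_eqI[where g = "\<lambda>c. c - sd b c - sd_htpy b (bd c)"])
       (use * in \<open>auto simp: algebra_simps\<close>)
qed

primrec sd_htpy_iter :: "('v list \<Rightarrow> 'v) \<Rightarrow> nat \<Rightarrow> ('v list \<Rightarrow>\<^sub>0 int) \<Rightarrow> ('v list \<Rightarrow>\<^sub>0 int)" where
  "sd_htpy_iter b 0 c = 0"
| "sd_htpy_iter b (Suc m) c = sd_htpy_iter b m c + sd_htpy b ((sd b ^^ m) c)"

lemma bd_sd_iter: "bd ((sd b ^^ m) c) = (sd b ^^ m) (bd c)"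
  by (induction m) (auto simp: bd_sd)

lemma sd_iter_0 [simp]: "(sd b ^^ m) 0 = 0"
  by (induction m) auto

text \<open>On a cycle each summand bounds the difference of two consecutive subdivisions, and these
  differences telescope.\<close>

lemma bd_sd_htpy_iter: "bd c = 0 \<Longrightarrow> bd (sd_htpy_iter b m c) = c - (sd b ^^ m) c"
  by (induction m) (auto simp: bd_sd_htpy bd_sd_iter)

text \<open>For vertices labelled by their second component, \<open>star b Q\<close> collects the simplices of the
  barycentric subdivision whose original vertex has a label in \<open>Q\<close>, and \<open>link_defect b Q\<close>
  measures the failure of \<open>star b Q\<close> to be a chain map.\<close>

definition star_base :: "'l set \<Rightarrow> ('p \<times> 'l) list \<Rightarrow> ('p list \<Rightarrow>\<^sub>0 int)" where
  "star_base Q xs = (if length xs = 1 \<and> snd (hd xs) \<in> Q then frag_of [fst (hd xs)] else 0)"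

definition link_base :: "'l set \<Rightarrow> ('p \<times> 'l) list \<Rightarrow> ('p list \<Rightarrow>\<^sub>0 int)" where
  "link_base Q xs = (if length xs = 1 \<and> snd (hd xs) \<in> Q then frag_of [] else 0)"

definition star :: "(('p \<times> 'l) list \<Rightarrow> 'p) \<Rightarrow> 'l set \<Rightarrow> (('p \<times> 'l) list \<Rightarrow>\<^sub>0 int) \<Rightarrow> ('p list \<Rightarrow>\<^sub>0 int)" where
  "star b Q = frag_extend (bar b (star_base Q))"

definition link_defect ::
    "(('p \<times> 'l) list \<Rightarrow> 'p) \<Rightarrow> 'l set \<Rightarrow> (('p \<times> 'l) list \<Rightarrow>\<^sub>0 int) \<Rightarrow> ('p list \<Rightarrow>\<^sub>0 int)" where
  "link_defect b Q = frag_extend (\<lambda>xs. frag_cmul ((-1) ^ (length xs - 1)) (bar b (link_base Q) xs))"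

lemma star_simps [simp]:
  "star b Q 0 = 0" "star b Q (x + y) = star b Q x + star b Q y" "star b Q (x - y) = star b Q x - star b Q y"
  "star b Q (frag_cmul k x) = frag_cmul k (star b Q x)"
  by (auto simp: star_def frag_extend_add frag_extend_diff frag_extend_cmul)

lemma link_defect_simps [simp]:
  "link_defect b Q 0 = 0" "link_defect b Q (x + y) = link_defect b Q x + link_defect b Q y"
  "link_defect b Q (x - y) = link_defect b Q x - link_defect b Q y"
  by (auto simp: link_defect_def frag_extend_add frag_extend_diff)

text \<open>A piece lists barycentres of decreasing faces and ends with an original vertex. Deleting
  that last entry gives the link term, and its position \<open>length xs - 1\<close> gives the sign
  in \<open>link_defect\<close>. Deleting the first entry gives the star of the boundary; the other
  faces cancel.\<close>

lemma bd_star: "bd (star b Q c) = star b Q (bd c) + link_defect b Q c"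
proof -
  have *: "bd (star b Q (frag_of xs)) = star b Q (list_bd xs) + link_defect b Q (frag_of xs)" for xs
  proof (induction xs rule: bar_induct)
    case (short xs)
    then consider "xs = []" | x where "xs = [x]" by (cases xs) auto
    then show ?case
      by cases (auto simp: star_def link_defect_def bar_short star_base_def link_base_def)
  next
    case (long xs)
    have 1: "bd (star b Q (list_bd xs)) = star b Q (bd (list_bd xs)) + link_defect b Q (list_bd xs)"
      by (rule frag_lin_eqI[where g = "\<lambda>c. star b Q (bd c) + link_defect b Q c"])
         (use long in \<open>auto simp: algebra_simps\<close>)
    have "link_defect b Q (list_bd xs)
        = frag_extend (\<lambda>ys. frag_cmul ((-1) ^ (length xs - 2)) (bar b (link_base Q) ys)) (list_bd xs)"
      unfolding link_defect_def
      by (rule frag_extend_eq) (auto dest!: length_keys_list_bd simp: numeral_2_eq_2)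
    then have 2: "vcone (b xs) (link_defect b Q (list_bd xs))
        = frag_cmul ((-1) ^ (length xs - 2)) (bar b (link_base Q) xs)"
      using long by (simp add: frag_extend_cmul_fun bar_long)
    obtain m where m: "length xs = Suc (Suc m)" using long(1) by (metis add_2_eq_Suc le_Suc_ex)
    have 3: "link_defect b Q (frag_of xs) = - vcone (b xs) (link_defect b Q (list_bd xs))"
      unfolding 2 by (simp add: link_defect_def m)
    show ?case
      using long 1 3 unfolding star_def
      by (simp add: bar_long bd_cone bd_list_bd)
  qed
  show ?thesis
    by (rule frag_lin_eqI[where g = "\<lambda>c. star b Q (bd c) + link_defect b Q c"])
       (use * in \<open>auto simp: algebra_simps\<close>)
qed

lemma link_defect_UNIV:
  assumes "\<And>xs. xs \<in> Poly_Mapping.keys c \<Longrightarrow> 2 \<le> length xs"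
  shows "link_defect b UNIV c = 0"
proof -
  have "bar b (link_base UNIV) xs = 0" if "2 \<le> length xs" for xs
    using that
  proof (induction "length xs" arbitrary: xs rule: less_induct)
    case less
    show ?case
    proof (cases "length xs = 2")
      case True
      then obtain x y where "xs = [x, y]" by (auto simp: numeral_2_eq_2 length_Suc_conv)
      then show ?thesis by (simp add: bar_long bar_short link_base_def frag_extend_diff)
    next
      case False
      have "frag_extend (bar b (link_base UNIV)) (list_bd xs) = 0"
        by (rule frag_extend_eq_0) (use less False in \<open>auto dest!: length_keys_list_bd\<close>)
      then show ?thesis using less.prems by (simp add: bar_long)
    qed
  qed
  then show ?thesis unfolding link_defect_def using assms by (intro frag_extend_eq_0) auto
qed

lemma star_Un:
  assumes "Q \<inter> Q' = {}"
  shows "star b (Q \<union> Q') c = star b Q c + star b Q' c"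
proof -
  have "bar b (star_base (Q \<union> Q')) xs = bar b (star_base Q) xs + bar b (star_base Q') xs" for xs
  proof (induction xs rule: bar_induct)
    case (short xs)
    with assms show ?case by (auto simp: bar_short star_base_def)
  next
    case (long xs)
    have "frag_extend (bar b (star_base (Q \<union> Q'))) (list_bd xs)
       = frag_extend (\<lambda>ys. bar b (star_base Q) ys + bar b (star_base Q') ys) (list_bd xs)"
      by (rule frag_extend_eq) (use long in auto)
    with long show ?case by (simp add: bar_long frag_extend_plus_fun)
  qed
  then have "star b (Q \<union> Q') c = frag_extend (\<lambda>xs. bar b (star_base Q) xs + bar b (star_base Q') xs) c"
    unfolding star_def by (intro frag_extend_eq)
  then show ?thesis by (simp add: star_def frag_extend_plus_fun)
qed

text \<open>A recursion that starts from 0 at every vertex stays 0. This ties each piece of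
  \<open>star b Q\<close> to a label in \<open>Q\<close> of the simplex it comes from, and later to
  a member of the covering.\<close>

lemma star_label:
  "bar b (star_base Q) xs \<noteq> 0 \<Longrightarrow> \<exists>x\<in>set xs. snd x \<in> Q"
proof (induction xs rule: bar_induct)
  case (short xs)
  then show ?case by (cases xs) (auto simp: bar_short star_base_def split: if_splits)
next
  case (long xs)
  have "frag_extend (bar b (star_base Q)) (list_bd xs) \<noteq> 0"
  proof
    assume "frag_extend (bar b (star_base Q)) (list_bd xs) = 0"
    then have "bar b (star_base Q) xs = 0" by (subst bar_long[OF long(1)]) simp
    with long(3) show False by simp
  qed
  then have "\<exists>ys\<in>Poly_Mapping.keys (list_bd xs). bar b (star_base Q) ys \<noteq> 0"
    by (rule contrapos_np) (intro frag_extend_eq_0, simp)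
  then obtain ys where ys: "ys \<in> Poly_Mapping.keys (list_bd xs)" "bar b (star_base Q) ys \<noteq> 0" ..
  from long(2)[OF ys] obtain x where "x \<in> set ys" "snd x \<in> Q" by blast
  moreover obtain j where "ys = del j xs" using keys_list_bd[OF ys(1)] by blast
  ultimately show ?case using set_del[of j xs] by blast
qed

section \<open>Affine simplices and general position with respect to skeleta\<close>

text \<open>The standard simplex indexed by its number of vertices rather than its dimension: the
  empty list then has an empty set of weights, and statements over \<open>wts (length xs)\<close>
  include that case.\<close>

definition wts :: "nat \<Rightarrow> (nat \<Rightarrow> real) set" where
  "wts n = {t. (\<forall>i. 0 \<le> t i) \<and> (\<forall>i\<ge>n. t i = 0) \<and> (\<Sum>i<n. t i) = 1}"

lemma standard_simplex_eq_wts: "standard_simplex p = wts (Suc p)"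
proof (intro equalityI subsetI)
  fix t assume "t \<in> standard_simplex p"
  then show "t \<in> wts (Suc p)"
    by (auto simp: wts_def standard_simplex_def lessThan_Suc_atMost)
next
  fix t assume t: "t \<in> wts (Suc p)"
  have "t i \<le> 1" for i
  proof (cases "i < Suc p")
    case True
    then have "t i \<le> (\<Sum>i<Suc p. t i)" using t by (intro member_le_sum) (auto simp: wts_def)
    then show ?thesis using t by (simp add: wts_def)
  qed (use t in \<open>auto simp: wts_def\<close>)
  then show "t \<in> standard_simplex p" using t
    unfolding wts_def standard_simplex_def by (auto simp: lessThan_Suc_atMost)
qed

lemma wts_0 [simp]: "wts 0 = {}"
  by (simp add: wts_def)

definition basis_pt :: "nat \<Rightarrow> nat \<Rightarrow> real" where
  "basis_pt i = (\<lambda>j. if j = i then 1 else 0)"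

lemma basis_pt_wts: "i < n \<Longrightarrow> basis_pt i \<in> wts n"
  by (auto simp: wts_def basis_pt_def)

definition bary :: "(nat \<Rightarrow> real) list \<Rightarrow> (nat \<Rightarrow> real) \<Rightarrow> (nat \<Rightarrow> real)" where
  "bary xs t = (\<lambda>i. \<Sum>l<length xs. t l * (xs ! l) i)"

lemma bary_Nil [simp]: "bary [] t = (\<lambda>i. 0)"
  by (simp add: bary_def)

lemma bary_Cons: "bary (x # xs) t = (\<lambda>i. t 0 * x i + bary xs (\<lambda>l. t (Suc l)) i)"
  unfolding bary_def length_Cons sum.lessThan_Suc_shift by simp

lemma bary_basis_pt: "l < length xs \<Longrightarrow> bary xs (basis_pt l) = xs ! l"
  by (auto simp: bary_def basis_pt_def if_distrib[of "\<lambda>x. x * _"] cong: if_cong)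

lemma bary_linear: "bary xs (\<lambda>l. a * s l + b * t l) = (\<lambda>i. a * bary xs s i + b * bary xs t i)"
  by (auto simp: bary_def algebra_simps sum.distrib sum_distrib_left)

lemma bary_bary: "bary (map (bary xs) ys) t = bary xs (bary ys t)"
proof
  fix i
  have "bary (map (bary xs) ys) t i = (\<Sum>l<length ys. \<Sum>m<length xs. t l * ((ys ! l) m * (xs ! m) i))"
    by (simp add: bary_def sum_distrib_left)
  also have "\<dots> = (\<Sum>m<length xs. \<Sum>l<length ys. t l * ((ys ! l) m * (xs ! m) i))"
    by (rule sum.swap)
  also have "\<dots> = bary xs (bary ys t) i"
    by (simp add: bary_def sum_distrib_right mult.assoc)
  finally show "bary (map (bary xs) ys) t i = bary xs (bary ys t) i" .
qed

lemma bary_cong: "(\<And>l. l < length xs \<Longrightarrow> s l = t l) \<Longrightarrow> bary xs s = bary xs t"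
  by (auto simp: bary_def)

lemma bary_simplical_face: "bary (map (simplical_face j) xs) t = simplical_face j (bary xs t)"
  by (auto simp: bary_def simplical_face_def)

lemma bary_del:
  "j < length xs \<Longrightarrow> bary (del j xs) t = bary xs (simplical_face j t)"
proof (induction xs arbitrary: j t)
  case (Cons x xs)
  show ?case
  proof (cases j)
    case 0
    then show ?thesis by (simp add: del_def bary_Cons simplical_face_def)
  next
    case (Suc k)
    have "(\<lambda>l. simplical_face (Suc k) t (Suc l)) = simplical_face k (\<lambda>l. t (Suc l))"
      by (auto simp: simplical_face_def fun_eq_iff)
    moreover have "del (Suc k) (x # xs) = x # del k xs" by (simp add: del_def)
    moreover have "bary (del k xs) (\<lambda>l. t (Suc l)) = bary xs (simplical_face k (\<lambda>l. t (Suc l)))"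
      using Cons Suc by auto
    ultimately show ?thesis using Suc by (simp add: bary_Cons simplical_face_def)
  qed
qed simp

lemma simplical_face_wts: "j \<le> n \<Longrightarrow> t \<in> wts n \<Longrightarrow> simplical_face j t \<in> wts (Suc n)"
proof (cases n)
  case (Suc m)
  assume "j \<le> n" "t \<in> wts n"
  then show ?thesis
    using simplical_face_in_standard_simplex[of n j t] Suc
    by (simp add: standard_simplex_eq_wts)
qed auto

text \<open>\<open>nz t\<close> - 1 is the dimension of the open face containing \<open>t\<close>,
  so \<open>t\<close> lies in the m-skeleton iff \<open>nz t\<close> is at most m + 1. All
  allowability estimates are phrased with this count.\<close>

definition nz :: "(nat \<Rightarrow> real) \<Rightarrow> nat" where
  "nz t = card {l. t l \<noteq> 0}"

lemma nz_simplical_face [simp]: "nz (simplical_face j t) = nz t"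
proof -
  let ?f = "\<lambda>l. if l < j then l else Suc l"
  have "{l. simplical_face j t l \<noteq> 0} = ?f ` {l. t l \<noteq> 0}"
  proof (intro equalityI subsetI)
    fix l assume l: "l \<in> {l. simplical_face j t l \<noteq> 0}"
    then consider "l < j" | "l > j" by (cases l j rule: linorder_cases) (auto simp: simplical_face_def)
    then show "l \<in> ?f ` {l. t l \<noteq> 0}"
    proof cases
      case 1
      then show ?thesis using l by (intro image_eqI[of _ _ l]) (auto simp: simplical_face_def)
    next
      case 2
      then show ?thesis using l by (intro image_eqI[of _ _ "l - 1"]) (auto simp: simplical_face_def)
    qed
  qed (auto simp: simplical_face_def split: if_splits)
  then have "nz (simplical_face j t) = card (?f ` {l. t l \<noteq> 0})" by (simp only: nz_def)
  also have "\<dots> = nz t"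
    unfolding nz_def by (rule card_image) (auto simp: inj_on_def split: if_splits)
  finally show ?thesis .
qed

lemma nz_le: "t \<in> wts n \<Longrightarrow> nz t \<le> n"
proof -
  assume "t \<in> wts n"
  then have "{l. t l \<noteq> 0} \<subseteq> {..<n}" by (auto simp: wts_def not_le[symmetric])
  then show ?thesis unfolding nz_def using card_mono[of "{..<n}" "{l. t l \<noteq> 0}"] by simp
qed

lemma nz_full: "t \<in> wts n \<Longrightarrow> (\<And>i. i < n \<Longrightarrow> 0 < t i) \<Longrightarrow> nz t = n"
proof -
  assume "t \<in> wts n" "\<And>i. i < n \<Longrightarrow> 0 < t i"
  then have "{l. t l \<noteq> 0} = {..<n}" by (force simp: wts_def not_le[symmetric])
  then show ?thesis by (simp add: nz_def)
qed

lemma nz_shift: "t 0 = 0 \<Longrightarrow> nz t = nz (\<lambda>l. t (Suc l))"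
proof -
  assume "t 0 = 0"
  then have "t = simplical_face 0 (\<lambda>l. t (Suc l))" by (auto simp: simplical_face_def)
  then show ?thesis by (metis nz_simplical_face)
qed

lemma wts_shift: "t \<in> wts (Suc n) \<Longrightarrow> t 0 = 0 \<Longrightarrow> (\<lambda>l. t (Suc l)) \<in> wts n"
  by (auto simp: wts_def sum.lessThan_Suc_shift simp del: sum.lessThan_Suc)

lemma wts_shift_scale:
  "t \<in> wts (Suc n) \<Longrightarrow> t 0 \<noteq> 1 \<Longrightarrow> (\<lambda>l. t (Suc l) / (1 - t 0)) \<in> wts n"
proof -
  assume t: "t \<in> wts (Suc n)" "t 0 \<noteq> 1"
  have s: "t 0 + (\<Sum>l<n. t (Suc l)) = 1" 
    using t by (auto simp: wts_def sum.lessThan_Suc_shift simp del: sum.lessThan_Suc)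
  moreover have "0 \<le> (\<Sum>l<n. t (Suc l))" using t by (auto simp: wts_def intro: sum_nonneg)
  ultimately have "0 < 1 - t 0" using t by linarith
  moreover have "(\<Sum>l<n. t (Suc l) / (1 - t 0)) = 1"
    using s t by (simp flip: sum_divide_distrib)
  ultimately show ?thesis using t by (auto simp: wts_def)
qed

lemma wts_head_1: "t \<in> wts (Suc n) \<Longrightarrow> t 0 = 1 \<Longrightarrow> t (Suc l) = 0"
proof -
  assume t: "t \<in> wts (Suc n)" "t 0 = 1"
  have s: "t 0 + (\<Sum>l<n. t (Suc l)) = 1" 
    using t by (auto simp: wts_def sum.lessThan_Suc_shift simp del: sum.lessThan_Suc)
  then have "(\<Sum>l<n. t (Suc l)) = 0" using t by simp
  then have "\<forall>l\<in>{..<n}. t (Suc l) = 0" using t by (subst (asm) sum_nonneg_eq_0_iff) (auto simp: wts_def)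
  then show ?thesis using t by (cases "l < n") (auto simp: wts_def)
qed

section \<open>Convexity, hulls and averages\<close>

definition cvx :: "(nat \<Rightarrow> real) set \<Rightarrow> bool" where
  "cvx K \<longleftrightarrow> (\<forall>x\<in>K. \<forall>y\<in>K. \<forall>u. 0 \<le> u \<and> u \<le> 1 \<longrightarrow> (\<lambda>i. u * x i + (1 - u) * y i) \<in> K)"

lemma cvxD: "cvx K \<Longrightarrow> x \<in> K \<Longrightarrow> y \<in> K \<Longrightarrow> 0 \<le> u \<Longrightarrow> u \<le> 1 \<Longrightarrow> (\<lambda>i. u * x i + (1 - u) * y i) \<in> K"
  by (simp add: cvx_def)

lemma cvx_wts: "cvx (wts n)"
  unfolding cvx_def by (auto simp: wts_def sum.distrib simp flip: sum_distrib_left)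

text \<open>Induction on the number of vertices: the tail rescaled by 1 - \<open>t 0\<close> gives a
  point of the set, and the whole is a combination of two points. If \<open>t 0 = 1\<close> the tail
  vanishes and cannot be rescaled.\<close>

lemma bary_in_cvx: "cvx K \<Longrightarrow> set xs \<subseteq> K \<Longrightarrow> t \<in> wts (length xs) \<Longrightarrow> bary xs t \<in> K"
proof (induction xs arbitrary: t)
  case (Cons x xs)
  show ?case
  proof (cases "t 0 = 1")
    case True
    then have "bary xs (\<lambda>l. t (Suc l)) = bary xs (\<lambda>l. 0)"
      using Cons.prems wts_head_1[of t "length xs"] by (intro bary_cong) auto
    then have "bary (x # xs) t = x" using True by (auto simp: bary_Cons) (simp add: bary_def)
    then show ?thesis using Cons by auto
  next
    case False
    let ?s = "\<lambda>l. t (Suc l) / (1 - t 0)"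
    have "bary xs ?s \<in> K" using Cons False wts_shift_scale[of t "length xs"] by auto
    moreover have "0 \<le> t 0 \<and> t 0 \<le> 1"
      using Cons.prems(3) unfolding length_Cons standard_simplex_eq_wts[symmetric] standard_simplex_def by blast
    moreover have "(\<lambda>l. t (Suc l)) = (\<lambda>l. (1 - t 0) * ?s l + 0 * ?s l)" using False by auto
    then have "bary xs (\<lambda>l. t (Suc l)) = (\<lambda>i. (1 - t 0) * bary xs ?s i)"
      using bary_linear[of xs "1 - t 0" ?s 0 ?s] by simp
    ultimately show ?thesis using Cons.prems unfolding cvx_def bary_Cons by auto
  qed
qed simp

definition ahull :: "(nat \<Rightarrow> real) list \<Rightarrow> (nat \<Rightarrow> real) set" where
  "ahull xs = bary xs ` wts (length xs)"

lemma cvx_hull: "cvx (ahull xs)"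
  unfolding cvx_def ahull_def
proof (intro ballI allI impI, clarify)
  fix s t :: "nat \<Rightarrow> real" and u :: real assume *: "s \<in> wts (length xs)" "t \<in> wts (length xs)" "0 \<le> u" "u \<le> 1"
  have "(\<lambda>i. u * bary xs s i + (1 - u) * bary xs t i) = bary xs (\<lambda>l. u * s l + (1 - u) * t l)"
    by (simp add: bary_linear)
  then show "(\<lambda>i. u * bary xs s i + (1 - u) * bary xs t i) \<in> bary xs ` wts (length xs)"
    using * cvx_wts[of "length xs"] by (auto simp: cvx_def)
qed

lemma set_subset_hull: "set xs \<subseteq> ahull xs"
proof
  fix x assume "x \<in> set xs"
  then obtain l where "l < length xs" "x = xs ! l" by (auto simp: in_set_conv_nth)
  then show "x \<in> ahull xs" unfolding ahull_def
    by (intro image_eqI[of _ _ "basis_pt l"]) (auto simp: bary_basis_pt basis_pt_wts)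
qed

lemma hull_subset_cvx: "cvx K \<Longrightarrow> set xs \<subseteq> K \<Longrightarrow> ahull xs \<subseteq> K"
  unfolding ahull_def using bary_in_cvx by blast

lemma hull_mono: "set ys \<subseteq> ahull xs \<Longrightarrow> ahull ys \<subseteq> ahull xs"
  by (rule hull_subset_cvx[OF cvx_hull])

definition unif :: "nat \<Rightarrow> nat \<Rightarrow> real" where
  "unif k = (\<lambda>i. if i < k then 1 / real k else 0)"

lemma unif_wts: "0 < k \<Longrightarrow> unif k \<in> wts k"
  by (auto simp: wts_def unif_def)

definition avg :: "(nat \<Rightarrow> real) list \<Rightarrow> nat \<Rightarrow> real" where
  "avg xs = bary xs (unif (length xs))"

lemma avg_in_cvx: "cvx K \<Longrightarrow> set xs \<subseteq> K \<Longrightarrow> xs \<noteq> [] \<Longrightarrow> avg xs \<in> K"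
  unfolding avg_def by (rule bary_in_cvx) (auto intro: unif_wts)

lemma avg_simplical_face: "avg (map (simplical_face j) xs) = simplical_face j (avg xs)"
  by (simp add: avg_def bary_simplical_face)

definition vertices :: "nat \<Rightarrow> (nat \<Rightarrow> real) list" where
  "vertices n = map basis_pt [0..<Suc n]"

lemma length_vertices [simp]: "length (vertices n) = Suc n"
  by (simp add: vertices_def)

lemma bary_vertices: "t \<in> wts (Suc n) \<Longrightarrow> bary (vertices n) t = t"
proof
  fix i assume t: "t \<in> wts (Suc n)"
  have "bary (vertices n) t i = (\<Sum>l<Suc n. t l * (basis_pt l) i)"
    unfolding bary_def by (intro sum.cong) (auto simp: vertices_def simp del: upt_Suc)
  also have "\<dots> = (\<Sum>l<Suc n. if l = i then t l else 0)"
    by (intro sum.cong) (auto simp: basis_pt_def)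
  also have "\<dots> = t i" using t by (subst sum.delta) (auto simp: wts_def)
  finally show "bary (vertices n) t i = t i" .
qed

lemma del_map: "del j (map f xs) = map f (del j xs)"
  by (simp add: del_def take_map drop_map)

lemma del_vertices:
  assumes "1 \<le> n" "j \<le> n"
  shows "del j (vertices n) = map (simplical_face j) (vertices (n - 1))"
proof (rule nth_equalityI)
  fix l assume "l < length (del j (vertices n))"
  then have l: "l < n" using assms by simp
  have "del j (vertices n) ! l = basis_pt (if l < j then l else Suc l)"
    using l assms unfolding del_def by (auto simp: vertices_def nth_append simp del: upt_Suc)
  also have "\<dots> = simplical_face j (basis_pt l)"
    by (auto simp: simplical_face_def basis_pt_def fun_eq_iff)
  also have "\<dots> = map (simplical_face j) (vertices (n - 1)) ! l"
    using l by (simp add: vertices_def del: upt_Suc)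
  finally show "del j (vertices n) ! l = map (simplical_face j) (vertices (n - 1)) ! l" .
qed (use assms in auto)

text \<open>The affine simplex \<open>xs\<close> in the standard \<open>n\<close>-simplex has dimension \<open>n + d\<close> and pulls the
  \<open>m\<close>-skeleton back into the \<open>(m + d)\<close>-skeleton.\<close>

definition good :: "nat \<Rightarrow> int \<Rightarrow> (nat \<Rightarrow> real) list \<Rightarrow> bool" where
  "good n d xs \<longleftrightarrow> int (length xs) = int n + d + 1 \<and> set xs \<subseteq> standard_simplex n
    \<and> (\<forall>t\<in>wts (length xs). int (nz t) \<le> int (nz (bary xs t)) + d)"

definition sinterior :: "nat \<Rightarrow> (nat \<Rightarrow> real) set" where
  "sinterior n = {b \<in> standard_simplex n. \<forall>i\<le>n. 0 < b i}"

lemma nz_sinterior: "b \<in> sinterior n \<Longrightarrow> nz b = Suc n"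
  by (rule nz_full) (auto simp: sinterior_def standard_simplex_eq_wts)

lemma cvx_standard_simplex: "cvx (standard_simplex n)"
  by (simp add: standard_simplex_eq_wts cvx_wts)

lemma cvx_sinterior: "cvx (sinterior n)"
  unfolding cvx_def
proof (intro ballI allI impI)
  fix x y :: "nat \<Rightarrow> real" and u :: real
  assume *: "x \<in> sinterior n" "y \<in> sinterior n" "0 \<le> u \<and> u \<le> 1"
  have "0 < u * x i + (1 - u) * y i" if "i \<le> n" for i
    using * that by (cases "u = 0") (auto simp: sinterior_def less_imp_le intro!: add_pos_nonneg)
  then show "(\<lambda>i. u * x i + (1 - u) * y i) \<in> sinterior n"
    using * cvx_standard_simplex[of n] unfolding sinterior_def cvx_def by auto
qed

text \<open>All summands are nonnegative, so one interior vertex with positive weight makes every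
  coordinate positive.\<close>

lemma bary_sinterior:
  assumes "set xs \<subseteq> standard_simplex n" "t \<in> wts (length xs)" "l < length xs" "0 < t l" "xs ! l \<in> sinterior n"
  shows "bary xs t \<in> sinterior n"
proof -
  have "bary xs t \<in> standard_simplex n"
    by (rule bary_in_cvx[OF cvx_standard_simplex]) (use assms in auto)
  moreover have "0 < bary xs t i" if "i \<le> n" for i
  proof -
    have nn: "0 \<le> t m * (xs ! m) i" if "m < length xs" for m
      using assms(1,2) nth_mem[OF that]
      by (intro mult_nonneg_nonneg) (auto simp: wts_def standard_simplex_def)
    have "0 < t l * (xs ! l) i" using assms that by (auto simp: sinterior_def)
    also have "\<dots> \<le> bary xs t i" unfolding bary_def
      by (rule member_le_sum[of l]) (use assms nn in auto)
    finally show ?thesis .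
  qed
  ultimately show ?thesis by (simp add: sinterior_def)
qed

text \<open>If the apex has weight 0, the bound for \<open>ys\<close> applies. Otherwise the image
  point is interior, all n + 1 of its coordinates are nonzero, and weights on n + d + 1 vertices
  cannot violate the bound.\<close>

lemma good_Cons_sinterior:
  assumes "b \<in> sinterior n" "int (length ys) = int n + d" "set ys \<subseteq> standard_simplex n"
    and "\<And>t. t \<in> wts (length ys) \<Longrightarrow> int (nz t) \<le> int (nz (bary ys t)) + d"
  shows "good n d (b # ys)"
  unfolding good_def
proof (intro conjI ballI)
  show s: "set (b # ys) \<subseteq> standard_simplex n" using assms by (auto simp: sinterior_def)
  fix t assume t: "t \<in> wts (length (b # ys))"
  show "int (nz t) \<le> int (nz (bary (b # ys) t)) + d"
  proof (cases "t 0 = 0")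
    case True
    then show ?thesis
      using assms(4)[of "\<lambda>l. t (Suc l)"] wts_shift[of t "length ys"] t
      by (auto simp: nz_shift bary_Cons)
  next
    case False
    then have "0 < t 0" using t by (auto simp: wts_def order_less_le)
    then have "bary (b # ys) t \<in> sinterior n"
      by (intro bary_sinterior[where l=0]) (use assms t s in auto)
    then show ?thesis using nz_sinterior nz_le[OF t] assms(2) by fastforce
  qed
qed (use assms in auto)

text \<open>\<open>e\<close> is the drop in dimension, 0 for stars and 1 for links. A point of a
  piece is rewritten in weights of the original simplex. If the apex has weight 0, induction on a
  face applies; otherwise all weights are positive, because the apex is the barycentre, and the
  count is the full length.\<close>

lemma bar_relative:
  assumes base: "\<And>xs ys. length xs \<le> 1 \<Longrightarrow> ys \<in> Poly_Mapping.keys (\<beta> xs) \<Longrightarrow>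
        length ys + e = length xs \<and> (\<forall>t\<in>wts (length ys). \<exists>s\<in>wts (length xs). bary ys t = bary (map fst xs) s \<and> nz t + e \<le> nz s)"
    and "ys \<in> Poly_Mapping.keys (bar (\<lambda>xs. avg (map fst xs)) \<beta> xs)"
  shows "length ys + e = length xs \<and> (\<forall>t\<in>wts (length ys). \<exists>s\<in>wts (length xs).
            bary ys t = bary (map fst xs) s \<and> nz t + e \<le> nz s)"
  using assms(2)
proof (induction xs arbitrary: ys rule: bar_induct)
  case (short xs)
  then have "ys \<in> Poly_Mapping.keys (\<beta> xs)" by (simp only: bar_short)
  from base[OF short(1) this] show ?case .
next
  case (long xs)
  let ?a = "avg (map fst xs)"
  let ?c = "frag_extend (bar (\<lambda>xs. avg (map fst xs)) \<beta>) (list_bd xs)"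
  have "ys \<in> Poly_Mapping.keys (vcone ?a ?c)"
    using long(3) by (simp only: bar_long[OF long(1)])
  from keys_cone_ex[OF this] obtain ys' where ys': "ys = ?a # ys'" "ys' \<in> Poly_Mapping.keys ?c"
    by auto
  from keys_frag_extend_ex[OF ys'(2)] obtain zs where zs: "zs \<in> Poly_Mapping.keys (list_bd xs)"
    "ys' \<in> Poly_Mapping.keys (bar (\<lambda>xs. avg (map fst xs)) \<beta> zs)" ..
  then obtain j where j: "j < length xs" "zs = del j xs" using keys_list_bd[OF zs(1)] by auto
  note IH = long(2)[OF zs]
  let ?k = "length xs"
  have len: "length ys' + e = ?k - 1" using IH j by simp
  have bar_zs: "bary (map fst zs) s = bary (map fst xs) (simplical_face j s)" for s
    using j bary_del[of j "map fst xs" s] by (simp add: del_map)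
  have face: "simplical_face j s \<in> wts ?k" if "s \<in> wts (length zs)" for s
  proof -
    have "j \<le> ?k - 1" "Suc (?k - 1) = ?k" using j(1) long(1) by auto
    then show ?thesis using that j simplical_face_wts[of j "?k - 1" s] by simp
  qed
  show ?case
  proof (intro conjI ballI)
    show "length ys + e = length xs" using len long(1) ys' by simp
    fix t assume t: "t \<in> wts (length ys)"
    then have t': "t \<in> wts (Suc (length ys'))" using ys' by simp
    show "\<exists>s\<in>wts (length xs). bary ys t = bary (map fst xs) s \<and> nz t + e \<le> nz s"
    proof (cases "t 0 = 0")
      case True
      then obtain s where s: "s \<in> wts (length zs)" "bary ys' (\<lambda>l. t (Suc l)) = bary (map fst zs) s"
          "nz (\<lambda>l. t (Suc l)) + e \<le> nz s"
        using IH wts_shift[OF t'] by blast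
      show ?thesis
        by (rule bexI[OF _ face[OF s(1)]])
           (use s True in \<open>auto simp: ys' bary_Cons bar_zs nz_shift\<close>)
    next
      case False
      then have t0: "0 < t 0" using t by (auto simp: wts_def order_less_le)
      have t1: "t 0 \<le> 1" using t' unfolding standard_simplex_eq_wts[symmetric] standard_simplex_def by blast
      have "\<exists>s\<in>wts ?k. bary ys' (\<lambda>l. t (Suc l)) = (\<lambda>i. (1 - t 0) * bary (map fst xs) s i)"
      proof (cases "t 0 = 1")
        case True
        then have "bary ys' (\<lambda>l. t (Suc l)) = bary ys' (\<lambda>l. 0)"
          using wts_head_1[OF t'] by (intro bary_cong) auto
        then show ?thesis using True long(1) by (intro bexI[OF _ unif_wts]) (auto simp: bary_def)
      next
        case False
        let ?s = "\<lambda>l. t (Suc l) / (1 - t 0)"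
        obtain s where s: "s \<in> wts (length zs)" "bary ys' ?s = bary (map fst zs) s"
          using IH wts_shift_scale[OF t' False] by blast
        have "(\<lambda>l. t (Suc l)) = (\<lambda>l. (1 - t 0) * ?s l + 0 * ?s l)" using False by auto
        then have "bary ys' (\<lambda>l. t (Suc l)) = (\<lambda>i. (1 - t 0) * bary ys' ?s i)"
          using bary_linear[of ys' "1 - t 0" ?s 0 ?s] by simp
        then show ?thesis by (intro bexI[OF _ face[OF s(1)]]) (simp add: s(2) bar_zs)
      qed
      then obtain s where s: "s \<in> wts ?k" "bary ys' (\<lambda>l. t (Suc l)) = (\<lambda>i. (1 - t 0) * bary (map fst xs) s i)"
        by blast
      \<comment> \<open>The weight \<open>t 0\<close> of the apex is spread evenly over all
        \<open>?k\<close> vertices, which makes \<open>nz ?s\<close> maximal.\<close>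
      let ?s = "\<lambda>l. t 0 * unif ?k l + (1 - t 0) * s l"
      have sw: "?s \<in> wts ?k"
        by (rule cvxD[OF cvx_wts]) (use s(1) t0 t1 long(1) in \<open>auto intro!: unif_wts\<close>)
      have "nz ?s = ?k"
        by (rule nz_full[OF sw]) (use t0 t1 s(1) in \<open>auto simp: unif_def wts_def intro!: add_pos_nonneg divide_pos_pos mult_nonneg_nonneg\<close>)
      moreover have "nz t + e \<le> ?k" using nz_le[OF t'] len long(1) by simp
      moreover have "bary ys t = bary (map fst xs) ?s"
        by (simp add: ys' bary_Cons s(2) bary_linear avg_def)
      ultimately show ?thesis using sw by (intro bexI[of _ ?s]) auto
    qed
  qed
qed

lemma star_relative:
  assumes "ys \<in> Poly_Mapping.keys (bar (\<lambda>xs. avg (map fst xs)) (star_base Q) xs)"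
  shows "length ys = length xs"
    and "\<And>t. t \<in> wts (length ys) \<Longrightarrow> \<exists>s\<in>wts (length xs). bary ys t = bary (map fst xs) s \<and> nz t \<le> nz s"
proof -
  have "length ys + 0 = length xs \<and> (\<forall>t\<in>wts (length ys). \<exists>s\<in>wts (length xs).
            bary ys t = bary (map fst xs) s \<and> nz t + 0 \<le> nz s)"
  proof (rule bar_relative[OF _ assms])
    fix xs :: "((nat \<Rightarrow> real) \<times> 'a) list" and ys
    assume *: "length xs \<le> 1" "ys \<in> Poly_Mapping.keys (star_base Q xs)"
    then have "ys = map fst xs"
      by (cases xs) (auto simp: star_base_def split: if_splits)
    then show "length ys + 0 = length xs \<and> (\<forall>t\<in>wts (length ys). \<exists>s\<in>wts (length xs).
            bary ys t = bary (map fst xs) s \<and> nz t + 0 \<le> nz s)" by auto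
  qed
  then show "length ys = length xs"
    and "\<And>t. t \<in> wts (length ys) \<Longrightarrow> \<exists>s\<in>wts (length xs). bary ys t = bary (map fst xs) s \<and> nz t \<le> nz s"
    by auto
qed

text \<open>The base piece is \<open>[]\<close>, one shorter than the vertex it replaces, and
  \<open>wts 0\<close> is empty. So the drop by one is present from the start, and
  \<open>bar_relative\<close> preserves it.\<close>

lemma link_relative:
  assumes "ys \<in> Poly_Mapping.keys (bar (\<lambda>xs. avg (map fst xs)) (link_base Q) xs)"
  shows "length ys + 1 = length xs"
    and "\<And>t. t \<in> wts (length ys) \<Longrightarrow> \<exists>s\<in>wts (length xs). bary ys t = bary (map fst xs) s \<and> nz t + 1 \<le> nz s"
proof -
  have "length ys + 1 = length xs \<and> (\<forall>t\<in>wts (length ys). \<exists>s\<in>wts (length xs).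
            bary ys t = bary (map fst xs) s \<and> nz t + 1 \<le> nz s)"
    by (rule bar_relative[OF _ assms]) (auto simp: link_base_def split: if_splits)
  then show "length ys + 1 = length xs"
    and "\<And>t. t \<in> wts (length ys) \<Longrightarrow> \<exists>s\<in>wts (length xs). bary ys t = bary (map fst xs) s \<and> nz t + 1 \<le> nz s"
    by auto
qed

lemma good_relative:
  assumes "good n 0 xs" "length ys + e = length xs"
    and rel: "\<And>t. t \<in> wts (length ys) \<Longrightarrow> \<exists>s\<in>wts (length xs). bary ys t = bary xs s \<and> nz t + e \<le> nz s"
  shows "good n (- int e) ys"
  unfolding good_def
proof (intro conjI ballI)
  show "set ys \<subseteq> standard_simplex n"
  proof
    fix y assume "y \<in> set ys"
    then obtain l where l: "l < length ys" "y = ys ! l" by (auto simp: in_set_conv_nth)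
    with rel[OF basis_pt_wts[OF l(1)]] obtain s where "s \<in> wts (length xs)" "y = bary xs s"
      by (auto simp: bary_basis_pt)
    then show "y \<in> standard_simplex n"
      using bary_in_cvx[OF cvx_standard_simplex] assms(1) by (simp add: good_def)
  qed
  fix t assume "t \<in> wts (length ys)"
  from rel[OF this] obtain s where s: "s \<in> wts (length xs)" "bary ys t = bary xs s" "nz t + e \<le> nz s"
    by blast
  then have "int (nz s) \<le> int (nz (bary xs s)) + 0" using assms(1) unfolding good_def by blast
  with s show "int (nz t) \<le> int (nz (bary ys t)) + - int e" by simp
qed (use assms in \<open>auto simp: good_def\<close>)

text \<open>A face map inserts a zero coordinate and so preserves \<open>nz\<close>, while the
  ambient dimension grows by one. The result is one vertex short of \<open>good n d\<close>; it has
  the form required by \<open>good_Cons_sinterior\<close>.\<close>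

lemma good_simplical_face_bound:
  assumes "good (n - 1) d xs" "1 \<le> n" "j \<le> n"
  shows "int (length (map (simplical_face j) xs)) = int n + d"
    and "set (map (simplical_face j) xs) \<subseteq> standard_simplex n"
    and "\<And>t. t \<in> wts (length xs) \<Longrightarrow> int (nz t) \<le> int (nz (bary (map (simplical_face j) xs) t)) + d"
  using assms simplical_face_in_standard_simplex[of n j]
  by (auto simp: good_def bary_simplical_face)

lemma good_vertices: "good n 0 (vertices n)"
proof -
  have "set (vertices n) \<subseteq> standard_simplex n"
    using basis_pt_wts[of _ "Suc n"] by (auto simp: standard_simplex_eq_wts vertices_def simp del: upt_Suc)
  then show ?thesis by (simp add: good_def bary_vertices)
qed

section \<open>Filling small labelled cycles\<close>

text \<open>A coordinatewise distance instead of \<open>dist\<close>: its balls are convex, and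
  averages can be estimated one coordinate at a time.\<close>

definition near :: "real \<Rightarrow> (nat \<Rightarrow> real) \<Rightarrow> (nat \<Rightarrow> real) \<Rightarrow> bool" where
  "near r x y \<longleftrightarrow> (\<forall>i. \<bar>x i - y i\<bar> \<le> r)"

lemma near_sym: "near r x y \<longleftrightarrow> near r y x"
  by (simp add: near_def abs_minus_commute)

lemma near_refl: "0 \<le> r \<Longrightarrow> near r x x"
  by (simp add: near_def)

lemma near_trans: "near r x y \<Longrightarrow> near s y z \<Longrightarrow> near (r + s) x z"
  unfolding near_def by (smt (verit, ccfv_threshold))

lemma near_mono: "near r x y \<Longrightarrow> r \<le> s \<Longrightarrow> near s x y"
  unfolding near_def by (meson order_trans)

lemma cvx_near: "cvx {y. near r x y}"
  unfolding cvx_def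
proof (intro ballI allI impI)
  fix y z :: "nat \<Rightarrow> real" and u :: real
  assume *: "y \<in> {y. near r x y}" "z \<in> {y. near r x y}" "0 \<le> u \<and> u \<le> 1"
  have "\<bar>x i - (u * y i + (1 - u) * z i)\<bar> \<le> r" for i
  proof -
    have eq: "x i - (u * y i + (1 - u) * z i) = u * (x i - y i) + (1 - u) * (x i - z i)"
      by (simp add: algebra_simps)
    have "\<bar>u * (x i - y i)\<bar> \<le> u * r" "\<bar>(1 - u) * (x i - z i)\<bar> \<le> (1 - u) * r"
      using * by (auto simp: abs_mult near_def intro!: mult_left_mono)
    then have "\<bar>u * (x i - y i) + (1 - u) * (x i - z i)\<bar> \<le> u * r + (1 - u) * r" by linarith
    also have "\<dots> = r" by (simp add: algebra_simps)
    finally show ?thesis unfolding eq .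
  qed
  then show "(\<lambda>i. u * y i + (1 - u) * z i) \<in> {y. near r x y}" by (simp add: near_def)
qed

text \<open>The metric on functions weights the coordinates by powers of 1/2, and these sum to the
  factor 2.\<close>

lemma near_imp_dist:
  assumes "near r x y" "0 \<le> r"
  shows "dist x y \<le> 2 * r"
proof -
  have s: "summable (\<lambda>n. (1 / 2) ^ n * r)" by (intro summable_mult2 summable_geometric) simp
  let ?f = "\<lambda>n. (1 / 2) ^ n * min (dist (x (from_nat n)) (y (from_nat n))) 1"
  have "dist x y = suminf ?f"
    by (simp add: dist_fun_def)
  also have "\<dots> \<le> suminf (\<lambda>n. (1 / 2) ^ n * r)"
  proof (rule suminf_le[OF _ _ s])
    show le: "?f n \<le> (1 / 2) ^ n * r" for n
      using assms by (intro mult_left_mono) (auto simp: near_def dist_real_def min.coboundedI1)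
    show "summable ?f"
      using le by (intro summable_comparison_test'[OF s, of 0]) (auto simp: norm_mult)
  qed
  also have "\<dots> = 2 * r" using suminf_mult2[of "\<lambda>n. (1 / 2) ^ n" r] suminf_geometric[of "1/2::real"]
    by (simp add: summable_geometric)
  finally show ?thesis .
qed

lemma lebesgue_near:
  assumes K: "compact K" "K \<subseteq> T" and "K \<subseteq> (\<Union>a\<in>A. W a)"
    and op: "\<And>a. a \<in> A \<Longrightarrow> openin (subtopology euclidean T) (W a)"
  shows "\<exists>r>0. \<forall>x\<in>K. \<exists>a\<in>A. \<forall>y\<in>T. near r x y \<longrightarrow> y \<in> W a"
proof -
  have "\<forall>a\<in>A. \<exists>O'. open O' \<and> W a = T \<inter> O'" using op by (simp add: openin_open)
  from bchoice[OF this] obtain V where "\<forall>a\<in>A. open (V a) \<and> W a = T \<inter> V a" by auto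
  then have V: "\<And>a. a \<in> A \<Longrightarrow> open (V a)" "\<And>a. a \<in> A \<Longrightarrow> W a = T \<inter> V a" by auto
  have cover: "K \<subseteq> \<Union> (V ` A)" using assms(3) V(2) by fastforce
  have "open G" if "G \<in> V ` A" for G using that V(1) by blast
  from Heine_Borel_lemma[OF K(1) cover this] obtain e
    where e: "0 < e" "\<And>x. x \<in> K \<Longrightarrow> \<exists>G\<in>V ` A. ball x e \<subseteq> G" by metis
  \<comment> \<open>By \<open>near_imp_dist\<close>, being near with radius e/4 gives distance at
    most e/2, hence a point of the open ball of radius \<open>e\<close>.\<close>
  show ?thesis
  proof (intro exI[of _ "e / 4"] conjI ballI)
    fix x assume "x \<in> K"
    with e obtain a where a: "a \<in> A" "ball x e \<subseteq> V a" by blast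
    have "y \<in> W a" if "y \<in> T" "near (e / 4) x y" for y
      using near_imp_dist[OF that(2)] a V(2)[OF a(1)] that e(1) by (auto simp: subset_iff)
    then show "\<exists>a\<in>A. \<forall>y\<in>T. near (e / 4) x y \<longrightarrow> y \<in> W a" using a by blast
  qed (use e in simp)
qed

lemma compact_standard_simplex: "compact (standard_simplex n)"
  using compactin_standard_simplex[of n] by (simp add: euclidean_product_topology)

lemma compact_hull: "compact (ahull xs)"
proof (cases xs)
  case (Cons x ys)
  have "continuous_on UNIV (bary xs)"
    unfolding bary_def
    by (intro continuous_on_coordinatewise_then_product continuous_intros) auto
  then show ?thesis
    unfolding ahull_def Cons length_Cons standard_simplex_eq_wts[symmetric]
    by (intro compact_continuous_image compact_standard_simplex) (auto simp: Cons intro: continuous_on_subset)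
qed (simp add: ahull_def)

section \<open>Simplices of iterated subdivisions and their mesh\<close>

definition mesh :: "real \<Rightarrow> (nat \<Rightarrow> real) list \<Rightarrow> bool" where
  "mesh r xs \<longleftrightarrow> (\<forall>u\<in>set xs. \<forall>v\<in>set xs. near r u v)"

lemma sd_keys:
  assumes "ys \<in> Poly_Mapping.keys (sd b c)"
  shows "\<exists>xs\<in>Poly_Mapping.keys c. length ys = length xs
    \<and> ys \<in> Poly_Mapping.keys (sd b (frag_of xs))"
proof -
  have closed: "length ys = length xs" if "ys \<in> Poly_Mapping.keys (sd b (frag_of xs))" for xs ys
    using that
  proof (induction "length xs" arbitrary: xs ys)
    case 0
    then show ?case by (auto simp: keys_frag_of)
  next
    case (Suc n)
    then have ne: "xs \<noteq> []" by auto
    from Suc.prems have "ys \<in> Poly_Mapping.keys (vcone (b xs) (sd b (list_bd xs)))"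
      by (simp only: sd_frag_of[OF ne])
    from keys_cone_ex[OF this] obtain zs where zs: "ys = b xs # zs" "zs \<in> Poly_Mapping.keys (sd b (list_bd xs))"
      by auto
    from keys_frag_extend_ex[OF zs(2)[unfolded sd_def]] obtain ws where
      ws: "ws \<in> Poly_Mapping.keys (list_bd xs)" "zs \<in> Poly_Mapping.keys (sd b (frag_of ws))"
      by (auto simp: sd_def)
    have "n = length ws" using length_keys_list_bd[OF ws(1)] Suc(2) by simp
    from Suc(1)[OF this ws(2)] show ?case using zs Suc(2) \<open>n = length ws\<close> by simp
  qed
  from keys_frag_extend_ex[OF assms[unfolded sd_def]] obtain xs where
    "xs \<in> Poly_Mapping.keys c" "ys \<in> Poly_Mapping.keys (sd b (frag_of xs))"
    by (auto simp: sd_def)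
  with closed show ?thesis by blast
qed

lemma sd_keys_closed:
  assumes "ys \<in> Poly_Mapping.keys (sd b (frag_of xs))" "set xs \<subseteq> A"
    and A: "\<And>zs. zs \<noteq> [] \<Longrightarrow> set zs \<subseteq> A \<Longrightarrow> b zs \<in> A"
  shows "set ys \<subseteq> A"
  using assms(1,2)
proof (induction "length xs" arbitrary: xs ys)
  case 0
  then show ?case by (auto simp: keys_frag_of)
next
  case (Suc n)
  then have ne: "xs \<noteq> []" by auto
  from Suc.prems have "ys \<in> Poly_Mapping.keys (vcone (b xs) (sd b (list_bd xs)))"
    by (simp only: sd_frag_of[OF ne])
  from keys_cone_ex[OF this] obtain zs where zs: "ys = b xs # zs" "zs \<in> Poly_Mapping.keys (sd b (list_bd xs))"
    by auto
  from sd_keys[OF zs(2)] obtain ws where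
    ws: "ws \<in> Poly_Mapping.keys (list_bd xs)" "zs \<in> Poly_Mapping.keys (sd b (frag_of ws))"
    by auto
  obtain j where j: "j < length xs" "ws = del j xs" using keys_list_bd[OF ws(1)] by auto
  have "set zs \<subseteq> A"
    by (rule Suc(1)[OF _ ws(2)]) (use j Suc(2) Suc.prems set_del[of j xs] in auto)
  then show ?case using zs A[OF ne] Suc.prems by simp
qed

text \<open>The quantifier over \<open>A\<close> comes after the choice of \<open>xs\<close>: one
  original simplex must work for every set closed under \<open>b\<close>, since hulls with labels,
  convex sets and balls are later inserted for the same \<open>xs\<close>.\<close>

lemma sd_htpy_keys:
  assumes "ys \<in> Poly_Mapping.keys (sd_htpy b c)"
  shows "\<exists>xs\<in>Poly_Mapping.keys c. length ys = Suc (length xs)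
    \<and> (\<forall>A. (\<forall>zs. zs \<noteq> [] \<longrightarrow> set zs \<subseteq> A \<longrightarrow> b zs \<in> A) \<longrightarrow> set xs \<subseteq> A \<longrightarrow> set ys \<subseteq> A)"
proof -
  have closed: "length ys = Suc (length xs) \<and>
      (\<forall>A. (\<forall>zs. zs \<noteq> [] \<longrightarrow> set zs \<subseteq> A \<longrightarrow> b zs \<in> A) \<longrightarrow> set xs \<subseteq> A \<longrightarrow> set ys \<subseteq> A)"
    if "ys \<in> Poly_Mapping.keys (sd_htpy b (frag_of xs))" for xs ys
    using that
  proof (induction "length xs" arbitrary: xs ys)
    case 0
    then show ?case by simp
  next
    case (Suc n)
    then have ne: "xs \<noteq> []" by auto
    from Suc.prems have "ys \<in> Poly_Mapping.keys (vcone (b xs) (frag_of xs - sd_htpy b (list_bd xs)))"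
      by (simp only: sd_htpy_frag_of[OF ne])
    from keys_cone_ex[OF this] obtain zs where zs: "ys = b xs # zs" "zs \<in> Poly_Mapping.keys (frag_of xs - sd_htpy b (list_bd xs))"
      by auto
    from keys_diff'[OF zs(2)] show ?case
    proof
      assume "zs \<in> Poly_Mapping.keys (frag_of xs)"
      then show ?case using zs(1) ne by (auto simp: keys_frag_of)
    next
      assume "zs \<in> Poly_Mapping.keys (sd_htpy b (list_bd xs))"
      from keys_frag_extend_ex[OF this[unfolded sd_htpy_def]] obtain ws where
        ws: "ws \<in> Poly_Mapping.keys (list_bd xs)" "zs \<in> Poly_Mapping.keys (sd_htpy b (frag_of ws))"
        by (auto simp: sd_htpy_def)
      have n: "n = length ws" using length_keys_list_bd[OF ws(1)] Suc(2) by simp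
      obtain j where j: "j < length xs" "ws = del j xs" using keys_list_bd[OF ws(1)] by auto
      have len: "length ys = Suc (length xs)" using Suc(1)[OF n ws(2)] zs(1) n Suc(2) by simp
      have "set ys \<subseteq> A" if A: "\<forall>zs. zs \<noteq> [] \<longrightarrow> set zs \<subseteq> A \<longrightarrow> b zs \<in> A" "set xs \<subseteq> A" for A
      proof -
        have "set ws \<subseteq> A" using j set_del[of j xs] A by blast
        then have "set zs \<subseteq> A" using Suc(1)[OF n ws(2)] A(1) by blast
        moreover have "b xs \<in> A" using A ne by blast
        ultimately show ?thesis using zs(1) by simp
      qed
      with len show ?case by blast
    qed
  qed
  from keys_frag_extend_ex[OF assms[unfolded sd_htpy_def]] obtain xs where
    "xs \<in> Poly_Mapping.keys c" "ys \<in> Poly_Mapping.keys (sd_htpy b (frag_of xs))"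
    by (auto simp: sd_htpy_def)
  with closed show ?thesis by blast
qed

lemma sd_iter_keys:
  assumes "ys \<in> Poly_Mapping.keys ((sd b ^^ m) c)"
  shows "\<exists>xs\<in>Poly_Mapping.keys c. length ys = length xs
    \<and> (\<forall>A. (\<forall>zs. zs \<noteq> [] \<longrightarrow> set zs \<subseteq> A \<longrightarrow> b zs \<in> A) \<longrightarrow> set xs \<subseteq> A \<longrightarrow> set ys \<subseteq> A)"
  using assms
proof (induction m arbitrary: ys)
  case (Suc m)
  then have "ys \<in> Poly_Mapping.keys (sd b ((sd b ^^ m) c))" by simp
  from sd_keys[OF this] obtain zs where zs: "zs \<in> Poly_Mapping.keys ((sd b ^^ m) c)"
    "length ys = length zs" "ys \<in> Poly_Mapping.keys (sd b (frag_of zs))" by auto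
  from Suc.IH[OF zs(1)] obtain xs where xs: "xs \<in> Poly_Mapping.keys c" "length zs = length xs"
    "\<forall>A. (\<forall>zs. zs \<noteq> [] \<longrightarrow> set zs \<subseteq> A \<longrightarrow> b zs \<in> A) \<longrightarrow> set xs \<subseteq> A \<longrightarrow> set zs \<subseteq> A" by auto
  show ?case
    by (rule bexI[OF _ xs(1)]) (use xs(2,3) zs(2) sd_keys_closed[OF zs(3)] in auto)
qed auto

lemma sd_htpy_iter_keys:
  assumes "ys \<in> Poly_Mapping.keys (sd_htpy_iter b m c)"
  shows "\<exists>xs\<in>Poly_Mapping.keys c. length ys = Suc (length xs)
    \<and> (\<forall>A. (\<forall>zs. zs \<noteq> [] \<longrightarrow> set zs \<subseteq> A \<longrightarrow> b zs \<in> A) \<longrightarrow> set xs \<subseteq> A \<longrightarrow> set ys \<subseteq> A)"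
  using assms
proof (induction m)
  case (Suc m)
  then consider "ys \<in> Poly_Mapping.keys (sd_htpy_iter b m c)" | "ys \<in> Poly_Mapping.keys (sd_htpy b ((sd b ^^ m) c))"
    using keys_add[of "sd_htpy_iter b m c" "sd_htpy b ((sd b ^^ m) c)"] by auto
  then show ?case
  proof cases
    case 2
    from sd_htpy_keys[OF 2] obtain zs where zs: "zs \<in> Poly_Mapping.keys ((sd b ^^ m) c)"
      "length ys = Suc (length zs)"
      "\<forall>A. (\<forall>zs. zs \<noteq> [] \<longrightarrow> set zs \<subseteq> A \<longrightarrow> b zs \<in> A) \<longrightarrow> set zs \<subseteq> A \<longrightarrow> set ys \<subseteq> A" by auto
    from sd_iter_keys[OF zs(1)] obtain xs where "xs \<in> Poly_Mapping.keys c" "length zs = length xs"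
      "\<forall>A. (\<forall>zs. zs \<noteq> [] \<longrightarrow> set zs \<subseteq> A \<longrightarrow> b zs \<in> A) \<longrightarrow> set xs \<subseteq> A \<longrightarrow> set zs \<subseteq> A" by auto
    then show ?thesis using zs by (intro bexI[of _ xs]) auto
  qed (use Suc in auto)
qed auto

text \<open>The difference to a vertex is an average of L differences, L the number of vertices. One
  of them is 0 and the others are at most \<open>d\<close>, which gives the factor 1 - 1/L.\<close>

lemma avg_near:
  assumes "mesh d xs" "x \<in> set xs" "length xs \<le> N" "0 \<le> d"
  shows "near ((1 - 1 / real N) * d) (avg xs) x"
  unfolding near_def
proof
  fix i
  let ?L = "length xs"
  have L: "0 < ?L" using assms(2) by (cases xs) auto
  obtain k where k: "k < ?L" "x = xs ! k" using assms(2) by (auto simp: in_set_conv_nth)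
  have "avg xs i = (\<Sum>l<?L. (xs ! l) i / real ?L)"
    unfolding avg_def bary_def by (intro sum.cong) (auto simp: unif_def)
  moreover have "x i = (\<Sum>l<?L. x i / real ?L)" using L by simp
  ultimately have "avg xs i - x i = (\<Sum>l<?L. ((xs ! l) i - x i) / real ?L)"
    by (simp add: sum_subtractf diff_divide_distrib)
  also have "\<dots> = (\<Sum>l\<in>{..<?L} - {k}. ((xs ! l) i - x i) / real ?L)"
    using k by (intro sum.mono_neutral_right) auto
  finally have "\<bar>avg xs i - x i\<bar> \<le> (\<Sum>l\<in>{..<?L} - {k}. \<bar>((xs ! l) i - x i) / real ?L\<bar>)"
    by (simp only: sum_abs)
  also have "\<dots> \<le> (\<Sum>l\<in>{..<?L} - {k}. d / real ?L)"
    using assms(1,2) L by (intro sum_mono) (auto simp: mesh_def near_def intro!: divide_right_mono)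
  also have "\<dots> = (real ?L - 1) * (d / real ?L)"
    using k L by (simp add: of_nat_diff Suc_leI)
  also have "\<dots> = (1 - 1 / real ?L) * d"
    using L by (simp add: field_simps)
  also have "\<dots> \<le> (1 - 1 / real N) * d"
    using assms(3,4) L order.strict_trans2[OF L assms(3)] by (intro mult_right_mono) (auto intro!: divide_left_mono mult_pos_pos)
  finally show "\<bar>avg xs i - x i\<bar> \<le> (1 - 1 / real N) * d" .
qed

lemma mesh_mono: "mesh d xs \<Longrightarrow> set ys \<subseteq> set xs \<Longrightarrow> d \<le> e \<Longrightarrow> mesh e ys"
  unfolding mesh_def using near_mono by blast

context
  fixes pt :: "'v \<Rightarrow> (nat \<Rightarrow> real)" and b :: "'v list \<Rightarrow> 'v"
  assumes pt_b: "\<And>zs. pt (b zs) = avg (map pt zs)"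
begin

lemma b_closed_cvx: "cvx K \<Longrightarrow> zs \<noteq> [] \<Longrightarrow> set zs \<subseteq> {v. pt v \<in> K} \<Longrightarrow> b zs \<in> {v. pt v \<in> K}"
  using avg_in_cvx[of K "map pt zs"] by (auto simp: pt_b)

text \<open>Vertices may carry labels, and \<open>pt\<close> reads off the position. The new apex is
  within the contracted distance of every old vertex; the ball about it is convex, so the vertices
  of the subdivided boundary stay in it as well.\<close>

lemma sd_mesh:
  assumes "ys \<in> Poly_Mapping.keys (sd b (frag_of xs))" "mesh d (map pt xs)" "length xs \<le> N" "0 \<le> d" "1 \<le> N"
  shows "mesh ((1 - 1 / real N) * d) (map pt ys)"
  using assms(1-3)
proof (induction "length xs" arbitrary: xs ys)
  case 0
  then show ?case by (auto simp: keys_frag_of mesh_def)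
next
  case (Suc n)
  let ?e = "(1 - 1 / real N) * d"
  have e: "0 \<le> ?e" using assms(4,5) by (intro mult_nonneg_nonneg) auto
  from Suc have ne: "xs \<noteq> []" by auto
  from Suc.prems have "ys \<in> Poly_Mapping.keys (vcone (b xs) (sd b (list_bd xs)))"
    by (simp only: sd_frag_of[OF ne])
  from keys_cone_ex[OF this] obtain zs where zs: "ys = b xs # zs" "zs \<in> Poly_Mapping.keys (sd b (list_bd xs))"
    by auto
  from sd_keys[OF zs(2)] obtain ws where
    ws: "ws \<in> Poly_Mapping.keys (list_bd xs)" "zs \<in> Poly_Mapping.keys (sd b (frag_of ws))"
    by auto
  obtain j where j: "j < length xs" "ws = del j xs" using keys_list_bd[OF ws(1)] by auto
  have m: "mesh ?e (map pt zs)"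
  proof (rule Suc(1)[OF _ ws(2)])
    show "mesh d (map pt ws)"
      by (rule mesh_mono[OF Suc.prems(2)]) (use j(2) set_del[of j xs] in auto)
  qed (use j Suc in auto)
  have "set zs \<subseteq> {v. pt v \<in> {w. near ?e (avg (map pt xs)) w}}"
  proof (rule sd_keys_closed[OF ws(2)])
    show "set ws \<subseteq> {v. pt v \<in> {w. near ?e (avg (map pt xs)) w}}"
      using j set_del[of j xs] avg_near[of d "map pt xs" _ N] Suc.prems assms(4) by auto
  qed (use b_closed_cvx[OF cvx_near] in auto)
  with m show ?case unfolding zs(1)
    by (auto simp: mesh_def pt_b near_refl[OF e] near_sym)
qed

lemma sd_iter_mesh:
  assumes "\<And>xs. xs \<in> Poly_Mapping.keys c \<Longrightarrow> mesh d (map pt xs) \<and> length xs \<le> N" "0 \<le> d" "1 \<le> N"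
    and "ys \<in> Poly_Mapping.keys ((sd b ^^ m) c)"
  shows "mesh ((1 - 1 / real N) ^ m * d) (map pt ys)"
  using assms(4)
proof (induction m arbitrary: ys)
  case (Suc m)
  then have "ys \<in> Poly_Mapping.keys (sd b ((sd b ^^ m) c))" by simp
  from sd_keys[OF this] obtain zs where zs: "zs \<in> Poly_Mapping.keys ((sd b ^^ m) c)"
    "length ys = length zs" "ys \<in> Poly_Mapping.keys (sd b (frag_of zs))" by auto
  have "length zs \<le> N" using sd_iter_keys[OF zs(1)] assms(1) by auto
  moreover have "0 \<le> (1 - 1 / real N) ^ m * d" using assms by (intro mult_nonneg_nonneg zero_le_power) auto
  ultimately have "mesh ((1 - 1 / real N) * ((1 - 1 / real N) ^ m * d)) (map pt ys)"
    by (intro sd_mesh[OF zs(3) Suc.IH[OF zs(1)]]) (use assms in auto)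
  then show ?case by (simp add: mult.assoc)
qed (use assms in auto)

text \<open>Coordinates lie between 0 and 1, so the initial mesh is at most 1, and every round
  contracts it by 1 - 1/N, where \<open>N\<close> exceeds the lengths of the finitely many
  simplices.\<close>

lemma sd_iter_small:
  assumes "0 < \<epsilon>" "\<And>xs. xs \<in> Poly_Mapping.keys c \<Longrightarrow> set (map pt xs) \<subseteq> standard_simplex n"
  shows "\<exists>m. \<forall>ys\<in>Poly_Mapping.keys ((sd b ^^ m) c). mesh \<epsilon> (map pt ys)"
proof -
  define N where "N = Suc (Max (length ` Poly_Mapping.keys c))"
  have N: "1 \<le> N" "length xs \<le> N" if "xs \<in> Poly_Mapping.keys c" for xs
    using that by (auto simp: N_def le_SucI)
  have "1 \<le> N" by (simp add: N_def)
  have "mesh 1 (map pt xs)" if "xs \<in> Poly_Mapping.keys c" for xs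
  proof -
    have "\<bar>pt u i - pt v i\<bar> \<le> 1" if "u \<in> set xs" "v \<in> set xs" for u v i
    proof -
      have "pt u \<in> standard_simplex n" "pt v \<in> standard_simplex n" using assms(2)[OF \<open>xs \<in> _\<close>] that by auto
      then have "0 \<le> pt u i" "pt u i \<le> 1" "0 \<le> pt v i" "pt v i \<le> 1" by (auto simp: standard_simplex_def)
      then show ?thesis by linarith
    qed
    then show ?thesis by (auto simp: mesh_def near_def)
  qed
  then have m: "mesh ((1 - 1 / real N) ^ m * 1) (map pt ys)"
    if "ys \<in> Poly_Mapping.keys ((sd b ^^ m) c)" for m ys
    by (intro sd_iter_mesh[OF _ _ \<open>1 \<le> N\<close> that]) (use N in auto)
  have "0 \<le> 1 - 1 / real N" "1 - 1 / real N < 1" using \<open>1 \<le> N\<close> by auto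
  then obtain m where "(1 - 1 / real N) ^ m < \<epsilon>"
    using real_arch_pow_inv[OF assms(1)] by blast
  then have "mesh \<epsilon> (map pt ys)" if "ys \<in> Poly_Mapping.keys ((sd b ^^ m) c)" for ys
    by (intro mesh_mono[OF m[OF that]]) auto
  then show ?thesis by blast
qed

end

abbreviation pts :: "((nat \<Rightarrow> real) \<times> 'i) list \<Rightarrow> (nat \<Rightarrow> real) list" where
  "pts \<equiv> map fst"

lemma keys_add': "x \<in> Poly_Mapping.keys (a + b) \<Longrightarrow> x \<in> Poly_Mapping.keys a \<or> x \<in> Poly_Mapping.keys b"
  using keys_add[of a b] by auto

text \<open>Used for the prism that pushes a cycle off the boundary: its pieces span old and moved
  vertices together and must remain close to the old hull.\<close>

lemma cvx_thicken:
  assumes "cvx A"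
  shows "cvx {y. \<exists>x\<in>A. near r x y}"
  unfolding cvx_def
proof (intro ballI allI impI)
  fix y y' :: "nat \<Rightarrow> real" and u :: real
  assume *: "y \<in> {y. \<exists>x\<in>A. near r x y}" "y' \<in> {y. \<exists>x\<in>A. near r x y}" "0 \<le> u \<and> u \<le> 1"
  then obtain x x' where x: "x \<in> A" "near r x y" "x' \<in> A" "near r x' y'" by blast
  have "\<bar>(u * x i + (1 - u) * x' i) - (u * y i + (1 - u) * y' i)\<bar> \<le> r" for i
  proof -
    have eq: "(u * x i + (1 - u) * x' i) - (u * y i + (1 - u) * y' i)
        = u * (x i - y i) + (1 - u) * (x' i - y' i)"
      by (simp add: algebra_simps)
    have "\<bar>u * (x i - y i)\<bar> \<le> u * r" "\<bar>(1 - u) * (x' i - y' i)\<bar> \<le> (1 - u) * r"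
      using * x by (auto simp: abs_mult near_def intro!: mult_left_mono)
    then have "\<bar>u * (x i - y i) + (1 - u) * (x' i - y' i)\<bar> \<le> u * r + (1 - u) * r" by linarith
    also have "\<dots> = r" by (simp add: algebra_simps)
    finally show ?thesis unfolding eq .
  qed
  then have "near r (\<lambda>i. u * x i + (1 - u) * x' i) (\<lambda>i. u * y i + (1 - u) * y' i)"
    by (simp add: near_def)
  moreover have "(\<lambda>i. u * x i + (1 - u) * x' i) \<in> A"
    by (rule cvxD[OF assms]) (use x * in auto)
  ultimately show "(\<lambda>i. u * y i + (1 - u) * y' i) \<in> {y. \<exists>x\<in>A. near r x y}" by blast
qed

lemma finite_uniform_radius:
  assumes "finite J" "\<And>j. j \<in> J \<Longrightarrow> \<exists>r>0. Q r j"
    and mono: "\<And>r s j. Q r j \<Longrightarrow> 0 < s \<Longrightarrow> s \<le> r \<Longrightarrow> Q s j"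
  shows "\<exists>r>0::real. \<forall>j\<in>J. Q r j"
  using assms(1,2)
proof (induction J rule: finite_induct)
  case empty
  show ?case by (rule exI[of _ 1]) simp
next
  case (insert j J)
  have "\<exists>r>0. \<forall>j\<in>J. Q r j" using insert by simp
  then obtain r where r: "r > 0" "\<forall>j\<in>J. Q r j" by blast
  from insert.prems obtain s where s: "s > 0" "Q s j" by blast
  have "Q (min r s) i" if "i \<in> insert j J" for i
    using that r s by (auto intro: mono[of s j "min r s"] mono[of r i "min r s"])
  then show ?case using r(1) s(1) by (intro exI[of _ "min r s"]) auto
qed

text \<open>By convexity every point of the simplex is interior, so all n + 1 coordinates are
  nonzero, as many as the weights can have.\<close>

lemma good_of_interior:
  assumes "set ps \<subseteq> sinterior n" "length ps = Suc n"
  shows "good n 0 ps"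
  unfolding good_def
proof (intro conjI ballI)
  fix t assume t: "t \<in> wts (length ps)"
  then have "bary ps t \<in> sinterior n" using bary_in_cvx[OF cvx_sinterior] assms by blast
  then show "int (nz t) \<le> int (nz (bary ps t)) + 0" using nz_le[OF t] nz_sinterior assms(2) by fastforce
qed (use assms in \<open>auto simp: sinterior_def\<close>)

text \<open>The hull must fit every label occurring, not just one. The condition then passes to
  faces, and a new vertex may inherit any label present.\<close>

definition small ::
    "('i \<Rightarrow> (nat \<Rightarrow> real) set) \<Rightarrow> 'i set \<Rightarrow> ((nat \<Rightarrow> real) \<times> 'i) list \<Rightarrow> bool" where
  "small W I xs \<longleftrightarrow> snd ` set xs \<subseteq> I \<and> (\<forall>a\<in>snd ` set xs. ahull (pts xs) \<subseteq> W a)"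

text \<open>Every small labelled cycle in the standard simplex bounds. It is first pushed off the boundary,
  then finely subdivided with new vertices inheriting labels, then relabelled by a function of the
  vertices (a Lebesgue number is available by then), and finally coned off and subdivided again.
  All new vertices are interior, which keeps the filling in general position.\<close>

lemma fill_small_cycle:
  fixes W :: "'i \<Rightarrow> (nat \<Rightarrow> real) set"
  assumes op: "\<And>a. a \<in> I \<Longrightarrow> openin (top_of_set (standard_simplex n)) (W a)"
    and cover: "standard_simplex n \<subseteq> (\<Union>a\<in>I. W a)"
    and cycle: "bd z = 0"
    and z: "\<And>xs. xs \<in> Poly_Mapping.keys z \<Longrightarrow> length xs = n \<and> small W I xs
      \<and> set (pts xs) \<subseteq> standard_simplex n \<and> (\<forall>t\<in>wts n. nz t \<le> nz (bary (pts xs) t))"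
  shows "\<exists>c. bd c = z \<and> (\<forall>xs\<in>Poly_Mapping.keys c. good n 0 (pts xs) \<and> small W I xs)"
proof -
  \<comment> \<open>Pairs of a simplex of \<open>z\<close> and one of its labels. There are finitely
    many, and each hull is compact inside a relatively open set, so one radius \<open>r\<close>
    serves them all.\<close>
  define J where "J = (SIGMA xs:Poly_Mapping.keys z. snd ` set xs)"
  define Q where "Q = (\<lambda>r (xs :: ((nat \<Rightarrow> real) \<times> 'i) list, a). \<forall>x\<in>ahull (pts xs). \<forall>y\<in>standard_simplex n. near r x y \<longrightarrow> y \<in> W a)"
  have "\<exists>r>0. \<forall>j\<in>J. Q r j"
  proof (rule finite_uniform_radius)
    show "finite J" by (auto simp: J_def)
    fix j assume "j \<in> J"
    then obtain xs a where j: "j = (xs, a)" "xs \<in> Poly_Mapping.keys z" "a \<in> snd ` set xs" by (auto simp: J_def)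
    note zxs = z[OF j(2)]
    have aI: "a \<in> I" using zxs j(3) by (auto simp: small_def)
    have "\<exists>r>0. \<forall>x\<in>ahull (pts xs). \<exists>a'\<in>{a}. \<forall>y\<in>standard_simplex n. near r x y \<longrightarrow> y \<in> W a'"
      by (rule lebesgue_near[OF compact_hull hull_subset_cvx[OF cvx_standard_simplex]])
         (use zxs aI op j(3) in \<open>auto simp: small_def\<close>)
    then show "\<exists>r>0. Q r j" by (simp add: Q_def j(1))
  next
    fix r s and j :: "((nat \<Rightarrow> real) \<times> 'i) list \<times> 'i" assume "Q r j" "s \<le> r" 
    then show "Q s j" unfolding Q_def using near_mono by (fastforce split: prod.splits)
  qed
  then obtain r where r: "0 < r" "\<forall>j\<in>J. Q r j" by blast
  have r_near: "y \<in> W a" if "xs \<in> Poly_Mapping.keys z" "a \<in> snd ` set xs" "x \<in> ahull (pts xs)"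
    "y \<in> standard_simplex n" "near r x y" for xs a x y
  proof -
    have "(xs, a) \<in> J" using that(1,2) by (simp add: J_def)
    then show ?thesis using r(2) that(3-) by (auto simp: Q_def)
  qed
  \<comment> \<open>At most r/2, so that pushed simplices keep a margin r/2 inside the sets of their
    labels; below 1, so that \<open>h\<close> is a convex combination keeping a share of
    \<open>v\<close>.\<close>
  define \<delta> where "\<delta> = min (r / 2) (1 / 2)"
  have \<delta>: "0 < \<delta>" "\<delta> \<le> r / 2" "\<delta> < 1" using r(1) by (auto simp: \<delta>_def)
  define b where "b = unif (Suc n)"
  have b: "b \<in> sinterior n"
    using unif_wts[of "Suc n"] by (auto simp: sinterior_def standard_simplex_eq_wts b_def unif_def)
  define h where "h = (\<lambda>v i. \<delta> * b i + (1 - \<delta>) * v i)"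
  have h: "h v \<in> sinterior n" "near \<delta> v (h v)" if v: "v \<in> standard_simplex n" for v
  proof -
    have "h v \<in> standard_simplex n"
      unfolding h_def by (rule cvxD[OF cvx_standard_simplex]) (use b v \<delta> in \<open>auto simp: sinterior_def\<close>)
    moreover have "0 < h v i" if "i \<le> n" for i
      unfolding h_def using that b v \<delta>
      by (intro add_pos_nonneg mult_pos_pos mult_nonneg_nonneg) (auto simp: sinterior_def standard_simplex_def)
    ultimately show "h v \<in> sinterior n" by (simp add: sinterior_def)
    have "\<bar>v i - h v i\<bar> \<le> \<delta>" for i
    proof -
      have "v i - h v i = \<delta> * (v i - b i)" by (simp add: h_def algebra_simps)
      moreover have "b \<in> standard_simplex n" using b by (simp add: sinterior_def)
      then have "0 \<le> v i \<and> v i \<le> 1 \<and> 0 \<le> b i \<and> b i \<le> 1" using v unfolding standard_simplex_def by blast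
      then have "\<bar>v i - b i\<bar> \<le> 1" by linarith
      ultimately show ?thesis using \<delta>(1) by (simp add: abs_mult mult_left_le)
    qed
    then show "near \<delta> v (h v)" by (simp add: near_def)
  qed
  define hh where "hh = map_prod h (\<lambda>a::'i. a)"
  have pts_hh: "pts (map hh xs) = map h (pts xs)" for xs by (simp add: hh_def)
  have thick: "y \<in> {y. \<exists>x\<in>ahull (pts xs). near \<delta> x y}"
    if "xs \<in> Poly_Mapping.keys z" "y \<in> ahull ps" "set ps \<subseteq> set (pts xs) \<union> h ` set (pts xs)" for xs ps y
  proof -
    have "set ps \<subseteq> {y. \<exists>x\<in>ahull (pts xs). near \<delta> x y}"
    proof
      fix v assume "v \<in> set ps"
      with that(3) obtain u where "u \<in> set (pts xs)" "v = u \<or> v = h u" by blast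
      moreover have "u \<in> standard_simplex n" using calculation z[OF that(1)] by blast
      ultimately show "v \<in> {y. \<exists>x\<in>ahull (pts xs). near \<delta> x y}"
        using h(2)[of u] near_refl[of \<delta> u] \<delta>(1) set_subset_hull[of "pts xs"] by fastforce
    qed
    then show ?thesis using hull_subset_cvx[OF cvx_thicken[OF cvx_hull]] that(2) by blast
  qed

  \<comment> \<open>In contrast to \<open>small\<close> this also records a margin and a position
    off the boundary. It passes to any simplex with vertices in the hull and labels among the given
    ones (\<open>inside_sub\<close>), and with n + 1 vertices it implies
    \<open>good\<close>.\<close>
  define inside where "inside = (\<lambda>xs. set (pts xs) \<subseteq> sinterior n \<and> snd ` set xs \<subseteq> I \<and>
    (\<forall>a\<in>snd ` set xs. \<forall>x\<in>ahull (pts xs). \<forall>y\<in>standard_simplex n. near (r/2) x y \<longrightarrow> y \<in> W a))"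
  have inside_pts: "set (pts xs) \<subseteq> sinterior n" if "inside xs" for xs
    using that unfolding inside_def by (rule conjunct1)
  have inside_hull: "ahull (pts xs) \<subseteq> sinterior n" if "inside xs" for xs
    by (rule hull_subset_cvx[OF cvx_sinterior inside_pts[OF that]])
  have inside_simplex: "x \<in> standard_simplex n" if "x \<in> sinterior n" for x
    using that by (simp add: sinterior_def)
  have inside_labels: "snd ` set xs \<subseteq> I" if "inside xs" for xs
    using that unfolding inside_def by (elim conjE)
  have inside_near: "y \<in> W a" if "inside xs" "a \<in> snd ` set xs" "x \<in> ahull (pts xs)"
      "y \<in> standard_simplex n" "near (r/2) x y" for xs a x y
    using that unfolding inside_def by (elim conjE) (drule (1) bspec, blast)
  have inside_hull_W: "ahull (pts xs) \<subseteq> W a" if "inside xs" "a \<in> snd ` set xs" for xs a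
  proof
    fix x assume x: "x \<in> ahull (pts xs)"
    show "x \<in> W a"
      by (rule inside_near[OF that x])
         (use subsetD[OF inside_hull[OF that(1)] x] inside_simplex r(1) in \<open>simp_all add: near_refl\<close>)
  qed
  have inside_imp_small: "small W I xs" if "inside xs" for xs
    unfolding small_def using inside_hull_W[OF that] inside_labels[OF that] by blast
  have inside_small: "good n 0 (pts xs) \<and> small W I xs" if "inside xs" "length xs = Suc n" for xs
    using good_of_interior[OF inside_pts[OF that(1)]] that inside_imp_small by simp

  define z1 where "z1 = vmap hh z"
  have z1_cycle: "bd z1 = 0" by (simp add: z1_def bd_vmap cycle)
  have z1: "length ys = n \<and> inside ys" if "ys \<in> Poly_Mapping.keys z1" for ys
  proof -
    from keys_vmap_ex[OF that[unfolded z1_def]] obtain xs where xs: "xs \<in> Poly_Mapping.keys z" "ys = map hh xs" by auto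
    note zxs = z[OF xs(1)]
    have lab: "snd ` set ys = snd ` set xs" by (auto simp: xs hh_def image_image)
    have "y \<in> W a" if *: "a \<in> snd ` set xs" "x \<in> ahull (map h (pts xs))" "y \<in> standard_simplex n" "near (r/2) x y" for a x y
    proof -
      obtain x' where x': "x' \<in> ahull (pts xs)" "near \<delta> x' x"
        using thick[OF xs(1) *(2)] by auto
      then have "near r x' y" using near_trans[OF x'(2) *(4)] \<delta> by (auto intro: near_mono)
      then show ?thesis using r_near[OF xs(1) *(1) x'(1) *(3)] by simp
    qed
    then have "\<forall>a\<in>snd ` set xs. \<forall>x\<in>ahull (map h (pts xs)). \<forall>y\<in>standard_simplex n. near (r/2) x y \<longrightarrow> y \<in> W a"
      by blast
    moreover have "set (map h (pts xs)) \<subseteq> sinterior n" using zxs h(1) by auto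
    moreover have "pts ys = map h (pts xs)" unfolding xs(2) by (rule pts_hh)
    ultimately have "inside ys" using zxs unfolding inside_def lab small_def by (simp only:)
    then show ?thesis using zxs xs(2) by simp
  qed

  \<comment> \<open>A new vertex takes the label of the first vertex of its face. Any rule picking a
    label present there would do, because the hull lies in the set of each of them.\<close>
  define bl where "bl = (\<lambda>zs :: ((nat \<Rightarrow> real) \<times> 'i) list. (avg (pts zs), snd (hd zs)))"
  have inside_sub: "inside ys" if xs: "inside xs"
   and sub: "\<forall>A. (\<forall>zs. zs \<noteq> [] \<longrightarrow> set zs \<subseteq> A \<longrightarrow> bl zs \<in> A) \<longrightarrow> set xs \<subseteq> A \<longrightarrow> set ys \<subseteq> A" for xs ys
  proof -
    let ?A = "ahull (pts xs) \<times> snd ` set xs"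
    have "bl zs \<in> ?A" if zs: "zs \<noteq> []" "set zs \<subseteq> ?A" for zs
    proof -
      have "set (pts zs) \<subseteq> ahull (pts xs)" using zs(2) by auto
      then have "avg (pts zs) \<in> ahull (pts xs)" using avg_in_cvx[OF cvx_hull, of "pts zs"] zs(1) by simp
      moreover have "hd zs \<in> ?A" using zs hd_in_set by blast
      ultimately show ?thesis by (simp add: bl_def mem_Times_iff)
    qed
    moreover have "set xs \<subseteq> ?A" using set_subset_hull[of "pts xs"] by force
    ultimately have "set ys \<subseteq> ?A" using sub by blast
    then have *: "set (pts ys) \<subseteq> ahull (pts xs)" "snd ` set ys \<subseteq> snd ` set xs" by auto
    show "inside ys" unfolding inside_def
    proof (intro conjI ballI impI)
      show "set (pts ys) \<subseteq> sinterior n" using *(1) inside_hull[OF xs] by blast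
      show "snd ` set ys \<subseteq> I" using *(2) inside_labels[OF xs] by blast
      fix a x y assume "a \<in> snd ` set ys" "x \<in> ahull (pts ys)" "y \<in> standard_simplex n" "near (r/2) x y"
      then show "y \<in> W a" using inside_near[OF xs _ _ _] *(2) hull_mono[OF *(1)] by blast
    qed
  qed

  \<comment> \<open>A Lebesgue number \<open>e\<close> for the whole covering; \<open>L x\<close>
    will be a label whose set contains the \<open>e\<close>-neighbourhood of \<open>x\<close>. From
    mesh \<open>e\<close> on, a vertex can be relabelled by its position alone.\<close>
  have "\<exists>e>0. \<forall>x\<in>standard_simplex n. \<exists>a\<in>I. \<forall>y\<in>standard_simplex n. near e x y \<longrightarrow> y \<in> W a"
    by (rule lebesgue_near[OF compact_standard_simplex order_refl cover op])
  then obtain e where e: "0 < e" "\<forall>x\<in>standard_simplex n. \<exists>a\<in>I. \<forall>y\<in>standard_simplex n. near e x y \<longrightarrow> y \<in> W a"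
    by blast
  from bchoice[OF e(2)[unfolded Bex_def]] obtain L where
    L: "\<And>x. x \<in> standard_simplex n \<Longrightarrow> L x \<in> I"
       "\<And>x y. x \<in> standard_simplex n \<Longrightarrow> y \<in> standard_simplex n \<Longrightarrow> near e x y \<Longrightarrow> y \<in> W (L x)"
    by auto
  have L_hull: "ahull ps \<subseteq> W (L v)" if "set ps \<subseteq> sinterior n" "mesh e ps" "v \<in> set ps" for ps v
  proof
    fix y assume y: "y \<in> ahull ps"
    have "ahull ps \<subseteq> {y. near e v y}"
      by (rule hull_subset_cvx[OF cvx_near]) (use that in \<open>auto simp: mesh_def\<close>)
    moreover have "ahull ps \<subseteq> sinterior n" by (rule hull_subset_cvx[OF cvx_sinterior that(1)])
    ultimately show "y \<in> W (L v)" using y that L(2)[of v y] by (auto simp: sinterior_def)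
  qed

  have "\<exists>m. \<forall>ys\<in>Poly_Mapping.keys ((sd bl ^^ m) z1). mesh e (map fst ys)"
  proof (rule sd_iter_small[OF _ e(1)])
    fix xs assume "xs \<in> Poly_Mapping.keys z1"
    then show "set (pts xs) \<subseteq> standard_simplex n" using z1 inside_pts[of xs] inside_simplex by blast
  qed (simp add: bl_def)
  then obtain m where m: "\<And>ys. ys \<in> Poly_Mapping.keys ((sd bl ^^ m) z1) \<Longrightarrow> mesh e (pts ys)" by blast
  define z2 where "z2 = (sd bl ^^ m) z1"
  have z2_cycle: "bd z2 = 0" by (simp add: z2_def bd_sd_iter z1_cycle)
  have z2: "length ys = n \<and> inside ys \<and> mesh e (pts ys)" if "ys \<in> Poly_Mapping.keys z2" for ys
  proof -
    from sd_iter_keys[OF that[unfolded z2_def]] obtain xs where xs: "xs \<in> Poly_Mapping.keys z1" "length ys = length xs"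
      "\<forall>A. (\<forall>zs. zs \<noteq> [] \<longrightarrow> set zs \<subseteq> A \<longrightarrow> bl zs \<in> A) \<longrightarrow> set xs \<subseteq> A \<longrightarrow> set ys \<subseteq> A" by auto
    show ?thesis using z1[OF xs(1)] inside_sub[OF _ xs(3)] xs(2) m[OF that[unfolded z2_def]] by simp
  qed
  define g where "g = (\<lambda>x :: (nat \<Rightarrow> real) \<times> 'i. (fst x, L (fst x)))"
  define y where "y = vmap fst z2"
  have y_cycle: "bd y = 0" by (simp add: y_def bd_vmap z2_cycle)
  have y: "length ps = n \<and> set ps \<subseteq> sinterior n \<and> mesh e ps" if "ps \<in> Poly_Mapping.keys y" for ps
  proof -
    from keys_vmap_ex[OF that[unfolded y_def]] obtain xs where "xs \<in> Poly_Mapping.keys z2" "ps = pts xs" by auto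
    then show ?thesis using z2[of xs] inside_pts[of xs] by simp
  qed
  have by_keys: "length ps = Suc n \<and> set ps \<subseteq> sinterior n" if "ps \<in> Poly_Mapping.keys (vcone b y)" for ps
  proof -
    from keys_cone_ex[OF that] obtain xs where "xs \<in> Poly_Mapping.keys y" "ps = b # xs" by auto
    then show ?thesis using y[of xs] b by simp
  qed
  have "\<exists>m. \<forall>ys\<in>Poly_Mapping.keys ((sd avg ^^ m) (vcone b y)). mesh e (map (\<lambda>x. x) ys)"
  proof (rule sd_iter_small[OF _ e(1)])
    fix xs assume "xs \<in> Poly_Mapping.keys (vcone b y)"
    then show "set (map (\<lambda>x. x) xs) \<subseteq> standard_simplex n" using by_keys[of xs] inside_simplex by auto
  qed simp
  then obtain k where k: "\<And>ys. ys \<in> Poly_Mapping.keys ((sd avg ^^ k) (vcone b y)) \<Longrightarrow> mesh e ys" by auto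
  \<comment> \<open>The subdivided cone is fine enough but bounds the subdivision of
    \<open>y\<close>; the homotopy term corrects the boundary back to \<open>y\<close>.\<close>
  define f where "f = (sd avg ^^ k) (vcone b y) + sd_htpy_iter avg k y"
  have f_bd: "bd f = y"
    by (simp add: f_def bd_sd_iter bd_cone y_cycle bd_sd_htpy_iter)
  have avg_closed: "\<forall>zs. zs \<noteq> [] \<longrightarrow> set zs \<subseteq> K \<longrightarrow> avg zs \<in> K" if "cvx K" for K
    using avg_in_cvx[OF that] by blast
  have f: "length ps = Suc n \<and> set ps \<subseteq> sinterior n \<and> mesh e ps" if psf: "ps \<in> Poly_Mapping.keys f" for ps
  proof -
    consider "ps \<in> Poly_Mapping.keys ((sd avg ^^ k) (vcone b y))" | "ps \<in> Poly_Mapping.keys (sd_htpy_iter avg k y)"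
      using subsetD[OF keys_add psf[unfolded f_def]] by blast
    then show ?thesis
    proof cases
      case 1
      from sd_iter_keys[OF 1] obtain xs where xs: "xs \<in> Poly_Mapping.keys (vcone b y)" "length ps = length xs"
        "\<forall>A. (\<forall>zs. zs \<noteq> [] \<longrightarrow> set zs \<subseteq> A \<longrightarrow> avg zs \<in> A) \<longrightarrow> set xs \<subseteq> A \<longrightarrow> set ps \<subseteq> A" by auto
      then show ?thesis using by_keys[OF xs(1)] avg_closed[OF cvx_sinterior[of n]] k[OF 1] by simp
    next
      case 2
      from sd_htpy_iter_keys[OF 2] obtain xs where xs: "xs \<in> Poly_Mapping.keys y" "length ps = Suc (length xs)"
        "\<And>A. (\<forall>zs. zs \<noteq> [] \<longrightarrow> set zs \<subseteq> A \<longrightarrow> avg zs \<in> A) \<Longrightarrow> set xs \<subseteq> A \<Longrightarrow> set ps \<subseteq> A" by auto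
      note yxs = y[OF xs(1)]
      \<comment> \<open>Balls are closed under \<open>avg\<close>. With balls about the old
        vertices, every vertex of \<open>ps\<close> is close to all old ones; with balls about the
        vertices of \<open>ps\<close>, these are then close to each other.\<close>
      have 1: "set ps \<subseteq> {v. near e x v}" if "x \<in> set xs" for x
        by (rule xs(3)[OF avg_closed[OF cvx_near]]) (use yxs that in \<open>auto simp: mesh_def\<close>)
      have "set ps \<subseteq> {v. near e u v}" if "u \<in> set ps" for u
        by (rule xs(3)[OF avg_closed[OF cvx_near]]) (use 1 that near_sym in blast)
      then have "mesh e ps" by (auto simp: mesh_def)
      then show ?thesis using xs(2) xs(3)[OF avg_closed[OF cvx_sinterior[of n]]] yxs by simp
    qed
  qed
  \<comment> \<open>The boundaries of the four terms telescope along \<open>vmap g z2\<close>,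
    \<open>z2\<close>, \<open>z1\<close> and \<open>z\<close>.\<close>
  define c where "c = vmap (\<lambda>w. (w, L w)) f - prism (\<lambda>x. x) g z2 + sd_htpy_iter bl m z1 - prism (\<lambda>x. x) hh z"
  have id: "vmap (\<lambda>x. x) u = u" for u :: "'v list \<Rightarrow>\<^sub>0 int" by (rule vmap_id) simp
  have "bd (vmap (\<lambda>w. (w, L w)) f) = vmap g z2"
    by (simp add: bd_vmap f_bd y_def vmap_vmap g_def)
  moreover have "bd (prism (\<lambda>x. x) g z2) = vmap g z2 - z2"
    by (simp add: bd_prism z2_cycle id) (simp add: prism_def)
  moreover have "bd (prism (\<lambda>x. x) hh z) = z1 - z"
    by (simp add: bd_prism cycle id z1_def) (simp add: prism_def)
  moreover have "bd (sd_htpy_iter bl m z1) = z1 - z2"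
    by (simp add: bd_sd_htpy_iter z1_cycle z2_def)
  ultimately have "bd c = z" by (simp add: c_def)
  moreover have "good n 0 (pts ys) \<and> small W I ys" if "ys \<in> Poly_Mapping.keys c" for ys
  proof -
    from that have "ys \<in> Poly_Mapping.keys (vmap (\<lambda>w. (w, L w)) f - prism (\<lambda>x. x) g z2 + sd_htpy_iter bl m z1)
        \<or> ys \<in> Poly_Mapping.keys (prism (\<lambda>x. x) hh z)"
      unfolding c_def by (rule keys_diff')
    then consider "ys \<in> Poly_Mapping.keys (vmap (\<lambda>w. (w, L w)) f)" | "ys \<in> Poly_Mapping.keys (prism (\<lambda>x. x) g z2)"
      | "ys \<in> Poly_Mapping.keys (sd_htpy_iter bl m z1)" | "ys \<in> Poly_Mapping.keys (prism (\<lambda>x. x) hh z)"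
      by (elim disjE) (auto dest!: keys_add' keys_diff')
    then show ?thesis
    proof cases
      case 1
      from keys_vmap_ex[OF 1] obtain ps where ps: "ps \<in> Poly_Mapping.keys f" "ys = map (\<lambda>w. (w, L w)) ps" by auto
      note fps = f[OF ps(1)]
      have [simp]: "pts ys = ps" by (simp add: ps(2) o_def)
      have "snd ` set ys = L ` set ps" by (auto simp: ps(2) image_image)
      moreover have "L ` set ps \<subseteq> I" using fps L(1) by (auto simp: sinterior_def)
      ultimately have "small W I ys" using L_hull[of ps] fps by (auto simp: small_def)
      then show ?thesis using good_of_interior[of ps n] fps by simp
    next
      case 2
      from keys_frag_extend_ex[OF 2[unfolded prism_def]] obtain xs where xs: "xs \<in> Poly_Mapping.keys z2"
        "ys \<in> Poly_Mapping.keys (list_prism (\<lambda>x. x) g xs)" by auto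
      from keys_list_prism[OF xs(2)] obtain k where k: "k < length xs" "ys = take (Suc k) xs @ map g (drop k xs)" by auto
      note zxs = z2[OF xs(1)]
      have pts: "set (pts ys) \<subseteq> set (pts xs)" unfolding k(2)
        by (auto simp: g_def dest: in_set_takeD in_set_dropD)
      have len: "length ys = Suc n" using k zxs by simp
      have "small W I xs" using zxs inside_imp_small by blast
      have inner: "set (pts xs) \<subseteq> sinterior n" using zxs inside_pts by blast
      have hull: "ahull (pts ys) \<subseteq> ahull (pts xs)"
        by (rule hull_mono) (use pts set_subset_hull in blast)
      \<comment> \<open>The piece mixes inherited labels and labels \<open>L\<close>, but it spans
        no points outside the hull of \<open>xs\<close>. Inherited labels are admissible there by
        \<open>inside\<close>, the labels \<open>L\<close> by the mesh.\<close>
      have "a \<in> I \<and> ahull (pts ys) \<subseteq> W a" if "a \<in> snd ` set ys" for a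
      proof -
        from that consider "a \<in> snd ` set xs" | v where "v \<in> set (pts xs)" "a = L v"
          unfolding k(2) by (force simp: g_def dest: in_set_takeD in_set_dropD)
        then show ?thesis
        proof cases
          case 1
          then show ?thesis using \<open>small W I xs\<close> hull unfolding small_def by blast
        next
          case 2
          have "v \<in> standard_simplex n" using 2(1) inner inside_simplex by blast
          then show ?thesis using L(1) L_hull[OF inner _ 2(1)] 2(2) zxs hull by blast
        qed
      qed
      then have "small W I ys" unfolding small_def by blast
      moreover have "good n 0 (pts ys)"
        using pts inner len by (intro good_of_interior) auto
      ultimately show ?thesis by simp
    next
      case 3
      from sd_htpy_iter_keys[OF 3] obtain xs where xs: "xs \<in> Poly_Mapping.keys z1" "length ys = Suc (length xs)"
        "\<forall>A. (\<forall>zs. zs \<noteq> [] \<longrightarrow> set zs \<subseteq> A \<longrightarrow> bl zs \<in> A) \<longrightarrow> set xs \<subseteq> A \<longrightarrow> set ys \<subseteq> A" by auto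
      show ?thesis using z1[OF xs(1)] inside_sub[OF _ xs(3)] xs(2) inside_small[of ys] by simp
    next
      case 4
      from keys_frag_extend_ex[OF 4[unfolded prism_def]] obtain xs where xs: "xs \<in> Poly_Mapping.keys z"
        "ys \<in> Poly_Mapping.keys (list_prism (\<lambda>x. x) hh xs)" by auto
      from keys_list_prism[OF xs(2)] obtain k where k: "k < length xs" "ys = take (Suc k) xs @ map hh (drop k xs)" by auto
      note zxs = z[OF xs(1)]
      let ?p = "pts xs"
      have pys: "pts ys = take (Suc k) ?p @ map h (drop k ?p)"
        using k(2) pts_hh[of "drop k xs"] by (simp add: take_map drop_map)
      have pts: "set (pts ys) \<subseteq> set ?p \<union> h ` set ?p" unfolding pys
        by (auto dest: in_set_takeD in_set_dropD)
      have labels: "snd ` set ys \<subseteq> snd ` set xs" unfolding k(2) hh_def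
        by (force dest: in_set_takeD in_set_dropD)
      have len: "length ys = Suc n" using k zxs by simp
      have sub: "set (pts ys) \<subseteq> standard_simplex n"
      proof
        fix v assume "v \<in> set (pts ys)"
        with pts consider "v \<in> set ?p" | u where "u \<in> set ?p" "v = h u" by blast
        then show "v \<in> standard_simplex n"
          by cases (use zxs h(1) inside_simplex in blast)+
      qed
      have "\<forall>a\<in>snd ` set ys. ahull (pts ys) \<subseteq> W a"
      proof (intro ballI subsetI)
        fix a assume a: "a \<in> snd ` set ys"
        fix x assume x: "x \<in> ahull (pts ys)"
        obtain x' where x': "x' \<in> ahull ?p" "near \<delta> x' x"
          using thick[OF xs(1) x pts] by auto
        have "near r x' x" using near_mono[OF x'(2)] \<delta> r(1) by simp
        moreover have "x \<in> standard_simplex n" using hull_subset_cvx[OF cvx_standard_simplex sub] x by blast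
        ultimately show "x \<in> W a" using r_near[OF xs(1) _ x'(1)] labels a by blast
      qed
      moreover have "snd ` set xs \<subseteq> I" using zxs by (simp add: small_def)
      ultimately have "small W I ys" unfolding small_def using subset_trans[OF labels] by (intro conjI)
      \<comment> \<open>If a pushed vertex has positive weight, the point is interior and the bound
        is trivial. Otherwise only the first k + 1 vertices count; these are unmoved vertices of
        \<open>xs\<close>, for which the general position of \<open>z\<close> applies.\<close>
      moreover have "int (nz t) \<le> int (nz (bary (pts ys) t)) + 0" if t: "t \<in> wts (length (pts ys))" for t
      proof (cases "\<exists>l>k. t l \<noteq> 0")
        case True
        then obtain l where l: "l > k" "t l \<noteq> 0" by blast
        have l': "l < length (pts ys)" using t l(2) by (auto simp: wts_def not_le[symmetric])
        \<comment> \<open>The vertex number \<open>k\<close> occurs twice in the prism, unmoved and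
          then moved, hence the shift by one.\<close>
        have "pts ys ! l = h (?p ! (l - 1))"
          using l(1) l' k(1) zxs len by (auto simp: pys nth_append)
        moreover have "?p ! (l - 1) \<in> set ?p"
          using l l' len zxs by (intro nth_mem) auto
        then have "h (?p ! (l - 1)) \<in> sinterior n" using zxs by (intro h) blast
        ultimately have "bary (pts ys) t \<in> sinterior n"
          using l(2) t by (intro bary_sinterior[OF sub t l']) (auto simp: wts_def order_less_le)
        then show ?thesis using nz_le[OF t] nz_sinterior len by fastforce
      next
        case False
        have "bary (pts ys) t = bary ?p t"
        proof
          fix i
          have "bary (pts ys) t i = (\<Sum>l<Suc k. t l * (pts ys ! l) i)"
            unfolding bary_def by (rule sum.mono_neutral_right) (use False k zxs len in auto)
          also have "\<dots> = (\<Sum>l<Suc k. t l * (?p ! l) i)"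
            using k by (intro sum.cong) (auto simp: pys nth_append)
          also have "\<dots> = bary ?p t i"
            unfolding bary_def by (rule sum.mono_neutral_left) (use False k in auto)
          finally show "bary (pts ys) t i = bary ?p t i" .
        qed
        moreover have "t \<in> wts n"
        proof -
          have "(\<Sum>l<Suc n. t l) = (\<Sum>l<n. t l)"
            using False k zxs by auto
          then show ?thesis using t len False k zxs by (auto simp: wts_def)
        qed
        ultimately show ?thesis using zxs by simp
      qed
      then have "good n 0 (pts ys)" using len sub by (simp add: good_def)
      ultimately show ?thesis by simp
    qed
  qed
  ultimately show ?thesis by blast
qed

section \<open>Natural subdivision operators subordinate to a covering\<close>

text \<open>The operator \<open>A\<close> evaluated on the boundary of \<sigma>: the pieces chosen
  for the faces are moved into the simplex by the maps \<open>\<phi> j\<close>. For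
  \<open>simplical_face\<close> this is made precise by \<open>act_boundary\<close>;
  \<open>lface\<close> is the labelled version.\<close>

definition face_sum ::
    "(nat \<Rightarrow> 'v \<Rightarrow> 'v) \<Rightarrow> (nat \<Rightarrow> ((nat \<Rightarrow> real) \<Rightarrow> 'a) \<Rightarrow> 'v list \<Rightarrow>\<^sub>0 int)
      \<Rightarrow> nat \<Rightarrow> ((nat \<Rightarrow> real) \<Rightarrow> 'a) \<Rightarrow> 'v list \<Rightarrow>\<^sub>0 int" where
  "face_sum \<phi> A n \<sigma> =
    (\<Sum>j\<le>n. frag_cmul ((-1) ^ j) (vmap (\<phi> j) (A (n - 1) (singular_face n j \<sigma>))))"

text \<open>The simplicial identity pairs each (j, i) with i < j with (i, j - 1), where the sign is
  opposite.\<close>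

lemma alternating_double_sum:
  fixes g :: "nat \<Rightarrow> nat \<Rightarrow> 'v \<Rightarrow>\<^sub>0 int"
  assumes g: "\<And>i j. i < j \<Longrightarrow> j \<le> Suc n \<Longrightarrow> g j i = g i (j - 1)"
  shows "(\<Sum>j\<le>Suc n. \<Sum>i\<le>n. frag_cmul ((-1) ^ (i + j)) (g j i)) = 0"
proof -
  let ?f = "\<lambda>(j, i). frag_cmul ((-1) ^ (i + j)) (g j i)"
  define A where "A = {(j, i). j \<le> Suc n \<and> i < j}"
  define B where "B = {(j, i). j \<le> i \<and> i \<le> n}"
  have "A \<subseteq> {..Suc n} \<times> {..Suc n}" "B \<subseteq> {..Suc n} \<times> {..Suc n}" by (auto simp: A_def B_def)
  then have fin: "finite A" "finite B" by (meson finite_SigmaI finite_atMost finite_subset)+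
  have AB: "{..Suc n} \<times> {..n} = A \<union> B" "A \<inter> B = {}" by (auto simp: A_def B_def)
  have "(\<Sum>j\<le>Suc n. \<Sum>i\<le>n. frag_cmul ((-1) ^ (i + j)) (g j i)) = sum ?f ({..Suc n} \<times> {..n})"
    by (rule sum.cartesian_product)
  also have "\<dots> = sum ?f A + sum ?f B"
    unfolding AB(1) by (rule sum.union_disjoint[OF fin AB(2)])
  also have "sum ?f A = (\<Sum>x\<in>B. - ?f x)"
  proof (rule sum.reindex_bij_witness[where i="\<lambda>(j, i). (Suc i, j)" and j="\<lambda>(j, i). (i, j - 1)"])
    fix x assume "x \<in> A"
    then obtain j i where x: "x = (j, i)" "j \<le> Suc n" "i < j" by (auto simp: A_def)
    have "(-1::int) ^ (i + j) = - ((-1) ^ (j - 1 + i))" using x(3) by (cases j) (auto simp: add.commute)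
    then show "- ?f (case x of (j, i) \<Rightarrow> (i, j - 1)) = ?f x"
      using g[OF x(3,2)] by (simp add: x(1))
  qed (auto simp: A_def B_def)
  also have "(\<Sum>x\<in>B. - ?f x) + sum ?f B = 0"
    by (simp add: sum_negf)
  finally show ?thesis .
qed

lemma vmap_sum: "finite J \<Longrightarrow> vmap f (sum h J) = (\<Sum>j\<in>J. vmap f (h j))"
  by (simp add: vmap_def frag_extend_sum o_def)

lemma bd_sum: "finite J \<Longrightarrow> bd (sum h J) = (\<Sum>j\<in>J. bd (h j))"
  by (simp add: bd_def frag_extend_sum o_def)

lemma face_sum_face_sum:
  assumes \<phi>: "\<And>i j v. i < j \<Longrightarrow> \<phi> j (\<phi> i v) = \<phi> i (\<phi> (j - 1) v)"
    and n: "2 \<le> n" and \<sigma>: "singular_simplex n X \<sigma>"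
  shows "face_sum \<phi> (face_sum \<phi> A) n \<sigma> = 0"
proof -
  obtain m where m: "n = Suc (Suc m)" using n by (metis add_2_eq_Suc le_Suc_ex)
  define g where "g = (\<lambda>j i. vmap (\<phi> j) (vmap (\<phi> i) (A m (singular_face (Suc m) i (singular_face n j \<sigma>)))))"
  have "face_sum \<phi> (face_sum \<phi> A) n \<sigma> = (\<Sum>j\<le>Suc (Suc m). \<Sum>i\<le>Suc m. frag_cmul ((-1) ^ (i + j)) (g j i))"
    unfolding face_sum_def m g_def
    by (simp add: vmap_sum frag_cmul_sum power_add mult.commute del: sum.atMost_Suc)
  also have "\<dots> = 0"
  proof (rule alternating_double_sum)
    fix i j :: nat assume ij: "i < j" "j \<le> Suc (Suc m)"
    have "singular_face (Suc m) i (singular_face n j \<sigma>) = singular_face (Suc m) (j - 1) (singular_face n i \<sigma>)"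
    proof
      fix t
      show "singular_face (Suc m) i (singular_face n j \<sigma>) t = singular_face (Suc m) (j - 1) (singular_face n i \<sigma>) t"
      proof (cases "t \<in> standard_simplex m")
        case True
        then have 1: "simplical_face i t \<in> standard_simplex (Suc m)" "simplical_face (j - 1) t \<in> standard_simplex (Suc m)"
          using simplical_face_in_standard_simplex[of "Suc m"] ij by auto
        have "simplical_face j (simplical_face i t) = simplical_face i (simplical_face (j - 1) t)"
          using ij(1) by (auto simp: simplical_face_def fun_eq_iff)
        then show ?thesis using True 1 by (simp add: singular_face_def m)
      qed (simp add: singular_face_def m)
    qed
    moreover have "vmap (\<phi> j) (vmap (\<phi> i) c) = vmap (\<phi> i) (vmap (\<phi> (j - 1)) c)" for c
      unfolding vmap_vmap by (rule vmap_cong) (simp add: \<phi>[OF ij(1)])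
    ultimately show "g j i = g i (j - 1)" by (simp add: g_def)
  qed
  finally show ?thesis .
qed

lemma bd_face_sum: "bd (face_sum \<phi> A n \<sigma>) = face_sum \<phi> (\<lambda>n \<sigma>. bd (A n \<sigma>)) n \<sigma>"
  by (simp add: face_sum_def bd_sum bd_vmap)

lemma face_sum_cong:
  "1 \<le> n \<Longrightarrow> singular_simplex n X \<sigma> \<Longrightarrow> (\<And>\<tau>. singular_simplex (n - 1) X \<tau> \<Longrightarrow> A (n - 1) \<tau> = B (n - 1) \<tau>)
    \<Longrightarrow> face_sum \<phi> A n \<sigma> = face_sum \<phi> B n \<sigma>"
  unfolding face_sum_def by (intro sum.cong refl) (simp add: singular_simplex_singular_face)

lemma face_sum_diff:
  fixes A B :: "nat \<Rightarrow> ((nat \<Rightarrow> real) \<Rightarrow> 'a) \<Rightarrow> 'v list \<Rightarrow>\<^sub>0 int"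
  shows "face_sum \<phi> (\<lambda>n \<sigma>. A n \<sigma> - B n \<sigma>) n \<sigma> = face_sum \<phi> A n \<sigma> - face_sum \<phi> B n \<sigma>"
proof -
  have "frag_cmul k (a - b) = frag_cmul k a - frag_cmul k b" for k and a b :: "'v list \<Rightarrow>\<^sub>0 int"
    by (rule poly_mapping_eqI) (simp add: lookup_minus algebra_simps)
  then show ?thesis by (simp add: face_sum_def sum_subtractf)
qed

lemma keys_sum_ex:
  "finite J \<Longrightarrow> x \<in> Poly_Mapping.keys (sum f J) \<Longrightarrow> \<exists>j\<in>J. x \<in> Poly_Mapping.keys (f j)"
  by (induction J rule: finite_induct) (auto dest: keys_add')

lemma keys_face_sum_ex:
  assumes "xs \<in> Poly_Mapping.keys (face_sum \<phi> A n \<sigma>)"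
  shows "\<exists>j\<le>n. \<exists>ys\<in>Poly_Mapping.keys (A (n - 1) (singular_face n j \<sigma>)). xs = map (\<phi> j) ys"
proof -
  from keys_sum_ex[OF finite_atMost assms[unfolded face_sum_def]] obtain j where
    "j \<le> n" "xs \<in> Poly_Mapping.keys (vmap (\<phi> j) (A (n - 1) (singular_face n j \<sigma>)))"
    by auto
  with keys_vmap_ex[OF this(2)] show ?thesis by blast
qed

text \<open>Says that the identity, viewed as a natural operator, commutes with the
  boundary.\<close>

lemma list_bd_vertices:
  assumes "1 \<le> n"
  shows "list_bd (vertices n) = face_sum simplical_face (\<lambda>n \<sigma>. frag_of (vertices n)) n \<sigma>"
  unfolding list_bd_eq_sum face_sum_def using assms
  by (simp add: lessThan_Suc_atMost del_vertices del: sum.atMost_Suc)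

definition lface :: "nat \<Rightarrow> (nat \<Rightarrow> real) \<times> 'i \<Rightarrow> (nat \<Rightarrow> real) \<times> 'i" where
  "lface j x = (simplical_face j (fst x), snd x)"

lemma simplical_face_comm:
  "i < j \<Longrightarrow> simplical_face j (simplical_face i v) = simplical_face i (simplical_face (j - 1) v)"
  by (auto simp: simplical_face_def fun_eq_iff)

lemma lface_comm: "i < j \<Longrightarrow> lface j (lface i v) = lface i (lface (j - 1) v)"
  by (simp add: lface_def simplical_face_comm)

lemma face_sum_face_sum_lface:
  "2 \<le> n \<Longrightarrow> singular_simplex n X \<sigma> \<Longrightarrow> face_sum lface (face_sum lface A) n \<sigma> = 0"
  by (rule face_sum_face_sum) (rule lface_comm)

lemma face_sum_face_sum_simplical_face:
  "2 \<le> n \<Longrightarrow> singular_simplex n X \<sigma> \<Longrightarrow> face_sum simplical_face (face_sum simplical_face A) n \<sigma> = 0"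
  by (rule face_sum_face_sum) (rule simplical_face_comm)

lemma pts_lface: "pts (map (lface j) xs) = map (simplical_face j) (pts xs)"
  by (simp add: lface_def)

definition pullback :: "nat \<Rightarrow> ((nat \<Rightarrow> real) \<Rightarrow> 'a) \<Rightarrow> 'a set \<Rightarrow> (nat \<Rightarrow> real) set" where
  "pullback n \<sigma> V = {t \<in> standard_simplex n. \<sigma> t \<in> V}"

lemma openin_pullback:
  assumes "singular_simplex n X \<sigma>" "openin X V"
  shows "openin (top_of_set (standard_simplex n)) (pullback n \<sigma> V)"
proof -
  have "continuous_map (top_of_set (standard_simplex n)) X \<sigma>"
    using assms(1) by (simp add: singular_simplex_def euclidean_product_topology)
  from openin_continuous_map_preimage[OF this assms(2)] show ?thesis
    by (simp add: pullback_def)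
qed

lemma ahull_lface_pullback:
  assumes "ahull (pts xs) \<subseteq> pullback m (singular_face (Suc m) j \<sigma>) V" "j \<le> Suc m"
  shows "ahull (pts (map (lface j) xs)) \<subseteq> pullback (Suc m) \<sigma> V"
proof
  fix x assume "x \<in> ahull (pts (map (lface j) xs))"
  then obtain t where t: "t \<in> wts (length xs)" "x = simplical_face j (bary (pts xs) t)"
    by (auto simp: ahull_def pts_lface bary_simplical_face simp del: map_map)
  then have "bary (pts xs) t \<in> pullback m (singular_face (Suc m) j \<sigma>) V"
    using assms(1) by (auto simp: ahull_def)
  then show "x \<in> pullback (Suc m) \<sigma> V"
    using simplical_face_in_standard_simplex[of "Suc m" j "bary (pts xs) t"] assms(2)
    by (auto simp: pullback_def t(2) singular_face_def)
qed

text \<open>The choice depends on the singular simplex alone, so a face shared by several simplices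
  is subdivided once and for all. The dimension is ignored by \<open>\<lambda>_\<close> because the
  recursion offers only the value at \<open>n\<close>, which is the one that \<open>face_sum\<close>
  asks for.\<close>

primrec small_family ::
    "'a topology \<Rightarrow> 'i set \<Rightarrow> ('i \<Rightarrow> 'a set) \<Rightarrow> nat \<Rightarrow> ((nat \<Rightarrow> real) \<Rightarrow> 'a)
      \<Rightarrow> ((nat \<Rightarrow> real) \<times> 'i) list \<Rightarrow>\<^sub>0 int" where
  "small_family X I U 0 \<sigma> = frag_of [(basis_pt 0, SOME k. k \<in> I \<and> \<sigma> (basis_pt 0) \<in> U k)]"
| "small_family X I U (Suc n) \<sigma> = (SOME c. bd c = face_sum lface (\<lambda>_. small_family X I U n) (Suc n) \<sigma>
     \<and> (\<forall>xs\<in>Poly_Mapping.keys c. good (Suc n) 0 (pts xs) \<and> small (\<lambda>k. pullback (Suc n) \<sigma> (U k)) I xs))"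

lemma small_family:
  assumes U: "\<And>k. k \<in> I \<Longrightarrow> openin X (U k)" "(\<Union>k\<in>I. U k) = topspace X"
    and \<sigma>: "singular_simplex n X \<sigma>"
  shows "(\<forall>xs\<in>Poly_Mapping.keys (small_family X I U n \<sigma>). good n 0 (pts xs) \<and> small (\<lambda>k. pullback n \<sigma> (U k)) I xs)
    \<and> bd (small_family X I U n \<sigma>) = (if n = 0 then frag_of [] else face_sum lface (small_family X I U) n \<sigma>)"
  using \<sigma>
proof (induction n arbitrary: \<sigma>)
  case 0
  have b: "basis_pt 0 \<in> standard_simplex 0" by (simp add: standard_simplex_0 basis_pt_def)
  then have "\<sigma> (basis_pt 0) \<in> topspace X"
    using 0 continuous_map_image_subset_topspace unfolding singular_simplex_def by fastforce
  then have "\<exists>k. k \<in> I \<and> \<sigma> (basis_pt 0) \<in> U k" using U(2) by blast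
  then have k: "(SOME k. k \<in> I \<and> \<sigma> (basis_pt 0) \<in> U k) \<in> I"
      "\<sigma> (basis_pt 0) \<in> U (SOME k. k \<in> I \<and> \<sigma> (basis_pt 0) \<in> U k)"
    by (auto dest!: someI_ex)
  have "ahull [basis_pt 0] \<subseteq> {basis_pt 0}"
    by (rule hull_subset_cvx) (auto simp: cvx_def algebra_simps)
  moreover have "good 0 0 [basis_pt 0]"
    using good_vertices[of 0] by (simp add: vertices_def)
  ultimately show ?case using k b by (auto simp: keys_frag_of small_def pullback_def)
next
  case (Suc n)
  let ?c = "small_family X I U"
  let ?z = "face_sum lface (\<lambda>_. ?c n) (Suc n) \<sigma>"
  have z_eq: "?z = face_sum lface ?c (Suc n) \<sigma>" by (simp add: face_sum_def)
  have face: "singular_simplex n X (singular_face (Suc n) j \<sigma>)" if "j \<le> Suc n" for j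
    using singular_simplex_singular_face[OF Suc.prems _ that] by simp
  \<comment> \<open>For an edge, the chosen vertices at both ends have boundary \<open>[]\<close>
    and cancel by the signs. In higher dimensions this is the vanishing of a double face
    sum.\<close>
  have cycle: "bd ?z = 0"
  proof (cases "n = 0")
    case True
    have "bd ?z = face_sum lface (\<lambda>n \<sigma>. frag_of []) (Suc n) \<sigma>"
      unfolding bd_face_sum
      by (rule face_sum_cong[OF _ Suc.prems]) (use Suc.IH True in auto)
    then show ?thesis using True by (simp add: face_sum_def)
  next
    case False
    have "bd ?z = face_sum lface (face_sum lface ?c) (Suc n) \<sigma>"
      unfolding z_eq bd_face_sum
      by (rule face_sum_cong[OF _ Suc.prems]) (use Suc.IH False in auto)
    then show ?thesis using face_sum_face_sum_lface[OF _ Suc.prems] False by simp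
  qed
  have "\<exists>c. bd c = ?z \<and> (\<forall>xs\<in>Poly_Mapping.keys c. good (Suc n) 0 (pts xs) \<and> small (\<lambda>k. pullback (Suc n) \<sigma> (U k)) I xs)"
  proof (rule fill_small_cycle[OF _ _ cycle])
    show "openin (top_of_set (standard_simplex (Suc n))) (pullback (Suc n) \<sigma> (U a))" if "a \<in> I" for a
      using openin_pullback[OF Suc.prems U(1)[OF that]] .
    have "\<sigma> ` standard_simplex (Suc n) \<subseteq> topspace X"
      using Suc.prems continuous_map_image_subset_topspace unfolding singular_simplex_def by fastforce
    then show "standard_simplex (Suc n) \<subseteq> (\<Union>a\<in>I. pullback (Suc n) \<sigma> (U a))"
      using U(2) by (auto simp: pullback_def)
    fix xs assume "xs \<in> Poly_Mapping.keys ?z"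
    from keys_face_sum_ex[OF this] obtain j ys where
      j: "j \<le> Suc n" and ys: "ys \<in> Poly_Mapping.keys (?c n (singular_face (Suc n) j \<sigma>))" "xs = map (lface j) ys"
      by auto
    have g: "good n 0 (pts ys)" and s: "small (\<lambda>k. pullback n (singular_face (Suc n) j \<sigma>) (U k)) I ys"
      using Suc.IH[OF face[OF j]] ys(1) by blast+
    have len: "length ys = Suc n" using g by (simp add: good_def)
    have lab: "snd ` set xs = snd ` set ys" by (auto simp: ys(2) image_image lface_def)
    have "small (\<lambda>k. pullback (Suc n) \<sigma> (U k)) I xs"
      unfolding small_def lab
    proof (intro conjI ballI)
      show "snd ` set ys \<subseteq> I" using s unfolding small_def by (rule conjunct1)
      fix a assume "a \<in> snd ` set ys"
      with s show "ahull (pts xs) \<subseteq> pullback (Suc n) \<sigma> (U a)"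
        unfolding ys(2) small_def by (intro ahull_lface_pullback[OF _ j]) (elim conjE, drule (1) bspec)
    qed
    then show "length xs = Suc n \<and> small (\<lambda>k. pullback (Suc n) \<sigma> (U k)) I xs
      \<and> set (pts xs) \<subseteq> standard_simplex (Suc n) \<and> (\<forall>t\<in>wts (Suc n). nz t \<le> nz (bary (pts xs) t))"
      using good_simplical_face_bound[of "Suc n" 0 "pts ys" j] g j len unfolding ys(2) pts_lface by simp
  qed
  from someI_ex[OF this] have c: "bd (?c (Suc n) \<sigma>) = ?z \<and> (\<forall>xs\<in>Poly_Mapping.keys (?c (Suc n) \<sigma>).
      good (Suc n) 0 (pts xs) \<and> small (\<lambda>k. pullback (Suc n) \<sigma> (U k)) I xs)"
    unfolding small_family.simps(2) .
  then have "bd (?c (Suc n) \<sigma>) = (if Suc n = 0 then frag_of [] else face_sum lface ?c (Suc n) \<sigma>)"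
    unfolding z_eq by (simp del: small_family.simps)
  with c show ?case by (intro conjI) (erule conjunct2)
qed

abbreviation labelled_avg :: "((nat \<Rightarrow> real) \<times> 'i) list \<Rightarrow> nat \<Rightarrow> real" where
  "labelled_avg xs \<equiv> avg (pts xs)"

lemma star_lface:
  fixes c :: "((nat \<Rightarrow> real) \<times> 'i) list \<Rightarrow>\<^sub>0 int"
  shows "vmap (simplical_face j) (star labelled_avg Q c) = star labelled_avg Q (vmap (lface j) c)"
proof -
  have "vmap (simplical_face j) (bar labelled_avg (star_base Q) xs) = bar labelled_avg (star_base Q) (map (lface j) xs)"
    for xs :: "((nat \<Rightarrow> real) \<times> 'i) list"
  proof (rule vmap_bar[where A=UNIV])
    fix ys :: "((nat \<Rightarrow> real) \<times> 'i) list"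
    show "simplical_face j (avg (pts ys)) = avg (pts (map (lface j) ys))"
      unfolding pts_lface avg_simplical_face ..
    show "vmap (simplical_face j) (star_base Q ys) = star_base Q (map (lface j) ys)"
      by (cases ys) (auto simp: star_base_def lface_def)
  qed simp
  then show ?thesis
    unfolding star_def vmap_def frag_extend_frag_extend by (simp add: vmap_def)
qed

lemma star_sum: "finite J \<Longrightarrow> star b Q (sum h J) = (\<Sum>j\<in>J. star b Q (h j))"
  by (simp add: star_def frag_extend_sum o_def)

lemma star_face_sum:
  "star labelled_avg Q (face_sum lface A n \<sigma>) = face_sum simplical_face (\<lambda>n \<sigma>. star labelled_avg Q (A n \<sigma>)) n \<sigma>"
  by (simp add: face_sum_def star_sum star_lface)

text \<open>The construction of acyclic models: the identity minus \<open>e\<close> minus the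
  homotopy on the faces is a cycle, and coning from the barycentre fills it. The apex
  \<open>unif (Suc (Suc n))\<close> is the barycentre of the (n + 1)-simplex.\<close>

primrec cone_htpy ::
    "(nat \<Rightarrow> ((nat \<Rightarrow> real) \<Rightarrow> 'a) \<Rightarrow> (nat \<Rightarrow> real) list \<Rightarrow>\<^sub>0 int)
      \<Rightarrow> nat \<Rightarrow> ((nat \<Rightarrow> real) \<Rightarrow> 'a) \<Rightarrow> (nat \<Rightarrow> real) list \<Rightarrow>\<^sub>0 int" where
  "cone_htpy e 0 \<sigma> = 0"
| "cone_htpy e (Suc n) \<sigma> = vcone (unif (Suc (Suc n)))
     (frag_of (vertices (Suc n)) - e (Suc n) \<sigma> - face_sum simplical_face (\<lambda>_. cone_htpy e n) (Suc n) \<sigma>)"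

lemma cone_htpy:
  assumes e0: "\<And>\<sigma>. singular_simplex 0 X \<sigma> \<Longrightarrow> e 0 \<sigma> = frag_of (vertices 0)"
    and e: "\<And>n \<sigma>. singular_simplex (Suc n) X \<sigma> \<Longrightarrow> bd (e (Suc n) \<sigma>) = face_sum simplical_face e (Suc n) \<sigma>"
    and good: "\<And>n \<sigma> xs. singular_simplex n X \<sigma> \<Longrightarrow> xs \<in> Poly_Mapping.keys (e n \<sigma>) \<Longrightarrow> good n 0 xs"
    and \<sigma>: "singular_simplex n X \<sigma>"
  shows "(\<forall>xs\<in>Poly_Mapping.keys (cone_htpy e n \<sigma>). good n 1 xs)
    \<and> (1 \<le> n \<longrightarrow> bd (cone_htpy e n \<sigma>) = frag_of (vertices n) - e n \<sigma> - face_sum simplical_face (cone_htpy e) n \<sigma>)"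
  using \<sigma>
proof (induction n arbitrary: \<sigma>)
  case (Suc n)
  let ?D = "cone_htpy e" and ?f = "face_sum simplical_face"
  have face: "singular_simplex n X (singular_face (Suc n) j \<sigma>)" if "j \<le> Suc n" for j
    using singular_simplex_singular_face[OF Suc.prems _ that] by simp
  have D_eq: "?f (\<lambda>_. ?D n) (Suc n) \<sigma> = ?f ?D (Suc n) \<sigma>" by (simp add: face_sum_def)
  have "bd (frag_of (vertices (Suc n)) - e (Suc n) \<sigma> - ?f ?D (Suc n) \<sigma>) = 0"
  proof (cases "n = 0")
    case True
    have "?f e (Suc n) \<sigma> = ?f (\<lambda>n \<sigma>. frag_of (vertices n)) (Suc n) \<sigma>"
      by (rule face_sum_cong[OF _ Suc.prems]) (use e0 True in auto)
    moreover have "?f ?D (Suc n) \<sigma> = 0" using True by (simp add: face_sum_def)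
    ultimately show ?thesis using e[OF Suc.prems] by (simp add: list_bd_vertices[of _ \<sigma>])
  next
    case False
    have "bd (?f ?D (Suc n) \<sigma>) = ?f (\<lambda>n \<sigma>. frag_of (vertices n) - e n \<sigma> - ?f ?D n \<sigma>) (Suc n) \<sigma>"
      unfolding bd_face_sum
      by (rule face_sum_cong[OF _ Suc.prems]) (use Suc.IH False in auto)
    also have "\<dots> = ?f (\<lambda>n \<sigma>. frag_of (vertices n)) (Suc n) \<sigma> - ?f e (Suc n) \<sigma>"
      using face_sum_face_sum_simplical_face[OF _ Suc.prems, of ?D] False
      by (simp add: face_sum_diff)
    finally show ?thesis using e[OF Suc.prems] by (simp add: list_bd_vertices[of _ \<sigma>])
  qed
  then have bd: "bd (?D (Suc n) \<sigma>) = frag_of (vertices (Suc n)) - e (Suc n) \<sigma> - ?f ?D (Suc n) \<sigma>"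
    unfolding cone_htpy.simps D_eq bd_cone by simp
  have apex: "unif (Suc (Suc n)) \<in> sinterior (Suc n)"
    using unif_wts[of "Suc (Suc n)"] by (auto simp: sinterior_def standard_simplex_eq_wts unif_def)
  \<comment> \<open>The apex is interior, so only the base matters. It is a piece of full dimension,
    with bound 0, or a homotopy piece of a face; both meet the premises of
    \<open>good_Cons_sinterior\<close> with d = 1.\<close>
  have "good (Suc n) 1 xs" if "xs \<in> Poly_Mapping.keys (?D (Suc n) \<sigma>)" for xs
  proof -
    from keys_cone_ex[OF that[unfolded cone_htpy.simps D_eq]] obtain ys where
      ys: "xs = unif (Suc (Suc n)) # ys"
        "ys \<in> Poly_Mapping.keys (frag_of (vertices (Suc n)) - e (Suc n) \<sigma> - ?f ?D (Suc n) \<sigma>)" by auto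
    from keys_diff'[OF ys(2)] consider "ys \<in> Poly_Mapping.keys (frag_of (vertices (Suc n)) - e (Suc n) \<sigma>)"
      | "ys \<in> Poly_Mapping.keys (?f ?D (Suc n) \<sigma>)" by blast
    then show ?thesis
    proof cases
      case 1
      then have "good (Suc n) 0 ys"
        using good[OF Suc.prems, of ys] good_vertices[of "Suc n"] keys_diff'[OF 1] by (auto simp: keys_frag_of)
      then have g: "int (length ys) = int (Suc n) + 1" "set ys \<subseteq> standard_simplex (Suc n)"
        "\<And>t. t \<in> wts (length ys) \<Longrightarrow> int (nz t) \<le> int (nz (bary ys t)) + 0"
        unfolding good_def by auto
      show ?thesis unfolding ys(1)
        by (rule good_Cons_sinterior[OF apex g(1,2)]) (use g(3) in force)
    next
      case 2
      from keys_face_sum_ex[OF 2] obtain j zs where j: "j \<le> Suc n"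
        and zs: "zs \<in> Poly_Mapping.keys (?D n (singular_face (Suc n) j \<sigma>))" "ys = map (simplical_face j) zs"
        by auto
      have "good n 1 zs" using Suc.IH[OF face[OF j]] zs(1) by blast
      then show ?thesis unfolding ys(1)
        using good_simplical_face_bound[of "Suc n" 1 zs j] j
        by (intro good_Cons_sinterior[OF apex]) (auto simp: zs(2))
    qed
  qed
  with bd show ?case by simp
qed simp

text \<open>The natural operators behind the homotopy: \<open>e Q\<close> collects the pieces with label in \<open>Q\<close> of a
  subdivision, \<open>B Q\<close> is the defect of \<open>e Q\<close> as a chain map and \<open>D\<close> is a homotopy between the
  identity and \<open>e UNIV\<close>.\<close>

proposition subdivision_operators:
  fixes X :: "'a topology" and I :: "'i set" and U :: "'i \<Rightarrow> 'a set"
  assumes U: "\<And>k. k \<in> I \<Longrightarrow> openin X (U k)" "(\<Union>k\<in>I. U k) = topspace X"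
  obtains e B :: "'i set \<Rightarrow> nat \<Rightarrow> ((nat \<Rightarrow> real) \<Rightarrow> 'a) \<Rightarrow> (nat \<Rightarrow> real) list \<Rightarrow>\<^sub>0 int"
    and D :: "nat \<Rightarrow> ((nat \<Rightarrow> real) \<Rightarrow> 'a) \<Rightarrow> (nat \<Rightarrow> real) list \<Rightarrow>\<^sub>0 int"
  where "\<And>Q n \<sigma> xs. singular_simplex n X \<sigma> \<Longrightarrow> xs \<in> Poly_Mapping.keys (e Q n \<sigma>) \<Longrightarrow> good n 0 xs"
    and "\<And>Q n \<sigma> xs. singular_simplex n X \<sigma> \<Longrightarrow> xs \<in> Poly_Mapping.keys (e Q n \<sigma>) \<Longrightarrow>
          \<exists>l\<in>Q \<inter> I. \<forall>t\<in>standard_simplex n. \<sigma> (bary xs t) \<in> U l"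
    and "\<And>Q n \<sigma> xs. singular_simplex n X \<sigma> \<Longrightarrow> xs \<in> Poly_Mapping.keys (B Q n \<sigma>) \<Longrightarrow> good n (-1) xs"
    and "\<And>n \<sigma> xs. singular_simplex n X \<sigma> \<Longrightarrow> xs \<in> Poly_Mapping.keys (D n \<sigma>) \<Longrightarrow> good n 1 xs"
    and "\<And>Q n \<sigma>. singular_simplex n X \<sigma> \<Longrightarrow> 1 \<le> n \<Longrightarrow>
          bd (e Q n \<sigma>) = face_sum simplical_face (e Q) n \<sigma> + B Q n \<sigma>"
    and "\<And>n \<sigma>. singular_simplex n X \<sigma> \<Longrightarrow> 1 \<le> n \<Longrightarrow>
          bd (D n \<sigma>) = frag_of (vertices n) - e UNIV n \<sigma> - face_sum simplical_face D n \<sigma>"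
    and "\<And>\<sigma>. singular_simplex 0 X \<sigma> \<Longrightarrow> D 0 \<sigma> = 0"
    and "\<And>\<sigma>. singular_simplex 0 X \<sigma> \<Longrightarrow> e UNIV 0 \<sigma> = frag_of (vertices 0)"
    and "\<And>Q Q' n \<sigma>. Q \<inter> Q' = {} \<Longrightarrow> e (Q \<union> Q') n \<sigma> = e Q n \<sigma> + e Q' n \<sigma>"
proof -
  define c where "c = small_family X I U"
  define e where "e = (\<lambda>Q n \<sigma>. star labelled_avg Q (c n \<sigma>))"
  define B where "B = (\<lambda>Q n \<sigma>. link_defect labelled_avg Q (c n \<sigma>))"
  define D where "D = cone_htpy (e UNIV)"
  have c: "good n 0 (pts xs)" "small (\<lambda>k. pullback n \<sigma> (U k)) I xs"
    if "singular_simplex n X \<sigma>" "xs \<in> Poly_Mapping.keys (c n \<sigma>)" for n \<sigma> xs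
    using small_family[OF U that(1)] that(2) unfolding c_def by blast+
  have bd_c: "bd (c n \<sigma>) = face_sum lface c n \<sigma>" if "singular_simplex n X \<sigma>" "1 \<le> n" for n \<sigma>
    using small_family[OF U that(1)] that(2) unfolding c_def by simp
  have e_good: "good n 0 xs" and e_U: "\<exists>l\<in>Q \<inter> I. \<forall>t\<in>standard_simplex n. \<sigma> (bary xs t) \<in> U l"
    if \<sigma>: "singular_simplex n X \<sigma>" and xs: "xs \<in> Poly_Mapping.keys (e Q n \<sigma>)" for Q n \<sigma> xs
  proof -
    from keys_frag_extend_ex[OF xs[unfolded e_def star_def]] obtain ys where
      ys: "ys \<in> Poly_Mapping.keys (c n \<sigma>)" "xs \<in> Poly_Mapping.keys (bar labelled_avg (star_base Q) ys)" by auto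
    note rel = star_relative[OF ys(2)]
    have g: "good n 0 (pts ys)" by (rule c[OF \<sigma> ys(1)])
    have "good n (- int 0) xs"
      by (rule good_relative[OF g]) (use rel in simp_all)
    then show "good n 0 xs" by simp
    have "bar labelled_avg (star_base Q) ys \<noteq> 0" using ys(2) by auto
    then obtain l where l: "l \<in> snd ` set ys" "l \<in> Q" using star_label by blast
    have sm: "ahull (pts ys) \<subseteq> pullback n \<sigma> (U l)" "l \<in> I"
      using c(2)[OF \<sigma> ys(1)] l(1) unfolding small_def by blast+
    have "\<sigma> (bary xs t) \<in> U l" if t: "t \<in> standard_simplex n" for t
    proof -
      have "length ys = Suc n" using g by (simp add: good_def)
      then obtain s where "s \<in> wts (length ys)" "bary xs t = bary (pts ys) s"
        using rel(2)[of t] t rel(1) by (auto simp: standard_simplex_eq_wts)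
      then have "bary xs t \<in> ahull (pts ys)" by (simp add: ahull_def)
      then show ?thesis using sm(1) by (auto simp: pullback_def)
    qed
    then show "\<exists>l\<in>Q \<inter> I. \<forall>t\<in>standard_simplex n. \<sigma> (bary xs t) \<in> U l" using l(2) sm(2) by blast
  qed
  have B_good: "good n (-1) xs" if \<sigma>: "singular_simplex n X \<sigma>" and xs: "xs \<in> Poly_Mapping.keys (B Q n \<sigma>)" for Q n \<sigma> xs
  proof -
    from keys_frag_extend_ex[OF xs[unfolded B_def link_defect_def]] obtain ys where
      ys: "ys \<in> Poly_Mapping.keys (c n \<sigma>)" "xs \<in> Poly_Mapping.keys (bar labelled_avg (link_base Q) ys)" by auto
    have "good n (- int 1) xs"
      by (rule good_relative[OF c(1)[OF \<sigma> ys(1)]]) (use link_relative[OF ys(2)] in simp_all)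
    then show ?thesis by simp
  qed
  have bd_e: "bd (e Q n \<sigma>) = face_sum simplical_face (e Q) n \<sigma> + B Q n \<sigma>"
    if \<sigma>: "singular_simplex n X \<sigma>" "1 \<le> n" for Q n \<sigma>
    unfolding e_def B_def bd_star bd_c[OF \<sigma>] star_face_sum ..
  \<comment> \<open>The simplices of \<open>c n \<sigma>\<close> have n + 1 \<ge> 2 vertices, so the
    total defect vanishes and \<open>e UNIV\<close> commutes with the boundary, as
    \<open>cone_htpy\<close> requires.\<close>
  have B_UNIV: "B UNIV n \<sigma> = 0" if \<sigma>: "singular_simplex n X \<sigma>" "1 \<le> n" for n \<sigma>
    unfolding B_def by (rule link_defect_UNIV) (use c(1)[OF \<sigma>(1)] \<sigma>(2) in \<open>fastforce simp: good_def\<close>)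
  have e0: "e UNIV 0 \<sigma> = frag_of (vertices 0)" for \<sigma>
    by (simp add: e_def c_def star_def bar_short star_base_def vertices_def)
  have D: "(\<forall>xs\<in>Poly_Mapping.keys (D n \<sigma>). good n 1 xs)
    \<and> (1 \<le> n \<longrightarrow> bd (D n \<sigma>) = frag_of (vertices n) - e UNIV n \<sigma> - face_sum simplical_face D n \<sigma>)"
    if \<sigma>: "singular_simplex n X \<sigma>" for n \<sigma>
    unfolding D_def
  proof (rule cone_htpy[where e="e UNIV" and X=X])
    fix n \<sigma> xs assume "singular_simplex n X \<sigma>" "xs \<in> Poly_Mapping.keys (e UNIV n \<sigma>)"
    then show "good n 0 xs" by (rule e_good)
  qed (use \<sigma> e0 in \<open>simp_all add: bd_e B_UNIV\<close>)
  show thesis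
  proof (rule that[of e B D])
    fix \<sigma> show "D 0 \<sigma> = 0" by (simp add: D_def)
  next
    fix Q Q' :: "'i set" and n \<sigma> assume "Q \<inter> Q' = {}"
    then show "e (Q \<union> Q') n \<sigma> = e Q n \<sigma> + e Q' n \<sigma>" by (simp add: e_def star_Un)
  qed (fact e_good e_U B_good bd_e | rule e0 | use D in blast)+
qed

section \<open>Integral combinations in an abelian group\<close>

definition additive :: "('m, 'y) ring_scheme \<Rightarrow> ('k, 'z) ring_scheme \<Rightarrow> ('m \<Rightarrow> 'k) \<Rightarrow> bool" where
  "additive M N h \<longleftrightarrow> h \<in> carrier M \<rightarrow> carrier N
    \<and> (\<forall>x\<in>carrier M. \<forall>y\<in>carrier M. h (x \<oplus>\<^bsub>M\<^esub> y) = h x \<oplus>\<^bsub>N\<^esub> h y)"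

locale additive_map = M?: abelian_group M + N?: abelian_group N
  for M :: "('m, 'y) ring_scheme" and N :: "('k, 'z) ring_scheme" and h +
  assumes add: "additive M N h"
begin

lemma closed [simp]: "x \<in> carrier M \<Longrightarrow> h x \<in> carrier N"
  using add by (auto simp: additive_def)

lemma plus: "x \<in> carrier M \<Longrightarrow> y \<in> carrier M \<Longrightarrow> h (x \<oplus>\<^bsub>M\<^esub> y) = h x \<oplus>\<^bsub>N\<^esub> h y"
  using add by (auto simp: additive_def)

lemma zero: "h \<zero>\<^bsub>M\<^esub> = \<zero>\<^bsub>N\<^esub>"
proof -
  have "h \<zero>\<^bsub>M\<^esub> \<oplus>\<^bsub>N\<^esub> h \<zero>\<^bsub>M\<^esub> = h \<zero>\<^bsub>M\<^esub>"
    using plus[of "\<zero>\<^bsub>M\<^esub>" "\<zero>\<^bsub>M\<^esub>"] by simp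
  then show ?thesis by (simp add: N.add.l_cancel_one)
qed

lemma uminus: "x \<in> carrier M \<Longrightarrow> h (\<ominus>\<^bsub>M\<^esub> x) = \<ominus>\<^bsub>N\<^esub> h x"
  using plus[of "\<ominus>\<^bsub>M\<^esub> x" x] zero by (simp add: M.l_neg N.minus_equality)

lemma minus: "x \<in> carrier M \<Longrightarrow> y \<in> carrier M \<Longrightarrow> h (x \<ominus>\<^bsub>M\<^esub> y) = h x \<ominus>\<^bsub>N\<^esub> h y"
  by (simp add: a_minus_def plus uminus)

end

text \<open>The additive extension of \<open>v\<close> to formal sums. Through it an identity
  between formal chains becomes one in a coefficient module.\<close>

definition int_comb :: "('m, 'z) ring_scheme \<Rightarrow> ('p \<Rightarrow> 'm) \<Rightarrow> ('p \<Rightarrow>\<^sub>0 int) \<Rightarrow> 'm" where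
  "int_comb M v w = finsum M (\<lambda>p. add_pow M (Poly_Mapping.lookup w p) (v p)) (Poly_Mapping.keys w)"

context abelian_group
begin

lemma add_pow_int_simps:
  "add_pow G (0::int) x = \<zero>" "x \<in> carrier G \<Longrightarrow> add_pow G (k::int) x \<in> carrier G"
  "x \<in> carrier G \<Longrightarrow> add_pow G (1::int) x = x"
  "x \<in> carrier G \<Longrightarrow> add_pow G (k + l::int) x = add_pow G k x \<oplus> add_pow G l x"
  using add.int_pow_closed[of x k] add.int_pow_1[of x] add.int_pow_mult[of x k l] int_pow_0[of "add_monoid G" x]
  by (simp_all add: add_pow_def)

lemma int_comb_superset:
  assumes "finite K" "Poly_Mapping.keys w \<subseteq> K" "v \<in> K \<rightarrow> carrier G"
  shows "int_comb G v w = finsum G (\<lambda>p. add_pow G (Poly_Mapping.lookup w p) (v p)) K"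
proof -
  have "finsum G (\<lambda>p. add_pow G (Poly_Mapping.lookup w p) (v p)) K = int_comb G v w"
    unfolding int_comb_def using assms
    by (intro add.finprod_mono_neutral_cong_right) (auto simp: in_keys_iff add_pow_int_simps Pi_iff)
  then show ?thesis by simp
qed

lemma int_comb_0 [simp]: "int_comb G v 0 = \<zero>"
  by (simp add: int_comb_def)

lemma int_comb_of [simp]: "v p \<in> carrier G \<Longrightarrow> int_comb G v (frag_of p) = v p"
  by (simp add: int_comb_def keys_frag_of finsum_insert[of "{}", simplified] add_pow_int_simps)

lemma int_comb_closed: "v \<in> Poly_Mapping.keys w \<rightarrow> carrier G \<Longrightarrow> int_comb G v w \<in> carrier G"
  unfolding int_comb_def by (intro finsum_closed) (auto simp: add_pow_int_simps)

lemma int_comb_add: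
  assumes "v \<in> Poly_Mapping.keys a \<union> Poly_Mapping.keys b \<rightarrow> carrier G"
  shows "int_comb G v (a + b) = int_comb G v a \<oplus> int_comb G v b"
proof -
  let ?K = "Poly_Mapping.keys a \<union> Poly_Mapping.keys b"
  have eq: "int_comb G v w = finsum G (\<lambda>p. add_pow G (Poly_Mapping.lookup w p) (v p)) ?K"
    if "Poly_Mapping.keys w \<subseteq> ?K" for w
    by (rule int_comb_superset) (use that assms in auto)
  have "int_comb G v (a + b) = finsum G (\<lambda>p. add_pow G (Poly_Mapping.lookup a p) (v p) \<oplus> add_pow G (Poly_Mapping.lookup b p) (v p)) ?K"
    unfolding eq[OF keys_add] using assms
    by (intro finsum_cong') (auto simp: lookup_add add_pow_int_simps Pi_iff)
  also have "\<dots> = int_comb G v a \<oplus> int_comb G v b"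
    using assms by (subst finsum_addf) (auto simp: eq add_pow_int_simps Pi_iff)
  finally show ?thesis .
qed

lemma int_comb_uminus:
  assumes "v \<in> Poly_Mapping.keys a \<rightarrow> carrier G"
  shows "int_comb G v (- a) = \<ominus> int_comb G v a"
proof -
  have "int_comb G v (- a) \<oplus> int_comb G v a = \<zero>"
    using int_comb_add[of v "- a" a] assms by simp
  then show ?thesis
    using assms by (intro minus_equality[symmetric]) (auto intro!: int_comb_closed)
qed

lemma int_comb_diff:
  assumes "v \<in> Poly_Mapping.keys a \<union> Poly_Mapping.keys b \<rightarrow> carrier G"
  shows "int_comb G v (a - b) = int_comb G v a \<ominus> int_comb G v b"
proof -
  have "int_comb G v (a + (- b)) = int_comb G v a \<oplus> int_comb G v (- b)"
    using assms by (intro int_comb_add) auto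
  also have "int_comb G v (- b) = \<ominus> int_comb G v b"
    using assms by (intro int_comb_uminus) auto
  finally show ?thesis by (simp add: a_minus_def)
qed

lemma int_comb_sum:
  assumes "finite K" "\<And>k. k \<in> K \<Longrightarrow> v \<in> Poly_Mapping.keys (f k) \<rightarrow> carrier G"
  shows "int_comb G v (sum f K) = finsum G (\<lambda>k. int_comb G v (f k)) K"
  using assms
proof (induction K rule: finite_induct)
  case (insert k K)
  have "v \<in> Poly_Mapping.keys (f k) \<union> Poly_Mapping.keys (sum f K) \<rightarrow> carrier G"
  proof (rule funcsetI)
    fix x assume "x \<in> Poly_Mapping.keys (f k) \<union> Poly_Mapping.keys (sum f K)"
    then obtain l where "l \<in> insert k K" "x \<in> Poly_Mapping.keys (f l)"
      using keys_sum_ex[OF insert(1), of x f] by auto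
    then show "v x \<in> carrier G" using insert.prems[of l] by auto
  qed
  from int_comb_add[OF this]
  have "int_comb G v (sum f (insert k K)) = int_comb G v (f k) \<oplus> int_comb G v (sum f K)"
    by (simp only: sum.insert[OF insert(1,2)])
  also have "int_comb G v (sum f K) = finsum G (\<lambda>k. int_comb G v (f k)) K"
    by (rule insert.IH) (rule insert.prems, simp)
  also have "int_comb G v (f k) \<oplus> \<dots> = finsum G (\<lambda>k. int_comb G v (f k)) (insert k K)"
    by (rule finsum_insert[OF insert(1,2), symmetric])
       (auto intro!: funcsetI int_comb_closed insert.prems)
  finally show ?case .
qed simp

lemma int_comb_cong:
  assumes "v \<in> Poly_Mapping.keys w \<rightarrow> carrier G" "\<And>p. p \<in> Poly_Mapping.keys w \<Longrightarrow> u p = v p"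
  shows "int_comb G u w = int_comb G v w"
  unfolding int_comb_def using assms
  by (intro finsum_cong') (auto simp: add_pow_int_simps Pi_iff)

text \<open>Additivity of \<open>int_comb\<close> needs all values in the carrier, so the induction
  must stay within formal sums whose generators have admissible values.\<close>

lemma frag_induct_keys [consumes 1, case_names zero one diff]:
  assumes w: "v \<in> Poly_Mapping.keys w \<rightarrow> A"
    and "P 0" "\<And>p. v p \<in> A \<Longrightarrow> P (frag_of p)"
    and "\<And>a b. v \<in> Poly_Mapping.keys a \<rightarrow> A \<Longrightarrow> v \<in> Poly_Mapping.keys b \<rightarrow> A \<Longrightarrow> P a \<Longrightarrow> P b \<Longrightarrow> P (a - b)"
  shows "P w"
proof -
  let ?P = "\<lambda>w. v \<in> Poly_Mapping.keys w \<rightarrow> A \<and> P w"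
  have "?P w"
  proof (rule frag_induction[where S="{p. v p \<in> A}" and P="?P" and c=w])
    show "Poly_Mapping.keys w \<subseteq> {p. v p \<in> A}" using w by auto
    show "?P 0" using assms(2) by auto
    show "?P (frag_of p)" if "p \<in> {p. v p \<in> A}" for p using assms(3) that by (auto simp: keys_frag_of)
    show "?P (a - b)" if "?P a" "?P b" for a b
    proof
      show "v \<in> Poly_Mapping.keys (a - b) \<rightarrow> A"
        using that by (auto dest!: keys_diff')
      show "P (a - b)" using assms(4) that by blast
    qed
  qed
  then show ?thesis ..
qed

lemma int_comb_frag_extend:
  assumes "\<And>p. p \<in> Poly_Mapping.keys w \<Longrightarrow> v \<in> Poly_Mapping.keys (f p) \<rightarrow> carrier G"
  shows "int_comb G v (frag_extend f w) = int_comb G (\<lambda>p. int_comb G v (f p)) w"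
proof -
  \<comment> \<open>Setting \<open>f\<close> to 0 off the keys of \<open>w\<close> makes the
    assumption hold for all generators, so the identity can be proved by induction over arbitrary
    formal sums.\<close>
  define F where "F = (\<lambda>p. if p \<in> Poly_Mapping.keys w then f p else 0)"
  have F: "v \<in> Poly_Mapping.keys (F p) \<rightarrow> carrier G" for p using assms by (auto simp: F_def)
  have 1: "int_comb G v (frag_extend F u) = int_comb G (\<lambda>p. int_comb G v (F p)) u" for u
  proof (induction u rule: frag_induction[OF subset_UNIV])
    case (3 a b)
    have ext: "v \<in> Poly_Mapping.keys (frag_extend F u) \<rightarrow> carrier G" for u
    proof
      fix x assume "x \<in> Poly_Mapping.keys (frag_extend F u)"
      from keys_frag_extend_ex[OF this] show "v x \<in> carrier G" using F by blast
    qed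
    have cl: "(\<lambda>p. int_comb G v (F p)) \<in> A \<rightarrow> carrier G" for A using int_comb_closed[OF F] by blast
    have "int_comb G v (frag_extend F (a - b)) = int_comb G v (frag_extend F a) \<ominus> int_comb G v (frag_extend F b)"
      unfolding frag_extend_diff using ext by (intro int_comb_diff) auto
    also have "\<dots> = int_comb G (\<lambda>p. int_comb G v (F p)) (a - b)"
      unfolding 3 using cl by (intro int_comb_diff[symmetric])
    finally show ?case .
  next
    case (2 x)
    then show ?case using int_comb_closed[OF F] by simp
  qed simp
  have 2: "frag_extend F w = frag_extend f w" by (rule frag_extend_eq) (simp add: F_def)
  have 3: "int_comb G (\<lambda>p. int_comb G v (f p)) w = int_comb G (\<lambda>p. int_comb G v (F p)) w"
    by (rule int_comb_cong) (use int_comb_closed[OF F] in \<open>auto simp: F_def\<close>)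
  show ?thesis using 1[of w] unfolding 2 3 .
qed

lemma int_comb_plus_fun:
  assumes "u \<in> Poly_Mapping.keys w \<rightarrow> carrier G" "v \<in> Poly_Mapping.keys w \<rightarrow> carrier G"
  shows "int_comb G (\<lambda>p. u p \<oplus> v p) w = int_comb G u w \<oplus> int_comb G v w"
proof -
  have "int_comb G (\<lambda>p. u p \<oplus> v p) w = finsum G (\<lambda>p. add_pow G (Poly_Mapping.lookup w p) (u p) \<oplus> add_pow G (Poly_Mapping.lookup w p) (v p)) (Poly_Mapping.keys w)"
    unfolding int_comb_def using assms
    by (intro finsum_cong') (auto simp: add_pow_int_simps Pi_iff add.int_pow_mult_distrib a_comm)
  then show ?thesis
    unfolding int_comb_def using assms by (simp add: finsum_addf Pi_iff add_pow_int_simps)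
qed

lemma int_comb_zero_fun: "int_comb G (\<lambda>p. \<zero>) w = \<zero>"
  unfolding int_comb_def by (simp add: finsum_zero add.int_pow_one)

end

lemma (in additive_map) int_comb:
  assumes "v \<in> Poly_Mapping.keys w \<rightarrow> carrier M"
  shows "h (int_comb M v w) = int_comb N (\<lambda>p. h (v p)) w"
  using assms
proof (induction w rule: M.frag_induct_keys)
  case (diff a b)
  have "h (int_comb M v (a - b)) = h (int_comb M v a) \<ominus>\<^bsub>N\<^esub> h (int_comb M v b)"
    using diff(1,2) by (subst M.int_comb_diff) (auto intro!: minus M.int_comb_closed)
  also have "\<dots> = int_comb N (\<lambda>p. h (v p)) (a - b)"
    unfolding diff(3,4) using diff(1,2) by (intro N.int_comb_diff[symmetric]) (auto simp: Pi_iff)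
  finally show ?case .
qed (auto simp: zero)

section \<open>Modules of coefficients\<close>

lemma (in left_module) smult_zero_left: "x \<in> carrier M \<Longrightarrow> \<zero>\<^bsub>R\<^esub> \<odot>\<^bsub>M\<^esub> x = \<zero>\<^bsub>M\<^esub>"
proof -
  assume x: "x \<in> carrier M"
  have "\<zero>\<^bsub>R\<^esub> \<odot>\<^bsub>M\<^esub> x \<oplus>\<^bsub>M\<^esub> \<zero>\<^bsub>R\<^esub> \<odot>\<^bsub>M\<^esub> x = \<zero>\<^bsub>R\<^esub> \<odot>\<^bsub>M\<^esub> x"
    using smult_l_distr[of "\<zero>\<^bsub>R\<^esub>" "\<zero>\<^bsub>R\<^esub>" x] x by simp
  then show ?thesis using x by (simp add: M.add.l_cancel_one smult_closed)
qed

lemma (in left_module) smult_minus_one: "x \<in> carrier M \<Longrightarrow> (\<ominus>\<^bsub>R\<^esub> \<one>\<^bsub>R\<^esub>) \<odot>\<^bsub>M\<^esub> x \<oplus>\<^bsub>M\<^esub> x = \<zero>\<^bsub>M\<^esub>"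
  using smult_l_distr[of "\<ominus>\<^bsub>R\<^esub> \<one>\<^bsub>R\<^esub>" "\<one>\<^bsub>R\<^esub>" x]
  by (simp add: smult_one R.l_neg smult_zero_left)

lemma (in left_module) smult_zero_right: "a \<in> carrier R \<Longrightarrow> a \<odot>\<^bsub>M\<^esub> \<zero>\<^bsub>M\<^esub> = \<zero>\<^bsub>M\<^esub>"
proof -
  assume a: "a \<in> carrier R"
  have "a \<odot>\<^bsub>M\<^esub> \<zero>\<^bsub>M\<^esub> \<oplus>\<^bsub>M\<^esub> a \<odot>\<^bsub>M\<^esub> \<zero>\<^bsub>M\<^esub> = a \<odot>\<^bsub>M\<^esub> \<zero>\<^bsub>M\<^esub>"
    using smult_r_distr[OF a M.zero_closed M.zero_closed] by simp
  then show ?thesis using a by (simp add: M.add.l_cancel_one smult_closed)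
qed

lemma mk_module_simps [simp]:
  "carrier (mk_module C z a s) = C" "\<zero>\<^bsub>mk_module C z a s\<^esub> = z"
  "x \<oplus>\<^bsub>mk_module C z a s\<^esub> y = a x y" "r \<odot>\<^bsub>mk_module C z a s\<^esub> x = s r x"
  by (simp_all add: mk_module_def)

text \<open>Additive inverses come from the scalar -1, so closure under addition and scalars
  suffices for the group structure.\<close>

lemma left_moduleI:
  fixes M :: "('r, 'm) module"
  assumes "ring R"
    and "\<And>x y. x \<in> carrier M \<Longrightarrow> y \<in> carrier M \<Longrightarrow> x \<oplus>\<^bsub>M\<^esub> y \<in> carrier M"
    and "\<zero>\<^bsub>M\<^esub> \<in> carrier M"
    and "\<And>x y z. x \<in> carrier M \<Longrightarrow> y \<in> carrier M \<Longrightarrow> z \<in> carrier M \<Longrightarrow> (x \<oplus>\<^bsub>M\<^esub> y) \<oplus>\<^bsub>M\<^esub> z = x \<oplus>\<^bsub>M\<^esub> (y \<oplus>\<^bsub>M\<^esub> z)"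
    and "\<And>x y. x \<in> carrier M \<Longrightarrow> y \<in> carrier M \<Longrightarrow> x \<oplus>\<^bsub>M\<^esub> y = y \<oplus>\<^bsub>M\<^esub> x"
    and "\<And>x. x \<in> carrier M \<Longrightarrow> \<zero>\<^bsub>M\<^esub> \<oplus>\<^bsub>M\<^esub> x = x"
    and neg: "\<And>x. x \<in> carrier M \<Longrightarrow> (\<ominus>\<^bsub>R\<^esub> \<one>\<^bsub>R\<^esub>) \<odot>\<^bsub>M\<^esub> x \<oplus>\<^bsub>M\<^esub> x = \<zero>\<^bsub>M\<^esub>"
    and smult: "\<And>a x. a \<in> carrier R \<Longrightarrow> x \<in> carrier M \<Longrightarrow> a \<odot>\<^bsub>M\<^esub> x \<in> carrier M"
    and "\<And>a b x. a \<in> carrier R \<Longrightarrow> b \<in> carrier R \<Longrightarrow> x \<in> carrier M \<Longrightarrow> (a \<oplus>\<^bsub>R\<^esub> b) \<odot>\<^bsub>M\<^esub> x = a \<odot>\<^bsub>M\<^esub> x \<oplus>\<^bsub>M\<^esub> b \<odot>\<^bsub>M\<^esub> x"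
    and "\<And>a x y. a \<in> carrier R \<Longrightarrow> x \<in> carrier M \<Longrightarrow> y \<in> carrier M \<Longrightarrow> a \<odot>\<^bsub>M\<^esub> (x \<oplus>\<^bsub>M\<^esub> y) = a \<odot>\<^bsub>M\<^esub> x \<oplus>\<^bsub>M\<^esub> a \<odot>\<^bsub>M\<^esub> y"
    and "\<And>a b x. a \<in> carrier R \<Longrightarrow> b \<in> carrier R \<Longrightarrow> x \<in> carrier M \<Longrightarrow> (a \<otimes>\<^bsub>R\<^esub> b) \<odot>\<^bsub>M\<^esub> x = a \<odot>\<^bsub>M\<^esub> (b \<odot>\<^bsub>M\<^esub> x)"
    and "\<And>x. x \<in> carrier M \<Longrightarrow> \<one>\<^bsub>R\<^esub> \<odot>\<^bsub>M\<^esub> x = x"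
  shows "left_module R M"
proof -
  interpret R: ring R by fact
  have "abelian_group M"
  proof (rule abelian_groupI)
    show "\<exists>y\<in>carrier M. y \<oplus>\<^bsub>M\<^esub> x = \<zero>\<^bsub>M\<^esub>" if "x \<in> carrier M" for x
      using neg[OF that] smult[OF _ that, of "\<ominus>\<^bsub>R\<^esub> \<one>\<^bsub>R\<^esub>"] by auto
  qed (fact assms)+
  show ?thesis
    by (intro left_module.intro left_module_axioms.intro \<open>abelian_group M\<close>) (fact assms)+
qed

locale coefficient_setting =
  fixes X :: "'a topology" and S :: "'a set" and R :: "'r ring" and G :: "('a, 'e, 'r) local_system"
  assumes ring: "ring R" and S: "S \<subseteq> topspace X"
    and system: "local_coefficient_system R (subtopology X S) G"
begin

abbreviation coef :: "nat \<Rightarrow> ((nat \<Rightarrow> real) \<Rightarrow> 'a) \<Rightarrow> ('r, (nat \<Rightarrow> real) \<Rightarrow> 'e) module" where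
  "coef n \<sigma> \<equiv> coefficients S G (int n) \<sigma>"

abbreviation ldom :: "nat \<Rightarrow> ((nat \<Rightarrow> real) \<Rightarrow> 'a) \<Rightarrow> (nat \<Rightarrow> real) set" where
  "ldom n \<sigma> \<equiv> lift_domain S (int n) \<sigma>"

lemma topspace_S: "topspace (subtopology X S) = S"
  using S by auto

lemma fiber_module: "y \<in> S \<Longrightarrow> left_module R (fiber G y)"
  and fiber_carrier: "y \<in> S \<Longrightarrow> carrier (fiber G y) = {e \<in> topspace (total G). proj G e = y}"
  using system unfolding local_coefficient_system_def topspace_S by blast+

lemma trivialization:
  assumes "y \<in> S"
  obtains V M \<phi> where "openin (subtopology X S) V" "y \<in> V" "left_module R (M :: ('r, 'e) module)"
    "homeomorphic_map (subtopology (total G) {e \<in> topspace (total G). proj G e \<in> V})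
      (prod_topology (subtopology (subtopology X S) V) (discrete_topology (carrier M))) \<phi>"
    "\<And>e. e \<in> topspace (total G) \<Longrightarrow> proj G e \<in> V \<Longrightarrow> fst (\<phi> e) = proj G e"
    "\<And>z. z \<in> V \<Longrightarrow> (\<lambda>e. snd (\<phi> e)) \<in> linear_maps R (fiber G z) M"
  using system assms unfolding local_coefficient_system_def topspace_S by meson

lemma continuous_into_discrete_comp2:
  assumes "continuous_map T (discrete_topology A) a" "continuous_map T (discrete_topology B) b"
    and "\<And>x y. x \<in> A \<Longrightarrow> y \<in> B \<Longrightarrow> h x y \<in> C"
  shows "continuous_map T (discrete_topology C) (\<lambda>t. h (a t) (b t))"
proof -
  have "continuous_map T (discrete_topology (A \<times> B)) (\<lambda>t. (a t, b t))"
    unfolding prod_topology_discrete_topology using assms(1,2) by (rule continuous_map_pairedI)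
  moreover have "continuous_map (discrete_topology (A \<times> B)) (discrete_topology C) (\<lambda>(x, y). h x y)"
    using assms(3) by auto
  ultimately have "continuous_map T (discrete_topology C) ((\<lambda>(x, y). h x y) \<circ> (\<lambda>t. (a t, b t)))"
    by (rule continuous_map_compose)
  then show ?thesis by (simp add: o_def)
qed

text \<open>Over a trivializing open set, lifts become locally constant maps to the model fiber \<open>M\<close> via the
  projections \<open>l\<close>; \<open>k\<close> is the result of a stalkwise operation on the lifts in \<open>Fs\<close>.\<close>

lemma continuous_lift_op:
  assumes \<sigma>: "singular_simplex n X \<sigma>"
    and Fs: "\<And>f. f \<in> Fs \<Longrightarrow> continuous_map (subtopology (powertop_real UNIV) (ldom n \<sigma>)) (total G) f
      \<and> (\<forall>t\<in>ldom n \<sigma>. proj G (f t) = \<sigma> t)"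
    and k: "\<And>t. t \<in> ldom n \<sigma> \<Longrightarrow> k t \<in> carrier (fiber G (\<sigma> t))"
    and op: "\<And>M l U. left_module R (M :: ('r, 'e) module) \<Longrightarrow>
        (\<And>t. t \<in> topspace U \<Longrightarrow> t \<in> ldom n \<sigma> \<and> l \<in> linear_maps R (fiber G (\<sigma> t)) M) \<Longrightarrow>
        (\<And>f. f \<in> Fs \<Longrightarrow> continuous_map U (discrete_topology (carrier M)) (\<lambda>t. l (f t))) \<Longrightarrow>
        continuous_map U (discrete_topology (carrier M)) (\<lambda>t. l (k t))"
  shows "continuous_map (subtopology (powertop_real UNIV) (ldom n \<sigma>)) (total G) k"
proof -
  let ?T = "subtopology (powertop_real UNIV) (ldom n \<sigma>)"
  have dom_S: "\<sigma> t \<in> S" if "t \<in> ldom n \<sigma>" for t using that by (auto simp: lift_domain_def)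
  have dom_sub: "ldom n \<sigma> \<subseteq> standard_simplex n" by (auto simp: lift_domain_def)
  have "continuous_map (subtopology (powertop_real UNIV) (standard_simplex n)) X \<sigma>"
    using \<sigma> by (simp add: singular_simplex_def)
  then have "continuous_map ?T X \<sigma>"
    by (rule continuous_map_from_subtopology_mono[OF _ dom_sub])
  then have \<sigma>_cont: "continuous_map ?T (subtopology X S) \<sigma>"
    using dom_S by (auto simp: continuous_map_in_subtopology)
  have local: "\<exists>W. openin ?T W \<and> t0 \<in> W \<and> continuous_map (subtopology ?T W) (total G) k"
    if t0: "t0 \<in> ldom n \<sigma>" for t0
  proof -
    obtain V M \<phi> where V: "openin (subtopology X S) V" "\<sigma> t0 \<in> V" and M: "left_module R (M :: ('r, 'e) module)"
      and \<phi>: "homeomorphic_map (subtopology (total G) {e \<in> topspace (total G). proj G e \<in> V})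
        (prod_topology (subtopology (subtopology X S) V) (discrete_topology (carrier M))) \<phi>"
      and fst_\<phi>: "\<And>e. e \<in> topspace (total G) \<Longrightarrow> proj G e \<in> V \<Longrightarrow> fst (\<phi> e) = proj G e"
      and lin: "\<And>z. z \<in> V \<Longrightarrow> (\<lambda>e. snd (\<phi> e)) \<in> linear_maps R (fiber G z) M"
      using trivialization[OF dom_S[OF t0]] by blast
    let ?E = "{e \<in> topspace (total G). proj G e \<in> V}"
    let ?P = "prod_topology (subtopology (subtopology X S) V) (discrete_topology (carrier M))"
    define W where "W = {t \<in> ldom n \<sigma>. \<sigma> t \<in> V}"
    let ?U = "subtopology ?T W"
    have W: "openin ?T W" "t0 \<in> W"
      using openin_continuous_map_preimage[OF \<sigma>_cont V(1)] t0 V(2) by (simp_all add: W_def)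
    have topU: "topspace ?U = W" by (auto simp: W_def)
    have lift: "continuous_map ?U (discrete_topology (carrier M)) (\<lambda>t. snd (\<phi> (f t)))"
      if "f \<in> Fs" for f
    proof -
      note f = conjunct1[OF Fs[OF that]] conjunct2[OF Fs[OF that], rule_format]
      have "f t \<in> ?E" if "t \<in> W" for t
        using that f continuous_map_image_subset_topspace[OF f(1)] by (auto simp: W_def)
      then have "continuous_map ?U (subtopology (total G) ?E) f"
        using continuous_map_from_subtopology[OF f(1)] topU by (auto simp: continuous_map_in_subtopology)
      from continuous_map_compose[OF this homeomorphic_imp_continuous_map[OF \<phi>]]
      have "continuous_map ?U ?P (\<phi> \<circ> f)" .
      from continuous_map_compose[OF this continuous_map_snd] show ?thesis by (simp add: o_def)
    qed
    have s: "continuous_map ?U (discrete_topology (carrier M)) (\<lambda>t. snd (\<phi> (k t)))"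
      by (rule op[OF M _ lift]) (use lin topU in \<open>auto simp: W_def\<close>)
    have "continuous_map ?U (subtopology (subtopology X S) V) \<sigma>"
      using continuous_map_from_subtopology[OF \<sigma>_cont] topU
      by (auto simp: continuous_map_in_subtopology W_def)
    from continuous_map_pairedI[OF this s]
    have pair: "continuous_map ?U ?P (\<lambda>t. (\<sigma> t, snd (\<phi> (k t))))" .
    \<comment> \<open>Locally \<open>k\<close> is the image under the inverse trivialization of the
      pair of \<sigma> and its component in \<open>M\<close>, and both of these are
      continuous.\<close>
    obtain \<psi> where \<psi>: "homeomorphic_maps (subtopology (total G) ?E) ?P \<phi> \<psi>"
      using \<phi> homeomorphic_map_maps by blast
    then have "continuous_map ?P (subtopology (total G) ?E) \<psi>" by (simp add: homeomorphic_maps_def)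
    then have "continuous_map ?P (total G) \<psi>" by (simp add: continuous_map_in_subtopology)
    from continuous_map_compose[OF pair this]
    have c: "continuous_map ?U (total G) (\<psi> \<circ> (\<lambda>t. (\<sigma> t, snd (\<phi> (k t)))))" .
    have "continuous_map ?U (total G) k"
    proof (rule continuous_map_eq[OF c])
      fix t assume "t \<in> topspace ?U"
      then have t: "t \<in> ldom n \<sigma>" "\<sigma> t \<in> V" by (auto simp: W_def)
      have kt: "k t \<in> topspace (total G)" "proj G (k t) = \<sigma> t"
        using k[OF t(1)] fiber_carrier[OF dom_S[OF t(1)]] by auto
      have "\<phi> (k t) = (\<sigma> t, snd (\<phi> (k t)))"
        using fst_\<phi>[OF kt(1)] kt(2) t(2) by (simp add: prod_eq_iff)
      moreover have "\<psi> (\<phi> (k t)) = k t"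
        using \<psi> kt t(2) by (simp add: homeomorphic_maps_def)
      ultimately show "(\<psi> \<circ> (\<lambda>t. (\<sigma> t, snd (\<phi> (k t))))) t = k t" by simp
    qed
    then show ?thesis using W by blast
  qed
  then obtain W where W: "\<And>t. t \<in> ldom n \<sigma> \<Longrightarrow> openin ?T (W t) \<and> t \<in> W t \<and> continuous_map (subtopology ?T (W t)) (total G) k"
    by metis
  show ?thesis
    by (rule pasting_lemma[where I="ldom n \<sigma>" and T=W and f="\<lambda>_. k"]) (use W in auto)
qed

lemma coefficient_iff:
  "m \<in> carrier (coef n \<sigma>) \<longleftrightarrow> m \<in> extensional (ldom n \<sigma>)
     \<and> continuous_map (subtopology (powertop_real UNIV) (ldom n \<sigma>)) (total G) m
     \<and> (\<forall>t\<in>ldom n \<sigma>. proj G (m t) = \<sigma> t)"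
  by (simp add: coefficients_def)

lemma coef_ops:
  "\<zero>\<^bsub>coef n \<sigma>\<^esub> = (\<lambda>t\<in>ldom n \<sigma>. \<zero>\<^bsub>fiber G (\<sigma> t)\<^esub>)"
  "m \<oplus>\<^bsub>coef n \<sigma>\<^esub> m' = (\<lambda>t\<in>ldom n \<sigma>. m t \<oplus>\<^bsub>fiber G (\<sigma> t)\<^esub> m' t)"
  "r \<odot>\<^bsub>coef n \<sigma>\<^esub> m = (\<lambda>t\<in>ldom n \<sigma>. r \<odot>\<^bsub>fiber G (\<sigma> t)\<^esub> m t)"
  by (simp_all add: coefficients_def)

lemma dom_S: "t \<in> ldom n \<sigma> \<Longrightarrow> \<sigma> t \<in> S"
  by (auto simp: lift_domain_def)

lemma coefficient_fiber: "m \<in> carrier (coef n \<sigma>) \<Longrightarrow> t \<in> ldom n \<sigma> \<Longrightarrow> m t \<in> carrier (fiber G (\<sigma> t))"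
proof -
  assume *: "m \<in> carrier (coef n \<sigma>)" "t \<in> ldom n \<sigma>"
  then have "m t \<in> topspace (total G)"
    unfolding coefficient_iff using continuous_map_image_subset_topspace by fastforce
  then show ?thesis using * fiber_carrier[OF dom_S[OF *(2)]] by (simp add: coefficient_iff)
qed

lemma coefficient_opI:
  assumes \<sigma>: "singular_simplex n X \<sigma>" and Fs: "Fs \<subseteq> carrier (coef n \<sigma>)"
    and k: "\<And>t. t \<in> ldom n \<sigma> \<Longrightarrow> k t \<in> carrier (fiber G (\<sigma> t))"
    and op: "\<And>M l U. left_module R (M :: ('r, 'e) module) \<Longrightarrow>
        (\<And>t. t \<in> topspace U \<Longrightarrow> t \<in> ldom n \<sigma> \<and> l \<in> linear_maps R (fiber G (\<sigma> t)) M) \<Longrightarrow>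
        (\<And>f. f \<in> Fs \<Longrightarrow> continuous_map U (discrete_topology (carrier M)) (\<lambda>t. l (f t))) \<Longrightarrow>
        continuous_map U (discrete_topology (carrier M)) (\<lambda>t. l (k t))"
  shows "restrict k (ldom n \<sigma>) \<in> carrier (coef n \<sigma>)"
  unfolding coefficient_iff
proof (intro conjI ballI)
  have "continuous_map (subtopology (powertop_real UNIV) (ldom n \<sigma>)) (total G) k"
  proof (rule continuous_lift_op[OF \<sigma> _ k, where Fs=Fs])
    show "continuous_map U (discrete_topology (carrier M)) (\<lambda>t. l (k t))"
      if "left_module R M" "\<And>t. t \<in> topspace U \<Longrightarrow> t \<in> ldom n \<sigma> \<and> l \<in> linear_maps R (fiber G (\<sigma> t)) M"
        "\<And>f. f \<in> Fs \<Longrightarrow> continuous_map U (discrete_topology (carrier M)) (\<lambda>t. l (f t))"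
      for M :: "('r, 'e) module" and l U
      using that by (rule op)
  qed (use Fs in \<open>auto simp: coefficient_iff\<close>)
  then show "continuous_map (subtopology (powertop_real UNIV) (ldom n \<sigma>)) (total G) (restrict k (ldom n \<sigma>))"
    by (rule continuous_map_eq) simp
  show "proj G (restrict k (ldom n \<sigma>) t) = \<sigma> t" if "t \<in> ldom n \<sigma>" for t
    using k[OF that] fiber_carrier[OF dom_S[OF that]] that by simp
qed simp

lemma linear_maps_zero:
  "left_module R M \<Longrightarrow> left_module R N \<Longrightarrow> l \<in> linear_maps R M N \<Longrightarrow> l \<zero>\<^bsub>M\<^esub> = \<zero>\<^bsub>N\<^esub>"
proof -
  assume "left_module R M" "left_module R N" and l: "l \<in> linear_maps R M N"
  then interpret M: left_module R M + N: left_module R N by blast+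
  interpret additive_map M N l
    by unfold_locales (use l in \<open>auto simp: linear_maps_def additive_def\<close>)
  show ?thesis by (rule zero)
qed

text \<open>The axioms hold stalkwise; what needs an argument is continuity of the stalkwise
  operations. In a trivialization they become operations on continuous maps into the discrete module
  \<open>M\<close>, by linearity of the projections on fibers.\<close>

lemma coef_left_module:
  assumes \<sigma>: "singular_simplex n X \<sigma>"
  shows "left_module R (coef n \<sigma>)"
proof -
  note fm = fiber_module[OF dom_S[of _ n \<sigma>]]
  interpret R: ring R by (rule ring)
  have zero: "\<zero>\<^bsub>coef n \<sigma>\<^esub> \<in> carrier (coef n \<sigma>)"
    unfolding coef_ops
  proof (rule coefficient_opI[OF \<sigma> empty_subsetI])
    fix t assume "t \<in> ldom n \<sigma>"
    then interpret left_module R "fiber G (\<sigma> t)" by (rule fm)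
    show "\<zero>\<^bsub>fiber G (\<sigma> t)\<^esub> \<in> carrier (fiber G (\<sigma> t))" by simp
  next
    fix M :: "('r, 'e) module" and l and U :: "(nat \<Rightarrow> real) topology"
    assume M: "left_module R M" and l: "\<And>t. t \<in> topspace U \<Longrightarrow> t \<in> ldom n \<sigma> \<and> l \<in> linear_maps R (fiber G (\<sigma> t)) M"
    interpret M: left_module R M by (rule M)
    have "continuous_map U (discrete_topology (carrier M)) (\<lambda>t. \<zero>\<^bsub>M\<^esub>)" by simp
    then show "continuous_map U (discrete_topology (carrier M)) (\<lambda>t. l \<zero>\<^bsub>fiber G (\<sigma> t)\<^esub>)"
    proof (rule continuous_map_eq)
      fix t assume "t \<in> topspace U"
      with l have t: "t \<in> ldom n \<sigma>" "l \<in> linear_maps R (fiber G (\<sigma> t)) M" by auto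
      show "\<zero>\<^bsub>M\<^esub> = l \<zero>\<^bsub>fiber G (\<sigma> t)\<^esub>" using linear_maps_zero[OF fm[OF t(1)] M t(2)] by simp
    qed
  qed
  have add: "m \<oplus>\<^bsub>coef n \<sigma>\<^esub> m' \<in> carrier (coef n \<sigma>)"
    if m: "m \<in> carrier (coef n \<sigma>)" "m' \<in> carrier (coef n \<sigma>)" for m m'
    unfolding coef_ops
  proof (rule coefficient_opI[OF \<sigma>, where Fs="{m, m'}"])
    fix t assume t: "t \<in> ldom n \<sigma>"
    then interpret left_module R "fiber G (\<sigma> t)" by (rule fm)
    show "m t \<oplus>\<^bsub>fiber G (\<sigma> t)\<^esub> m' t \<in> carrier (fiber G (\<sigma> t))"
      using coefficient_fiber[OF m(1) t] coefficient_fiber[OF m(2) t] by simp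
  next
    fix M :: "('r, 'e) module" and l and U :: "(nat \<Rightarrow> real) topology"
    assume M: "left_module R M" and l: "\<And>t. t \<in> topspace U \<Longrightarrow> t \<in> ldom n \<sigma> \<and> l \<in> linear_maps R (fiber G (\<sigma> t)) M"
      and c: "\<And>f. f \<in> {m, m'} \<Longrightarrow> continuous_map U (discrete_topology (carrier M)) (\<lambda>t. l (f t))"
    interpret M: left_module R M by (rule M)
    have "continuous_map U (discrete_topology (carrier M)) (\<lambda>t. l (m t) \<oplus>\<^bsub>M\<^esub> l (m' t))"
      by (rule continuous_into_discrete_comp2[OF c c]) auto
    then show "continuous_map U (discrete_topology (carrier M)) (\<lambda>t. l (m t \<oplus>\<^bsub>fiber G (\<sigma> t)\<^esub> m' t))"
    proof (rule continuous_map_eq)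
      fix t assume "t \<in> topspace U"
      with l have t: "t \<in> ldom n \<sigma>" "l \<in> linear_maps R (fiber G (\<sigma> t)) M" by auto
      then show "l (m t) \<oplus>\<^bsub>M\<^esub> l (m' t) = l (m t \<oplus>\<^bsub>fiber G (\<sigma> t)\<^esub> m' t)"
        using coefficient_fiber[OF m(1) t(1)] coefficient_fiber[OF m(2) t(1)] by (simp add: linear_maps_def)
    qed
  qed (use m in auto)
  have smult: "r \<odot>\<^bsub>coef n \<sigma>\<^esub> m \<in> carrier (coef n \<sigma>)"
    if r: "r \<in> carrier R" and m: "m \<in> carrier (coef n \<sigma>)" for m r
    unfolding coef_ops
  proof (rule coefficient_opI[OF \<sigma>, where Fs="{m}"])
    fix t assume t: "t \<in> ldom n \<sigma>"
    then interpret left_module R "fiber G (\<sigma> t)" by (rule fm)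
    show "r \<odot>\<^bsub>fiber G (\<sigma> t)\<^esub> m t \<in> carrier (fiber G (\<sigma> t))"
      using coefficient_fiber[OF m t] r by (simp add: smult_closed)
  next
    fix M :: "('r, 'e) module" and l and U :: "(nat \<Rightarrow> real) topology"
    assume M: "left_module R M" and l: "\<And>t. t \<in> topspace U \<Longrightarrow> t \<in> ldom n \<sigma> \<and> l \<in> linear_maps R (fiber G (\<sigma> t)) M"
      and c: "\<And>f. f \<in> {m} \<Longrightarrow> continuous_map U (discrete_topology (carrier M)) (\<lambda>t. l (f t))"
    interpret M: left_module R M by (rule M)
    have "continuous_map U (discrete_topology (carrier M)) (\<lambda>t. r \<odot>\<^bsub>M\<^esub> l (m t))"
      by (rule continuous_into_discrete_comp2[OF c c, where h="\<lambda>x y. r \<odot>\<^bsub>M\<^esub> y"]) (auto simp: r M.smult_closed)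
    then show "continuous_map U (discrete_topology (carrier M)) (\<lambda>t. l (r \<odot>\<^bsub>fiber G (\<sigma> t)\<^esub> m t))"
    proof (rule continuous_map_eq)
      fix t assume "t \<in> topspace U"
      with l have t: "t \<in> ldom n \<sigma>" "l \<in> linear_maps R (fiber G (\<sigma> t)) M" by auto
      then show "r \<odot>\<^bsub>M\<^esub> l (m t) = l (r \<odot>\<^bsub>fiber G (\<sigma> t)\<^esub> m t)"
        using coefficient_fiber[OF m t(1)] r by (simp add: linear_maps_def)
    qed
  qed (use m in auto)
  have fib: "abelian_group (fiber G (\<sigma> t))" if "t \<in> ldom n \<sigma>" for t
    using fm[OF that] by (simp add: left_module_def)
  have ext: "(\<lambda>t\<in>ldom n \<sigma>. m t) = m" if "m \<in> carrier (coef n \<sigma>)" for m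
    using that by (simp add: coefficient_iff extensional_restrict)
  show ?thesis
  proof (rule left_moduleI[OF ring add zero _ _ _ _ smult])
    fix x y z assume *: "x \<in> carrier (coef n \<sigma>)" "y \<in> carrier (coef n \<sigma>)" "z \<in> carrier (coef n \<sigma>)"
    show "(x \<oplus>\<^bsub>coef n \<sigma>\<^esub> y) \<oplus>\<^bsub>coef n \<sigma>\<^esub> z = x \<oplus>\<^bsub>coef n \<sigma>\<^esub> (y \<oplus>\<^bsub>coef n \<sigma>\<^esub> z)"
      unfolding coef_ops
      by (rule restrict_ext)
         (use * in \<open>simp add: abelian_monoid.a_assoc[OF abelian_group.axioms(1)[OF fib]] coefficient_fiber\<close>)
  next
    fix x y assume *: "x \<in> carrier (coef n \<sigma>)" "y \<in> carrier (coef n \<sigma>)"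
    show "x \<oplus>\<^bsub>coef n \<sigma>\<^esub> y = y \<oplus>\<^bsub>coef n \<sigma>\<^esub> x"
      unfolding coef_ops
      by (rule restrict_ext)
         (use * in \<open>simp add: abelian_monoid.a_comm[OF abelian_group.axioms(1)[OF fib]] coefficient_fiber\<close>)
    fix a assume a: "a \<in> carrier R"
    show "a \<odot>\<^bsub>coef n \<sigma>\<^esub> (x \<oplus>\<^bsub>coef n \<sigma>\<^esub> y) = a \<odot>\<^bsub>coef n \<sigma>\<^esub> x \<oplus>\<^bsub>coef n \<sigma>\<^esub> a \<odot>\<^bsub>coef n \<sigma>\<^esub> y"
      unfolding coef_ops
      by (rule restrict_ext)
         (use * a in \<open>simp add: left_module.smult_r_distr[OF fm] coefficient_fiber\<close>)
  next
    fix x assume x: "x \<in> carrier (coef n \<sigma>)"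
    show "\<zero>\<^bsub>coef n \<sigma>\<^esub> \<oplus>\<^bsub>coef n \<sigma>\<^esub> x = x"
      unfolding coef_ops
      by (subst (2) ext[OF x, symmetric], rule restrict_ext)
         (use x in \<open>simp add: abelian_monoid.l_zero[OF abelian_group.axioms(1)[OF fib]] coefficient_fiber\<close>)
    show "(\<ominus>\<^bsub>R\<^esub> \<one>\<^bsub>R\<^esub>) \<odot>\<^bsub>coef n \<sigma>\<^esub> x \<oplus>\<^bsub>coef n \<sigma>\<^esub> x = \<zero>\<^bsub>coef n \<sigma>\<^esub>"
      unfolding coef_ops
      by (rule restrict_ext)
         (use x in \<open>simp add: left_module.smult_minus_one[OF fm] coefficient_fiber\<close>)
    show "\<one>\<^bsub>R\<^esub> \<odot>\<^bsub>coef n \<sigma>\<^esub> x = x"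
      unfolding coef_ops
      by (subst (2) ext[OF x, symmetric], rule restrict_ext)
         (use x in \<open>simp add: left_module.smult_one[OF fm] coefficient_fiber\<close>)
    fix a b assume a: "a \<in> carrier R" "b \<in> carrier R"
    show "(a \<oplus>\<^bsub>R\<^esub> b) \<odot>\<^bsub>coef n \<sigma>\<^esub> x = a \<odot>\<^bsub>coef n \<sigma>\<^esub> x \<oplus>\<^bsub>coef n \<sigma>\<^esub> b \<odot>\<^bsub>coef n \<sigma>\<^esub> x"
      unfolding coef_ops
      by (rule restrict_ext)
         (use x a in \<open>simp add: left_module.smult_l_distr[OF fm] coefficient_fiber\<close>)
    show "(a \<otimes>\<^bsub>R\<^esub> b) \<odot>\<^bsub>coef n \<sigma>\<^esub> x = a \<odot>\<^bsub>coef n \<sigma>\<^esub> (b \<odot>\<^bsub>coef n \<sigma>\<^esub> x)"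
      unfolding coef_ops
      by (rule restrict_ext)
         (use x a in \<open>simp add: left_module.smult_assoc[OF fm] coefficient_fiber\<close>)
  qed
qed

end

section \<open>Natural operators on locally finite chains\<close>

lemma frag_extend_swap:
  "frag_extend (\<lambda>x. frag_extend (\<lambda>y. h x y) d) c = frag_extend (\<lambda>y. frag_extend (\<lambda>x. h x y) c) d"
proof (induction c rule: frag_induction[OF subset_UNIV])
  case (3 a b)
  then show ?case by (simp add: frag_extend_diff frag_extend_minus_fun)
qed (simp_all add: frag_extend_zero_fun)

definition affine_simplex :: "nat \<Rightarrow> nat \<Rightarrow> (nat \<Rightarrow> real) list \<Rightarrow> bool" where
  "affine_simplex n n' xs \<longleftrightarrow> length xs = Suc n' \<and> set xs \<subseteq> standard_simplex n"

definition simplex_comp :: "nat \<Rightarrow> ((nat \<Rightarrow> real) \<Rightarrow> 'a) \<Rightarrow> (nat \<Rightarrow> real) list \<Rightarrow> ((nat \<Rightarrow> real) \<Rightarrow> 'a)" where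
  "simplex_comp n' \<sigma> xs = restrict (\<sigma> \<circ> bary xs) (standard_simplex n')"

lemma bary_affine: "affine_simplex n n' xs \<Longrightarrow> t \<in> standard_simplex n' \<Longrightarrow> bary xs t \<in> standard_simplex n"
  using bary_in_cvx[OF cvx_standard_simplex, of xs n t]
  by (simp add: affine_simplex_def standard_simplex_eq_wts[of n'])

lemma continuous_bary: "continuous_map (powertop_real UNIV) (powertop_real UNIV) (bary xs)"
proof -
  have "continuous_on UNIV (bary xs)"
    unfolding bary_def
    by (intro continuous_on_coordinatewise_then_product continuous_intros) auto
  then show ?thesis by (simp add: euclidean_product_topology)
qed

lemma singular_simplex_comp:
  assumes "singular_simplex n X \<sigma>" "affine_simplex n n' xs"
  shows "singular_simplex n' X (simplex_comp n' \<sigma> xs)"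
proof -
  have "continuous_map (subtopology (powertop_real UNIV) (standard_simplex n'))
      (subtopology (powertop_real UNIV) (standard_simplex n)) (bary xs)"
    using continuous_map_from_subtopology[OF continuous_bary] bary_affine[OF assms(2)]
    by (auto simp: continuous_map_in_subtopology)
  moreover have "continuous_map (subtopology (powertop_real UNIV) (standard_simplex n)) X \<sigma>"
    using assms(1) by (simp add: singular_simplex_def)
  ultimately have "continuous_map (subtopology (powertop_real UNIV) (standard_simplex n')) X (\<sigma> \<circ> bary xs)"
    by (rule continuous_map_compose)
  then have "continuous_map (subtopology (powertop_real UNIV) (standard_simplex n')) X (simplex_comp n' \<sigma> xs)"
    by (rule continuous_map_eq) (simp add: simplex_comp_def)
  then show ?thesis by (simp add: singular_simplex_def simplex_comp_def)
qed

lemma affine_simplex_map: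
  assumes "affine_simplex n n' xs" "affine_simplex n' n'' ys"
  shows "affine_simplex n n'' (map (bary xs) ys)"
  using assms bary_affine[OF assms(1)] by (auto simp: affine_simplex_def)

lemma simplex_comp_comp:
  assumes "affine_simplex n' n'' ys"
  shows "simplex_comp n'' (simplex_comp n' \<sigma> xs) ys = simplex_comp n'' \<sigma> (map (bary xs) ys)"
  using bary_affine[OF assms] by (auto simp: simplex_comp_def bary_bary intro!: restrict_ext)

lemma affine_vertices: "affine_simplex n n (vertices n)"
  using good_vertices[of n] by (simp add: affine_simplex_def good_def)

lemma simplex_comp_vertices:
  "singular_simplex n X \<sigma> \<Longrightarrow> simplex_comp n \<sigma> (vertices n) = \<sigma>"
  by (rule ext) (auto simp: simplex_comp_def bary_vertices standard_simplex_eq_wts singular_simplex_def extensional_def)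

lemma map_bary_vertices:
  "length xs = Suc n \<Longrightarrow> map (bary xs) (vertices n) = xs"
  by (rule nth_equalityI) (auto simp: vertices_def bary_basis_pt simp del: upt_Suc)

lemma simplices_nat: "simplices X (int n) = {\<sigma>. singular_simplex n X \<sigma>}"
  by (simp add: simplices_def)

context coefficient_setting
begin

definition pull :: "nat \<Rightarrow> ((nat \<Rightarrow> real) \<Rightarrow> 'a) \<Rightarrow> (nat \<Rightarrow> real) list
    \<Rightarrow> ((nat \<Rightarrow> real) \<Rightarrow> 'e) \<Rightarrow> ((nat \<Rightarrow> real) \<Rightarrow> 'e)" where
  "pull n' \<tau> xs m = restrict (m \<circ> bary xs) (ldom n' \<tau>)"

abbreviation csimp :: "nat \<Rightarrow> ('a, 'e) coeff_chain \<Rightarrow> ((nat \<Rightarrow> real) \<Rightarrow> 'a) set" where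
  "csimp n \<xi> \<equiv> chain_simplices X S G (int n) \<xi>"

abbreviation chains :: "nat \<Rightarrow> ('r, ('a, 'e) coeff_chain) module" where
  "chains n \<equiv> locally_finite_chains X S G (int n)"

lemma ldom_comp:
  "affine_simplex n n' xs \<Longrightarrow> t \<in> ldom n' (simplex_comp n' \<sigma> xs) \<Longrightarrow>
    bary xs t \<in> ldom n \<sigma> \<and> simplex_comp n' \<sigma> xs t = \<sigma> (bary xs t)"
  using bary_affine[of n n' xs t] by (auto simp: lift_domain_def simplex_comp_def)

lemma pull_closed:
  assumes xs: "affine_simplex n n' xs" and m: "m \<in> carrier (coef n \<sigma>)"
  shows "pull n' (simplex_comp n' \<sigma> xs) xs m \<in> carrier (coef n' (simplex_comp n' \<sigma> xs))"
proof -
  let ?\<tau> = "simplex_comp n' \<sigma> xs"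
  have "continuous_map (subtopology (powertop_real UNIV) (ldom n' ?\<tau>))
      (subtopology (powertop_real UNIV) (ldom n \<sigma>)) (bary xs)"
    using continuous_map_from_subtopology[OF continuous_bary] ldom_comp[OF xs]
    by (auto simp: continuous_map_in_subtopology)
  moreover have "continuous_map (subtopology (powertop_real UNIV) (ldom n \<sigma>)) (total G) m"
    using m by (simp add: coefficient_iff)
  ultimately have "continuous_map (subtopology (powertop_real UNIV) (ldom n' ?\<tau>)) (total G) (m \<circ> bary xs)"
    by (rule continuous_map_compose)
  then have "continuous_map (subtopology (powertop_real UNIV) (ldom n' ?\<tau>)) (total G) (pull n' ?\<tau> xs m)"
    by (rule continuous_map_eq) (simp add: pull_def)
  then show ?thesis using m ldom_comp[OF xs, of _ \<sigma>] by (auto simp: coefficient_iff pull_def)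
qed

lemma coef_abelian: "singular_simplex n X \<sigma> \<Longrightarrow> abelian_group (coef n \<sigma>)"
  using coef_left_module left_module.axioms(2) by blast

lemma pull_additive:
  assumes xs: "affine_simplex n n' xs" and \<sigma>: "singular_simplex n X \<sigma>"
  shows "additive_map (coef n \<sigma>) (coef n' (simplex_comp n' \<sigma> xs)) (pull n' (simplex_comp n' \<sigma> xs) xs)"
proof (intro additive_map.intro additive_map_axioms.intro)
  let ?\<tau> = "simplex_comp n' \<sigma> xs"
  show "abelian_group (coef n \<sigma>)" "abelian_group (coef n' ?\<tau>)"
    using coef_abelian \<sigma> singular_simplex_comp[OF \<sigma> xs] by blast+
  show "additive (coef n \<sigma>) (coef n' ?\<tau>) (pull n' ?\<tau> xs)"
    unfolding additive_def
  proof (intro conjI ballI)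
    show "pull n' ?\<tau> xs \<in> carrier (coef n \<sigma>) \<rightarrow> carrier (coef n' ?\<tau>)"
      using pull_closed[OF xs] by blast
    fix m m'
    show "pull n' ?\<tau> xs (m \<oplus>\<^bsub>coef n \<sigma>\<^esub> m') = pull n' ?\<tau> xs m \<oplus>\<^bsub>coef n' ?\<tau>\<^esub> pull n' ?\<tau> xs m'"
      unfolding pull_def coef_ops by (rule restrict_ext) (use ldom_comp[OF xs, of _ \<sigma>] in auto)
  qed
qed

lemma pull_smult:
  assumes xs: "affine_simplex n n' xs"
  shows "pull n' (simplex_comp n' \<sigma> xs) xs (r \<odot>\<^bsub>coef n \<sigma>\<^esub> m)
    = r \<odot>\<^bsub>coef n' (simplex_comp n' \<sigma> xs)\<^esub> pull n' (simplex_comp n' \<sigma> xs) xs m"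
  unfolding pull_def coef_ops by (rule restrict_ext) (use ldom_comp[OF xs, of _ \<sigma>] in auto)

lemma pull_pull:
  assumes xs: "affine_simplex n n' xs" and ys: "affine_simplex n' n'' ys"
    and \<tau>: "\<tau> = simplex_comp n' \<sigma> xs" and \<rho>: "\<rho> = simplex_comp n'' \<tau> ys"
  shows "pull n'' \<rho> ys (pull n' \<tau> xs m) = pull n'' \<rho> (map (bary xs) ys) m"
  unfolding pull_def by (rule restrict_ext) (use ldom_comp[OF ys, of _ \<tau>] \<rho> in \<open>auto simp: bary_bary\<close>)

section \<open>Modules of locally finite chains\<close>

lemma chains_iff:
  "\<xi> \<in> carrier (chains n) \<longleftrightarrow> \<xi> \<in> (\<Pi>\<^sub>E \<sigma>\<in>simplices X (int n). carrier (coef n \<sigma>))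
    \<and> (\<forall>x\<in>topspace X. \<exists>V. openin X V \<and> x \<in> V
          \<and> finite {\<sigma> \<in> csimp n \<xi>. \<sigma> ` standard_simplex n \<inter> V \<noteq> {}})"
  by (simp add: locally_finite_chains_def)

lemma chains_coef: "\<xi> \<in> carrier (chains n) \<Longrightarrow> singular_simplex n X \<sigma> \<Longrightarrow> \<xi> \<sigma> \<in> carrier (coef n \<sigma>)"
  by (auto simp: chains_iff simplices_nat)

lemma csimp_iff: "\<sigma> \<in> csimp n \<xi> \<longleftrightarrow> singular_simplex n X \<sigma> \<and> \<xi> \<sigma> \<noteq> \<zero>\<^bsub>coef n \<sigma>\<^esub>"
  by (simp add: chain_simplices_def simplices_nat)

lemma finite_csimp_at:
  assumes "\<xi> \<in> carrier (chains n)" "x \<in> topspace X"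
  shows "finite {\<sigma> \<in> csimp n \<xi>. x \<in> \<sigma> ` standard_simplex n}"
proof -
  obtain V where V: "x \<in> V" "finite {\<sigma> \<in> csimp n \<xi>. \<sigma> ` standard_simplex n \<inter> V \<noteq> {}}"
    using assms unfolding chains_iff by blast
  show ?thesis by (rule finite_subset[OF _ V(2)]) (use V(1) in blast)
qed

lemma chains_ops:
  "\<zero>\<^bsub>chains n\<^esub> = (\<lambda>\<sigma>\<in>simplices X (int n). \<zero>\<^bsub>coef n \<sigma>\<^esub>)"
  "\<xi> \<oplus>\<^bsub>chains n\<^esub> \<eta> = (\<lambda>\<sigma>\<in>simplices X (int n). \<xi> \<sigma> \<oplus>\<^bsub>coef n \<sigma>\<^esub> \<eta> \<sigma>)"
  "r \<odot>\<^bsub>chains n\<^esub> \<xi> = (\<lambda>\<sigma>\<in>simplices X (int n). r \<odot>\<^bsub>coef n \<sigma>\<^esub> \<xi> \<sigma>)"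
  by (simp_all add: locally_finite_chains_def)

lemma csimp_zero: "csimp n \<zero>\<^bsub>chains n\<^esub> = {}"
  by (auto simp: csimp_iff chains_ops simplices_nat)

lemma csimp_add: "csimp n (\<xi> \<oplus>\<^bsub>chains n\<^esub> \<eta>) \<subseteq> csimp n \<xi> \<union> csimp n \<eta>"
proof
  fix \<sigma> assume \<sigma>: "\<sigma> \<in> csimp n (\<xi> \<oplus>\<^bsub>chains n\<^esub> \<eta>)"
  then interpret abelian_group "coef n \<sigma>" using coef_abelian by (simp add: csimp_iff)
  show "\<sigma> \<in> csimp n \<xi> \<union> csimp n \<eta>"
    using \<sigma> by (auto simp: csimp_iff chains_ops simplices_nat)
qed

lemma csimp_smult: "r \<in> carrier R \<Longrightarrow> csimp n (r \<odot>\<^bsub>chains n\<^esub> \<xi>) \<subseteq> csimp n \<xi>"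
proof
  fix \<sigma> assume r: "r \<in> carrier R" and \<sigma>: "\<sigma> \<in> csimp n (r \<odot>\<^bsub>chains n\<^esub> \<xi>)"
  then interpret left_module R "coef n \<sigma>" using coef_left_module by (simp add: csimp_iff)
  show "\<sigma> \<in> csimp n \<xi>"
    using \<sigma> smult_zero_right[OF r] by (auto simp: csimp_iff chains_ops simplices_nat)
qed

lemma locally_finite_subset:
  assumes "\<xi> \<in> (\<Pi>\<^sub>E \<sigma>\<in>simplices X (int n). carrier (coef n \<sigma>))"
    and "\<And>x. x \<in> topspace X \<Longrightarrow> \<exists>V K. openin X V \<and> x \<in> V \<and> finite K
        \<and> (\<forall>\<sigma>\<in>csimp n \<xi>. \<sigma> ` standard_simplex n \<inter> V \<noteq> {} \<longrightarrow> \<sigma> \<in> K)"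
  shows "\<xi> \<in> carrier (chains n)"
  unfolding chains_iff
proof (intro conjI ballI)
  fix x assume "x \<in> topspace X"
  from assms(2)[OF this] obtain V K where V: "openin X V" "x \<in> V" "finite K"
    "\<forall>\<sigma>\<in>csimp n \<xi>. \<sigma> ` standard_simplex n \<inter> V \<noteq> {} \<longrightarrow> \<sigma> \<in> K" by blast
  have "{\<sigma> \<in> csimp n \<xi>. \<sigma> ` standard_simplex n \<inter> V \<noteq> {}} \<subseteq> K" using V(4) by blast
  from finite_subset[OF this V(3)] V(1,2)
  show "\<exists>V. openin X V \<and> x \<in> V \<and> finite {\<sigma> \<in> csimp n \<xi>. \<sigma> ` standard_simplex n \<inter> V \<noteq> {}}"
    by (intro exI[of _ V] conjI)
qed fact

lemma locally_finite_chainD: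
  assumes "\<xi> \<in> carrier (chains n)" "x \<in> topspace X"
  obtains V where "openin X V" "x \<in> V" "finite {\<sigma> \<in> csimp n \<xi>. \<sigma> ` standard_simplex n \<inter> V \<noteq> {}}"
  using assms unfolding chains_iff by blast

lemma chains_left_module: "left_module R (chains n)"
proof (rule left_moduleI[OF ring])
  note lm = coef_left_module
  note ab = abelian_group.axioms(1)[OF coef_abelian]
  fix \<xi> \<eta> assume \<xi>: "\<xi> \<in> carrier (chains n)" and \<eta>: "\<eta> \<in> carrier (chains n)"
  show "\<xi> \<oplus>\<^bsub>chains n\<^esub> \<eta> \<in> carrier (chains n)"
  proof (rule locally_finite_subset)
    show "\<xi> \<oplus>\<^bsub>chains n\<^esub> \<eta> \<in> (\<Pi>\<^sub>E \<sigma>\<in>simplices X (int n). carrier (coef n \<sigma>))"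
      unfolding chains_ops using \<xi> \<eta>
      by (auto simp: simplices_nat chains_coef intro!: abelian_monoid.a_closed[OF ab])
    fix x assume x: "x \<in> topspace X"
    obtain V where V: "openin X V" "x \<in> V" "finite {\<sigma> \<in> csimp n \<xi>. \<sigma> ` standard_simplex n \<inter> V \<noteq> {}}"
      by (rule locally_finite_chainD[OF \<xi> x])
    obtain V' where V': "openin X V'" "x \<in> V'" "finite {\<sigma> \<in> csimp n \<eta>. \<sigma> ` standard_simplex n \<inter> V' \<noteq> {}}"
      by (rule locally_finite_chainD[OF \<eta> x])
    show "\<exists>V K. openin X V \<and> x \<in> V \<and> finite K
        \<and> (\<forall>\<sigma>\<in>csimp n (\<xi> \<oplus>\<^bsub>chains n\<^esub> \<eta>). \<sigma> ` standard_simplex n \<inter> V \<noteq> {} \<longrightarrow> \<sigma> \<in> K)"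
      by (rule exI[of _ "V \<inter> V'"], rule exI[of _ "{\<sigma> \<in> csimp n \<xi>. \<sigma> ` standard_simplex n \<inter> V \<noteq> {}} \<union> {\<sigma> \<in> csimp n \<eta>. \<sigma> ` standard_simplex n \<inter> V' \<noteq> {}}"])
         (use V V' csimp_add[of n \<xi> \<eta>] in auto)
  qed
  show "\<xi> \<oplus>\<^bsub>chains n\<^esub> \<eta> = \<eta> \<oplus>\<^bsub>chains n\<^esub> \<xi>"
    unfolding chains_ops
    by (rule restrict_ext) (use \<xi> \<eta> in \<open>simp add: simplices_nat chains_coef abelian_monoid.a_comm[OF ab]\<close>)
  show "(\<xi> \<oplus>\<^bsub>chains n\<^esub> \<eta>) \<oplus>\<^bsub>chains n\<^esub> \<theta> = \<xi> \<oplus>\<^bsub>chains n\<^esub> (\<eta> \<oplus>\<^bsub>chains n\<^esub> \<theta>)"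
    if "\<theta> \<in> carrier (chains n)" for \<theta>
    unfolding chains_ops
    by (rule restrict_ext) (use \<xi> \<eta> that in \<open>simp add: simplices_nat chains_coef abelian_monoid.a_assoc[OF ab]\<close>)
  show "a \<odot>\<^bsub>chains n\<^esub> (\<xi> \<oplus>\<^bsub>chains n\<^esub> \<eta>) = a \<odot>\<^bsub>chains n\<^esub> \<xi> \<oplus>\<^bsub>chains n\<^esub> a \<odot>\<^bsub>chains n\<^esub> \<eta>"
    if "a \<in> carrier R" for a
    unfolding chains_ops
    by (rule restrict_ext) (use \<xi> \<eta> that in \<open>simp add: simplices_nat chains_coef left_module.smult_r_distr[OF lm]\<close>)
next
  note lm = coef_left_module
  note ab = abelian_group.axioms(1)[OF coef_abelian]
  show "\<zero>\<^bsub>chains n\<^esub> \<in> carrier (chains n)"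
  proof (rule locally_finite_subset)
    show "\<zero>\<^bsub>chains n\<^esub> \<in> (\<Pi>\<^sub>E \<sigma>\<in>simplices X (int n). carrier (coef n \<sigma>))"
      unfolding chains_ops by (auto simp: simplices_nat intro!: abelian_monoid.zero_closed[OF ab])
    show "\<exists>V K. openin X V \<and> x \<in> V \<and> finite K
        \<and> (\<forall>\<sigma>\<in>csimp n \<zero>\<^bsub>chains n\<^esub>. \<sigma> ` standard_simplex n \<inter> V \<noteq> {} \<longrightarrow> \<sigma> \<in> K)"
      if "x \<in> topspace X" for x
      using that csimp_zero by (intro exI[of _ "topspace X"] exI[of _ "{}"]) auto
  qed
  fix \<xi> assume \<xi>: "\<xi> \<in> carrier (chains n)"
  have ext: "(\<lambda>\<sigma>\<in>simplices X (int n). \<xi> \<sigma>) = \<xi>"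
    using \<xi> by (auto simp: chains_iff PiE_def extensional_restrict)
  show "\<zero>\<^bsub>chains n\<^esub> \<oplus>\<^bsub>chains n\<^esub> \<xi> = \<xi>"
    unfolding chains_ops
    by (subst (2) ext[symmetric], rule restrict_ext)
       (use \<xi> in \<open>simp add: simplices_nat chains_coef abelian_monoid.l_zero[OF ab]\<close>)
  show "\<one>\<^bsub>R\<^esub> \<odot>\<^bsub>chains n\<^esub> \<xi> = \<xi>"
    unfolding chains_ops
    by (subst (2) ext[symmetric], rule restrict_ext)
       (use \<xi> in \<open>simp add: simplices_nat chains_coef left_module.smult_one[OF lm]\<close>)
  show "(\<ominus>\<^bsub>R\<^esub> \<one>\<^bsub>R\<^esub>) \<odot>\<^bsub>chains n\<^esub> \<xi> \<oplus>\<^bsub>chains n\<^esub> \<xi> = \<zero>\<^bsub>chains n\<^esub>"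
    unfolding chains_ops
    by (rule restrict_ext)
       (use \<xi> in \<open>simp add: simplices_nat chains_coef left_module.smult_minus_one[OF lm]\<close>)
  fix a assume a: "a \<in> carrier R"
  show "a \<odot>\<^bsub>chains n\<^esub> \<xi> \<in> carrier (chains n)"
  proof (rule locally_finite_subset)
    show "a \<odot>\<^bsub>chains n\<^esub> \<xi> \<in> (\<Pi>\<^sub>E \<sigma>\<in>simplices X (int n). carrier (coef n \<sigma>))"
      unfolding chains_ops using \<xi> a
      by (auto simp: simplices_nat chains_coef intro!: left_module.smult_closed[OF lm])
    fix x assume x: "x \<in> topspace X"
    obtain V where V: "openin X V" "x \<in> V" "finite {\<sigma> \<in> csimp n \<xi>. \<sigma> ` standard_simplex n \<inter> V \<noteq> {}}"
      by (rule locally_finite_chainD[OF \<xi> x])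
    show "\<exists>V K. openin X V \<and> x \<in> V \<and> finite K
        \<and> (\<forall>\<sigma>\<in>csimp n (a \<odot>\<^bsub>chains n\<^esub> \<xi>). \<sigma> ` standard_simplex n \<inter> V \<noteq> {} \<longrightarrow> \<sigma> \<in> K)"
      by (rule exI[of _ V], rule exI[of _ "{\<sigma> \<in> csimp n \<xi>. \<sigma> ` standard_simplex n \<inter> V \<noteq> {}}"])
         (use V csimp_smult[OF a, of n \<xi>] in auto)
  qed
  fix b assume b: "b \<in> carrier R"
  show "(a \<oplus>\<^bsub>R\<^esub> b) \<odot>\<^bsub>chains n\<^esub> \<xi> = a \<odot>\<^bsub>chains n\<^esub> \<xi> \<oplus>\<^bsub>chains n\<^esub> b \<odot>\<^bsub>chains n\<^esub> \<xi>"
    unfolding chains_ops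
    by (rule restrict_ext)
       (use \<xi> a b in \<open>simp add: simplices_nat chains_coef left_module.smult_l_distr[OF lm]\<close>)
  show "(a \<otimes>\<^bsub>R\<^esub> b) \<odot>\<^bsub>chains n\<^esub> \<xi> = a \<odot>\<^bsub>chains n\<^esub> (b \<odot>\<^bsub>chains n\<^esub> \<xi>)"
    unfolding chains_ops
    by (rule restrict_ext)
       (use \<xi> a b in \<open>simp add: simplices_nat chains_coef left_module.smult_assoc[OF lm]\<close>)
qed

text \<open>A natural operator assigns to a singular \<open>n\<close>-simplex an integral combination of affine
  simplices of the standard simplex; it acts by precomposition.\<close>

definition op_form where
  "op_form A n n' Q \<tau> = (\<Sum>\<sigma>\<in>Q. frag_extend
     (\<lambda>xs. if simplex_comp n' \<sigma> xs = \<tau> then frag_of (\<sigma>, xs) else 0) (A n \<sigma>))"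

text \<open>The simplices of the chain that contribute to the coefficient of \<tau>. That there are
  finitely many is \<open>finite_op_rel\<close>, which rests on local finiteness.\<close>

definition op_rel where
  "op_rel A n n' \<xi> \<tau> = {\<sigma> \<in> csimp n \<xi>. \<exists>xs\<in>Poly_Mapping.keys (A n \<sigma>). simplex_comp n' \<sigma> xs = \<tau>}"

text \<open>Contributions are collected as pairs of a singular and an affine simplex, since one
  \<open>xs\<close> may occur for several \<sigma> with unrelated coefficients. The sum stays formal
  until it is evaluated in the module of \<tau>, so identities of formal sums carry over.\<close>

definition act :: "(nat \<Rightarrow> ((nat \<Rightarrow> real) \<Rightarrow> 'a) \<Rightarrow> ((nat \<Rightarrow> real) list \<Rightarrow>\<^sub>0 int)) \<Rightarrow> nat \<Rightarrow> nat
    \<Rightarrow> ('a, 'e) coeff_chain \<Rightarrow> ('a, 'e) coeff_chain" where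
  "act A n n' \<xi> = (\<lambda>\<tau>\<in>simplices X (int n').
     int_comb (coef n' \<tau>) (\<lambda>(\<sigma>, xs). pull n' \<tau> xs (\<xi> \<sigma>)) (op_form A n n' (op_rel A n n' \<xi> \<tau>) \<tau>))"

definition affine_op :: "(nat \<Rightarrow> ((nat \<Rightarrow> real) \<Rightarrow> 'a) \<Rightarrow> ((nat \<Rightarrow> real) list \<Rightarrow>\<^sub>0 int)) \<Rightarrow> nat \<Rightarrow> nat \<Rightarrow> bool" where
  "affine_op A n n' \<longleftrightarrow> (\<forall>\<sigma> xs. singular_simplex n X \<sigma> \<longrightarrow> xs \<in> Poly_Mapping.keys (A n \<sigma>) \<longrightarrow> affine_simplex n n' xs)"

lemma affine_opD: "affine_op A n n' \<Longrightarrow> singular_simplex n X \<sigma> \<Longrightarrow> xs \<in> Poly_Mapping.keys (A n \<sigma>) \<Longrightarrow> affine_simplex n n' xs"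
  by (auto simp: affine_op_def)

lemma keys_op_form:
  assumes "finite Q" "(\<sigma>, xs) \<in> Poly_Mapping.keys (op_form A n n' Q \<tau>)"
  shows "\<sigma> \<in> Q \<and> xs \<in> Poly_Mapping.keys (A n \<sigma>) \<and> simplex_comp n' \<sigma> xs = \<tau>"
proof -
  from keys_sum_ex[OF assms(1) assms(2)[unfolded op_form_def]] obtain \<sigma>' where
    \<sigma>': "\<sigma>' \<in> Q" "(\<sigma>, xs) \<in> Poly_Mapping.keys (frag_extend
     (\<lambda>xs. if simplex_comp n' \<sigma>' xs = \<tau> then frag_of (\<sigma>', xs) else 0) (A n \<sigma>'))" by blast
  from keys_frag_extend_ex[OF \<sigma>'(2)] \<sigma>'(1) show ?thesis
    by (auto simp: keys_frag_of split: if_splits)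
qed

lemma point_in_image:
  assumes "singular_simplex n' X \<tau>"
  shows "\<tau> (basis_pt 0) \<in> topspace X" "\<tau> (basis_pt 0) \<in> \<tau> ` standard_simplex n'"
proof -
  have "basis_pt 0 \<in> standard_simplex n'" by (simp add: standard_simplex_eq_wts basis_pt_wts)
  then show "\<tau> (basis_pt 0) \<in> topspace X" "\<tau> (basis_pt 0) \<in> \<tau> ` standard_simplex n'"
    using assms continuous_map_image_subset_topspace unfolding singular_simplex_def by fastforce+
qed

lemma image_simplex_comp: "affine_simplex n n' xs \<Longrightarrow> simplex_comp n' \<sigma> xs ` standard_simplex n' \<subseteq> \<sigma> ` standard_simplex n"
  using bary_affine by (auto simp: simplex_comp_def)

text \<open>The image of a piece lies in the image of its simplex. So every simplex contributing to
  \<tau> passes through each point of \<tau>, and local finiteness at one point leaves finitely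
  many.\<close>

lemma op_rel_subset:
  assumes "affine_op A n n'" "x \<in> \<tau> ` standard_simplex n'"
  shows "op_rel A n n' \<xi> \<tau> \<subseteq> {\<sigma> \<in> csimp n \<xi>. x \<in> \<sigma> ` standard_simplex n}"
proof
  fix \<sigma> assume "\<sigma> \<in> op_rel A n n' \<xi> \<tau>"
  then obtain xs where \<sigma>: "\<sigma> \<in> csimp n \<xi>" and xs: "xs \<in> Poly_Mapping.keys (A n \<sigma>)" "simplex_comp n' \<sigma> xs = \<tau>"
    by (auto simp: op_rel_def)
  have "singular_simplex n X \<sigma>" using \<sigma> by (simp add: csimp_iff)
  from image_simplex_comp[OF affine_opD[OF assms(1) this xs(1)], of \<sigma>] show "\<sigma> \<in> {\<sigma> \<in> csimp n \<xi>. x \<in> \<sigma> ` standard_simplex n}"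
    using assms(2) \<sigma> xs(2) by auto
qed

lemma finite_op_rel:
  assumes "affine_op A n n'" "\<xi> \<in> carrier (chains n)" "singular_simplex n' X \<tau>"
  shows "finite (op_rel A n n' \<xi> \<tau>)"
  using op_rel_subset[OF assms(1) point_in_image(2)[OF assms(3)]] finite_csimp_at[OF assms(2) point_in_image(1)[OF assms(3)]]
  by (rule finite_subset)

lemma op_form_values:
  assumes A: "affine_op A n n'" and \<xi>: "\<xi> \<in> carrier (chains n)" and Q: "finite Q" "Q \<subseteq> {\<sigma>. singular_simplex n X \<sigma>}"
  shows "(\<lambda>(\<sigma>, xs). pull n' \<tau> xs (\<xi> \<sigma>)) \<in> Poly_Mapping.keys (op_form A n n' Q \<tau>) \<rightarrow> carrier (coef n' \<tau>)"
proof (rule funcsetI)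
  fix p assume p: "p \<in> Poly_Mapping.keys (op_form A n n' Q \<tau>)"
  obtain \<sigma> xs where pe: "p = (\<sigma>, xs)" by (cases p)
  note k = keys_op_form[OF Q(1) p[unfolded pe]]
  then have \<sigma>: "singular_simplex n X \<sigma>" using Q(2) by blast
  have "affine_simplex n n' xs" using affine_opD[OF A \<sigma>] k by blast
  from pull_closed[OF this chains_coef[OF \<xi> \<sigma>]] show "(case p of (\<sigma>, xs) \<Rightarrow> pull n' \<tau> xs (\<xi> \<sigma>)) \<in> carrier (coef n' \<tau>)"
    using k pe by simp
qed

lemma pull_zero:
  assumes "affine_simplex n n' xs" "singular_simplex n X \<sigma>"
  shows "pull n' (simplex_comp n' \<sigma> xs) xs \<zero>\<^bsub>coef n \<sigma>\<^esub> = \<zero>\<^bsub>coef n' (simplex_comp n' \<sigma> xs)\<^esub>"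
  by (rule additive_map.zero[OF pull_additive[OF assms]])

text \<open>Further simplices in \<open>Q\<close> only pull back zero coefficients. Any finite set
  containing the contributing simplices may thus serve as index set, so several chains or operators
  can be compared over one set.\<close>

lemma act_eq:
  assumes A: "affine_op A n n'" and \<xi>: "\<xi> \<in> carrier (chains n)" and \<tau>: "singular_simplex n' X \<tau>"
    and Q: "finite Q" "Q \<subseteq> {\<sigma>. singular_simplex n X \<sigma>}" "op_rel A n n' \<xi> \<tau> \<subseteq> Q"
  shows "act A n n' \<xi> \<tau> = int_comb (coef n' \<tau>) (\<lambda>(\<sigma>, xs). pull n' \<tau> xs (\<xi> \<sigma>)) (op_form A n n' Q \<tau>)"
proof -
  interpret M: abelian_group "coef n' \<tau>" by (rule coef_abelian[OF \<tau>])
  let ?v = "\<lambda>(\<sigma>, xs). pull n' \<tau> xs (\<xi> \<sigma>)" and ?P = "op_rel A n n' \<xi> \<tau>"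
  have "op_form A n n' Q \<tau> = op_form A n n' (Q - ?P) \<tau> + op_form A n n' ?P \<tau>"
    unfolding op_form_def by (rule sum.subset_diff[OF Q(3,1)])
  moreover have v1: "?v \<in> Poly_Mapping.keys (op_form A n n' (Q - ?P) \<tau>) \<rightarrow> carrier (coef n' \<tau>)"
    by (rule op_form_values[OF A \<xi>]) (use Q in auto)
  moreover have v2: "?v \<in> Poly_Mapping.keys (op_form A n n' ?P \<tau>) \<rightarrow> carrier (coef n' \<tau>)"
    by (rule op_form_values[OF A \<xi> finite_subset[OF Q(3,1)]]) (use Q in auto)
  moreover have "?v \<in> Poly_Mapping.keys (op_form A n n' (Q - ?P) \<tau>) \<union> Poly_Mapping.keys (op_form A n n' ?P \<tau>) \<rightarrow> carrier (coef n' \<tau>)"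
    by (rule funcsetI) (erule UnE, erule funcset_mem[OF v1], erule funcset_mem[OF v2])
  ultimately have "int_comb (coef n' \<tau>) ?v (op_form A n n' Q \<tau>)
      = int_comb (coef n' \<tau>) ?v (op_form A n n' (Q - ?P) \<tau>) \<oplus>\<^bsub>coef n' \<tau>\<^esub> int_comb (coef n' \<tau>) ?v (op_form A n n' ?P \<tau>)"
    by (simp only: M.int_comb_add)
  also have "int_comb (coef n' \<tau>) ?v (op_form A n n' (Q - ?P) \<tau>) = int_comb (coef n' \<tau>) (\<lambda>p. \<zero>\<^bsub>coef n' \<tau>\<^esub>) (op_form A n n' (Q - ?P) \<tau>)"
  proof (rule M.int_comb_cong)
    fix p assume p: "p \<in> Poly_Mapping.keys (op_form A n n' (Q - ?P) \<tau>)"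
    obtain \<sigma> xs where pe: "p = (\<sigma>, xs)" by (cases p)
    have k: "\<sigma> \<in> Q - ?P" "xs \<in> Poly_Mapping.keys (A n \<sigma>)" "simplex_comp n' \<sigma> xs = \<tau>"
      using keys_op_form[OF finite_Diff[OF Q(1)] p[unfolded pe]] by auto
    then have \<sigma>: "singular_simplex n X \<sigma>" using Q(2) by blast
    have "\<xi> \<sigma> = \<zero>\<^bsub>coef n \<sigma>\<^esub>" using k \<sigma> by (auto simp: op_rel_def csimp_iff)
    with pull_zero[OF affine_opD[OF A \<sigma> k(2)] \<sigma>] show "(case p of (\<sigma>, xs) \<Rightarrow> pull n' \<tau> xs (\<xi> \<sigma>)) = \<zero>\<^bsub>coef n' \<tau>\<^esub>"
      using k(3) pe by simp
  qed auto
  finally show ?thesis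
    using \<tau> M.int_comb_closed[OF op_form_values[OF A \<xi>, of ?P \<tau>]] Q finite_subset[OF Q(3,1)]
    by (simp add: act_def simplices_nat M.int_comb_zero_fun)
qed

lemma act_coef:
  assumes A: "affine_op A n n'" and \<xi>: "\<xi> \<in> carrier (chains n)" and \<tau>: "singular_simplex n' X \<tau>"
  shows "act A n n' \<xi> \<tau> \<in> carrier (coef n' \<tau>)"
proof -
  interpret M: abelian_group "coef n' \<tau>" by (rule coef_abelian[OF \<tau>])
  have sub: "op_rel A n n' \<xi> \<tau> \<subseteq> {\<sigma>. singular_simplex n X \<sigma>}" by (auto simp: op_rel_def csimp_iff)
  show ?thesis
    unfolding act_eq[OF A \<xi> \<tau> finite_op_rel[OF A \<xi> \<tau>] sub order_refl]
    by (rule M.int_comb_closed[OF op_form_values[OF A \<xi> finite_op_rel[OF A \<xi> \<tau>] sub]])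
qed

lemma csimp_act:
  assumes "\<tau> \<in> csimp n' (act A n n' \<xi>)"
  shows "\<exists>\<sigma>\<in>csimp n \<xi>. \<exists>xs\<in>Poly_Mapping.keys (A n \<sigma>). \<tau> = simplex_comp n' \<sigma> xs"
proof (rule ccontr)
  assume "\<not> ?thesis"
  then have "op_rel A n n' \<xi> \<tau> = {}" by (auto simp: op_rel_def)
  moreover have \<tau>: "singular_simplex n' X \<tau>" using assms by (simp add: csimp_iff)
  then interpret M: abelian_group "coef n' \<tau>" by (rule coef_abelian)
  have "op_form A n n' {} \<tau> = 0" by (simp add: op_form_def)
  ultimately have "act A n n' \<xi> \<tau> = \<zero>\<^bsub>coef n' \<tau>\<^esub>" using \<tau> by (simp add: act_def simplices_nat)
  then show False using assms by (simp add: csimp_iff)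
qed

lemma act_closed:
  assumes A: "affine_op A n n'" and \<xi>: "\<xi> \<in> carrier (chains n)"
  shows "act A n n' \<xi> \<in> carrier (chains n')"
proof (rule locally_finite_subset)
  show "act A n n' \<xi> \<in> (\<Pi>\<^sub>E \<sigma>\<in>simplices X (int n'). carrier (coef n' \<sigma>))"
    using act_coef[OF A \<xi>] by (auto simp: simplices_nat act_def)
  fix x assume x: "x \<in> topspace X"
  obtain V where V: "openin X V" "x \<in> V" "finite {\<sigma> \<in> csimp n \<xi>. \<sigma> ` standard_simplex n \<inter> V \<noteq> {}}"
    by (rule locally_finite_chainD[OF \<xi> x])
  let ?F = "{\<sigma> \<in> csimp n \<xi>. \<sigma> ` standard_simplex n \<inter> V \<noteq> {}}"
  \<comment> \<open>A simplex of the result that meets \<open>V\<close> is a piece of a simplex that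
    meets \<open>V\<close>, and each simplex has finitely many pieces.\<close>
  let ?K = "\<Union>\<sigma>\<in>?F. simplex_comp n' \<sigma> ` Poly_Mapping.keys (A n \<sigma>)"
  have "\<tau> \<in> ?K" if \<tau>: "\<tau> \<in> csimp n' (act A n n' \<xi>)" "\<tau> ` standard_simplex n' \<inter> V \<noteq> {}" for \<tau>
  proof -
    obtain \<sigma> xs where \<sigma>: "\<sigma> \<in> csimp n \<xi>" "xs \<in> Poly_Mapping.keys (A n \<sigma>)" "\<tau> = simplex_comp n' \<sigma> xs"
      using csimp_act[OF \<tau>(1)] by blast
    have "affine_simplex n n' xs" using affine_opD[OF A _ \<sigma>(2)] \<sigma>(1) by (simp add: csimp_iff)
    from image_simplex_comp[OF this, of \<sigma>] \<tau>(2) \<sigma>(3) have "\<sigma> ` standard_simplex n \<inter> V \<noteq> {}" by blast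
    then show ?thesis using \<sigma> by blast
  qed
  moreover have "finite ?K" using V(3) by (intro finite_UN_I finite_imageI) auto
  ultimately show "\<exists>V K. openin X V \<and> x \<in> V \<and> finite K
        \<and> (\<forall>\<sigma>\<in>csimp n' (act A n n' \<xi>). \<sigma> ` standard_simplex n' \<inter> V \<noteq> {} \<longrightarrow> \<sigma> \<in> K)"
    using V(1,2) by (intro exI[of _ V] exI[of _ ?K]) auto
qed

end

context coefficient_setting
begin

lemma op_relD:
  "op_rel A n n' \<xi> \<tau> \<subseteq> {\<sigma>. singular_simplex n X \<sigma>}"
  by (auto simp: op_rel_def csimp_iff)

lemma act_extensional: "\<not> singular_simplex n' X \<tau> \<Longrightarrow> act A n n' \<xi> \<tau> = undefined"
  by (simp add: act_def simplices_nat)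

lemma chain_extensional: "\<xi> \<in> carrier (chains n) \<Longrightarrow> \<not> singular_simplex n X \<tau> \<Longrightarrow> \<xi> \<tau> = undefined"
  by (auto simp: chains_iff simplices_nat)

lemma act_cong:
  assumes "\<And>\<sigma>. singular_simplex n X \<sigma> \<Longrightarrow> A n \<sigma> = A' n \<sigma>"
  shows "act A n n' \<xi> = act A' n n' \<xi>"
proof -
  have 1: "op_rel A n n' \<xi> \<tau> = op_rel A' n n' \<xi> \<tau>" for \<tau>
    using assms by (auto simp: op_rel_def csimp_iff)
  have "op_form A n n' (op_rel A' n n' \<xi> \<tau>) \<tau> = op_form A' n n' (op_rel A' n n' \<xi> \<tau>) \<tau>" for \<tau>
    unfolding op_form_def using assms op_relD[of A'] by (intro sum.cong refl) (auto simp: subset_iff)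
  with 1 show ?thesis by (simp add: act_def)
qed

text \<open>A finite index set depending on the chain and \<tau> but not on the operator; vertex 0
  of \<tau> serves as test point.\<close>

definition near_simplices where
  "near_simplices n \<xi> \<tau> = {\<sigma> \<in> csimp n \<xi>. \<tau> (basis_pt 0) \<in> \<sigma> ` standard_simplex n}"

lemma finite_near_simplices:
  "\<xi> \<in> carrier (chains n) \<Longrightarrow> singular_simplex n' X \<tau> \<Longrightarrow> finite (near_simplices n \<xi> \<tau>)"
  unfolding near_simplices_def by (intro finite_csimp_at point_in_image(1))

lemma near_simplices_singular: "near_simplices n \<xi> \<tau> \<subseteq> {\<sigma>. singular_simplex n X \<sigma>}"
  by (auto simp: near_simplices_def csimp_iff)

lemma op_rel_near:
  "affine_op A n n' \<Longrightarrow> singular_simplex n' X \<tau> \<Longrightarrow> op_rel A n n' \<xi> \<tau> \<subseteq> near_simplices n \<xi> \<tau>"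
  unfolding near_simplices_def by (intro op_rel_subset point_in_image(2))

lemma act_near:
  assumes "affine_op A n n'" "\<xi> \<in> carrier (chains n)" "singular_simplex n' X \<tau>"
  shows "act A n n' \<xi> \<tau> = int_comb (coef n' \<tau>) (\<lambda>(\<sigma>, xs). pull n' \<tau> xs (\<xi> \<sigma>)) (op_form A n n' (near_simplices n \<xi> \<tau>) \<tau>)"
  by (rule act_eq[OF assms finite_near_simplices[OF assms(2,3)] near_simplices_singular op_rel_near[OF assms(1,3)]])

text \<open>Pieces of pieces: \<open>B\<close> is applied to each simplex \<sigma> \<circ> xs, and
  its affine simplices are carried into the simplex of \<sigma> by \<open>bary xs\<close>. The
  argument \<open>m\<close> is a dummy that gives the result the type of an operator.\<close>

definition op_comp where
  "op_comp A n n' B = (\<lambda>(m::nat) \<sigma>. frag_extend (\<lambda>xs. vmap (bary xs) (B n' (simplex_comp n' \<sigma> xs))) (A n \<sigma>))"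

lemma affine_op_comp:
  assumes A: "affine_op A n n'" and B: "affine_op B n' n''"
  shows "affine_op (op_comp A n n' B) n n''"
  unfolding affine_op_def op_comp_def
proof (intro allI impI)
  fix \<sigma> zs assume \<sigma>: "singular_simplex n X \<sigma>"
    and "zs \<in> Poly_Mapping.keys (frag_extend (\<lambda>xs. vmap (bary xs) (B n' (simplex_comp n' \<sigma> xs))) (A n \<sigma>))"
  from keys_frag_extend_ex[OF this(2)] obtain xs where
    xs: "xs \<in> Poly_Mapping.keys (A n \<sigma>)" "zs \<in> Poly_Mapping.keys (vmap (bary xs) (B n' (simplex_comp n' \<sigma> xs)))" by auto
  from keys_vmap_ex[OF xs(2)] obtain ys where ys: "ys \<in> Poly_Mapping.keys (B n' (simplex_comp n' \<sigma> xs))" "zs = map (bary xs) ys"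
    by auto
  have a: "affine_simplex n n' xs" by (rule affine_opD[OF A \<sigma> xs(1)])
  show "affine_simplex n n'' zs" unfolding ys(2)
    by (rule affine_simplex_map[OF a affine_opD[OF B singular_simplex_comp[OF \<sigma> a] ys(1)]])
qed

text \<open>Each intermediate simplex is replaced by all pairs that produce it. Summing over the
  intermediate simplices then picks out \<open>simplex_comp n' \<sigma> xs\<close> for every pair,
  which leaves the formal sum of the composite.\<close>

lemma op_form_comp:
  assumes A: "affine_op A n n'" and B: "affine_op B n' n''"
    and Q: "finite Q" "Q \<subseteq> {\<sigma>. singular_simplex n X \<sigma>}"
    and Q': "Q' = (\<Union>\<sigma>\<in>Q. simplex_comp n' \<sigma> ` Poly_Mapping.keys (A n \<sigma>))"
  shows "frag_extend (\<lambda>(\<tau>, ys). frag_extend (\<lambda>(\<sigma>, xs). frag_of (\<sigma>, map (bary xs) ys)) (op_form A n n' Q \<tau>))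
      (op_form B n' n'' Q' \<rho>) = op_form (op_comp A n n' B) n n'' Q \<rho>"
proof -
  have fQ': "finite Q'" using Q(1) by (simp add: Q')
  define h where "h = (\<lambda>\<tau> ys \<sigma> xs. if simplex_comp n'' \<tau> ys = \<rho> \<and> simplex_comp n' \<sigma> xs = \<tau> then frag_of (\<sigma>, map (bary xs) ys) else 0)"
  have inner: "frag_extend (\<lambda>(\<sigma>, xs). frag_of (\<sigma>, map (bary xs) ys)) (op_form A n n' Q \<tau>)
      = (\<Sum>\<sigma>\<in>Q. frag_extend (\<lambda>xs. if simplex_comp n' \<sigma> xs = \<tau> then frag_of (\<sigma>, map (bary xs) ys) else 0) (A n \<sigma>))" for \<tau> ys
    unfolding op_form_def
    by (subst frag_extend_sum[OF Q(1)]) (auto simp: frag_extend_frag_extend o_def if_distrib cong: if_cong)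
  have "frag_extend (\<lambda>(\<tau>, ys). frag_extend (\<lambda>(\<sigma>, xs). frag_of (\<sigma>, map (bary xs) ys)) (op_form A n n' Q \<tau>))
      (op_form B n' n'' Q' \<rho>)
    = (\<Sum>\<tau>\<in>Q'. frag_extend (\<lambda>ys. \<Sum>\<sigma>\<in>Q. frag_extend (h \<tau> ys \<sigma>) (A n \<sigma>)) (B n' \<tau>))"
    unfolding op_form_def[of B]
    apply (subst frag_extend_sum[OF fQ'])
    apply (simp add: o_def frag_extend_frag_extend)
    apply (rule sum.cong[OF refl])
    apply (rule frag_extend_eq)
    apply (simp add: inner h_def frag_extend_zero_fun cong: if_cong)
    done
  also have "\<dots> = (\<Sum>\<tau>\<in>Q'. \<Sum>\<sigma>\<in>Q. frag_extend (\<lambda>xs. frag_extend (\<lambda>ys. h \<tau> ys \<sigma> xs) (B n' \<tau>)) (A n \<sigma>))"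
    by (simp add: frag_extend_sum_fun[OF Q(1)] frag_extend_swap[where c="B n' _"])
  also have "\<dots> = (\<Sum>\<sigma>\<in>Q. frag_extend (\<lambda>xs. \<Sum>\<tau>\<in>Q'. frag_extend (\<lambda>ys. h \<tau> ys \<sigma> xs) (B n' \<tau>)) (A n \<sigma>))"
    by (subst sum.swap) (simp add: frag_extend_sum_fun[OF fQ'])
  also have "\<dots> = op_form (op_comp A n n' B) n n'' Q \<rho>"
    unfolding op_form_def
  proof (rule sum.cong[OF refl])
    fix \<sigma> assume \<sigma>: "\<sigma> \<in> Q"
    have "(\<Sum>\<tau>\<in>Q'. frag_extend (\<lambda>ys. h \<tau> ys \<sigma> xs) (B n' \<tau>))
        = frag_extend (\<lambda>zs. if simplex_comp n'' \<sigma> zs = \<rho> then frag_of (\<sigma>, zs) else 0) (vmap (bary xs) (B n' (simplex_comp n' \<sigma> xs)))"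
      if xs: "xs \<in> Poly_Mapping.keys (A n \<sigma>)" for xs
    proof -
      have \<sigma>s: "singular_simplex n X \<sigma>" using \<sigma> Q(2) by blast
      have a: "affine_simplex n n' xs" by (rule affine_opD[OF A \<sigma>s xs])
      let ?\<tau> = "simplex_comp n' \<sigma> xs"
      have "(\<Sum>\<tau>\<in>Q'. frag_extend (\<lambda>ys. h \<tau> ys \<sigma> xs) (B n' \<tau>))
          = (\<Sum>\<tau>\<in>Q'. if \<tau> = ?\<tau> then frag_extend (\<lambda>ys. h ?\<tau> ys \<sigma> xs) (B n' ?\<tau>) else 0)"
        by (rule sum.cong[OF refl]) (auto simp: h_def frag_extend_zero_fun)
      also have "\<dots> = frag_extend (\<lambda>ys. h ?\<tau> ys \<sigma> xs) (B n' ?\<tau>)"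
        using fQ' \<sigma> xs Q' by (subst sum.delta) auto
      also have "\<dots> = frag_extend (\<lambda>ys. if simplex_comp n'' \<sigma> (map (bary xs) ys) = \<rho> then frag_of (\<sigma>, map (bary xs) ys) else 0) (B n' ?\<tau>)"
        by (rule frag_extend_eq)
           (simp add: h_def simplex_comp_comp[OF affine_opD[OF B singular_simplex_comp[OF \<sigma>s a]]])
      finally show ?thesis by (simp add: vmap_def frag_extend_frag_extend)
    qed
    then show "frag_extend (\<lambda>xs. \<Sum>\<tau>\<in>Q'. frag_extend (\<lambda>ys. h \<tau> ys \<sigma> xs) (B n' \<tau>)) (A n \<sigma>)
      = frag_extend (\<lambda>xs. if simplex_comp n'' \<sigma> xs = \<rho> then frag_of (\<sigma>, xs) else 0) (op_comp A n n' B n \<sigma>)"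
      unfolding op_comp_def frag_extend_frag_extend by (intro frag_extend_eq)
  qed
  finally show ?thesis .
qed

text \<open>Functoriality, based on \<open>pull_pull\<close>. With it, composites of operators on
  chains are computed by composing formal chains in standard simplices.\<close>

lemma act_act:
  assumes A: "affine_op A n n'" and B: "affine_op B n' n''" and \<xi>: "\<xi> \<in> carrier (chains n)"
  shows "act B n' n'' (act A n n' \<xi>) = act (op_comp A n n' B) n n'' \<xi>"
proof
  fix \<rho>
  show "act B n' n'' (act A n n' \<xi>) \<rho> = act (op_comp A n n' B) n n'' \<xi> \<rho>"
  proof (cases "singular_simplex n'' X \<rho>")
    case \<rho>: True
    let ?M = "coef n'' \<rho>"
    interpret M: abelian_group ?M by (rule coef_abelian[OF \<rho>])
    let ?x = "\<rho> (basis_pt 0)"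
    define Q where "Q = near_simplices n \<xi> \<rho>"
    define Q' where "Q' = (\<Union>\<sigma>\<in>Q. simplex_comp n' \<sigma> ` Poly_Mapping.keys (A n \<sigma>))"
    have Q: "finite Q" "Q \<subseteq> {\<sigma>. singular_simplex n X \<sigma>}"
      using finite_near_simplices[OF \<xi> \<rho>] near_simplices_singular by (auto simp: Q_def)
    have Q': "finite Q'" "Q' \<subseteq> {\<sigma>. singular_simplex n' X \<sigma>}"
    proof -
      show "finite Q'" using Q(1) by (simp add: Q'_def)
      have "singular_simplex n' X (simplex_comp n' \<sigma> xs)" if "\<sigma> \<in> Q" "xs \<in> Poly_Mapping.keys (A n \<sigma>)" for \<sigma> xs
      proof -
        have \<sigma>: "singular_simplex n X \<sigma>" using that(1) Q(2) by blast
        show ?thesis by (rule singular_simplex_comp[OF \<sigma> affine_opD[OF A \<sigma> that(2)]])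
      qed
      then show "Q' \<subseteq> {\<sigma>. singular_simplex n' X \<sigma>}" by (auto simp: Q'_def)
    qed
    \<comment> \<open>Images shrink at both stages, so every simplex that leads to \<rho> passes
      through the test point of \<rho>. Hence the finite set \<open>Q\<close> covers both
      stages.\<close>
    have inQ: "\<sigma> \<in> Q" if "\<sigma> \<in> csimp n \<xi>" "xs \<in> Poly_Mapping.keys (A n \<sigma>)"
        "ys \<in> Poly_Mapping.keys (B n' (simplex_comp n' \<sigma> xs))" "simplex_comp n'' (simplex_comp n' \<sigma> xs) ys = \<rho>" for \<sigma> xs ys
    proof -
      have \<sigma>: "singular_simplex n X \<sigma>" using that(1) by (simp add: csimp_iff)
      have a: "affine_simplex n n' xs" by (rule affine_opD[OF A \<sigma> that(2)])
      have b: "affine_simplex n' n'' ys" by (rule affine_opD[OF B singular_simplex_comp[OF \<sigma> a] that(3)])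
      have "?x \<in> simplex_comp n' \<sigma> xs ` standard_simplex n'"
        using image_simplex_comp[OF b, of "simplex_comp n' \<sigma> xs"] point_in_image(2)[OF \<rho>] that(4) by auto
      then show ?thesis
        using image_simplex_comp[OF a, of \<sigma>] that(1) by (auto simp: Q_def near_simplices_def)
    qed
    have rel: "op_rel B n' n'' (act A n n' \<xi>) \<rho> \<subseteq> Q'"
    proof
      fix \<tau> assume "\<tau> \<in> op_rel B n' n'' (act A n n' \<xi>) \<rho>"
      then obtain ys where \<tau>: "\<tau> \<in> csimp n' (act A n n' \<xi>)" "ys \<in> Poly_Mapping.keys (B n' \<tau>)" "simplex_comp n'' \<tau> ys = \<rho>"
        by (auto simp: op_rel_def)
      obtain \<sigma> xs where \<sigma>: "\<sigma> \<in> csimp n \<xi>" "xs \<in> Poly_Mapping.keys (A n \<sigma>)" "\<tau> = simplex_comp n' \<sigma> xs"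
        using csimp_act[OF \<tau>(1)] by blast
      have "\<sigma> \<in> Q" using inQ[OF \<sigma>(1,2)] \<tau>(2,3) \<sigma>(3) by simp
      then show "\<tau> \<in> Q'" using \<sigma>(2,3) by (auto simp: Q'_def)
    qed
    define v where "v = (\<lambda>(\<sigma>, zs). pull n'' \<rho> zs (\<xi> \<sigma>))"
    define H where "H = (\<lambda>(\<tau>, ys). frag_extend (\<lambda>(\<sigma>, xs). frag_of (\<sigma>, map (bary xs) ys)) (op_form A n n' Q \<tau>))"
    \<comment> \<open>The coefficient of an intermediate simplex is itself an integral combination;
      pulling it back term by term gives the combination described by \<open>H\<close>.\<close>
    have facts: "(case p of (\<tau>, ys) \<Rightarrow> pull n'' \<rho> ys (act A n n' \<xi> \<tau>)) = int_comb ?M v (H p)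
        \<and> v \<in> Poly_Mapping.keys (H p) \<rightarrow> carrier ?M"
      if p: "p \<in> Poly_Mapping.keys (op_form B n' n'' Q' \<rho>)" for p
    proof -
      obtain \<tau> ys where pe: "p = (\<tau>, ys)" by (cases p)
      have k: "\<tau> \<in> Q'" "ys \<in> Poly_Mapping.keys (B n' \<tau>)" "simplex_comp n'' \<tau> ys = \<rho>"
        using keys_op_form[OF Q'(1) p[unfolded pe]] by auto
      then have \<tau>: "singular_simplex n' X \<tau>" using Q'(2) by blast
      have b: "affine_simplex n' n'' ys" by (rule affine_opD[OF B \<tau> k(2)])
      have rel\<tau>: "op_rel A n n' \<xi> \<tau> \<subseteq> Q"
        using inQ k by (fastforce simp: op_rel_def)
      interpret T: abelian_group "coef n' \<tau>" by (rule coef_abelian[OF \<tau>])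
      interpret pl: additive_map "coef n' \<tau>" ?M "pull n'' \<rho> ys"
        using pull_additive[OF b \<tau>] k(3) by simp
      have vals: "(\<lambda>(\<sigma>, xs). pull n' \<tau> xs (\<xi> \<sigma>)) \<in> Poly_Mapping.keys (op_form A n n' Q \<tau>) \<rightarrow> carrier (coef n' \<tau>)"
        by (rule op_form_values[OF A \<xi> Q])
      have 1: "pull n'' \<rho> ys (pull n' \<tau> xs (\<xi> \<sigma>)) = v (\<sigma>, map (bary xs) ys) \<and> v (\<sigma>, map (bary xs) ys) \<in> carrier ?M"
        if q: "(\<sigma>, xs) \<in> Poly_Mapping.keys (op_form A n n' Q \<tau>)" for \<sigma> xs
      proof -
        have kk: "\<sigma> \<in> Q" "xs \<in> Poly_Mapping.keys (A n \<sigma>)" "simplex_comp n' \<sigma> xs = \<tau>"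
          using keys_op_form[OF Q(1) q] by auto
        then have \<sigma>: "singular_simplex n X \<sigma>" using Q(2) by blast
        have a: "affine_simplex n n' xs" by (rule affine_opD[OF A \<sigma> kk(2)])
        have eq: "pull n'' \<rho> ys (pull n' \<tau> xs (\<xi> \<sigma>)) = v (\<sigma>, map (bary xs) ys)"
          unfolding v_def using pull_pull[OF a b kk(3)[symmetric] k(3)[symmetric]] by simp
        moreover have "pull n'' \<rho> ys (pull n' \<tau> xs (\<xi> \<sigma>)) \<in> carrier ?M"
          by (rule pl.closed) (use funcset_mem[OF vals q] in simp)
        ultimately show ?thesis by simp
      qed
      have "pull n'' \<rho> ys (act A n n' \<xi> \<tau>) = int_comb ?M (\<lambda>q. pull n'' \<rho> ys ((\<lambda>(\<sigma>, xs). pull n' \<tau> xs (\<xi> \<sigma>)) q)) (op_form A n n' Q \<tau>)"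
        unfolding act_eq[OF A \<xi> \<tau> Q rel\<tau>] by (rule pl.int_comb[OF vals])
      also have "\<dots> = int_comb ?M (\<lambda>q. int_comb ?M v ((\<lambda>(\<sigma>, xs). frag_of (\<sigma>, map (bary xs) ys)) q)) (op_form A n n' Q \<tau>)"
      proof (rule M.int_comb_cong)
        show "(\<lambda>q. int_comb ?M v (case q of (\<sigma>, xs) \<Rightarrow> frag_of (\<sigma>, map (bary xs) ys)))
            \<in> Poly_Mapping.keys (op_form A n n' Q \<tau>) \<rightarrow> carrier ?M"
          using 1 by (auto simp: M.int_comb_of)
      qed (use 1 in \<open>auto simp: M.int_comb_of\<close>)
      also have "\<dots> = int_comb ?M v (H (\<tau>, ys))"
        unfolding H_def prod.case
        by (rule M.int_comb_frag_extend[symmetric]) (use 1 in \<open>auto simp: keys_frag_of\<close>)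
      finally have "pull n'' \<rho> ys (act A n n' \<xi> \<tau>) = int_comb ?M v (H (\<tau>, ys))" .
      moreover have "v \<in> Poly_Mapping.keys (H (\<tau>, ys)) \<rightarrow> carrier ?M"
      proof (rule funcsetI)
        fix q assume "q \<in> Poly_Mapping.keys (H (\<tau>, ys))"
        from keys_frag_extend_ex[OF this[unfolded H_def prod.case]] show "v q \<in> carrier ?M"
          using 1 by (auto simp: keys_frag_of)
      qed
      ultimately show ?thesis unfolding pe by simp
    qed
    have "act B n' n'' (act A n n' \<xi>) \<rho> = int_comb ?M (\<lambda>(\<tau>, ys). pull n'' \<rho> ys (act A n n' \<xi> \<tau>)) (op_form B n' n'' Q' \<rho>)"
      by (rule act_eq[OF B act_closed[OF A \<xi>] \<rho> Q' rel])
    also have "\<dots> = int_comb ?M (\<lambda>p. int_comb ?M v (H p)) (op_form B n' n'' Q' \<rho>)"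
      by (rule M.int_comb_cong) (use facts in \<open>auto intro!: funcsetI M.int_comb_closed\<close>)
    also have "\<dots> = int_comb ?M v (frag_extend H (op_form B n' n'' Q' \<rho>))"
      by (rule M.int_comb_frag_extend[symmetric]) (use facts in blast)
    also have "frag_extend H (op_form B n' n'' Q' \<rho>) = op_form (op_comp A n n' B) n n'' Q \<rho>"
      unfolding H_def by (rule op_form_comp[OF A B Q Q'_def])
    also have "int_comb ?M v \<dots> = act (op_comp A n n' B) n n'' \<xi> \<rho>"
      unfolding Q_def v_def by (rule act_near[OF affine_op_comp[OF A B] \<xi> \<rho>, symmetric])
    finally show ?thesis .
  qed (simp add: act_extensional)
qed

section \<open>Identity and linearity of the action\<close>

lemma affine_op_vertices: "affine_op (\<lambda>n \<sigma>. frag_of (vertices n)) n n"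
  by (simp add: affine_op_def keys_frag_of affine_vertices)

lemma act_vertices:
  assumes \<xi>: "\<xi> \<in> carrier (chains n)"
  shows "act (\<lambda>n \<sigma>. frag_of (vertices n)) n n \<xi> = \<xi>"
proof
  fix \<tau>
  show "act (\<lambda>n \<sigma>. frag_of (vertices n)) n n \<xi> \<tau> = \<xi> \<tau>"
  proof (cases "singular_simplex n X \<tau>")
    case \<tau>: True
    interpret M: abelian_group "coef n \<tau>" by (rule coef_abelian[OF \<tau>])
    have "op_rel (\<lambda>n \<sigma>. frag_of (vertices n)) n n \<xi> \<tau> \<subseteq> {\<tau>}"
      by (auto simp: op_rel_def csimp_iff keys_frag_of simplex_comp_vertices)
    then have "act (\<lambda>n \<sigma>. frag_of (vertices n)) n n \<xi> \<tau>
        = int_comb (coef n \<tau>) (\<lambda>(\<sigma>, xs). pull n \<tau> xs (\<xi> \<sigma>)) (op_form (\<lambda>n \<sigma>. frag_of (vertices n)) n n {\<tau>} \<tau>)"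
      by (intro act_eq[OF affine_op_vertices \<xi> \<tau>]) (use \<tau> in auto)
    moreover have "op_form (\<lambda>n \<sigma>. frag_of (vertices n)) n n {\<tau>} \<tau> = frag_of (\<tau>, vertices n)"
      by (simp add: op_form_def simplex_comp_vertices[OF \<tau>])
    moreover have "pull n \<tau> (vertices n) (\<xi> \<tau>) = \<xi> \<tau>"
    proof -
      have "bary (vertices n) t = t" if "t \<in> ldom n \<tau>" for t
        using that by (intro bary_vertices) (simp add: lift_domain_def standard_simplex_eq_wts)
      then have "pull n \<tau> (vertices n) (\<xi> \<tau>) = restrict (\<xi> \<tau>) (ldom n \<tau>)"
        unfolding pull_def by (intro restrict_ext) simp
      also have "\<dots> = \<xi> \<tau>" using chains_coef[OF \<xi> \<tau>] by (simp add: coefficient_iff extensional_restrict)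
      finally show ?thesis .
    qed
    ultimately show ?thesis using chains_coef[OF \<xi> \<tau>] by simp
  qed (simp add: act_extensional chain_extensional[OF \<xi>])
qed

lemma act_plus:
  assumes A: "affine_op A n n'" and A': "affine_op A' n n'" and \<xi>: "\<xi> \<in> carrier (chains n)"
  shows "act (\<lambda>n \<sigma>. A n \<sigma> + A' n \<sigma>) n n' \<xi> = act A n n' \<xi> \<oplus>\<^bsub>chains n'\<^esub> act A' n n' \<xi>"
proof
  fix \<tau>
  have AA: "affine_op (\<lambda>n \<sigma>. A n \<sigma> + A' n \<sigma>) n n'"
    using A A' unfolding affine_op_def by (blast dest: keys_add')
  show "act (\<lambda>n \<sigma>. A n \<sigma> + A' n \<sigma>) n n' \<xi> \<tau> = (act A n n' \<xi> \<oplus>\<^bsub>chains n'\<^esub> act A' n n' \<xi>) \<tau>"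
  proof (cases "singular_simplex n' X \<tau>")
    case \<tau>: True
    interpret M: abelian_group "coef n' \<tau>" by (rule coef_abelian[OF \<tau>])
    let ?Q = "near_simplices n \<xi> \<tau>"
    have "op_form (\<lambda>n \<sigma>. A n \<sigma> + A' n \<sigma>) n n' ?Q \<tau> = op_form A n n' ?Q \<tau> + op_form A' n n' ?Q \<tau>"
      by (simp add: op_form_def frag_extend_add sum.distrib)
    moreover note v1 = op_form_values[OF A \<xi> finite_near_simplices[OF \<xi> \<tau>] near_simplices_singular, of \<tau>]
    moreover note v2 = op_form_values[OF A' \<xi> finite_near_simplices[OF \<xi> \<tau>] near_simplices_singular, of \<tau>]
    moreover have "(\<lambda>(\<sigma>, xs). pull n' \<tau> xs (\<xi> \<sigma>)) \<in> Poly_Mapping.keys (op_form A n n' ?Q \<tau>)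
        \<union> Poly_Mapping.keys (op_form A' n n' ?Q \<tau>) \<rightarrow> carrier (coef n' \<tau>)"
      by (rule funcsetI) (erule UnE, erule funcset_mem[OF v1], erule funcset_mem[OF v2])
    ultimately show ?thesis
      by (simp add: act_near[OF AA \<xi> \<tau>] act_near[OF A \<xi> \<tau>] act_near[OF A' \<xi> \<tau>] M.int_comb_add chains_ops simplices_nat \<tau>)
  qed (simp add: act_extensional chains_ops simplices_nat)
qed

lemma act_add:
  assumes A: "affine_op A n n'" and \<xi>: "\<xi> \<in> carrier (chains n)" and \<eta>: "\<eta> \<in> carrier (chains n)"
  shows "act A n n' (\<xi> \<oplus>\<^bsub>chains n\<^esub> \<eta>) = act A n n' \<xi> \<oplus>\<^bsub>chains n'\<^esub> act A n n' \<eta>"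
proof
  fix \<tau>
  interpret Ch: left_module R "chains n" by (rule chains_left_module)
  show "act A n n' (\<xi> \<oplus>\<^bsub>chains n\<^esub> \<eta>) \<tau> = (act A n n' \<xi> \<oplus>\<^bsub>chains n'\<^esub> act A n n' \<eta>) \<tau>"
  proof (cases "singular_simplex n' X \<tau>")
    case \<tau>: True
    interpret M: abelian_group "coef n' \<tau>" by (rule coef_abelian[OF \<tau>])
    let ?Q = "near_simplices n \<xi> \<tau> \<union> near_simplices n \<eta> \<tau>"
    have Q: "finite ?Q" "?Q \<subseteq> {\<sigma>. singular_simplex n X \<sigma>}"
      using finite_near_simplices[OF \<xi> \<tau>] finite_near_simplices[OF \<eta> \<tau>] near_simplices_singular by auto
    have sum: "\<xi> \<oplus>\<^bsub>chains n\<^esub> \<eta> \<in> carrier (chains n)" using \<xi> \<eta> by simp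
    have "near_simplices n (\<xi> \<oplus>\<^bsub>chains n\<^esub> \<eta>) \<tau> \<subseteq> ?Q"
      using csimp_add[of n \<xi> \<eta>] by (auto simp: near_simplices_def)
    then have r: "op_rel A n n' (\<xi> \<oplus>\<^bsub>chains n\<^esub> \<eta>) \<tau> \<subseteq> ?Q" "op_rel A n n' \<xi> \<tau> \<subseteq> ?Q" "op_rel A n n' \<eta> \<tau> \<subseteq> ?Q"
      using op_rel_near[OF A \<tau>] by blast+
    note v1 = op_form_values[OF A \<xi> Q, of \<tau>] and v2 = op_form_values[OF A \<eta> Q, of \<tau>]
    have "int_comb (coef n' \<tau>) (\<lambda>(\<sigma>, xs). pull n' \<tau> xs ((\<xi> \<oplus>\<^bsub>chains n\<^esub> \<eta>) \<sigma>)) (op_form A n n' ?Q \<tau>)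
      = int_comb (coef n' \<tau>) (\<lambda>p. (\<lambda>(\<sigma>, xs). pull n' \<tau> xs (\<xi> \<sigma>)) p \<oplus>\<^bsub>coef n' \<tau>\<^esub> (\<lambda>(\<sigma>, xs). pull n' \<tau> xs (\<eta> \<sigma>)) p) (op_form A n n' ?Q \<tau>)"
    proof (rule M.int_comb_cong)
      show "(\<lambda>p. (\<lambda>(\<sigma>, xs). pull n' \<tau> xs (\<xi> \<sigma>)) p \<oplus>\<^bsub>coef n' \<tau>\<^esub> (\<lambda>(\<sigma>, xs). pull n' \<tau> xs (\<eta> \<sigma>)) p)
        \<in> Poly_Mapping.keys (op_form A n n' ?Q \<tau>) \<rightarrow> carrier (coef n' \<tau>)"
        by (rule funcsetI, rule M.a_closed, erule funcset_mem[OF v1], erule funcset_mem[OF v2])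
      fix p assume p: "p \<in> Poly_Mapping.keys (op_form A n n' ?Q \<tau>)"
      obtain \<sigma> xs where pe: "p = (\<sigma>, xs)" by (cases p)
      have kk: "\<sigma> \<in> ?Q" "xs \<in> Poly_Mapping.keys (A n \<sigma>)" "simplex_comp n' \<sigma> xs = \<tau>"
        using keys_op_form[OF Q(1) p[unfolded pe]] by auto
      then have \<sigma>: "singular_simplex n X \<sigma>" using Q(2) by blast
      interpret pl: additive_map "coef n \<sigma>" "coef n' \<tau>" "pull n' \<tau> xs"
        using pull_additive[OF affine_opD[OF A \<sigma> kk(2)] \<sigma>] kk(3) by simp
      show "(case p of (\<sigma>, xs) \<Rightarrow> pull n' \<tau> xs ((\<xi> \<oplus>\<^bsub>chains n\<^esub> \<eta>) \<sigma>))
        = (\<lambda>(\<sigma>, xs). pull n' \<tau> xs (\<xi> \<sigma>)) p \<oplus>\<^bsub>coef n' \<tau>\<^esub> (\<lambda>(\<sigma>, xs). pull n' \<tau> xs (\<eta> \<sigma>)) p"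
        unfolding pe using chains_coef[OF \<xi> \<sigma>] chains_coef[OF \<eta> \<sigma>] \<sigma>
        by (simp add: chains_ops simplices_nat pl.plus)
    qed
    then show ?thesis
      by (simp add: act_eq[OF A sum \<tau> Q r(1)] act_eq[OF A \<xi> \<tau> Q r(2)] act_eq[OF A \<eta> \<tau> Q r(3)]
          M.int_comb_plus_fun[OF v1 v2] chains_ops(2)[where n=n'] simplices_nat \<tau>)
  qed (simp add: act_extensional chains_ops simplices_nat)
qed

lemma act_smult:
  assumes A: "affine_op A n n'" and \<xi>: "\<xi> \<in> carrier (chains n)" and r: "r \<in> carrier R"
  shows "act A n n' (r \<odot>\<^bsub>chains n\<^esub> \<xi>) = r \<odot>\<^bsub>chains n'\<^esub> act A n n' \<xi>"
proof
  fix \<tau>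
  interpret Ch: left_module R "chains n" by (rule chains_left_module)
  show "act A n n' (r \<odot>\<^bsub>chains n\<^esub> \<xi>) \<tau> = (r \<odot>\<^bsub>chains n'\<^esub> act A n n' \<xi>) \<tau>"
  proof (cases "singular_simplex n' X \<tau>")
    case \<tau>: True
    interpret M: left_module R "coef n' \<tau>" by (rule coef_left_module[OF \<tau>])
    interpret sm: additive_map "coef n' \<tau>" "coef n' \<tau>" "\<lambda>m. r \<odot>\<^bsub>coef n' \<tau>\<^esub> m"
      by unfold_locales (auto simp: additive_def r M.smult_closed M.smult_r_distr)
    let ?Q = "near_simplices n \<xi> \<tau>"
    have Q: "finite ?Q" "?Q \<subseteq> {\<sigma>. singular_simplex n X \<sigma>}"
      using finite_near_simplices[OF \<xi> \<tau>] near_simplices_singular by auto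
    have sum: "r \<odot>\<^bsub>chains n\<^esub> \<xi> \<in> carrier (chains n)" using \<xi> r by (simp add: Ch.smult_closed)
    have "near_simplices n (r \<odot>\<^bsub>chains n\<^esub> \<xi>) \<tau> \<subseteq> ?Q"
      using csimp_smult[OF r, of n \<xi>] by (auto simp: near_simplices_def)
    then have rl: "op_rel A n n' (r \<odot>\<^bsub>chains n\<^esub> \<xi>) \<tau> \<subseteq> ?Q" "op_rel A n n' \<xi> \<tau> \<subseteq> ?Q"
      using op_rel_near[OF A \<tau>] by blast+
    note v1 = op_form_values[OF A \<xi> Q, of \<tau>]
    have "int_comb (coef n' \<tau>) (\<lambda>(\<sigma>, xs). pull n' \<tau> xs ((r \<odot>\<^bsub>chains n\<^esub> \<xi>) \<sigma>)) (op_form A n n' ?Q \<tau>)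
      = int_comb (coef n' \<tau>) (\<lambda>p. r \<odot>\<^bsub>coef n' \<tau>\<^esub> (\<lambda>(\<sigma>, xs). pull n' \<tau> xs (\<xi> \<sigma>)) p) (op_form A n n' ?Q \<tau>)"
    proof (rule M.int_comb_cong)
      show "(\<lambda>p. r \<odot>\<^bsub>coef n' \<tau>\<^esub> (\<lambda>(\<sigma>, xs). pull n' \<tau> xs (\<xi> \<sigma>)) p)
        \<in> Poly_Mapping.keys (op_form A n n' ?Q \<tau>) \<rightarrow> carrier (coef n' \<tau>)"
        by (rule funcsetI, rule M.smult_closed[OF r], erule funcset_mem[OF v1])
      fix p assume p: "p \<in> Poly_Mapping.keys (op_form A n n' ?Q \<tau>)"
      obtain \<sigma> xs where pe: "p = (\<sigma>, xs)" by (cases p)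
      have kk: "\<sigma> \<in> ?Q" "xs \<in> Poly_Mapping.keys (A n \<sigma>)" "simplex_comp n' \<sigma> xs = \<tau>"
        using keys_op_form[OF Q(1) p[unfolded pe]] by auto
      then have \<sigma>: "singular_simplex n X \<sigma>" using Q(2) by blast
      show "(case p of (\<sigma>, xs) \<Rightarrow> pull n' \<tau> xs ((r \<odot>\<^bsub>chains n\<^esub> \<xi>) \<sigma>))
        = r \<odot>\<^bsub>coef n' \<tau>\<^esub> (\<lambda>(\<sigma>, xs). pull n' \<tau> xs (\<xi> \<sigma>)) p"
        unfolding pe using pull_smult[OF affine_opD[OF A \<sigma> kk(2)], of \<sigma> r "\<xi> \<sigma>"] kk(3) \<sigma>
        by (simp add: chains_ops simplices_nat)
    qed
    then show ?thesis
      by (simp add: act_eq[OF A sum \<tau> Q rl(1)] act_eq[OF A \<xi> \<tau> Q rl(2)]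
          sm.int_comb[OF v1] chains_ops(3)[where n=n'] simplices_nat \<tau>)
  qed (simp add: act_extensional chains_ops simplices_nat)
qed

end

context coefficient_setting
begin

section \<open>The boundary as a natural operator\<close>

lemma bary_del_vertices:
  assumes "1 \<le> n" "j \<le> n" "t \<in> standard_simplex (n - 1)"
  shows "bary (del j (vertices n)) t = simplical_face j t"
  using assms bary_vertices[of "simplical_face j t" n] simplical_face_wts[of j n t]
  by (simp add: bary_del standard_simplex_eq_wts)

lemma simplex_comp_face:
  assumes "1 \<le> n" "k \<le> n"
  shows "simplex_comp (n - 1) \<sigma> (del k (vertices n)) = singular_face n k \<sigma>"
proof
  fix t show "simplex_comp (n - 1) \<sigma> (del k (vertices n)) t = singular_face n k \<sigma> t"
    using bary_del_vertices[OF assms, of t]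
    by (cases "t \<in> standard_simplex (n - 1)") (simp_all add: simplex_comp_def singular_face_def)
qed

lemma affine_op_faces: "1 \<le> n \<Longrightarrow> affine_op (\<lambda>n \<sigma>. list_bd (vertices n)) n (n - 1)"
  unfolding affine_op_def
proof (intro allI impI)
  fix xs assume n: "1 \<le> n" and "xs \<in> Poly_Mapping.keys (list_bd (vertices n))"
  from keys_list_bd[OF this(2)] obtain j where j: "j < Suc n" "xs = del j (vertices n)" by auto
  then show "affine_simplex n (n - 1) xs"
    using affine_vertices[of n] set_del[of j "vertices n"] n by (auto simp: affine_simplex_def)
qed

text \<open>The signed faces of the standard simplex form an operator whose action is the boundary.
  Its closure properties, linearity and vanishing square then follow from the general theory of the
  action.\<close>

lemma boundary_eq_act:
  assumes n: "1 \<le> n" and \<xi>: "\<xi> \<in> carrier (chains n)"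
  shows "boundary X S G (int n) \<xi> = act (\<lambda>n \<sigma>. list_bd (vertices n)) n (n - 1) \<xi>"
proof
  fix \<tau>
  note One_nat_def [simp del]
  let ?d = "\<lambda>n (\<sigma> :: (nat \<Rightarrow> real) \<Rightarrow> 'a). list_bd (vertices n)"
  have int_n: "int n - 1 = int (n - 1)" using n by simp
  note A = affine_op_faces[OF n]
  show "boundary X S G (int n) \<xi> \<tau> = act ?d n (n - 1) \<xi> \<tau>"
  proof (cases "singular_simplex (n - 1) X \<tau>")
    case \<tau>: True
    let ?M = "coef (n - 1) \<tau>"
    interpret M: abelian_group ?M by (rule coef_abelian[OF \<tau>])
    define Q where "Q = near_simplices n \<xi> \<tau>"
    have Q: "finite Q" "Q \<subseteq> {\<sigma>. singular_simplex n X \<sigma>}"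
      using finite_near_simplices[OF \<xi> \<tau>] near_simplices_singular by (auto simp: Q_def)
    have face: "simplex_comp (n - 1) \<sigma> (del k (vertices n)) = singular_face n k \<sigma>" if "k \<le> n" for \<sigma> :: "(nat \<Rightarrow> real) \<Rightarrow> 'a" and k
      by (rule simplex_comp_face[OF n that])
    define K where "K = {(\<sigma>, k). \<sigma> \<in> csimp n \<xi> \<and> k \<le> n \<and> singular_face n k \<sigma> = \<tau>}"
    \<comment> \<open>A simplex with face \<tau> passes through the test point of \<tau>, so the
      index set of the sum in \<open>boundary\<close> lies in a finite product.\<close>
    have KQ: "K = {p \<in> Q \<times> {..n}. singular_face n (snd p) (fst p) = \<tau>}"
    proof -
      have "\<sigma> \<in> Q" if "\<sigma> \<in> csimp n \<xi>" "k \<le> n" "singular_face n k \<sigma> = \<tau>" for \<sigma> k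
      proof -
        have \<sigma>: "singular_simplex n X \<sigma>" using that(1) by (simp add: csimp_iff)
        have aff: "affine_simplex n (n - 1) (del k (vertices n))"
          using affine_vertices[of n] set_del[of k "vertices n"] n that(2) by (auto simp: affine_simplex_def)
        show ?thesis
          using image_simplex_comp[OF aff, of \<sigma>] face[OF that(2), of \<sigma>] that(1,3) point_in_image(2)[OF \<tau>]
          by (auto simp: Q_def near_simplices_def)
      qed
      then show ?thesis by (auto simp: K_def Q_def near_simplices_def)
    qed
    have finK: "finite K" unfolding KQ using Q(1) by simp
    let ?v = "\<lambda>(\<sigma>, xs). pull (n - 1) \<tau> xs (\<xi> \<sigma>)"
    let ?w = "\<lambda>p. frag_cmul ((-1) ^ snd p) (frag_of (fst p, del (snd p) (vertices n)))"
    have "op_form ?d n (n - 1) Q \<tau> = (\<Sum>\<sigma>\<in>Q. \<Sum>k\<le>n. if singular_face n k \<sigma> = \<tau> then ?w (\<sigma>, k) else 0)"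
      unfolding op_form_def
    proof (rule sum.cong[OF refl])
      fix \<sigma> assume "\<sigma> \<in> Q"
      let ?h = "\<lambda>xs. if simplex_comp (n - 1) \<sigma> xs = \<tau> then frag_of (\<sigma>, xs) else 0"
      have "frag_extend ?h (list_bd (vertices n)) = (\<Sum>k\<le>n. frag_cmul ((-1) ^ k) (?h (del k (vertices n))))"
        unfolding list_bd_eq_sum length_vertices lessThan_Suc_atMost
        by (subst frag_extend_sum) (auto simp: o_def frag_extend_cmul)
      also have "\<dots> = (\<Sum>k\<le>n. if singular_face n k \<sigma> = \<tau> then ?w (\<sigma>, k) else 0)"
      proof (rule sum.cong[OF refl])
        fix k assume "k \<in> {..n}"
        then have k: "k \<le> n" by simp
        show "frag_cmul ((-1) ^ k) (?h (del k (vertices n))) = (if singular_face n k \<sigma> = \<tau> then ?w (\<sigma>, k) else 0)"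
          unfolding face[OF k] by simp
      qed
      finally show "frag_extend ?h (list_bd (vertices n)) = (\<Sum>k\<le>n. if singular_face n k \<sigma> = \<tau> then ?w (\<sigma>, k) else 0)" .
    qed
    also have "\<dots> = (\<Sum>p\<in>Q \<times> {..n}. if singular_face n (snd p) (fst p) = \<tau> then ?w p else 0)"
      by (subst sum.cartesian_product) (rule sum.cong, auto)
    also have "\<dots> = (\<Sum>p\<in>K. ?w p)"
      unfolding KQ using Q(1) by (intro sum.inter_filter[symmetric]) simp
    finally have form: "op_form ?d n (n - 1) Q \<tau> = (\<Sum>p\<in>K. ?w p)" .
    have term_eq: "int_comb ?M ?v (?w p) = face_coefficient S G (int n) \<tau> (snd p) (\<xi> (fst p))
        \<and> ?v (fst p, del (snd p) (vertices n)) \<in> carrier ?M" if p: "p \<in> K" for p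
    proof -
      obtain \<sigma> k where pe: "p = (\<sigma>, k)" by (cases p)
      have k: "k \<le> n" "singular_face n k \<sigma> = \<tau>" and \<sigma>: "singular_simplex n X \<sigma>"
        using p by (auto simp: pe K_def csimp_iff)
      have aff: "affine_simplex n (n - 1) (del k (vertices n))"
        using affine_vertices[of n] set_del[of k "vertices n"] n k(1) by (auto simp: affine_simplex_def)
      have c: "pull (n - 1) \<tau> (del k (vertices n)) (\<xi> \<sigma>) \<in> carrier ?M"
        using pull_closed[OF aff chains_coef[OF \<xi> \<sigma>]] face[OF k(1), of \<sigma>] k(2) by simp
      have "pull (n - 1) \<tau> (del k (vertices n)) (\<xi> \<sigma>) = restrict (\<xi> \<sigma> \<circ> simplical_face k) (ldom (n - 1) \<tau>)"
        unfolding pull_def using bary_del_vertices[OF n k(1)]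
        by (intro restrict_ext) (simp add: lift_domain_def)
      then have f: "face_coefficient S G (int n) \<tau> k (\<xi> \<sigma>)
          = (if even k then pull (n - 1) \<tau> (del k (vertices n)) (\<xi> \<sigma>) else \<ominus>\<^bsub>?M\<^esub> pull (n - 1) \<tau> (del k (vertices n)) (\<xi> \<sigma>))"
        by (simp add: face_coefficient_def int_n Let_def)
      have "int_comb ?M ?v (- frag_of (\<sigma>, del k (vertices n))) = \<ominus>\<^bsub>?M\<^esub> pull (n - 1) \<tau> (del k (vertices n)) (\<xi> \<sigma>)"
        using M.int_comb_uminus[of ?v "frag_of (\<sigma>, del k (vertices n))"] c by (simp add: keys_frag_of)
      then show ?thesis using f c pe by (cases "even k") simp_all
    qed
    have "act ?d n (n - 1) \<xi> \<tau> = int_comb ?M ?v (\<Sum>p\<in>K. ?w p)"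
      unfolding form[symmetric] Q_def by (rule act_near[OF A \<xi> \<tau>])
    also have "\<dots> = finsum ?M (\<lambda>p. int_comb ?M ?v (?w p)) K"
      by (rule M.int_comb_sum[OF finK]) (use term_eq in \<open>auto simp: keys_frag_of\<close>)
    also have "\<dots> = finsum ?M (\<lambda>p. face_coefficient S G (int n) \<tau> (snd p) (\<xi> (fst p))) K"
    proof (rule M.finsum_cong'[OF refl])
      show "(\<lambda>p. face_coefficient S G (int n) \<tau> (snd p) (\<xi> (fst p))) \<in> K \<rightarrow> carrier ?M"
      proof (rule funcsetI)
        fix p assume p: "p \<in> K"
        have "int_comb ?M ?v (?w p) \<in> carrier ?M"
          by (rule M.int_comb_closed) (use term_eq[OF p] in \<open>auto simp: keys_frag_of\<close>)
        then show "face_coefficient S G (int n) \<tau> (snd p) (\<xi> (fst p)) \<in> carrier ?M" using term_eq[OF p] by simp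
      qed
    qed (use term_eq in blast)
    also have "\<dots> = boundary X S G (int n) \<xi> \<tau>"
      using \<tau> by (simp add: boundary_def int_n simplices_nat K_def split_def)
    finally show ?thesis by simp
  qed (simp add: act_extensional boundary_def int_n simplices_nat)
qed

lemma boundary_nonpos: "i \<le> 0 \<Longrightarrow> boundary X S G i \<xi> = (\<lambda>_. undefined)"
  by (simp add: boundary_def simplices_def restrict_def)

lemma boundary_closed: "1 \<le> n \<Longrightarrow> \<xi> \<in> carrier (chains n) \<Longrightarrow> boundary X S G (int n) \<xi> \<in> carrier (chains (n - 1))"
  unfolding boundary_eq_act by (rule act_closed[OF affine_op_faces])

text \<open>The affine map of \<open>xs\<close> carries the vertices of the standard simplex to
  \<open>xs\<close> itself, so the faces of a piece are the formal faces of
  \<open>xs\<close>.\<close>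

lemma boundary_act:
  assumes A: "affine_op A n n'" and n': "1 \<le> n'" and \<xi>: "\<xi> \<in> carrier (chains n)"
  shows "boundary X S G (int n') (act A n n' \<xi>) = act (\<lambda>n \<sigma>. bd (A n \<sigma>)) n (n' - 1) \<xi>"
    and "affine_op (\<lambda>n \<sigma>. bd (A n \<sigma>)) n (n' - 1)"
proof -
  have eq: "op_comp A n n' (\<lambda>n \<sigma>. list_bd (vertices n)) n \<sigma> = bd (A n \<sigma>)" if \<sigma>: "singular_simplex n X \<sigma>" for \<sigma>
    unfolding op_comp_def bd_def
  proof (rule frag_extend_eq)
    fix xs assume "xs \<in> Poly_Mapping.keys (A n \<sigma>)"
    then have "affine_simplex n n' xs" by (rule affine_opD[OF A \<sigma>])
    then show "vmap (bary xs) (list_bd (vertices n')) = list_bd xs"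
      unfolding list_bd_map[symmetric] by (simp add: map_bary_vertices affine_simplex_def)
  qed
  show "boundary X S G (int n') (act A n n' \<xi>) = act (\<lambda>n \<sigma>. bd (A n \<sigma>)) n (n' - 1) \<xi>"
    unfolding boundary_eq_act[OF n' act_closed[OF A \<xi>]] act_act[OF A affine_op_faces[OF n'] \<xi>]
    by (rule act_cong) (rule eq)
  show "affine_op (\<lambda>n \<sigma>. bd (A n \<sigma>)) n (n' - 1)"
    using affine_op_comp[OF A affine_op_faces[OF n']] eq by (auto simp: affine_op_def)
qed

text \<open>Here the pieces are those of the faces, included by the face maps. Together with
  \<open>boundary_act\<close> this expresses every term of a homotopy formula as an action on one
  and the same chain.\<close>

lemma act_boundary:
  assumes A: "affine_op A (n - 1) n'" and n: "1 \<le> n" and \<xi>: "\<xi> \<in> carrier (chains n)"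
  shows "act A (n - 1) n' (boundary X S G (int n) \<xi>) = act (face_sum simplical_face A) n n' \<xi>"
    and "affine_op (face_sum simplical_face A) n n'"
proof -
  have eq: "op_comp (\<lambda>n \<sigma>. list_bd (vertices n)) n (n - 1) A n \<sigma> = face_sum simplical_face A n \<sigma>" if \<sigma>: "singular_simplex n X \<sigma>" for \<sigma>
  proof -
    have "op_comp (\<lambda>n \<sigma>. list_bd (vertices n)) n (n - 1) A n \<sigma>
      = (\<Sum>j\<le>n. frag_cmul ((-1) ^ j) (vmap (bary (del j (vertices n))) (A (n - 1) (simplex_comp (n - 1) \<sigma> (del j (vertices n))))))"
      unfolding op_comp_def list_bd_eq_sum length_vertices lessThan_Suc_atMost
      by (subst frag_extend_sum) (auto simp: o_def frag_extend_cmul)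
    also have "\<dots> = face_sum simplical_face A n \<sigma>"
      unfolding face_sum_def
    proof (rule sum.cong[OF refl])
      fix j assume "j \<in> {..n}"
      then have j: "j \<le> n" by simp
      have face: "simplex_comp (n - 1) \<sigma> (del j (vertices n)) = singular_face n j \<sigma>"
        by (rule simplex_comp_face[OF n j])
      have \<sigma>j: "singular_simplex (n - 1) X (singular_face n j \<sigma>)"
        using singular_simplex_singular_face[OF \<sigma> n j] by simp
      have "vmap (bary (del j (vertices n))) (A (n - 1) (singular_face n j \<sigma>)) = vmap (simplical_face j) (A (n - 1) (singular_face n j \<sigma>))"
      proof (rule vmap_cong)
        fix xs x assume "xs \<in> Poly_Mapping.keys (A (n - 1) (singular_face n j \<sigma>))" "x \<in> set xs"
        then have "x \<in> standard_simplex (n - 1)"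
          using affine_opD[OF A \<sigma>j] by (auto simp: affine_simplex_def)
        then show "bary (del j (vertices n)) x = simplical_face j x" by (rule bary_del_vertices[OF n j])
      qed
      then show "frag_cmul ((-1) ^ j) (vmap (bary (del j (vertices n))) (A (n - 1) (simplex_comp (n - 1) \<sigma> (del j (vertices n)))))
         = frag_cmul ((-1) ^ j) (vmap (simplical_face j) (A (n - 1) (singular_face n j \<sigma>)))"
        unfolding face by (rule arg_cong)
    qed
    finally show ?thesis .
  qed
  show "act A (n - 1) n' (boundary X S G (int n) \<xi>) = act (face_sum simplical_face A) n n' \<xi>"
    unfolding boundary_eq_act[OF n \<xi>] act_act[OF affine_op_faces[OF n] A \<xi>]
    by (rule act_cong) (rule eq)
  show "affine_op (face_sum simplical_face A) n n'"
    using affine_op_comp[OF affine_op_faces[OF n] A] eq by (auto simp: affine_op_def)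
qed

lemma csimp_zero_op:
  assumes "\<And>\<sigma>. singular_simplex n X \<sigma> \<Longrightarrow> A n \<sigma> = 0"
  shows "csimp n' (act A n n' \<xi>) = {}"
proof -
  have "\<tau> \<notin> csimp n' (act A n n' \<xi>)" for \<tau>
  proof
    assume "\<tau> \<in> csimp n' (act A n n' \<xi>)"
    from csimp_act[OF this] show False using assms by (auto simp: csimp_iff)
  qed
  then show ?thesis by blast
qed

lemma csimp_empty_eq_zero:
  assumes "\<xi> \<in> carrier (chains n)" "csimp n \<xi> = {}"
  shows "\<xi> = \<zero>\<^bsub>chains n\<^esub>"
proof
  fix \<sigma>
  show "\<xi> \<sigma> = \<zero>\<^bsub>chains n\<^esub> \<sigma>"
    using assms chain_extensional[OF assms(1), of \<sigma>]
    by (cases "singular_simplex n X \<sigma>") (auto simp: csimp_iff chains_ops simplices_nat)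
qed

lemma csimp_boundary_boundary:
  assumes "2 \<le> n" "\<xi> \<in> carrier (chains n)"
  shows "csimp (n - 2) (boundary X S G (int (n - 1)) (boundary X S G (int n) \<xi>)) = {}"
proof -
  have 1: "1 \<le> n" "1 \<le> n - 1" using assms(1) by auto
  have "boundary X S G (int (n - 1)) (boundary X S G (int n) \<xi>) = act (\<lambda>n \<sigma>. bd (list_bd (vertices n))) n (n - 1 - 1) \<xi>"
    unfolding boundary_eq_act[OF 1(1) assms(2)] by (rule boundary_act(1)[OF affine_op_faces[OF 1(1)] 1(2) assms(2)])
  moreover have "n - 2 = n - 1 - 1" by simp
  ultimately show ?thesis by (simp only:) (rule csimp_zero_op, simp add: bd_list_bd)
qed

lemma boundary_add:
  assumes "1 \<le> n" "\<xi> \<in> carrier (chains n)" "\<eta> \<in> carrier (chains n)"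
  shows "boundary X S G (int n) (\<xi> \<oplus>\<^bsub>chains n\<^esub> \<eta>) = boundary X S G (int n) \<xi> \<oplus>\<^bsub>chains (n - 1)\<^esub> boundary X S G (int n) \<eta>"
proof -
  interpret left_module R "chains n" by (rule chains_left_module)
  note sum = a_closed[OF assms(2,3)]
  show ?thesis
    unfolding boundary_eq_act[OF assms(1) sum] boundary_eq_act[OF assms(1,2)] boundary_eq_act[OF assms(1,3)]
    by (rule act_add[OF affine_op_faces[OF assms(1)] assms(2,3)])
qed

lemma boundary_smult:
  assumes "1 \<le> n" "\<xi> \<in> carrier (chains n)" "r \<in> carrier R"
  shows "boundary X S G (int n) (r \<odot>\<^bsub>chains n\<^esub> \<xi>) = r \<odot>\<^bsub>chains (n - 1)\<^esub> boundary X S G (int n) \<xi>"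
proof -
  interpret left_module R "chains n" by (rule chains_left_module)
  note sm = smult_closed[OF assms(3,2)]
  show ?thesis
    unfolding boundary_eq_act[OF assms(1) sm] boundary_eq_act[OF assms(1,2)]
    by (rule act_smult[OF affine_op_faces[OF assms(1)] assms(2,3)])
qed

abbreviation support :: "int \<Rightarrow> ('a, 'e) coeff_chain \<Rightarrow> 'a set" where
  "support i \<xi> \<equiv> chain_support X S G i \<xi>"

lemma support_nat: "support (int n) \<xi> = (\<Union>\<sigma>\<in>csimp n \<xi>. \<sigma> ` standard_simplex n)"
  by (simp add: chain_support_def)

lemma support_act:
  assumes A: "affine_op A n n'"
  shows "support (int n') (act A n n' \<xi>) \<subseteq> support (int n) \<xi>"
proof
  fix x assume "x \<in> support (int n') (act A n n' \<xi>)"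
  then obtain \<tau> where \<tau>: "\<tau> \<in> csimp n' (act A n n' \<xi>)" "x \<in> \<tau> ` standard_simplex n'"
    by (auto simp: support_nat)
  obtain \<sigma> xs where \<sigma>: "\<sigma> \<in> csimp n \<xi>" "xs \<in> Poly_Mapping.keys (A n \<sigma>)" "\<tau> = simplex_comp n' \<sigma> xs"
    using csimp_act[OF \<tau>(1)] by blast
  have "affine_simplex n n' xs" using affine_opD[OF A _ \<sigma>(2)] \<sigma>(1) by (simp add: csimp_iff)
  from image_simplex_comp[OF this, of \<sigma>] \<tau>(2) have "x \<in> \<sigma> ` standard_simplex n"
    unfolding \<sigma>(3) by blast
  with \<sigma>(1) show "x \<in> support (int n) \<xi>"
    unfolding support_nat by blast
qed

end

section \<open>Natural operators on intersection chains\<close>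

text \<open>In passing from dimension n to n + d, the bound on the skeleton moves by
  \<open>d\<close> for each codimension \<open>k\<close>, and so does the estimate in
  \<open>good n d\<close>.\<close>

lemma allowable_simplex_comp:
  assumes xs: "good n d xs" and n': "int n' = int n + d" and \<sigma>: "allowable_simplex N F p (int n) \<sigma>"
  shows "allowable_simplex N F p (int n') (simplex_comp n' \<sigma> xs)"
  unfolding allowable_simplex_def
proof (intro allI impI subsetI)
  fix k t assume k: "(1::nat) \<le> k"
    and t: "t \<in> {t \<in> standard_simplex (nat (int n')). simplex_comp n' \<sigma> xs t \<in> F (int N - int k) - F (int N - int k - 1)}"
  have aff: "affine_simplex n n' xs" using xs n' by (auto simp: good_def affine_simplex_def)
  have ts: "t \<in> standard_simplex n'" using t by simp
  have "\<sigma> (bary xs t) \<in> F (int N - int k) - F (int N - int k - 1)"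
    using t ts by (simp add: simplex_comp_def)
  then have "bary xs t \<in> simplex_skeleton (int n) (int n - int k + p k)"
    using \<sigma> k bary_affine[OF aff ts] unfolding allowable_simplex_def by auto
  then have "int (nz (bary xs t)) \<le> int n - int k + p k + 1" by (simp add: simplex_skeleton_def nz_def)
  moreover have "int (nz t) \<le> int (nz (bary xs t)) + d"
    using xs ts aff by (auto simp: good_def affine_simplex_def standard_simplex_eq_wts)
  ultimately have "int (nz t) \<le> int n' - int k + p k + 1" using n' by linarith
  then show "t \<in> simplex_skeleton (int n') (int n' - int k + p k)"
    using ts by (simp add: simplex_skeleton_def nz_def)
qed

lemma left_module_restrict:
  assumes "left_module R M" "H \<subseteq> carrier M" "\<zero>\<^bsub>M\<^esub> \<in> H"
    and "\<And>x y. x \<in> H \<Longrightarrow> y \<in> H \<Longrightarrow> x \<oplus>\<^bsub>M\<^esub> y \<in> H"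
    and "\<And>r x. r \<in> carrier R \<Longrightarrow> x \<in> H \<Longrightarrow> r \<odot>\<^bsub>M\<^esub> x \<in> H"
  shows "left_module R (M\<lparr>carrier := H\<rparr>)"
proof -
  interpret left_module R M by fact
  have [simp]: "x \<in> carrier M" if "x \<in> H" for x using that assms(2) by blast
  show ?thesis
    by (rule left_moduleI[OF R.ring_axioms])
       (auto simp: assms(3-5) M.a_assoc smult_minus_one smult_l_distr smult_r_distr smult_assoc smult_one intro: M.a_comm)
qed

locale intersection_setting =
  fixes X :: "'a topology" and N :: nat and F :: "int \<Rightarrow> 'a set" and p :: "nat \<Rightarrow> int"
    and R :: "'r ring" and G :: "('a, 'e, 'r) local_system"
  assumes ring_R: "ring R"
    and local_system: "local_coefficient_system R (subtopology X (regular_part X N F)) G"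

sublocale intersection_setting \<subseteq> coefficient_setting X "regular_part X N F" R G
  by (intro coefficient_setting.intro ring_R local_system) auto

context intersection_setting
begin

abbreviation IC :: "int \<Rightarrow> ('r, ('a, 'e) coeff_chain) module" where
  "IC i \<equiv> intersection_chains X N F p G i"

abbreviation "boundary_map \<equiv> boundary X (regular_part X N F) G"

abbreviation "allowable n \<sigma> \<equiv> allowable_simplex N F p (int n) \<sigma>"

lemma IC_ops [simp]:
  "\<zero>\<^bsub>IC i\<^esub> = \<zero>\<^bsub>locally_finite_chains X (regular_part X N F) G i\<^esub>"
  "\<xi> \<oplus>\<^bsub>IC i\<^esub> \<eta> = \<xi> \<oplus>\<^bsub>locally_finite_chains X (regular_part X N F) G i\<^esub> \<eta>"
  "r \<odot>\<^bsub>IC i\<^esub> \<xi> = r \<odot>\<^bsub>locally_finite_chains X (regular_part X N F) G i\<^esub> \<xi>"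
  by (simp_all add: intersection_chains_def Let_def)

lemma IC_iff:
  "\<xi> \<in> carrier (IC (int n)) \<longleftrightarrow> \<xi> \<in> carrier (chains n) \<and> (\<forall>\<sigma>\<in>csimp n \<xi>. allowable n \<sigma>)
    \<and> (1 \<le> n \<longrightarrow> (\<forall>\<tau>\<in>csimp (n - 1) (boundary_map (int n) \<xi>). allowable (n - 1) \<tau>))"
proof (cases "1 \<le> n")
  case True
  then have "int n - 1 = int (n - 1)" by simp
  then show ?thesis using True by (simp add: intersection_chains_def Let_def allowable_chain_def)
next
  case False
  then have "chain_simplices X (regular_part X N F) G (int n - 1) \<eta> = {}" for \<eta>
    by (simp add: chain_simplices_def simplices_def)
  then show ?thesis using False by (simp add: intersection_chains_def Let_def allowable_chain_def)
qed

lemma IC_chains: "\<xi> \<in> carrier (IC (int n)) \<Longrightarrow> \<xi> \<in> carrier (chains n)"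
  by (simp add: IC_iff)

text \<open>An extensional function on the empty set of simplices; the module is zero, so any
  identity in it holds by \<open>IC_neg_eq\<close>.\<close>

lemma IC_neg: "i < 0 \<Longrightarrow> carrier (IC i) = {\<lambda>_. undefined}"
  by (auto simp: intersection_chains_def Let_def locally_finite_chains_def simplices_def
      allowable_chain_def chain_simplices_def PiE_def extensional_def)

lemma IC_neg_eq: "i < 0 \<Longrightarrow> \<xi> \<in> carrier (IC i) \<Longrightarrow> \<eta> \<in> carrier (IC i) \<Longrightarrow> \<xi> = \<eta>"
  by (simp add: IC_neg)

lemma IC_left_module: "left_module R (IC i)"
proof (cases "0 \<le> i")
  case True
  then obtain n where i: "i = int n" using nonneg_eq_int by blast
  interpret C: left_module R "chains n" by (rule chains_left_module)
  have "left_module R ((chains n)\<lparr>carrier := carrier (IC (int n))\<rparr>)"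
  proof (rule left_module_restrict[OF chains_left_module])
    show "carrier (IC (int n)) \<subseteq> carrier (chains n)" using IC_chains by blast
    have "csimp (n - 1) (boundary_map (int n) \<zero>\<^bsub>chains n\<^esub>) = {}" if "1 \<le> n"
    proof -
      have "\<tau> \<notin> csimp (n - 1) (boundary_map (int n) \<zero>\<^bsub>chains n\<^esub>)" for \<tau>
        unfolding boundary_eq_act[OF that C.zero_closed]
        using csimp_act[of \<tau> "n - 1" _ n "\<zero>\<^bsub>chains n\<^esub>"] csimp_zero by blast
      then show ?thesis by blast
    qed
    then show "\<zero>\<^bsub>chains n\<^esub> \<in> carrier (IC (int n))" by (auto simp: IC_iff csimp_zero)
    show "\<xi> \<oplus>\<^bsub>chains n\<^esub> \<eta> \<in> carrier (IC (int n))"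
      if "\<xi> \<in> carrier (IC (int n))" "\<eta> \<in> carrier (IC (int n))" for \<xi> \<eta>
      using that csimp_add[of n \<xi> \<eta>] csimp_add[of "n - 1" "boundary_map (int n) \<xi>" "boundary_map (int n) \<eta>"]
      unfolding IC_iff by (auto simp: boundary_add)
    show "r \<odot>\<^bsub>chains n\<^esub> \<xi> \<in> carrier (IC (int n))"
      if "r \<in> carrier R" "\<xi> \<in> carrier (IC (int n))" for r \<xi>
      using that csimp_smult[OF that(1), of n \<xi>] csimp_smult[OF that(1), of "n - 1" "boundary_map (int n) \<xi>"]
      unfolding IC_iff by (auto simp: boundary_smult C.smult_closed)
  qed
  moreover have "(chains n)\<lparr>carrier := carrier (IC (int n))\<rparr> = IC (int n)"
    by (simp add: intersection_chains_def Let_def)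
  ultimately show ?thesis by (simp add: i)
next
  case False
  then have e: "simplices X i = {}" by (simp add: simplices_def)
  have ops: "\<zero>\<^bsub>IC i\<^esub> = (\<lambda>_. undefined)" "\<And>\<xi> \<eta>. \<xi> \<oplus>\<^bsub>IC i\<^esub> \<eta> = (\<lambda>_. undefined)" "\<And>r \<xi>. r \<odot>\<^bsub>IC i\<^esub> \<xi> = (\<lambda>_. undefined)"
    by (simp_all add: locally_finite_chains_def e restrict_def)
  show ?thesis
    by (rule left_moduleI[OF ring_R]) (use False in \<open>auto simp: ops IC_neg simp del: IC_ops\<close>)
qed

text \<open>The boundary of the image splits into \<open>B\<close> acting on \<xi> and
  \<open>A'\<close> acting on the boundary of \<xi>. The regrouping is essential: single faces of
  simplices of \<xi> need not be allowable, only those surviving in the boundary, and these are what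
  \<open>A'\<close> acts on. \<open>B\<close> acts on simplices of \<xi> but lands one dimension
  lower, hence the bound d - 1.\<close>

lemma act_IC:
  assumes good: "\<And>\<sigma> xs. singular_simplex n X \<sigma> \<Longrightarrow> xs \<in> Poly_Mapping.keys (A n \<sigma>) \<Longrightarrow> good n d xs"
    and n': "int n' = int n + d" and \<xi>: "\<xi> \<in> carrier (IC (int n))"
    and bd_A: "\<And>\<sigma>. singular_simplex n X \<sigma> \<Longrightarrow> 1 \<le> n' \<Longrightarrow>
        bd (A n \<sigma>) = B n \<sigma> + (if 1 \<le> n then face_sum simplical_face A' n \<sigma> else 0)"
    and B: "\<And>\<sigma> xs. singular_simplex n X \<sigma> \<Longrightarrow> 1 \<le> n' \<Longrightarrow> xs \<in> Poly_Mapping.keys (B n \<sigma>) \<Longrightarrow> good n (d - 1) xs"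
    and A': "\<And>\<sigma> xs. 1 \<le> n \<Longrightarrow> singular_simplex (n - 1) X \<sigma> \<Longrightarrow> 1 \<le> n' \<Longrightarrow> xs \<in> Poly_Mapping.keys (A' (n - 1) \<sigma>) \<Longrightarrow> good (n - 1) d xs"
  shows "act A n n' \<xi> \<in> carrier (IC (int n'))"
proof -
  have ch: "\<xi> \<in> carrier (chains n)" using \<xi> by (rule IC_chains)
  have good_affine: "affine_simplex m m' xs" if "good m e xs" "int m' = int m + e" for m m' e xs
    using that by (auto simp: good_def affine_simplex_def)
  have A: "affine_op A n n'"
    unfolding affine_op_def using good good_affine[OF _ n'] by blast
  have allow: "allowable m' \<tau>"
    if allow: "\<tau> \<in> csimp m' (act C m m' \<zeta>)" "\<And>\<sigma> xs. singular_simplex m X \<sigma> \<Longrightarrow> xs \<in> Poly_Mapping.keys (C m \<sigma>) \<Longrightarrow> good m e xs"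
      "int m' = int m + e" "\<And>\<sigma>. \<sigma> \<in> csimp m \<zeta> \<Longrightarrow> allowable m \<sigma>" for \<tau> C m m' e \<zeta>
  proof -
    obtain \<sigma> xs where \<sigma>: "\<sigma> \<in> csimp m \<zeta>" "xs \<in> Poly_Mapping.keys (C m \<sigma>)" "\<tau> = simplex_comp m' \<sigma> xs"
      using csimp_act[OF allow(1)] by blast
    show ?thesis unfolding \<sigma>(3)
      by (rule allowable_simplex_comp[OF allow(2)[OF _ \<sigma>(2)] allow(3) allow(4)[OF \<sigma>(1)]])
         (use \<sigma>(1) in \<open>simp add: csimp_iff\<close>)
  qed
  have "allowable (n' - 1) \<tau>" if 1: "1 \<le> n'" and \<tau>: "\<tau> \<in> csimp (n' - 1) (boundary_map (int n') (act A n n' \<xi>))" for \<tau>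
  proof -
    let ?F = "\<lambda>m \<sigma>. if 1 \<le> m then face_sum simplical_face A' m \<sigma> else 0"
    have B_aff: "affine_op B n (n' - 1)"
      unfolding affine_op_def using B[OF _ 1] good_affine[of n "d - 1" _ "n' - 1"] n' 1 by auto
    have F: "affine_op ?F n (n' - 1) \<and> (\<forall>\<tau>\<in>csimp (n' - 1) (act ?F n (n' - 1) \<xi>). allowable (n' - 1) \<tau>)"
    proof (cases "1 \<le> n")
      case True
      have e: "int (n' - 1) = int (n - 1) + d" using n' 1 True by simp
      have A'_aff: "affine_op A' (n - 1) (n' - 1)"
        unfolding affine_op_def using A'[OF True _ 1] good_affine[OF _ e] by blast
      have "affine_op ?F n (n' - 1)" using act_boundary(2)[OF A'_aff True ch] True by (simp add: affine_op_def)
      moreover have "act ?F n (n' - 1) \<xi> = act (face_sum simplical_face A') n (n' - 1) \<xi>"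
        by (rule act_cong) (use True in simp)
      then have eq: "act ?F n (n' - 1) \<xi> = act A' (n - 1) (n' - 1) (boundary_map (int n) \<xi>)"
        by (simp only: act_boundary(1)[OF A'_aff True ch])
      have "allowable (n' - 1) \<tau>" if "\<tau> \<in> csimp (n' - 1) (act ?F n (n' - 1) \<xi>)" for \<tau>
        by (rule allow[OF that[unfolded eq] A'[OF True _ 1] e]) (use \<xi> True in \<open>auto simp: IC_iff\<close>)
      ultimately show ?thesis by blast
    next
      case False
      then show ?thesis using csimp_zero_op[of n ?F "n' - 1" \<xi>] by (simp add: affine_op_def)
    qed
    have "boundary_map (int n') (act A n n' \<xi>) = act (\<lambda>n \<sigma>. bd (A n \<sigma>)) n (n' - 1) \<xi>"
      by (rule boundary_act(1)[OF A 1 ch])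
    also have "\<dots> = act (\<lambda>n \<sigma>. B n \<sigma> + ?F n \<sigma>) n (n' - 1) \<xi>"
      by (rule act_cong) (rule bd_A[OF _ 1])
    also have "\<dots> = act B n (n' - 1) \<xi> \<oplus>\<^bsub>chains (n' - 1)\<^esub> act ?F n (n' - 1) \<xi>"
      by (rule act_plus[OF B_aff conjunct1[OF F] ch])
    finally have "\<tau> \<in> csimp (n' - 1) (act B n (n' - 1) \<xi>) \<union> csimp (n' - 1) (act ?F n (n' - 1) \<xi>)"
      using \<tau> csimp_add[of "n' - 1" "act B n (n' - 1) \<xi>" "act ?F n (n' - 1) \<xi>"] by auto
    then show ?thesis
    proof
      assume "\<tau> \<in> csimp (n' - 1) (act B n (n' - 1) \<xi>)"
      then show ?thesis
        by (rule allow[OF _ B[OF _ 1]]) (use \<xi> n' 1 in \<open>auto simp: IC_iff\<close>)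
    qed (use F in blast)
  qed
  moreover have "allowable n' \<tau>" if "\<tau> \<in> csimp n' (act A n n' \<xi>)" for \<tau>
    by (rule allow[OF that good n']) (use \<xi> in \<open>auto simp: IC_iff\<close>)
  ultimately show ?thesis using act_closed[OF A ch] by (auto simp: IC_iff)
qed

end

context intersection_setting
begin

lemma act_linear:
  assumes A: "affine_op A n n'" and closed: "\<And>\<xi>. \<xi> \<in> carrier (IC (int n)) \<Longrightarrow> act A n n' \<xi> \<in> carrier (IC (int n'))"
  shows "act A n n' \<in> linear_maps R (IC (int n)) (IC (int n'))"
  unfolding linear_maps_def
  using act_add[OF A IC_chains IC_chains] act_smult[OF A IC_chains] closed by auto

lemma zero_linear: "(\<lambda>_. \<zero>\<^bsub>IC i'\<^esub>) \<in> linear_maps R (IC i) (IC i')"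
proof -
  interpret left_module R "IC i'" by (rule IC_left_module)
  show ?thesis unfolding linear_maps_def using smult_zero_right by (auto simp del: IC_ops)
qed

lemma linear_maps_closed: "f \<in> linear_maps R M M' \<Longrightarrow> x \<in> carrier M \<Longrightarrow> f x \<in> carrier M'"
  by (auto simp: linear_maps_def)

lemma support_neg: "i < 0 \<Longrightarrow> support i \<xi> = {}"
  by (simp add: chain_support_def chain_simplices_def simplices_def)

lemma boundary_IC: "\<xi> \<in> carrier (IC (int n)) \<Longrightarrow> 1 \<le> n \<Longrightarrow> boundary_map (int n) \<xi> \<in> carrier (IC (int (n - 1)))"
proof -
  assume \<xi>: "\<xi> \<in> carrier (IC (int n))" and n: "1 \<le> n"
  note ch = IC_chains[OF \<xi>]
  have "csimp (n - 1 - 1) (boundary_map (int (n - 1)) (boundary_map (int n) \<xi>)) = {}" if "1 \<le> n - 1"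
    using csimp_boundary_boundary[of n \<xi>] ch that by (simp add: numeral_2_eq_2)
  then show ?thesis
    using \<xi> n boundary_closed[OF n ch] unfolding IC_iff[of _ "n - 1"] IC_iff[of _ n] by auto
qed

lemma boundary_linear: "boundary_map i \<in> linear_maps R (IC i) (IC (i - 1))"
proof (cases "1 \<le> i")
  case True
  then obtain n where i: "i = int n" and n: "1 \<le> n" using nonneg_eq_int[of i] by auto
  have e: "int n - 1 = int (n - 1)" using n by simp
  show ?thesis
    unfolding linear_maps_def i e
    using boundary_add[OF n IC_chains IC_chains] boundary_smult[OF n IC_chains] boundary_IC[OF _ n] by auto
next
  case False
  then have u: "\<xi> = (\<lambda>_. undefined)" if "\<xi> \<in> carrier (IC (i - 1))" for \<xi>
    using that by (simp add: IC_neg)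
  have c: "boundary_map i \<xi> \<in> carrier (IC (i - 1))" for \<xi>
    using False by (simp add: boundary_nonpos IC_neg)
  interpret left_module R "IC (i - 1)" by (rule IC_left_module)
  show ?thesis
    unfolding linear_maps_def
    by (auto simp: c simp del: IC_ops intro!: IC_neg_eq[of "i - 1"] smult_closed) (use False in auto)
qed

lemma support_boundary: "\<xi> \<in> carrier (IC i) \<Longrightarrow> support (i - 1) (boundary_map i \<xi>) \<subseteq> support i \<xi>"
proof (cases "1 \<le> i")
  case True
  then obtain n where i: "i = int n" and n: "1 \<le> n" using nonneg_eq_int[of i] by auto
  have e: "int n - 1 = int (n - 1)" using n by simp
  assume "\<xi> \<in> carrier (IC i)"
  then show ?thesis
    unfolding i e using support_act[OF affine_op_faces[OF n], of \<xi>] boundary_eq_act[OF n IC_chains] by simp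
qed (simp add: support_neg)

text \<open>\<open>E\<close> is indexed by sets of labels because the covering may be infinite. The
  operator of all labels is not built as a sum; it can be split along any partition, and only on
  stalks does a finite sum over single labels appear.\<close>

proposition subdivision_homotopy:
  fixes U :: "'i \<Rightarrow> 'a set"
  assumes U: "\<And>k. k \<in> I \<Longrightarrow> openin X (U k)" "(\<Union>k\<in>I. U k) = topspace X"
  obtains E :: "'i set \<Rightarrow> int \<Rightarrow> ('a, 'e) coeff_chain \<Rightarrow> ('a, 'e) coeff_chain"
    and H :: "int \<Rightarrow> ('a, 'e) coeff_chain \<Rightarrow> ('a, 'e) coeff_chain"
  where "\<And>Q i. E Q i \<in> linear_maps R (IC i) (IC i)"
    and "\<And>i. H i \<in> linear_maps R (IC i) (IC (i + 1))"
    and "\<And>Q i \<xi>. \<xi> \<in> carrier (IC i) \<Longrightarrow> support i (E Q i \<xi>) \<subseteq> support i \<xi>"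
    and "\<And>i \<xi>. \<xi> \<in> carrier (IC i) \<Longrightarrow> support (i + 1) (H i \<xi>) \<subseteq> support i \<xi>"
    and "\<And>Q i \<xi>. \<xi> \<in> carrier (IC i) \<Longrightarrow> support i (E Q i \<xi>) \<subseteq> (\<Union>l\<in>Q \<inter> I. U l)"
    and "\<And>Q Q' i \<xi>. \<xi> \<in> carrier (IC i) \<Longrightarrow> Q \<inter> Q' = {} \<Longrightarrow> E (Q \<union> Q') i \<xi> = E Q i \<xi> \<oplus>\<^bsub>IC i\<^esub> E Q' i \<xi>"
    and "\<And>i \<xi>. \<xi> \<in> carrier (IC i) \<Longrightarrow>
          \<xi> = E UNIV i \<xi> \<oplus>\<^bsub>IC i\<^esub> (boundary_map (i + 1) (H i \<xi>) \<oplus>\<^bsub>IC i\<^esub> H (i - 1) (boundary_map i \<xi>))"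
proof -
  note One_nat_def [simp del]
  obtain e B :: "'i set \<Rightarrow> nat \<Rightarrow> ((nat \<Rightarrow> real) \<Rightarrow> 'a) \<Rightarrow> (nat \<Rightarrow> real) list \<Rightarrow>\<^sub>0 int"
    and D :: "nat \<Rightarrow> ((nat \<Rightarrow> real) \<Rightarrow> 'a) \<Rightarrow> (nat \<Rightarrow> real) list \<Rightarrow>\<^sub>0 int"
  where e_good: "\<And>Q n \<sigma> xs. singular_simplex n X \<sigma> \<Longrightarrow> xs \<in> Poly_Mapping.keys (e Q n \<sigma>) \<Longrightarrow> good n 0 xs"
    and e_U: "\<And>Q n \<sigma> xs. singular_simplex n X \<sigma> \<Longrightarrow> xs \<in> Poly_Mapping.keys (e Q n \<sigma>) \<Longrightarrow>
          \<exists>l\<in>Q \<inter> I. \<forall>t\<in>standard_simplex n. \<sigma> (bary xs t) \<in> U l"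
    and B_good: "\<And>Q n \<sigma> xs. singular_simplex n X \<sigma> \<Longrightarrow> xs \<in> Poly_Mapping.keys (B Q n \<sigma>) \<Longrightarrow> good n (-1) xs"
    and D_good: "\<And>n \<sigma> xs. singular_simplex n X \<sigma> \<Longrightarrow> xs \<in> Poly_Mapping.keys (D n \<sigma>) \<Longrightarrow> good n 1 xs"
    and bd_e: "\<And>Q n \<sigma>. singular_simplex n X \<sigma> \<Longrightarrow> 1 \<le> n \<Longrightarrow>
          bd (e Q n \<sigma>) = face_sum simplical_face (e Q) n \<sigma> + B Q n \<sigma>"
    and bd_D: "\<And>n \<sigma>. singular_simplex n X \<sigma> \<Longrightarrow> 1 \<le> n \<Longrightarrow>
          bd (D n \<sigma>) = frag_of (vertices n) - e UNIV n \<sigma> - face_sum simplical_face D n \<sigma>"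
    and D0: "\<And>\<sigma>. singular_simplex 0 X \<sigma> \<Longrightarrow> D 0 \<sigma> = 0"
    and e0: "\<And>\<sigma>. singular_simplex 0 X \<sigma> \<Longrightarrow> e UNIV 0 \<sigma> = frag_of (vertices 0)"
    and e_Un: "\<And>Q Q' n \<sigma>. Q \<inter> Q' = {} \<Longrightarrow> e (Q \<union> Q') n \<sigma> = e Q n \<sigma> + e Q' n \<sigma>"
    using subdivision_operators[of I X U, OF U] by blast
  have good_affine: "affine_simplex m m' xs" if "good m d xs" "int m' = int m + d" for m m' d xs
    using that by (auto simp: good_def affine_simplex_def)
  have e_aff: "affine_op (e Q) n n" for Q n
    unfolding affine_op_def by (intro allI impI good_affine[OF e_good]) simp_all
  have D_aff: "affine_op D n (Suc n)" for n
    unfolding affine_op_def by (intro allI impI good_affine[OF D_good]) simp_all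
  \<comment> \<open>The defect \<open>B Q\<close> consists of link pieces, whose bound -1 is the one
    that \<open>act_IC\<close> demands for d = 0.\<close>
  have e_IC: "act (e Q) n n \<xi> \<in> carrier (IC (int n))" if "\<xi> \<in> carrier (IC (int n))" for Q n \<xi>
  proof (rule act_IC[where d=0 and B="B Q" and A'="e Q", OF e_good _ that])
    show "bd (e Q n \<sigma>) = B Q n \<sigma> + (if 1 \<le> n then face_sum simplical_face (e Q) n \<sigma> else 0)"
      if "singular_simplex n X \<sigma>" "1 \<le> n" for \<sigma>
      using bd_e[OF that] that(2) by (simp add: add.commute)
    show "good n (0 - 1) xs" if "singular_simplex n X \<sigma>" "xs \<in> Poly_Mapping.keys (B Q n \<sigma>)" for \<sigma> xs
      using B_good[OF that] by simp
    show "good (n - 1) 0 xs" if "singular_simplex (n - 1) X \<sigma>" "xs \<in> Poly_Mapping.keys (e Q (n - 1) \<sigma>)" for \<sigma> xs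
      using e_good[OF that] .
  qed simp_all
  \<comment> \<open>The homotopy formula is read as a formula for the boundary of \<open>D\<close>:
    the identity minus \<open>e UNIV\<close> takes the role of \<open>B\<close>, and the face terms
    enter with a minus sign. In degree 0 everything vanishes, as \<open>D\<close> does.\<close>
  have D_IC: "act D n (Suc n) \<xi> \<in> carrier (IC (int (Suc n)))" if "\<xi> \<in> carrier (IC (int n))" for n \<xi>
  proof (rule act_IC[where d=1 and A'="\<lambda>n \<sigma>. - D n \<sigma>" and
      B="\<lambda>n \<sigma>. if 1 \<le> n then frag_of (vertices n) - e UNIV n \<sigma> else 0", OF D_good _ that])
    have "face_sum simplical_face (\<lambda>n \<sigma>. - D n \<sigma>) n \<sigma> = - face_sum simplical_face D n \<sigma>" for \<sigma>
      using face_sum_diff[of simplical_face "\<lambda>n \<sigma>. 0" D n \<sigma>] by (simp add: face_sum_def)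
    then show "bd (D n \<sigma>) = (if 1 \<le> n then frag_of (vertices n) - e UNIV n \<sigma> else 0) +
        (if 1 \<le> n then face_sum simplical_face (\<lambda>n \<sigma>. - D n \<sigma>) n \<sigma> else 0)"
      if "singular_simplex n X \<sigma>" for \<sigma>
      using bd_D[OF that] D0[of \<sigma>] that by (cases n) auto
    show "good n (1 - 1) xs" if "singular_simplex n X \<sigma>" 
      "xs \<in> Poly_Mapping.keys (if 1 \<le> n then frag_of (vertices n) - e UNIV n \<sigma> else 0)" for \<sigma> xs
    proof -
      have "xs \<in> Poly_Mapping.keys (frag_of (vertices n) - e UNIV n \<sigma>)" using that(2) by (auto split: if_splits)
      from keys_diff'[OF this] show ?thesis using e_good[OF that(1)] good_vertices by (auto simp: keys_frag_of)
    qed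
    show "good (n - 1) 1 xs" if "singular_simplex (n - 1) X \<sigma>" "xs \<in> Poly_Mapping.keys (- D (n - 1) \<sigma>)" for \<sigma> xs
      using D_good[OF that(1)] that(2) by simp
  qed simp_all
  define E where "E = (\<lambda>Q i. if 0 \<le> i then act (e Q) (nat i) (nat i) else (\<lambda>\<xi>. \<xi>))"
  \<comment> \<open>From degree -1 the map goes to the 0-chains, a module that need not vanish, so
    its zero is the right default. The default of \<open>E\<close> acts on a zero module.\<close>
  define H where "H = (\<lambda>i. if 0 \<le> i then act D (nat i) (Suc (nat i)) else (\<lambda>\<xi>. \<zero>\<^bsub>IC (i + 1)\<^esub>))"
  have E_nat: "E Q (int n) = act (e Q) n n" for Q n by (simp add: E_def)
  have H_nat: "H (int n) = act D n (Suc n)" for n by (simp add: H_def)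
  have int_cases: "(\<exists>n. i = int n) \<or> i < 0" for i by (metis nonneg_eq_int not_le)
  have E_lin: "E Q i \<in> linear_maps R (IC i) (IC i)" for Q i
    using int_cases[of i]
  proof (elim disjE exE)
    fix n assume i: "i = int n"
    show ?thesis unfolding i E_nat by (rule act_linear[OF e_aff e_IC])
  next
    assume "i < 0"
    then show ?thesis by (simp add: E_def linear_maps_def)
  qed
  have H_lin: "H i \<in> linear_maps R (IC i) (IC (i + 1))" for i
    using int_cases[of i]
  proof (elim disjE exE)
    fix n assume i: "i = int n"
    have s: "int n + 1 = int (Suc n)" by simp
    show ?thesis unfolding i H_nat s by (rule act_linear[OF D_aff D_IC])
  next
    assume "i < 0"
    then show ?thesis using zero_linear[of "i + 1" i] by (simp add: H_def del: IC_ops)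
  qed
  have homotopy: "\<xi> = E UNIV i \<xi> \<oplus>\<^bsub>IC i\<^esub> (boundary_map (i + 1) (H i \<xi>) \<oplus>\<^bsub>IC i\<^esub> H (i - 1) (boundary_map i \<xi>))"
    if \<xi>: "\<xi> \<in> carrier (IC i)" for i \<xi>
  proof -
    interpret L: left_module R "IC i" by (rule IC_left_module)
    have c1: "E UNIV i \<xi> \<in> carrier (IC i)" by (rule linear_maps_closed[OF E_lin \<xi>])
    have c2: "boundary_map (i + 1) (H i \<xi>) \<in> carrier (IC i)"
      using linear_maps_closed[OF boundary_linear linear_maps_closed[OF H_lin \<xi>]] by simp
    have c3: "H (i - 1) (boundary_map i \<xi>) \<in> carrier (IC i)"
      using linear_maps_closed[OF H_lin linear_maps_closed[OF boundary_linear \<xi>]] by simp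
    consider n where "i = int n" "1 \<le> n" | "i = 0" | "i < 0"
      using int_cases[of i] by (metis One_nat_def Suc_leI int_eq_iff_numeral neq0_conv of_nat_0)
    then show ?thesis
    proof cases
      case (1 n)
      note i = 1(1) and n = 1(2)
      have ch: "\<xi> \<in> carrier (chains n)" using \<xi> i by (simp add: IC_chains)
      have im: "i - 1 = int (n - 1)" "i + 1 = int (Suc n)" using i n by auto
      have Suc_n: "Suc (n - 1) = n" using n by simp
      have D_aff': "affine_op D (n - 1) n" using D_aff[of "n - 1"] Suc_n by simp
      have "\<xi> = act (\<lambda>n \<sigma>. frag_of (vertices n)) n n \<xi>" by (rule act_vertices[OF ch, symmetric])
      also have "\<dots> = act (\<lambda>n \<sigma>. e UNIV n \<sigma> + (bd (D n \<sigma>) + face_sum simplical_face D n \<sigma>)) n n \<xi>"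
        by (rule act_cong) (simp add: bd_D n)
      also have "\<dots> = act (e UNIV) n n \<xi> \<oplus>\<^bsub>chains n\<^esub> act (\<lambda>n \<sigma>. bd (D n \<sigma>) + face_sum simplical_face D n \<sigma>) n n \<xi>"
      proof (rule act_plus[OF e_aff _ ch])
        show "affine_op (\<lambda>n \<sigma>. bd (D n \<sigma>) + face_sum simplical_face D n \<sigma>) n n"
          using boundary_act(2)[OF D_aff _ ch] act_boundary(2)[OF D_aff' n ch]
          unfolding affine_op_def by (auto dest!: keys_add')
      qed
      also have "act (\<lambda>n \<sigma>. bd (D n \<sigma>) + face_sum simplical_face D n \<sigma>) n n \<xi>
          = act (\<lambda>n \<sigma>. bd (D n \<sigma>)) n n \<xi> \<oplus>\<^bsub>chains n\<^esub> act (face_sum simplical_face D) n n \<xi>"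
        using boundary_act(2)[OF D_aff _ ch] act_boundary(2)[OF D_aff' n ch] by (intro act_plus ch) auto
      also have "act (\<lambda>n \<sigma>. bd (D n \<sigma>)) n n \<xi> = boundary_map (int (Suc n)) (act D n (Suc n) \<xi>)"
        using boundary_act(1)[OF D_aff _ ch] by simp
      also have "act (face_sum simplical_face D) n n \<xi> = act D (n - 1) n (boundary_map (int n) \<xi>)"
        by (rule act_boundary(1)[OF D_aff' n ch, symmetric])
      finally show ?thesis
        unfolding im unfolding i E_nat H_nat Suc_n by simp
    next
      \<comment> \<open>In degree 0 the operator \<open>e UNIV\<close> is the identity and
        \<open>D\<close> is 0; the remaining term is the default value of \<open>H\<close> in degree
        -1.\<close>
      case 2
      then have i: "i = int 0" by simp
      have ch: "\<xi> \<in> carrier (chains 0)" using \<xi> unfolding i by (rule IC_chains)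
      have "E UNIV i \<xi> = act (\<lambda>n \<sigma>. frag_of (vertices n)) 0 0 \<xi>"
        unfolding i E_nat by (rule act_cong) (rule e0)
      then have "E UNIV i \<xi> = \<xi>" using act_vertices[OF ch] by simp
      moreover have "boundary_map (i + 1) (H i \<xi>) = \<zero>\<^bsub>IC i\<^esub>"
      proof -
        have s: "int 0 + 1 = int (Suc 0)" by simp
        have eq: "boundary_map (i + 1) (H i \<xi>) = act (\<lambda>n \<sigma>. bd (D n \<sigma>)) 0 0 \<xi>"
          unfolding i s H_nat using boundary_act(1)[OF D_aff _ ch] by simp
        have empty: "csimp 0 (act (\<lambda>n \<sigma>. bd (D n \<sigma>)) 0 0 \<xi>) = {}"
          by (rule csimp_zero_op) (simp add: D0)
        from c2 have "act (\<lambda>n \<sigma>. bd (D n \<sigma>)) 0 0 \<xi> \<in> carrier (chains 0)"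
          unfolding eq unfolding i by (rule IC_chains)
        from csimp_empty_eq_zero[OF this empty] show ?thesis
          unfolding eq unfolding i IC_ops .
      qed
      moreover have "H (i - 1) (boundary_map i \<xi>) = \<zero>\<^bsub>IC i\<^esub>"
        using 2 by (simp add: H_def)
      ultimately show ?thesis using \<xi> by (simp del: IC_ops)
    next
      case 3
      show ?thesis by (rule IC_neg_eq[OF 3 \<xi>]) (simp del: IC_ops add: c1 c2 c3)
    qed
  qed
  show thesis
  proof (rule that[of E H])
    show "support i (E Q i \<xi>) \<subseteq> support i \<xi>" for Q i \<xi>
      using int_cases[of i]
    proof (elim disjE exE)
      fix n assume i: "i = int n"
      show ?thesis unfolding i E_nat by (rule support_act[OF e_aff])
    qed (simp add: support_neg)
    show "support (i + 1) (H i \<xi>) \<subseteq> support i \<xi>" if \<xi>: "\<xi> \<in> carrier (IC i)" for i \<xi>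
      using int_cases[of i]
    proof (elim disjE exE)
      fix n assume i: "i = int n"
      have s: "int n + 1 = int (Suc n)" by simp
      show ?thesis unfolding i H_nat s by (rule support_act[OF D_aff])
    next
      assume i: "i < 0"
      show ?thesis
      proof (cases "i + 1 < 0")
        case False
        then have "i + 1 = int 0" using i by simp
        moreover have "H i \<xi> = \<zero>\<^bsub>chains 0\<^esub>" using i calculation by (simp add: H_def)
        ultimately show ?thesis by (simp only: support_nat csimp_zero) simp
      qed (simp add: support_neg)
    qed
    show "support i (E Q i \<xi>) \<subseteq> (\<Union>l\<in>Q \<inter> I. U l)" for Q i \<xi>
      using int_cases[of i]
    proof (elim disjE exE)
      fix n assume i: "i = int n"
      show ?thesis
      proof
        fix x assume "x \<in> support i (E Q i \<xi>)"
        then obtain \<tau> t where \<tau>: "\<tau> \<in> csimp n (act (e Q) n n \<xi>)" "t \<in> standard_simplex n" "x = \<tau> t"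
          by (auto simp: i E_nat support_nat)
        obtain \<sigma> xs where \<sigma>: "\<sigma> \<in> csimp n \<xi>" "xs \<in> Poly_Mapping.keys (e Q n \<sigma>)" "\<tau> = simplex_comp n \<sigma> xs"
          using csimp_act[OF \<tau>(1)] by blast
        have "singular_simplex n X \<sigma>" using \<sigma>(1) by (simp add: csimp_iff)
        from e_U[OF this \<sigma>(2)] \<tau>(2,3) \<sigma>(3) show "x \<in> (\<Union>l\<in>Q \<inter> I. U l)"
          by (auto simp: simplex_comp_def)
      qed
    qed (simp add: support_neg)
    show "E (Q \<union> Q') i \<xi> = E Q i \<xi> \<oplus>\<^bsub>IC i\<^esub> E Q' i \<xi>"
      if \<xi>: "\<xi> \<in> carrier (IC i)" and Q: "Q \<inter> Q' = {}" for Q Q' i \<xi>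
      using int_cases[of i]
    proof (elim disjE exE)
      fix n assume i: "i = int n"
      have "act (e (Q \<union> Q')) n n \<xi> = act (\<lambda>n \<sigma>. e Q n \<sigma> + e Q' n \<sigma>) n n \<xi>"
        by (rule act_cong) (rule e_Un[OF Q])
      also have "\<dots> = act (e Q) n n \<xi> \<oplus>\<^bsub>chains n\<^esub> act (e Q') n n \<xi>"
        using \<xi> i by (intro act_plus e_aff) (simp add: IC_chains)
      finally show ?thesis by (simp add: i E_nat)
    next
      assume i: "i < 0"
      interpret L: left_module R "IC i" by (rule IC_left_module)
      show ?thesis
        by (rule IC_neg_eq[OF i]) (simp_all del: IC_ops add: linear_maps_closed[OF E_lin \<xi>])
    qed
  qed (fact E_lin H_lin homotopy)+
qed

end

section \<open>Sheafification of a presheaf of quotients of a constant presheaf\<close>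

text \<open>In the application \<open>C j\<close> consists of all intersection chains and
  \<open>N j U\<close> of those supported off the closure of \<open>U\<close>; shrinking
  \<open>U\<close> enlarges \<open>N j U\<close>, which makes the quotient maps
  restrictions.\<close>

locale quotient_presheaf =
  fixes X :: "'a topology" and R :: "'r ring" and C :: "int \<Rightarrow> ('r, 'm) module"
    and N :: "int \<Rightarrow> 'a set \<Rightarrow> 'm set" and P :: "('a, 'r, 'm set) dg_presheaf"
  assumes C_module: "left_module R (C j)"
    and N_subset: "N j U \<subseteq> carrier (C j)"
    and N_zero: "\<zero>\<^bsub>C j\<^esub> \<in> N j U"
    and N_add: "x \<in> N j U \<Longrightarrow> y \<in> N j U \<Longrightarrow> x \<oplus>\<^bsub>C j\<^esub> y \<in> N j U"
    and N_smult: "r \<in> carrier R \<Longrightarrow> x \<in> N j U \<Longrightarrow> r \<odot>\<^bsub>C j\<^esub> x \<in> N j U"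
    and N_mono: "openin X U \<Longrightarrow> openin X V \<Longrightarrow> V \<subseteq> U \<Longrightarrow> N j U \<subseteq> N j V"
    and sections_P: "sections P j U = quotient_module (C j) (N j U)"
    and restr_P: "restr P j U V = quotient_map_to (C j) (N j V) (\<lambda>c. c)"
begin

definition cls :: "int \<Rightarrow> 'a set \<Rightarrow> 'm \<Rightarrow> 'm set" where
  "cls j U x = N j U +>\<^bsub>C j\<^esub> x"

lemma N_uminus: "x \<in> N j U \<Longrightarrow> \<ominus>\<^bsub>C j\<^esub> x \<in> N j U"
proof -
  assume x: "x \<in> N j U"
  interpret left_module R "C j" by (rule C_module)
  have xc: "x \<in> carrier (C j)" using x N_subset by blast
  have "\<ominus>\<^bsub>C j\<^esub> x = (\<ominus>\<^bsub>R\<^esub> \<one>\<^bsub>R\<^esub>) \<odot>\<^bsub>C j\<^esub> x"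
    using smult_minus_one[OF xc] xc by (intro M.minus_equality) (auto intro: smult_closed)
  then show ?thesis using N_smult[OF _ x, of "\<ominus>\<^bsub>R\<^esub> \<one>\<^bsub>R\<^esub>"] by simp
qed

lemma N_subgroup: "subgroup (N j U) (add_monoid (C j))"
proof
  show "inv\<^bsub>add_monoid (C j)\<^esub> x \<in> N j U" if "x \<in> N j U" for x
    using N_uminus[OF that] by (simp add: a_inv_def)
qed (use N_subset N_zero N_add in auto)

lemma N_abelian_subgroup: "abelian_subgroup (N j U) (C j)"
proof -
  interpret left_module R "C j" by (rule C_module)
  show ?thesis by (rule abelian_subgroupI3[OF additive_subgroup.intro[OF N_subgroup] M.abelian_group_axioms])
qed

lemma cls_self: "x \<in> carrier (C j) \<Longrightarrow> x \<in> cls j U x"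
  unfolding cls_def by (rule abelian_subgroup.a_rcos_self[OF N_abelian_subgroup])

lemma cls_memD: "y \<in> cls j U x \<Longrightarrow> \<exists>h\<in>N j U. y = h \<oplus>\<^bsub>C j\<^esub> x"
  by (auto simp: cls_def a_r_coset_def')

lemma cls_absorb: "h \<in> N j U \<Longrightarrow> x \<in> carrier (C j) \<Longrightarrow> cls j U (h \<oplus>\<^bsub>C j\<^esub> x) = cls j U x"
proof -
  assume h: "h \<in> N j U" and x: "x \<in> carrier (C j)"
  have "h \<oplus>\<^bsub>C j\<^esub> x \<in> N j U +>\<^bsub>C j\<^esub> x" using h by (auto simp: a_r_coset_def')
  interpret left_module R "C j" by (rule C_module)
  from M.a_repr_independence[OF \<open>h \<oplus>\<^bsub>C j\<^esub> x \<in> N j U +>\<^bsub>C j\<^esub> x\<close> x N_subgroup]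
  show ?thesis by (simp add: cls_def)
qed

lemma cls_add:
  "x \<in> carrier (C j) \<Longrightarrow> y \<in> carrier (C j) \<Longrightarrow> cls j U x <+>\<^bsub>C j\<^esub> cls j U y = cls j U (x \<oplus>\<^bsub>C j\<^esub> y)"
  unfolding cls_def by (rule abelian_subgroup.a_rcos_sum[OF N_abelian_subgroup])

lemma cls_map:
  assumes f: "f \<in> linear_maps R (C j) (C j')" and fN: "\<And>h. h \<in> N j U \<Longrightarrow> f h \<in> N j' V"
    and x: "x \<in> carrier (C j)"
  shows "quotient_map_to (C j') (N j' V) f (cls j U x) = cls j' V (f x)"
proof -
  have "N j' V +>\<^bsub>C j'\<^esub> f y = cls j' V (f x)" if y: "y \<in> cls j U x" for y
  proof -
    obtain h where h: "h \<in> N j U" "y = h \<oplus>\<^bsub>C j\<^esub> x" using cls_memD[OF y] by blast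
    have hc: "h \<in> carrier (C j)" using h(1) N_subset by blast
    have "f y = f h \<oplus>\<^bsub>C j'\<^esub> f x" using f h(2) hc x by (simp add: linear_maps_def)
    moreover have "f x \<in> carrier (C j')" using f x by (auto simp: linear_maps_def)
    ultimately show ?thesis using cls_absorb[OF fN[OF h(1)]] by (simp add: cls_def)
  qed
  then show ?thesis unfolding quotient_map_to_def using cls_self[OF x, of U] by blast
qed

lemma id_linear: "(\<lambda>c. c) \<in> linear_maps R (C j) (C j)"
  by (simp add: linear_maps_def)

lemma restr_cls:
  "openin X U \<Longrightarrow> openin X V \<Longrightarrow> V \<subseteq> U \<Longrightarrow> x \<in> carrier (C j) \<Longrightarrow> restr P j U V (cls j U x) = cls j V x"
  unfolding restr_P by (rule cls_map[OF id_linear]) (use N_mono in blast)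

lemma cls_mono:
  assumes "openin X U" "openin X V" "V \<subseteq> U" "x \<in> carrier (C j)" "y \<in> carrier (C j)" "cls j U x = cls j U y"
  shows "cls j V x = cls j V y"
  using restr_cls[OF assms(1-3), of _ j] assms(4-6) by metis

lemma carrier_sections_P: "carrier (sections P j U) = cls j U ` carrier (C j)"
  by (auto simp: sections_P quotient_module_def A_RCOSETS_def' cls_def)

lemma sections_P_zero: "\<zero>\<^bsub>sections P j U\<^esub> = cls j U \<zero>\<^bsub>C j\<^esub>"
proof -
  interpret left_module R "C j" by (rule C_module)
  show ?thesis using M.a_coset_add_zero[OF N_subset, of U] by (simp add: sections_P quotient_module_def cls_def)
qed

lemma sections_P_add:
  "x \<in> carrier (C j) \<Longrightarrow> y \<in> carrier (C j) \<Longrightarrow>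
    cls j U x \<oplus>\<^bsub>sections P j U\<^esub> cls j U y = cls j U (x \<oplus>\<^bsub>C j\<^esub> y)"
  by (simp add: sections_P quotient_module_def cls_add)

lemma sections_P_smult:
  assumes r: "r \<in> carrier R" and x: "x \<in> carrier (C j)"
  shows "r \<odot>\<^bsub>sections P j U\<^esub> cls j U x = cls j U (r \<odot>\<^bsub>C j\<^esub> x)"
proof -
  interpret left_module R "C j" by (rule C_module)
  have "N j U +>\<^bsub>C j\<^esub> (r \<odot>\<^bsub>C j\<^esub> y) = cls j U (r \<odot>\<^bsub>C j\<^esub> x)" if "y \<in> cls j U x" for y
  proof -
    obtain h where h: "h \<in> N j U" "y = h \<oplus>\<^bsub>C j\<^esub> x" using cls_memD[OF \<open>y \<in> cls j U x\<close>] by blast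
    have hc: "h \<in> carrier (C j)" using h(1) N_subset by blast
    have "r \<odot>\<^bsub>C j\<^esub> y = r \<odot>\<^bsub>C j\<^esub> h \<oplus>\<^bsub>C j\<^esub> r \<odot>\<^bsub>C j\<^esub> x" using h(2) hc x r by (simp add: smult_r_distr)
    then show ?thesis using cls_absorb[OF N_smult[OF r h(1)], of "r \<odot>\<^bsub>C j\<^esub> x"] r x by (simp add: cls_def smult_closed)
  qed
  moreover have "r \<odot>\<^bsub>sections P j U\<^esub> cls j U x = (\<Union>y\<in>cls j U x. N j U +>\<^bsub>C j\<^esub> (r \<odot>\<^bsub>C j\<^esub> y))"
    by (simp add: sections_P quotient_module_def)
  ultimately show ?thesis using cls_self[OF x, of U] by auto
qed

text \<open>Every germ of the presheaf comes from a global element; this is the germ of \<open>c\<close>.\<close>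

definition germ_P :: "int \<Rightarrow> 'a \<Rightarrow> 'm \<Rightarrow> ('a set \<times> 'm set) set" where
  "germ_P j x c = {(V, t). openin X V \<and> x \<in> V \<and> (\<exists>d\<in>carrier (C j). t = cls j V d
     \<and> (\<exists>W. openin X W \<and> x \<in> W \<and> W \<subseteq> V \<and> cls j W c = cls j W d))}"

lemma germ_cls:
  assumes U: "openin X U" "x \<in> U" and c: "c \<in> carrier (C j)"
  shows "germ X P j x U (cls j U c) = germ_P j x c"
proof (intro equalityI subsetI)
  fix p assume "p \<in> germ X P j x U (cls j U c)"
  then obtain V d W where p: "p = (V, cls j V d)" and V: "openin X V" "x \<in> V" and d: "d \<in> carrier (C j)"
    and W: "openin X W" "x \<in> W" "W \<subseteq> U \<inter> V" "restr P j U W (cls j U c) = restr P j V W (cls j V d)"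
    unfolding germ_def carrier_sections_P by blast
  have "cls j W c = cls j W d"
    using W(4) restr_cls[OF U(1) W(1) _ c] restr_cls[OF V(1) W(1) _ d] W(3) by simp
  then show "p \<in> germ_P j x c" unfolding germ_P_def p using V d W by blast
next
  fix p assume "p \<in> germ_P j x c"
  then obtain V d W where p: "p = (V, cls j V d)" and V: "openin X V" "x \<in> V" and d: "d \<in> carrier (C j)"
    and W: "openin X W" "x \<in> W" "W \<subseteq> V" "cls j W c = cls j W d"
    unfolding germ_P_def by blast
  have WU: "openin X (W \<inter> U)" using W(1) U(1) by blast
  have "cls j (W \<inter> U) c = cls j (W \<inter> U) d" by (rule cls_mono[OF W(1) WU _ c d W(4)]) simp
  moreover have "W \<inter> U \<subseteq> U" "W \<inter> U \<subseteq> V" using W(3) by auto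
  ultimately have "restr P j U (W \<inter> U) (cls j U c) = restr P j V (W \<inter> U) (cls j V d)"
    using restr_cls[OF U(1) WU _ c] restr_cls[OF V(1) WU _ d] by simp
  moreover have "x \<in> W \<inter> U" "W \<inter> U \<subseteq> U \<inter> V" using W U(2) by auto
  ultimately show "p \<in> germ X P j x U (cls j U c)"
    unfolding germ_def p carrier_sections_P using V d WU by blast
qed

lemma germ_P_eqI:
  assumes c: "c \<in> carrier (C j)" and d: "d \<in> carrier (C j)"
    and W: "openin X W" "x \<in> W" "cls j W c = cls j W d"
  shows "germ_P j x c = germ_P j x d"
proof -
  have "germ_P j x c \<subseteq> germ_P j x d" if c: "c \<in> carrier (C j)" and d: "d \<in> carrier (C j)" and e: "cls j W c = cls j W d" for c d
  proof
    fix p assume "p \<in> germ_P j x c"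
    then obtain V d' W' where p: "p = (V, cls j V d')" and V: "openin X V" "x \<in> V" and d': "d' \<in> carrier (C j)"
      and W': "openin X W'" "x \<in> W'" "W' \<subseteq> V" "cls j W' c = cls j W' d'"
      unfolding germ_P_def by blast
    have o: "openin X (W' \<inter> W)" using W'(1) W(1) by blast
    have "cls j (W' \<inter> W) c = cls j (W' \<inter> W) d'" by (rule cls_mono[OF W'(1) o _ c d' W'(4)]) simp
    moreover have "cls j (W' \<inter> W) c = cls j (W' \<inter> W) d" by (rule cls_mono[OF W(1) o _ c d e]) simp
    ultimately have "cls j (W' \<inter> W) d = cls j (W' \<inter> W) d'" by simp
    moreover have "x \<in> W' \<inter> W" "W' \<inter> W \<subseteq> V" using W W' by auto
    ultimately show "p \<in> germ_P j x d" unfolding germ_P_def p using V d' o by blast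
  qed
  from this[OF c d W(3)] this[OF d c W(3)[symmetric]] show ?thesis by blast
qed

text \<open>The germ of \<open>c\<close> contains the class of \<open>c\<close> over the whole
  space. Its membership in the germ of \<open>d\<close> yields a neighbourhood on which the classes
  agree.\<close>

lemma germ_P_eqD:
  assumes x: "x \<in> topspace X" and c: "c \<in> carrier (C j)" and d: "d \<in> carrier (C j)" and e: "germ_P j x c = germ_P j x d"
  shows "\<exists>W. openin X W \<and> x \<in> W \<and> cls j W c = cls j W d"
proof -
  have "(topspace X, cls j (topspace X) c) \<in> germ_P j x c"
    unfolding germ_P_def using x c by (auto intro!: exI[of _ "topspace X"])
  with e obtain d' W where d': "d' \<in> carrier (C j)" "cls j (topspace X) c = cls j (topspace X) d'"
    and W: "openin X W" "x \<in> W" "cls j W d = cls j W d'" unfolding germ_P_def by auto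
  have "cls j W c = cls j W d'"
    by (rule cls_mono[OF openin_topspace W(1) openin_subset[OF W(1)] c d'(1) d'(2)])
  with W show ?thesis by auto
qed

lemma germ_P_mem:
  assumes "p \<in> germ_P j x c" and c: "c \<in> carrier (C j)"
  obtains V d where "p = (V, cls j V d)" "openin X V" "x \<in> V" "d \<in> carrier (C j)" "germ_P j x d = germ_P j x c"
proof -
  obtain V d W where p: "p = (V, cls j V d)" and V: "openin X V" "x \<in> V" and d: "d \<in> carrier (C j)"
      and W: "openin X W" "x \<in> W" "cls j W c = cls j W d"
    using assms(1) unfolding germ_P_def by blast
  show thesis by (rule that[OF p V d germ_P_eqI[OF d c W(1,2) W(3)[symmetric]]])
qed

lemma germ_P_nonempty: "x \<in> topspace X \<Longrightarrow> c \<in> carrier (C j) \<Longrightarrow> germ_P j x c \<noteq> {}"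
  unfolding germ_P_def by (auto intro!: exI[of _ "topspace X"])

lemma germ_P_add_cong:
  assumes x: "x \<in> topspace X" and "c \<in> carrier (C j)" "c' \<in> carrier (C j)" "d \<in> carrier (C j)" "d' \<in> carrier (C j)"
    and "germ_P j x c = germ_P j x c'" "germ_P j x d = germ_P j x d'"
  shows "germ_P j x (c \<oplus>\<^bsub>C j\<^esub> d) = germ_P j x (c' \<oplus>\<^bsub>C j\<^esub> d')"
proof -
  interpret left_module R "C j" by (rule C_module)
  obtain W where W: "openin X W" "x \<in> W" "cls j W c = cls j W c'" using germ_P_eqD[OF x assms(2,3,6)] by blast
  obtain W' where W': "openin X W'" "x \<in> W'" "cls j W' d = cls j W' d'" using germ_P_eqD[OF x assms(4,5,7)] by blast
  have o: "openin X (W \<inter> W')" using W W' by blast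
  have "cls j (W \<inter> W') c = cls j (W \<inter> W') c'" by (rule cls_mono[OF W(1) o _ assms(2,3) W(3)]) simp
  moreover have "cls j (W \<inter> W') d = cls j (W \<inter> W') d'" by (rule cls_mono[OF W'(1) o _ assms(4,5) W'(3)]) simp
  ultimately have "cls j (W \<inter> W') (c \<oplus>\<^bsub>C j\<^esub> d) = cls j (W \<inter> W') (c' \<oplus>\<^bsub>C j\<^esub> d')"
    using assms(2-5) by (simp flip: cls_add)
  then show ?thesis using o W W' assms(2-5) by (intro germ_P_eqI[of _ _ _ "W \<inter> W'"]) auto
qed

abbreviation "stalk_P \<equiv> stalk X P"

lemma carrier_stalk_P: "x \<in> topspace X \<Longrightarrow> carrier (stalk_P j x) = germ_P j x ` carrier (C j)"
proof (intro equalityI subsetI)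
  fix a assume "x \<in> topspace X" "a \<in> carrier (stalk_P j x)"
  then obtain U c where "a = germ X P j x U (cls j U c)" "openin X U" "x \<in> U" "c \<in> carrier (C j)"
    by (auto simp: stalk_def carrier_sections_P)
  then show "a \<in> germ_P j x ` carrier (C j)" by (simp add: germ_cls)
next
  fix a assume x: "x \<in> topspace X" and "a \<in> germ_P j x ` carrier (C j)"
  then obtain c where c: "c \<in> carrier (C j)" "a = germ_P j x c" by blast
  then have "a = germ X P j x (topspace X) (cls j (topspace X) c)" using x by (simp add: germ_cls)
  then show "a \<in> carrier (stalk_P j x)" using x c by (auto simp: stalk_def carrier_sections_P)
qed

lemma stalk_P_zero: "x \<in> topspace X \<Longrightarrow> \<zero>\<^bsub>stalk_P j x\<^esub> = germ_P j x \<zero>\<^bsub>C j\<^esub>"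
proof -
  assume "x \<in> topspace X"
  interpret left_module R "C j" by (rule C_module)
  show ?thesis using \<open>x \<in> topspace X\<close> by (simp add: stalk_def sections_P_zero germ_cls)
qed

text \<open>Evaluates operations and maps on stalks, which are defined as unions over
  representatives: independence of the representative and nonemptiness of the germ suffice.\<close>

lemma UN_constant_on: "A \<noteq> {} \<Longrightarrow> (\<And>p. p \<in> A \<Longrightarrow> f p = k) \<Longrightarrow> (\<Union>p\<in>A. f p) = k"
  by auto

lemma stalk_P_add:
  assumes x: "x \<in> topspace X" and c: "c \<in> carrier (C j)" and d: "d \<in> carrier (C j)"
  shows "germ_P j x c \<oplus>\<^bsub>stalk_P j x\<^esub> germ_P j x d = germ_P j x (c \<oplus>\<^bsub>C j\<^esub> d)"
proof -
  interpret left_module R "C j" by (rule C_module)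
  have "(\<Union>(V, t)\<in>germ_P j x d. germ X P j x (U \<inter> V) (restr P j U (U \<inter> V) s \<oplus>\<^bsub>sections P j (U \<inter> V)\<^esub> restr P j V (U \<inter> V) t))
      = germ_P j x (c \<oplus>\<^bsub>C j\<^esub> d)" if p: "(U, s) \<in> germ_P j x c" for U s
  proof (rule UN_constant_on[OF germ_P_nonempty[OF x d]])
    obtain c' where U: "s = cls j U c'" "openin X U" "x \<in> U" and c': "c' \<in> carrier (C j)" "germ_P j x c' = germ_P j x c"
      using germ_P_mem[OF p c] by auto
    fix q assume q: "q \<in> germ_P j x d"
    obtain V d' where V: "q = (V, cls j V d')" "openin X V" "x \<in> V" and d': "d' \<in> carrier (C j)" "germ_P j x d' = germ_P j x d"
      using germ_P_mem[OF q d] by auto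
    have o: "openin X (U \<inter> V)" "x \<in> U \<inter> V" using U V by auto
    show "(case q of (V, t) \<Rightarrow> germ X P j x (U \<inter> V) (restr P j U (U \<inter> V) s \<oplus>\<^bsub>sections P j (U \<inter> V)\<^esub> restr P j V (U \<inter> V) t))
        = germ_P j x (c \<oplus>\<^bsub>C j\<^esub> d)"
      using c' d' o
      by (simp add: V(1) U(1) restr_cls[OF U(2) o(1)] restr_cls[OF V(2) o(1)] sections_P_add germ_cls
          germ_P_add_cong[OF x c'(1) c d'(1) d c'(2) d'(2)])
  qed
  then show ?thesis
    using germ_P_nonempty[OF x c] by (auto simp: stalk_def split: prod.splits)
qed

lemma stalk_map_germ_P:
  assumes x: "x \<in> topspace X" and g: "g \<in> linear_maps R (C j) (C (j + d))"
    and gN: "\<And>U h. openin X U \<Longrightarrow> h \<in> N j U \<Longrightarrow> g h \<in> N (j + d) U"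
    and f: "\<And>U. f j U = quotient_map_to (C (j + d)) (N (j + d) U) g" and c: "c \<in> carrier (C j)"
  shows "stalk_map X P d f j x (germ_P j x c) = germ_P (j + d) x (g c)"
  unfolding stalk_map_def
proof (rule UN_constant_on[OF germ_P_nonempty[OF x c]])
  fix p assume p: "p \<in> germ_P j x c"
  obtain U c' where U: "p = (U, cls j U c')" "openin X U" "x \<in> U" and c': "c' \<in> carrier (C j)" "germ_P j x c' = germ_P j x c"
    using germ_P_mem[OF p c] by auto
  obtain W where W: "openin X W" "x \<in> W" "cls j W c' = cls j W c" using germ_P_eqD[OF x c'(1) c c'(2)] by blast
  have gc: "g c \<in> carrier (C (j + d))" "g c' \<in> carrier (C (j + d))" using g c c'(1) by (auto simp: linear_maps_def)
  have m: "quotient_map_to (C (j + d)) (N (j + d) V) g (cls j V b) = cls (j + d) V (g b)"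
    if "openin X V" "b \<in> carrier (C j)" for V b
    by (rule cls_map[OF g gN[OF that(1)] that(2)])
  have "cls (j + d) W (g c') = cls (j + d) W (g c)"
    using m[OF W(1) c'(1)] m[OF W(1) c] W(3) by simp
  then have "germ_P (j + d) x (g c') = germ_P (j + d) x (g c)" by (rule germ_P_eqI[OF gc(2,1) W(1,2)])
  then show "(case p of (U, s) \<Rightarrow> germ X P (j + d) x U (f j U s)) = germ_P (j + d) x (g c)"
    using U gc by (simp add: f m[OF U(2) c'(1)] germ_cls)
qed

lemma stalk_P_smult:
  assumes x: "x \<in> topspace X" and c: "c \<in> carrier (C j)" and r: "r \<in> carrier R"
  shows "r \<odot>\<^bsub>stalk_P j x\<^esub> germ_P j x c = germ_P j x (r \<odot>\<^bsub>C j\<^esub> c)"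
proof -
  interpret left_module R "C j" by (rule C_module)
  have "(\<Union>(U, s)\<in>germ_P j x c. germ X P j x U (r \<odot>\<^bsub>sections P j U\<^esub> s)) = germ_P j x (r \<odot>\<^bsub>C j\<^esub> c)"
  proof (rule UN_constant_on[OF germ_P_nonempty[OF x c]])
    fix p assume p: "p \<in> germ_P j x c"
    obtain U c' where U: "p = (U, cls j U c')" "openin X U" "x \<in> U" and c': "c' \<in> carrier (C j)" "germ_P j x c' = germ_P j x c"
      using germ_P_mem[OF p c] by auto
    obtain W where W: "openin X W" "x \<in> W" "cls j W c' = cls j W c" using germ_P_eqD[OF x c'(1) c c'(2)] by blast
    have "cls j W (r \<odot>\<^bsub>C j\<^esub> c') = cls j W (r \<odot>\<^bsub>C j\<^esub> c)"
      using W(3) sections_P_smult[OF r c, of W] sections_P_smult[OF r c'(1), of W] by simp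
    then have "germ_P j x (r \<odot>\<^bsub>C j\<^esub> c') = germ_P j x (r \<odot>\<^bsub>C j\<^esub> c)"
      using W r c c'(1) by (intro germ_P_eqI[OF _ _ W(1,2)]) (auto intro: smult_closed)
    then show "(case p of (U, s) \<Rightarrow> germ X P j x U (r \<odot>\<^bsub>sections P j U\<^esub> s)) = germ_P j x (r \<odot>\<^bsub>C j\<^esub> c)"
      using U r c'(1) by (simp add: sections_P_smult germ_cls smult_closed)
  qed
  then show ?thesis by (simp add: stalk_def)
qed

section \<open>Sections and stalks of the sheafification\<close>

abbreviation "L \<equiv> sheafification X P"

text \<open>One global element for all points of \<open>W\<close> at once. Locally every section of
  the sheafification is of this kind.\<close>

definition represents :: "int \<Rightarrow> 'm \<Rightarrow> ('a \<Rightarrow> ('a set \<times> 'm set) set) \<Rightarrow> 'a set \<Rightarrow> bool" where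
  "represents j c f W \<longleftrightarrow> (\<forall>y\<in>W. f y = germ_P j y c)"

lemma sections_L_iff:
  assumes U: "openin X U"
  shows "f \<in> carrier (sections L j U) \<longleftrightarrow> f \<in> extensional U
    \<and> (\<forall>x\<in>U. \<exists>V. openin X V \<and> x \<in> V \<and> V \<subseteq> U \<and> (\<exists>c\<in>carrier (C j). represents j c f V))"
proof -
  have 1: "(\<exists>s. s \<in> carrier (sections P j V) \<and> (\<forall>y\<in>V. f y = germ X P j y V s))
    \<longleftrightarrow> (\<exists>c\<in>carrier (C j). represents j c f V)" if "openin X V" for V
    unfolding carrier_sections_P represents_def using germ_cls[OF that] by auto
  have "f \<in> carrier (sections L j U) \<longleftrightarrow> f \<in> (\<Pi>\<^sub>E x\<in>U. carrier (stalk_P j x))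
    \<and> (\<forall>x\<in>U. \<exists>V. openin X V \<and> x \<in> V \<and> V \<subseteq> U \<and> (\<exists>s. s \<in> carrier (sections P j V) \<and> (\<forall>y\<in>V. f y = germ X P j y V s)))"
    by (simp add: sheafification_def)
  also have "\<dots> \<longleftrightarrow> f \<in> (\<Pi>\<^sub>E x\<in>U. carrier (stalk_P j x))
    \<and> (\<forall>x\<in>U. \<exists>V. openin X V \<and> x \<in> V \<and> V \<subseteq> U \<and> (\<exists>c\<in>carrier (C j). represents j c f V))"
    by (simp add: 1 cong: conj_cong)
  also have "\<dots> \<longleftrightarrow> f \<in> extensional U
    \<and> (\<forall>x\<in>U. \<exists>V. openin X V \<and> x \<in> V \<and> V \<subseteq> U \<and> (\<exists>c\<in>carrier (C j). represents j c f V))"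
    (is "_ \<longleftrightarrow> _ \<and> ?local")
  proof (rule iffI; elim conjE; rule conjI)
    assume "f \<in> extensional U" and l: "?local"
    show "f \<in> (\<Pi>\<^sub>E x\<in>U. carrier (stalk_P j x))"
    proof (rule PiE_I)
      fix x assume x: "x \<in> U"
      then have "x \<in> topspace X" using openin_subset[OF U] by blast
      moreover obtain c where "c \<in> carrier (C j)" "f x = germ_P j x c"
        using bspec[OF l x] unfolding represents_def by blast
      ultimately show "f x \<in> carrier (stalk_P j x)" by (simp add: carrier_stalk_P)
    qed (use \<open>f \<in> extensional U\<close> in \<open>simp add: extensional_def\<close>)
  qed (assumption | simp add: PiE_def)+
  finally show ?thesis .
qed

lemma sections_L_ops:
  "\<zero>\<^bsub>sections L j U\<^esub> = (\<lambda>x\<in>U. \<zero>\<^bsub>stalk_P j x\<^esub>)"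
  "f \<oplus>\<^bsub>sections L j U\<^esub> g = (\<lambda>x\<in>U. f x \<oplus>\<^bsub>stalk_P j x\<^esub> g x)"
  "r \<odot>\<^bsub>sections L j U\<^esub> f = (\<lambda>x\<in>U. r \<odot>\<^bsub>stalk_P j x\<^esub> f x)"
  "restr L j U V f = restrict f V"
  by (simp_all add: sheafification_def)

lemma sections_L_germ:
  assumes "openin X U" "f \<in> carrier (sections L j U)" "x \<in> U"
  obtains c where "c \<in> carrier (C j)" "f x = germ_P j x c"
  using assms unfolding sections_L_iff[OF assms(1)] represents_def by blast

lemma sections_L_add:
  assumes U: "openin X U" and f: "f \<in> carrier (sections L j U)" and g: "g \<in> carrier (sections L j U)"
  shows "f \<oplus>\<^bsub>sections L j U\<^esub> g \<in> carrier (sections L j U)"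
  unfolding sections_L_iff[OF U]
proof (intro conjI ballI)
  interpret left_module R "C j" by (rule C_module)
  fix x assume x: "x \<in> U"
  obtain V c where V: "openin X V" "x \<in> V" "V \<subseteq> U" "c \<in> carrier (C j)" "represents j c f V"
    using f x unfolding sections_L_iff[OF U] by blast
  obtain V' d where V': "openin X V'" "x \<in> V'" "V' \<subseteq> U" "d \<in> carrier (C j)" "represents j d g V'"
    using g x unfolding sections_L_iff[OF U] by blast
  have "represents j (c \<oplus>\<^bsub>C j\<^esub> d) (f \<oplus>\<^bsub>sections L j U\<^esub> g) (V \<inter> V')"
    unfolding represents_def
  proof
    fix y assume y: "y \<in> V \<inter> V'"
    then have "y \<in> topspace X" "y \<in> U" using openin_subset[OF V(1)] V(3) by auto
    then show "(f \<oplus>\<^bsub>sections L j U\<^esub> g) y = germ_P j y (c \<oplus>\<^bsub>C j\<^esub> d)"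
      using y V(4,5) V'(4,5) by (simp add: sections_L_ops represents_def stalk_P_add)
  qed
  moreover have "openin X (V \<inter> V')" "x \<in> V \<inter> V'" "V \<inter> V' \<subseteq> U" "c \<oplus>\<^bsub>C j\<^esub> d \<in> carrier (C j)"
    using V V' by auto
  ultimately show "\<exists>V. openin X V \<and> x \<in> V \<and> V \<subseteq> U \<and> (\<exists>c\<in>carrier (C j). represents j c (f \<oplus>\<^bsub>sections L j U\<^esub> g) V)"
    by blast
qed (simp add: sections_L_ops)

text \<open>The germ of the section \<open>germ_P j _ c\<close> of the sheafification.\<close>

definition germ_L :: "int \<Rightarrow> 'a \<Rightarrow> 'm \<Rightarrow> ('a set \<times> ('a \<Rightarrow> ('a set \<times> 'm set) set)) set" where
  "germ_L j x c = {(V, t). openin X V \<and> x \<in> V \<and> t \<in> carrier (sections L j V)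
     \<and> (\<exists>W. openin X W \<and> x \<in> W \<and> W \<subseteq> V \<and> represents j c t W)}"

text \<open>Sections are locally given by global elements, so the stalks of the sheafification are
  again parametrized by \<open>C j\<close>. Computations on them are done with such
  representatives.\<close>

lemma germ_eq_germ_L:
  assumes U: "openin X U" "x \<in> U" and s: "s \<in> carrier (sections L j U)"
    and W: "openin X W" "x \<in> W" "W \<subseteq> U" "represents j c s W"
  shows "germ X L j x U s = germ_L j x c"
proof (intro equalityI subsetI)
  fix p assume "p \<in> germ X L j x U s"
  then obtain V t W' where p: "p = (V, t)" and V: "openin X V" "x \<in> V" "t \<in> carrier (sections L j V)"
    and W': "openin X W'" "x \<in> W'" "W' \<subseteq> U \<inter> V" "restrict s W' = restrict t W'"
    unfolding germ_def sections_L_ops by blast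
  have "s y = t y" if "y \<in> W'" for y using fun_cong[OF W'(4), of y] that by simp
  then have "represents j c t (W \<inter> W')" using W(4) by (auto simp: represents_def)
  moreover have "openin X (W \<inter> W')" "x \<in> W \<inter> W'" "W \<inter> W' \<subseteq> V" using W W' by auto
  ultimately show "p \<in> germ_L j x c" unfolding germ_L_def p using V by blast
next
  fix p assume "p \<in> germ_L j x c"
  then obtain V t W' where p: "p = (V, t)" and V: "openin X V" "x \<in> V" "t \<in> carrier (sections L j V)"
    and W': "openin X W'" "x \<in> W'" "W' \<subseteq> V" "represents j c t W'"
    unfolding germ_L_def by blast
  have "restrict s (W \<inter> W') = restrict t (W \<inter> W')"
    by (rule restrict_ext) (use W(4) W'(4) in \<open>simp add: represents_def\<close>)
  moreover have "openin X (W \<inter> W')" "x \<in> W \<inter> W'" "W \<inter> W' \<subseteq> U \<inter> V" using W W' by auto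
  ultimately show "p \<in> germ X L j x U s" unfolding germ_def sections_L_ops p using V by blast
qed

lemma const_section:
  assumes U: "openin X U" and c: "c \<in> carrier (C j)"
  shows "(\<lambda>y\<in>U. germ_P j y c) \<in> carrier (sections L j U)" "represents j c (\<lambda>y\<in>U. germ_P j y c) U"
  unfolding sections_L_iff[OF U] represents_def using U c by auto

lemma germ_L_mem:
  assumes "p \<in> germ_L j x c"
  obtains V t W where "p = (V, t)" "openin X V" "x \<in> V" "t \<in> carrier (sections L j V)"
    "openin X W" "x \<in> W" "W \<subseteq> V" "represents j c t W"
  using assms unfolding germ_L_def by blast

lemma germ_L_nonempty: "x \<in> topspace X \<Longrightarrow> c \<in> carrier (C j) \<Longrightarrow> germ_L j x c \<noteq> {}"
  using const_section[OF openin_topspace, of c j] unfolding germ_L_def by blast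

lemma carrier_stalk_L:
  assumes x: "x \<in> topspace X"
  shows "carrier (stalk X L j x) = germ_L j x ` carrier (C j)"
proof (intro equalityI subsetI)
  fix a assume "a \<in> carrier (stalk X L j x)"
  then obtain U s where a: "a = germ X L j x U s" and U: "openin X U" "x \<in> U" and s: "s \<in> carrier (sections L j U)"
    by (auto simp: stalk_def)
  obtain V c where V: "openin X V" "x \<in> V" "V \<subseteq> U" "c \<in> carrier (C j)" "represents j c s V"
    using s U unfolding sections_L_iff[OF U(1)] by blast
  have "a = germ_L j x c" unfolding a by (rule germ_eq_germ_L[OF U s V(1-3,5)])
  then show "a \<in> germ_L j x ` carrier (C j)" using V(4) by blast
next
  fix a assume "a \<in> germ_L j x ` carrier (C j)"
  then obtain c where c: "c \<in> carrier (C j)" "a = germ_L j x c" by blast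
  note k = const_section[OF openin_topspace c(1)]
  have "a = germ X L j x (topspace X) (\<lambda>y\<in>topspace X. germ_P j y c)"
    unfolding c(2) by (rule germ_eq_germ_L[OF _ x k(1) _ x _ k(2), symmetric]) auto
  then show "a \<in> carrier (stalk X L j x)" using x k(1) by (auto simp: stalk_def)
qed

lemma stalk_L_zero:
  assumes x: "x \<in> topspace X"
  shows "\<zero>\<^bsub>stalk X L j x\<^esub> = germ_L j x \<zero>\<^bsub>C j\<^esub>"
proof -
  interpret left_module R "C j" by (rule C_module)
  have "\<zero>\<^bsub>sections L j (topspace X)\<^esub> = (\<lambda>y\<in>topspace X. germ_P j y \<zero>\<^bsub>C j\<^esub>)"
    unfolding sections_L_ops by (rule restrict_ext) (simp add: stalk_P_zero)
  moreover have "\<zero>\<^bsub>stalk X L j x\<^esub> = germ X L j x (topspace X) \<zero>\<^bsub>sections L j (topspace X)\<^esub>"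
    by (simp add: stalk_def)
  ultimately show ?thesis
    using germ_eq_germ_L[OF openin_topspace x const_section(1)[OF openin_topspace M.zero_closed] openin_topspace x order_refl
        const_section(2)[OF openin_topspace M.zero_closed]] by simp
qed

lemma restr_section:
  assumes "openin X U" "openin X V" "V \<subseteq> U" "f \<in> carrier (sections L j U)"
  shows "restrict f V \<in> carrier (sections L j V)"
  unfolding sections_L_iff[OF assms(2)]
proof (intro conjI ballI)
  fix x assume x: "x \<in> V"
  then have "x \<in> U" using assms(3) by blast
  then obtain W c where W: "openin X W" "x \<in> W" "W \<subseteq> U" "c \<in> carrier (C j)" "represents j c f W"
    using assms(4) unfolding sections_L_iff[OF assms(1)] by blast
  have "represents j c (restrict f V) (W \<inter> V)" using W(5) by (auto simp: represents_def)
  moreover have "openin X (W \<inter> V)" "x \<in> W \<inter> V" "W \<inter> V \<subseteq> V" using W x assms(2) by auto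
  ultimately show "\<exists>W. openin X W \<and> x \<in> W \<and> W \<subseteq> V \<and> (\<exists>c\<in>carrier (C j). represents j c (restrict f V) W)"
    using W(4) by blast
qed simp

lemma stalk_L_add:
  assumes x: "x \<in> topspace X" and c: "c \<in> carrier (C j)" and d: "d \<in> carrier (C j)"
  shows "germ_L j x c \<oplus>\<^bsub>stalk X L j x\<^esub> germ_L j x d = germ_L j x (c \<oplus>\<^bsub>C j\<^esub> d)"
proof -
  have "(\<Union>(V, t)\<in>germ_L j x d. germ X L j x (U \<inter> V) (restr L j U (U \<inter> V) s \<oplus>\<^bsub>sections L j (U \<inter> V)\<^esub> restr L j V (U \<inter> V) t))
      = germ_L j x (c \<oplus>\<^bsub>C j\<^esub> d)" if p: "(U, s) \<in> germ_L j x c" for U s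
  proof (rule UN_constant_on[OF germ_L_nonempty[OF x d]])
    obtain W where U: "openin X U" "x \<in> U" "s \<in> carrier (sections L j U)"
      and W: "openin X W" "x \<in> W" "W \<subseteq> U" "represents j c s W"
      using p unfolding germ_L_def by blast
    fix q assume q: "q \<in> germ_L j x d"
    obtain V t W' where V: "q = (V, t)" "openin X V" "x \<in> V" "t \<in> carrier (sections L j V)"
      and W': "openin X W'" "x \<in> W'" "W' \<subseteq> V" "represents j d t W'"
      by (rule germ_L_mem[OF q])
    have o: "openin X (U \<inter> V)" using U V by auto
    let ?s = "restrict s (U \<inter> V) \<oplus>\<^bsub>sections L j (U \<inter> V)\<^esub> restrict t (U \<inter> V)"
    have sec: "?s \<in> carrier (sections L j (U \<inter> V))"
      by (intro sections_L_add[OF o] restr_section[OF U(1) o] restr_section[OF V(2) o]) (use U V in auto)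
    have "germ X L j x (U \<inter> V) ?s = germ_L j x (c \<oplus>\<^bsub>C j\<^esub> d)"
    proof (rule germ_eq_germ_L[OF o _ sec, of x "W \<inter> W'"])
      show "represents j (c \<oplus>\<^bsub>C j\<^esub> d) ?s (W \<inter> W')"
        unfolding represents_def
      proof
        fix y assume y: "y \<in> W \<inter> W'"
        then have "y \<in> topspace X" "y \<in> U" "y \<in> V" using openin_subset[OF W(1)] W(3) W'(3) by auto
        then show "?s y = germ_P j y (c \<oplus>\<^bsub>C j\<^esub> d)"
          using y W(4) W'(4) c d by (simp add: sections_L_ops represents_def stalk_P_add)
      qed
    qed (use U V W W' in auto)
    then show "(case q of (V, t) \<Rightarrow> germ X L j x (U \<inter> V) (restr L j U (U \<inter> V) s \<oplus>\<^bsub>sections L j (U \<inter> V)\<^esub> restr L j V (U \<inter> V) t))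
        = germ_L j x (c \<oplus>\<^bsub>C j\<^esub> d)"
      by (simp add: V(1) sections_L_ops(4))
  qed
  then show ?thesis
    using germ_L_nonempty[OF x c] by (auto simp: stalk_def split: prod.splits)
qed

lemma germ_L_eqI:
  assumes W: "openin X W" "x \<in> W" and "\<And>y. y \<in> W \<Longrightarrow> germ_P j y c = germ_P j y d"
  shows "germ_L j x c = germ_L j x d"
proof -
  have "germ_L j x c \<subseteq> germ_L j x d" if eq: "\<And>y. y \<in> W \<Longrightarrow> germ_P j y c = germ_P j y d" for c d
  proof
    fix p assume p: "p \<in> germ_L j x c"
    obtain V t W' where V: "p = (V, t)" "openin X V" "x \<in> V" "t \<in> carrier (sections L j V)"
      and W': "openin X W'" "x \<in> W'" "W' \<subseteq> V" "represents j c t W'"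
      by (rule germ_L_mem[OF p])
    have "represents j d t (W \<inter> W')" using W'(4) eq by (auto simp: represents_def)
    moreover have "openin X (W \<inter> W')" "x \<in> W \<inter> W'" "W \<inter> W' \<subseteq> V" using W W' by auto
    ultimately show "p \<in> germ_L j x d" unfolding germ_L_def V(1) using V(2-4) by blast
  qed
  from this[of c d] this[of d c] assms(3) show ?thesis by fastforce
qed

text \<open>An element of \<open>N j W\<close> has zero class over \<open>W\<close>. This is how a
  condition on supports becomes vanishing on a stalk.\<close>

lemma germ_L_zeroI:
  assumes W: "openin X W" "x \<in> W" and c: "c \<in> N j W"
  shows "germ_L j x c = germ_L j x \<zero>\<^bsub>C j\<^esub>"
proof (rule germ_L_eqI[OF W])
  interpret left_module R "C j" by (rule C_module)
  fix y assume y: "y \<in> W"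
  have cc: "c \<in> carrier (C j)" using c N_subset by blast
  have "cls j W c = cls j W (c \<oplus>\<^bsub>C j\<^esub> \<zero>\<^bsub>C j\<^esub>)" using cc by simp
  also have "\<dots> = cls j W \<zero>\<^bsub>C j\<^esub>" by (rule cls_absorb[OF c]) simp
  finally show "germ_P j y c = germ_P j y \<zero>\<^bsub>C j\<^esub>" by (intro germ_P_eqI[OF cc _ W(1) y]) auto
qed

text \<open>\<open>germ_L\<close> maps \<open>C j\<close> onto the stalk and respects the
  operations, so the group axioms are inherited from \<open>C j\<close>.\<close>

lemma stalk_L_additive:
  assumes x: "x \<in> topspace X"
  shows "additive_map (C j) (stalk X L j x) (germ_L j x)"
proof -
  interpret C: left_module R "C j" by (rule C_module)
  have surj: "\<exists>c\<in>carrier (C j). a = germ_L j x c" if "a \<in> carrier (stalk X L j x)" for a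
    using that carrier_stalk_L[OF x] by blast
  have mem: "germ_L j x c \<in> carrier (stalk X L j x)" if "c \<in> carrier (C j)" for c
    using that carrier_stalk_L[OF x] by blast
  have "abelian_group (stalk X L j x)"
  proof (rule abelian_groupI)
    fix a b c assume "a \<in> carrier (stalk X L j x)" "b \<in> carrier (stalk X L j x)" "c \<in> carrier (stalk X L j x)"
    then obtain a' b' c' where "a = germ_L j x a'" "b = germ_L j x b'" "c = germ_L j x c'"
      "a' \<in> carrier (C j)" "b' \<in> carrier (C j)" "c' \<in> carrier (C j)" using surj by meson
    then show "a \<oplus>\<^bsub>stalk X L j x\<^esub> b \<oplus>\<^bsub>stalk X L j x\<^esub> c = a \<oplus>\<^bsub>stalk X L j x\<^esub> (b \<oplus>\<^bsub>stalk X L j x\<^esub> c)"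
      by (simp add: stalk_L_add[OF x] C.a_assoc)
  next
    fix a b assume "a \<in> carrier (stalk X L j x)" "b \<in> carrier (stalk X L j x)"
    then obtain a' b' where ab: "a = germ_L j x a'" "b = germ_L j x b'" "a' \<in> carrier (C j)" "b' \<in> carrier (C j)"
      using surj by meson
    then show "a \<oplus>\<^bsub>stalk X L j x\<^esub> b \<in> carrier (stalk X L j x)" by (simp add: stalk_L_add[OF x] mem)
    show "a \<oplus>\<^bsub>stalk X L j x\<^esub> b = b \<oplus>\<^bsub>stalk X L j x\<^esub> a" using ab by (simp add: stalk_L_add[OF x] C.a_comm)
  next
    fix a assume "a \<in> carrier (stalk X L j x)"
    then obtain a' where a: "a = germ_L j x a'" "a' \<in> carrier (C j)" using surj by meson
    then show "\<zero>\<^bsub>stalk X L j x\<^esub> \<oplus>\<^bsub>stalk X L j x\<^esub> a = a" by (simp add: stalk_L_zero[OF x] stalk_L_add[OF x])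
    show "\<exists>b\<in>carrier (stalk X L j x). b \<oplus>\<^bsub>stalk X L j x\<^esub> a = \<zero>\<^bsub>stalk X L j x\<^esub>"
      by (rule bexI[of _ "germ_L j x (\<ominus>\<^bsub>C j\<^esub> a')"]) (use a in \<open>simp_all add: mem stalk_L_zero[OF x] stalk_L_add[OF x] C.l_neg\<close>)
  qed (simp add: stalk_L_zero[OF x] mem)
  then show ?thesis
    by (intro additive_map.intro additive_map_axioms.intro C.abelian_group_axioms)
       (auto simp: additive_def mem stalk_L_add[OF x])
qed

section \<open>Maps of the sheafification induced by maps of global elements\<close>

definition graded_map :: "int \<Rightarrow> (int \<Rightarrow> 'm \<Rightarrow> 'm) \<Rightarrow> bool" where
  "graded_map d g \<longleftrightarrow> (\<forall>j. g j \<in> linear_maps R (C j) (C (j + d)))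
    \<and> (\<forall>j U h. openin X U \<longrightarrow> h \<in> N j U \<longrightarrow> g j h \<in> N (j + d) U)"

definition presheaf_map :: "int \<Rightarrow> (int \<Rightarrow> 'm \<Rightarrow> 'm) \<Rightarrow> int \<Rightarrow> 'a set \<Rightarrow> 'm set \<Rightarrow> 'm set" where
  "presheaf_map d g j U = quotient_map_to (C (j + d)) (N (j + d) U) (g j)"

text \<open>The same formula as for the differential of \<open>sheafification\<close>, so that by
  \<open>differential_L\<close> the boundary is treated like the operators and the homotopy.\<close>

definition sheaf_map where
  "sheaf_map d g j U f = (\<lambda>x\<in>U. stalk_map X P d (presheaf_map d g) j x (f x))"

lemma stalk_presheaf_map:
  assumes "graded_map d g" "x \<in> topspace X" "c \<in> carrier (C j)"
  shows "stalk_map X P d (presheaf_map d g) j x (germ_P j x c) = germ_P (j + d) x (g j c)"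
  by (rule stalk_map_germ_P) (use assms in \<open>auto simp: graded_map_def presheaf_map_def\<close>)

lemma graded_map_closed: "graded_map d g \<Longrightarrow> c \<in> carrier (C j) \<Longrightarrow> g j c \<in> carrier (C (j + d))"
  by (auto simp: graded_map_def linear_maps_def)

lemma represents_sheaf_map:
  assumes g: "graded_map d g" and W: "W \<subseteq> U" "W \<subseteq> topspace X" and c: "c \<in> carrier (C j)" "represents j c f W"
  shows "represents (j + d) (g j c) (sheaf_map d g j U f) W"
  unfolding represents_def
proof
  fix y assume y: "y \<in> W"
  then have "f y = germ_P j y c" using c(2) by (simp add: represents_def)
  then show "sheaf_map d g j U f y = germ_P (j + d) y (g j c)"
    using stalk_presheaf_map[OF g _ c(1), of y] y W by (auto simp: sheaf_map_def)
qed

lemma sheaf_map_closed: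
  assumes g: "graded_map d g" and U: "openin X U" and f: "f \<in> carrier (sections L j U)"
  shows "sheaf_map d g j U f \<in> carrier (sections L (j + d) U)"
  unfolding sections_L_iff[OF U]
proof (intro conjI ballI)
  fix x assume "x \<in> U"
  then obtain V c where V: "openin X V" "x \<in> V" "V \<subseteq> U" "c \<in> carrier (C j)" "represents j c f V"
    using f unfolding sections_L_iff[OF U] by blast
  then show "\<exists>V. openin X V \<and> x \<in> V \<and> V \<subseteq> U \<and> (\<exists>c\<in>carrier (C (j + d)). represents (j + d) c (sheaf_map d g j U f) V)"
    using represents_sheaf_map[OF g V(3) openin_subset[OF V(1)] V(4,5)] graded_map_closed[OF g V(4)] by blast
qed (simp add: sheaf_map_def)

lemma graded_endomorphism_sheaf_map:
  assumes g: "graded_map d g"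
  shows "graded_endomorphism R X L d (sheaf_map d g)"
  unfolding graded_endomorphism_def
proof (intro conjI allI impI ballI)
  fix j U assume U: "openin X U"
  interpret left_module R "C j" by (rule C_module)
  have lin: "g j \<in> linear_maps R (C j) (C (j + d))" using g by (simp add: graded_map_def)
  show "sheaf_map d g j U \<in> linear_maps R (sections L j U) (sections L (j + d) U)"
    unfolding linear_maps_def
  proof (intro CollectI conjI ballI funcsetI)
    fix f assume f: "f \<in> carrier (sections L j U)"
    show "sheaf_map d g j U f \<in> carrier (sections L (j + d) U)" by (rule sheaf_map_closed[OF g U f])
    show "sheaf_map d g j U (f \<oplus>\<^bsub>sections L j U\<^esub> f') = sheaf_map d g j U f \<oplus>\<^bsub>sections L (j + d) U\<^esub> sheaf_map d g j U f'"
      if f': "f' \<in> carrier (sections L j U)" for f'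
      unfolding sections_L_ops(2)[where j="j + d"] unfolding sheaf_map_def
    proof (rule restrict_ext)
      fix x assume x: "x \<in> U"
      then have xt: "x \<in> topspace X" using openin_subset[OF U] by blast
      obtain c where c: "c \<in> carrier (C j)" "f x = germ_P j x c" by (rule sections_L_germ[OF U f x])
      obtain c' where c': "c' \<in> carrier (C j)" "f' x = germ_P j x c'" by (rule sections_L_germ[OF U f' x])
      have gl: "g j (c \<oplus>\<^bsub>C j\<^esub> c') = g j c \<oplus>\<^bsub>C (j + d)\<^esub> g j c'" using lin c(1) c'(1) by (simp add: linear_maps_def)
      show "stalk_map X P d (presheaf_map d g) j x ((f \<oplus>\<^bsub>sections L j U\<^esub> f') x)
        = (\<lambda>x\<in>U. stalk_map X P d (presheaf_map d g) j x (f x)) x \<oplus>\<^bsub>stalk_P (j + d) x\<^esub> (\<lambda>x\<in>U. stalk_map X P d (presheaf_map d g) j x (f' x)) x"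
        using x c c' by (simp add: sections_L_ops stalk_P_add[OF xt] stalk_presheaf_map[OF g xt] gl graded_map_closed[OF g])
    qed
  next
    fix r f assume r: "r \<in> carrier R" and f: "f \<in> carrier (sections L j U)"
    show "sheaf_map d g j U (r \<odot>\<^bsub>sections L j U\<^esub> f) = r \<odot>\<^bsub>sections L (j + d) U\<^esub> sheaf_map d g j U f"
      unfolding sections_L_ops(3)[where j="j + d"] unfolding sheaf_map_def
    proof (rule restrict_ext)
      fix x assume x: "x \<in> U"
      then have xt: "x \<in> topspace X" using openin_subset[OF U] by blast
      obtain c where c: "c \<in> carrier (C j)" "f x = germ_P j x c" by (rule sections_L_germ[OF U f x])
      have gl: "g j (r \<odot>\<^bsub>C j\<^esub> c) = r \<odot>\<^bsub>C (j + d)\<^esub> g j c" using lin c(1) r by (simp add: linear_maps_def)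
      show "stalk_map X P d (presheaf_map d g) j x ((r \<odot>\<^bsub>sections L j U\<^esub> f) x)
        = r \<odot>\<^bsub>stalk_P (j + d) x\<^esub> (\<lambda>x\<in>U. stalk_map X P d (presheaf_map d g) j x (f x)) x"
        using x c r by (simp add: sections_L_ops stalk_P_smult[OF xt] stalk_presheaf_map[OF g xt] gl graded_map_closed[OF g] smult_closed)
    qed
  qed
next
  fix j U V f assume UV: "openin X U \<and> openin X V \<and> V \<subseteq> U"
  show "restr L (j + d) U V (sheaf_map d g j U f) = sheaf_map d g j V (restr L j U V f)"
    unfolding sections_L_ops sheaf_map_def by (rule ext) (use UV in auto)
qed

lemma stalk_sheaf_map:
  assumes g: "graded_map d g" and x: "x \<in> topspace X" and c: "c \<in> carrier (C j)"
  shows "stalk_map X L d (sheaf_map d g) j x (germ_L j x c) = germ_L (j + d) x (g j c)"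
  unfolding stalk_map_def
proof (rule UN_constant_on[OF germ_L_nonempty[OF x c]])
  fix p assume p: "p \<in> germ_L j x c"
  obtain V t W where V: "p = (V, t)" "openin X V" "x \<in> V" "t \<in> carrier (sections L j V)"
      and W: "openin X W" "x \<in> W" "W \<subseteq> V" "represents j c t W"
    by (rule germ_L_mem[OF p])
  have "germ X L (j + d) x V (sheaf_map d g j V t) = germ_L (j + d) x (g j c)"
    by (rule germ_eq_germ_L[OF V(2,3) sheaf_map_closed[OF g V(2,4)] W(1-3)
        represents_sheaf_map[OF g W(3) openin_subset[OF W(1)] c W(4)]])
  then show "(case p of (U, s) \<Rightarrow> germ X L (j + d) x U (sheaf_map d g j U s)) = germ_L (j + d) x (g j c)"
    by (simp add: V(1))
qed

end

section \<open>Homotopical fineness\<close>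

context intersection_setting
begin

abbreviation chains_off :: "int \<Rightarrow> 'a set \<Rightarrow> ('a, 'e) coeff_chain set" where
  "chains_off i U \<equiv> intersection_chains_in X N F p G i (topspace X - X closure_of U)"

lemma chains_off_iff:
  "\<xi> \<in> chains_off i U \<longleftrightarrow> \<xi> \<in> carrier (IC i) \<and> support i \<xi> \<subseteq> topspace X - X closure_of U"
  by (simp add: intersection_chains_in_def)

lemma support_zero: "support i \<zero>\<^bsub>IC i\<^esub> = {}"
proof (cases "i < 0")
  case False
  then obtain n where "i = int n" using nonneg_eq_int[of i] by auto
  then show ?thesis by (simp add: support_nat csimp_zero)
qed (simp add: support_neg)

lemma support_add: "support i (\<xi> \<oplus>\<^bsub>IC i\<^esub> \<eta>) \<subseteq> support i \<xi> \<union> support i \<eta>"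
proof (cases "i < 0")
  case False
  then obtain n where "i = int n" using nonneg_eq_int[of i] by auto
  then show ?thesis using csimp_add[of n \<xi> \<eta>] by (simp add: support_nat) blast
qed (simp add: support_neg)

lemma support_smult: "r \<in> carrier R \<Longrightarrow> support i (r \<odot>\<^bsub>IC i\<^esub> \<xi>) \<subseteq> support i \<xi>"
proof (cases "i < 0")
  case False
  assume r: "r \<in> carrier R"
  from False obtain n where "i = int n" using nonneg_eq_int[of i] by auto
  then show ?thesis using csimp_smult[OF r, of n \<xi>] by (simp add: support_nat) blast
qed (simp add: support_neg)

sublocale IS: quotient_presheaf X R "\<lambda>j. IC (int N - j)" "\<lambda>j. chains_off (int N - j)" "IS_presheaf X N F p G"
proof (rule quotient_presheaf.intro)
  fix j U
  interpret left_module R "IC (int N - j)" by (rule IC_left_module)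
  show "left_module R (IC (int N - j))" by (rule IC_left_module)
  show "chains_off (int N - j) U \<subseteq> carrier (IC (int N - j))" by (auto simp: chains_off_iff)
  show "\<zero>\<^bsub>IC (int N - j)\<^esub> \<in> chains_off (int N - j) U"
    unfolding chains_off_iff using support_zero[of "int N - j"] M.zero_closed by auto
  show "x \<oplus>\<^bsub>IC (int N - j)\<^esub> y \<in> chains_off (int N - j) U"
    if "x \<in> chains_off (int N - j) U" "y \<in> chains_off (int N - j) U" for x y
    using that support_add[of "int N - j" x y] M.a_closed unfolding chains_off_iff by blast
  show "r \<odot>\<^bsub>IC (int N - j)\<^esub> x \<in> chains_off (int N - j) U"
    if "r \<in> carrier R" "x \<in> chains_off (int N - j) U" for r x
    using that support_smult[of r "int N - j" x] smult_closed unfolding chains_off_iff by blast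
  show "chains_off (int N - j) U \<subseteq> chains_off (int N - j) V" if "V \<subseteq> U" for V
    using closure_of_mono[OF that, of X] unfolding chains_off_iff subset_iff by blast
qed (simp_all add: IS_presheaf_def Let_def)

text \<open>Sheaf degree \<open>j\<close> is chain degree \<open>int N - j\<close>, so a map of
  degree \<open>d\<close> lowers the chain degree by \<open>d\<close>. As supports do not grow,
  chains off a set stay off it.\<close>

lemma graded_mapI:
  assumes "\<And>i. g i \<in> linear_maps R (IC i) (IC (i - d))"
    and "\<And>i \<xi>. \<xi> \<in> carrier (IC i) \<Longrightarrow> support (i - d) (g i \<xi>) \<subseteq> support i \<xi>"
  shows "IS.graded_map d (\<lambda>j. g (int N - j))"
proof -
  have "g (int N - j) h \<in> chains_off (int N - (j + d)) U" if h: "h \<in> chains_off (int N - j) U" for j U h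
  proof -
    have hc: "h \<in> carrier (IC (int N - j))" "support (int N - j) h \<subseteq> topspace X - X closure_of U"
      using h unfolding chains_off_iff by auto
    show ?thesis
      using assms(2)[OF hc(1)] hc(2) linear_maps_closed[OF assms(1) hc(1)]
      unfolding chains_off_iff diff_diff_eq by blast
  qed
  then show ?thesis unfolding IS.graded_map_def using assms(1)[of "int N - _"] by (simp add: diff_diff_eq)
qed

lemma differential_L:
  "differential IS.L = (\<lambda>j U. IS.sheaf_map 1 (\<lambda>j. boundary_map (int N - j)) j U)"
proof -
  have "differential (IS_presheaf X N F p G) = IS.presheaf_map 1 (\<lambda>j. boundary_map (int N - j))"
    by (intro ext) (simp add: IS_presheaf_def Let_def IS.presheaf_map_def)
  then show ?thesis by (intro ext) (simp add: sheafification_def IS.sheaf_map_def)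
qed

theorem homotopically_fine_IS_sheaf: "homotopically_fine TYPE('i) R X (IS_sheaf X N F p G)"
  unfolding homotopically_fine_def IS_sheaf_def
proof (intro allI impI)
  fix I :: "'i set" and U
  assume cover: "locally_finite_open_cover X I U"
  have U: "\<And>k. k \<in> I \<Longrightarrow> openin X (U k)" "(\<Union>k\<in>I. U k) = topspace X"
    using cover by (auto simp: locally_finite_open_cover_def)
  obtain E :: "'i set \<Rightarrow> int \<Rightarrow> ('a, 'e) coeff_chain \<Rightarrow> ('a, 'e) coeff_chain"
    and H :: "int \<Rightarrow> ('a, 'e) coeff_chain \<Rightarrow> ('a, 'e) coeff_chain"
  where E: "\<And>Q i. E Q i \<in> linear_maps R (IC i) (IC i)"
    and H: "\<And>i. H i \<in> linear_maps R (IC i) (IC (i + 1))"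
    and E_support: "\<And>Q i \<xi>. \<xi> \<in> carrier (IC i) \<Longrightarrow> support i (E Q i \<xi>) \<subseteq> support i \<xi>"
    and H_support: "\<And>i \<xi>. \<xi> \<in> carrier (IC i) \<Longrightarrow> support (i + 1) (H i \<xi>) \<subseteq> support i \<xi>"
    and E_U: "\<And>Q i \<xi>. \<xi> \<in> carrier (IC i) \<Longrightarrow> support i (E Q i \<xi>) \<subseteq> (\<Union>l\<in>Q \<inter> I. U l)"
    and E_Un: "\<And>Q Q' i \<xi>. \<xi> \<in> carrier (IC i) \<Longrightarrow> Q \<inter> Q' = {} \<Longrightarrow> E (Q \<union> Q') i \<xi> = E Q i \<xi> \<oplus>\<^bsub>IC i\<^esub> E Q' i \<xi>"
    and homotopy: "\<And>i \<xi>. \<xi> \<in> carrier (IC i) \<Longrightarrow>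
          \<xi> = E UNIV i \<xi> \<oplus>\<^bsub>IC i\<^esub> (boundary_map (i + 1) (H i \<xi>) \<oplus>\<^bsub>IC i\<^esub> H (i - 1) (boundary_map i \<xi>))"
    using subdivision_homotopy[of I U, OF U] by blast
  define e where "e = (\<lambda>k. IS.sheaf_map 0 (\<lambda>j. E {k} (int N - j)))"
  define D where "D = IS.sheaf_map (-1) (\<lambda>j. H (int N - j))"
  have gE: "IS.graded_map 0 (\<lambda>j. E {k} (int N - j))" for k
    by (rule graded_mapI) (use E E_support in simp_all)
  have gH: "IS.graded_map (-1) (\<lambda>j. H (int N - j))"
    by (rule graded_mapI) (use H H_support in simp_all)
  have gB: "IS.graded_map 1 (\<lambda>j. boundary_map (int N - j))"
    by (rule graded_mapI[OF boundary_linear support_boundary])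
  have stalk_e: "stalk_map X IS.L 0 (e k) j x (IS.germ_L j x \<xi>) = IS.germ_L j x (E {k} (int N - j) \<xi>)"
    if "x \<in> topspace X" "\<xi> \<in> carrier (IC (int N - j))" for k j x \<xi>
    using IS.stalk_sheaf_map[OF gE that] by (simp add: e_def)
  have stalk_D: "stalk_map X IS.L (-1) D j x (IS.germ_L j x \<xi>) = IS.germ_L (j - 1) x (H (int N - j) \<xi>)"
    if "x \<in> topspace X" "\<xi> \<in> carrier (IC (int N - j))" for j x \<xi>
    using IS.stalk_sheaf_map[OF gH that] by (simp add: D_def)
  have stalk_B: "stalk_map X IS.L 1 (differential IS.L) j x (IS.germ_L j x \<xi>)
      = IS.germ_L (j + 1) x (boundary_map (int N - j) \<xi>)"
    if "x \<in> topspace X" "\<xi> \<in> carrier (IC (int N - j))" for j x \<xi>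
    using IS.stalk_sheaf_map[OF gB that] by (simp add: differential_L)
  \<comment> \<open>The support of the image lies in the union of the \<open>U k\<close> with
    \<open>k\<close> in \<open>Q\<close>, however many they are. These sets are open, so if they
    miss \<open>W\<close> they miss its closure, and the chain is zero over
    \<open>W\<close>.\<close>
  have vanish: "IS.germ_L j x (E Q (int N - j) \<xi>) = \<zero>\<^bsub>stalk X IS.L j x\<^esub>"
    if W: "openin X W" "x \<in> W" "\<And>k. k \<in> Q \<inter> I \<Longrightarrow> U k \<inter> W = {}" and \<xi>: "\<xi> \<in> carrier (IC (int N - j))"
    for j x \<xi> Q W
  proof -
    have x: "x \<in> topspace X" using W(1,2) openin_subset by blast
    have "U k \<inter> X closure_of W = {}" if k: "k \<in> Q \<inter> I" for k
      using W(3)[OF k] U(1)[of k] k by (simp add: openin_Int_closure_of_eq_empty)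
    then have "(\<Union>l\<in>Q \<inter> I. U l) \<subseteq> topspace X - X closure_of W"
      using U(2) by blast
    then have "E Q (int N - j) \<xi> \<in> chains_off (int N - j) W"
      unfolding chains_off_iff using E_U[OF \<xi>, of Q] linear_maps_closed[OF E \<xi>, of Q] by blast
    from IS.germ_L_zeroI[OF W(1,2) this] show ?thesis by (simp add: IS.stalk_L_zero[OF x])
  qed
  show "\<exists>e D. (\<forall>k\<in>I. graded_endomorphism R X IS.L 0 (e k)) \<and> graded_endomorphism R X IS.L (-1) D
        \<and> (\<forall>k\<in>I. \<forall>j. \<forall>x\<in>topspace X - X closure_of U k. \<forall>a\<in>carrier (stalk X IS.L j x).
              stalk_map X IS.L 0 (e k) j x a = \<zero>\<^bsub>stalk X IS.L j x\<^esub>)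
        \<and> (\<forall>j. \<forall>x\<in>topspace X. \<forall>a\<in>carrier (stalk X IS.L j x).
              finsum (stalk X IS.L j x) (\<lambda>k. stalk_map X IS.L 0 (e k) j x a) {k \<in> I. x \<in> X closure_of U k}
              = a \<ominus>\<^bsub>stalk X IS.L j x\<^esub>
                  stalk_map X IS.L 1 (differential IS.L) (j - 1) x (stalk_map X IS.L (-1) D j x a)
                \<ominus>\<^bsub>stalk X IS.L j x\<^esub>
                  stalk_map X IS.L (-1) D (j + 1) x (stalk_map X IS.L 1 (differential IS.L) j x a))"
  proof (intro exI[of _ e] exI[of _ D] conjI ballI allI)
    show "graded_endomorphism R X IS.L 0 (e k)" for k
      unfolding e_def by (rule IS.graded_endomorphism_sheaf_map[OF gE])
    show "graded_endomorphism R X IS.L (-1) D"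
      unfolding D_def by (rule IS.graded_endomorphism_sheaf_map[OF gH])
  next
    fix k j x a
    assume k: "k \<in> I" and x: "x \<in> topspace X - X closure_of U k" and "a \<in> carrier (stalk X IS.L j x)"
    then obtain \<xi> where \<xi>: "\<xi> \<in> carrier (IC (int N - j))" "a = IS.germ_L j x \<xi>"
      using IS.carrier_stalk_L[of x j] by auto
    \<comment> \<open>The complement of the closure is the open neighbourhood of \<open>x\<close> to
      which \<open>vanish\<close> is applied.\<close>
    have "U k \<inter> (topspace X - X closure_of U k) = {}"
      using closure_of_subset[OF openin_subset[OF U(1)[OF k]]] by blast
    then show "stalk_map X IS.L 0 (e k) j x a = \<zero>\<^bsub>stalk X IS.L j x\<^esub>"
      using vanish[of "topspace X - X closure_of U k" x "{k}" \<xi> j] stalk_e[of x \<xi> j k] x \<xi> by (simp add: openin_diff)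
  next
    fix j x a
    assume x: "x \<in> topspace X" and "a \<in> carrier (stalk X IS.L j x)"
    then obtain \<xi> where \<xi>: "\<xi> \<in> carrier (IC (int N - j))" and a: "a = IS.germ_L j x \<xi>"
      using IS.carrier_stalk_L[of x j] by auto
    define i where "i = int N - j"
    define K where "K = {k \<in> I. x \<in> X closure_of U k}"
    interpret g: additive_map "IC i" "stalk X IS.L j x" "IS.germ_L j x"
      unfolding i_def by (rule IS.stalk_L_additive[OF x])
    note \<xi>' = \<xi>[folded i_def]
    have Ec: "E Q i \<xi> \<in> carrier (IC i)" for Q by (rule linear_maps_closed[OF E \<xi>'])
    obtain V where V: "openin X V" "x \<in> V" "finite {k \<in> I. U k \<inter> V \<noteq> {}}"
      using cover x unfolding locally_finite_open_cover_def by blast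
    define J where "J = {k \<in> I. U k \<inter> V \<noteq> {}}"
    have KJ: "K \<subseteq> J"
    proof
      fix k assume "k \<in> K"
      then have k: "k \<in> I" "x \<in> X closure_of U k" by (auto simp: K_def)
      have "V \<inter> U k \<noteq> {}" using k(2) V(1,2) unfolding in_closure_of by blast
      then show "k \<in> J" using k(1) by (auto simp: J_def)
    qed
    then have finK: "finite K" using V(3) finite_subset J_def by blast
    \<comment> \<open>The finitely many closures belonging to \<open>J - K\<close> do not contain
      \<open>x\<close> and can be cut away. Then \<open>W\<close> meets \<open>U k\<close> only for
      \<open>k\<close> in \<open>K\<close>.\<close>
    define W where "W = V - (\<Union>k\<in>J - K. X closure_of U k)"
    have W: "openin X W" "x \<in> W"
    proof -
      have "closedin X (\<Union>k\<in>J - K. X closure_of U k)"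
        by (rule closedin_Union) (use V(3) in \<open>auto simp: J_def\<close>)
      then show "openin X W" unfolding W_def using V(1) by (rule openin_diff[rotated])
      show "x \<in> W" using V(2) by (auto simp: W_def K_def J_def)
    qed
    have off: "IS.germ_L j x (E (- K) i \<xi>) = \<zero>\<^bsub>stalk X IS.L j x\<^esub>"
      unfolding i_def
    proof (rule vanish[OF W _ \<xi>])
      fix k assume k: "k \<in> - K \<inter> I"
      show "U k \<inter> W = {}"
      proof (cases "k \<in> J")
        case True
        then show ?thesis using k closure_of_subset[OF openin_subset[OF U(1)[of k]]] by (auto simp: W_def)
      next
        case False
        then show ?thesis using k by (auto simp: W_def J_def)
      qed
    qed
    \<comment> \<open>Additivity in disjoint label sets; the empty label set has zero germ by
      \<open>vanish\<close>, as no member of the covering is involved.\<close>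
    have sum: "finsum (stalk X IS.L j x) (\<lambda>k. IS.germ_L j x (E {k} i \<xi>)) Q = IS.germ_L j x (E Q i \<xi>)" if "finite Q" for Q
      using that
    proof (induction Q rule: finite_induct)
      case empty
      have "IS.germ_L j x (E {} i \<xi>) = \<zero>\<^bsub>stalk X IS.L j x\<^esub>"
        unfolding i_def by (rule vanish[OF W _ \<xi>]) simp
      then show ?case by simp
    next
      case (insert k Q)
      have "E (insert k Q) i \<xi> = E {k} i \<xi> \<oplus>\<^bsub>IC i\<^esub> E Q i \<xi>"
        using E_Un[OF \<xi>', of "{k}" Q] insert.hyps(2) by simp
      then show ?case
        using insert by (simp add: g.N.finsum_insert Ec g.plus del: IC_ops)
    qed
    define b where "b = boundary_map (i + 1) (H i \<xi>)"
    define h where "h = H (i - 1) (boundary_map i \<xi>)"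
    have Hc: "H i \<xi> \<in> carrier (IC (i + 1))" by (rule linear_maps_closed[OF H \<xi>'])
    have Bc: "boundary_map i \<xi> \<in> carrier (IC (i - 1))" by (rule linear_maps_closed[OF boundary_linear \<xi>'])
    have bc: "b \<in> carrier (IC i)"
      using linear_maps_closed[OF boundary_linear Hc] by (simp add: b_def)
    have hc: "h \<in> carrier (IC i)"
      using linear_maps_closed[OF H Bc] by (simp add: h_def)
    have deg: "int N - (j - 1) = i + 1" "int N - (j + 1) = i - 1" "int N - j = i" by (simp_all add: i_def)
    have "stalk_map X IS.L 1 (differential IS.L) (j - 1) x (stalk_map X IS.L (-1) D j x a) = IS.germ_L j x b"
      using stalk_B[OF x, of "H i \<xi>" "j - 1"] stalk_D[OF x \<xi>] Hc unfolding deg by (simp add: a b_def)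
    moreover have "stalk_map X IS.L (-1) D (j + 1) x (stalk_map X IS.L 1 (differential IS.L) j x a) = IS.germ_L j x h"
      using stalk_D[OF x, of "boundary_map i \<xi>" "j + 1"] stalk_B[OF x \<xi>] Bc unfolding deg by (simp add: a h_def)
    moreover have "stalk_map X IS.L 0 (e k) j x a = IS.germ_L j x (E {k} i \<xi>)" for k
      unfolding a i_def by (rule stalk_e[OF x \<xi>])
    moreover have "IS.germ_L j x \<xi> = IS.germ_L j x (E K i \<xi>) \<oplus>\<^bsub>stalk X IS.L j x\<^esub>
        (IS.germ_L j x b \<oplus>\<^bsub>stalk X IS.L j x\<^esub> IS.germ_L j x h)"
    proof -
      \<comment> \<open>All labels outside \<open>K\<close> die at \<open>x\<close> together,
        without being summed one by one. This turns the operator of all labels into the finite sum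
        over \<open>K\<close>.\<close>
      have "E UNIV i \<xi> = E K i \<xi> \<oplus>\<^bsub>IC i\<^esub> E (- K) i \<xi>" using E_Un[OF \<xi>', of K "- K"] by simp
      then have "IS.germ_L j x (E UNIV i \<xi>) = IS.germ_L j x (E K i \<xi>)"
        using off Ec by (simp add: g.plus del: IC_ops)
      moreover have "IS.germ_L j x \<xi> = IS.germ_L j x (E UNIV i \<xi> \<oplus>\<^bsub>IC i\<^esub> (b \<oplus>\<^bsub>IC i\<^esub> h))"
        using homotopy[OF \<xi>'] by (simp only: b_def h_def)
      ultimately show ?thesis
        using Ec bc hc by (simp add: g.plus del: IC_ops)
    qed
    moreover have "s = (s \<oplus>\<^bsub>stalk X IS.L j x\<^esub> (t \<oplus>\<^bsub>stalk X IS.L j x\<^esub> u)) \<ominus>\<^bsub>stalk X IS.L j x\<^esub> t \<ominus>\<^bsub>stalk X IS.L j x\<^esub> u"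
      if "s \<in> carrier (stalk X IS.L j x)" "t \<in> carrier (stalk X IS.L j x)" "u \<in> carrier (stalk X IS.L j x)" for s t u
    proof -
      define v where "v = t \<oplus>\<^bsub>stalk X IS.L j x\<^esub> u"
      have v: "v \<in> carrier (stalk X IS.L j x)" using that by (simp add: v_def)
      have "(s \<oplus>\<^bsub>stalk X IS.L j x\<^esub> v) \<ominus>\<^bsub>stalk X IS.L j x\<^esub> t \<ominus>\<^bsub>stalk X IS.L j x\<^esub> u
          = (s \<oplus>\<^bsub>stalk X IS.L j x\<^esub> v) \<ominus>\<^bsub>stalk X IS.L j x\<^esub> v"
        using that v unfolding a_minus_def by (subst (3) v_def) (simp add: g.N.minus_add g.N.a_assoc)
      also have "\<dots> = s" using that v by (simp add: a_minus_def g.N.a_assoc g.N.r_neg)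
      finally show ?thesis by (simp add: v_def)
    qed
    ultimately show "finsum (stalk X IS.L j x) (\<lambda>k. stalk_map X IS.L 0 (e k) j x a) {k \<in> I. x \<in> X closure_of U k}
        = a \<ominus>\<^bsub>stalk X IS.L j x\<^esub>
            stalk_map X IS.L 1 (differential IS.L) (j - 1) x (stalk_map X IS.L (-1) D j x a)
          \<ominus>\<^bsub>stalk X IS.L j x\<^esub>
            stalk_map X IS.L (-1) D (j + 1) x (stalk_map X IS.L 1 (differential IS.L) j x a)"
      using sum[OF finK] Ec bc hc by (simp add: a flip: K_def)
  qed
qed

end

theorem proposition3p5:
  fixes X :: "'a topology" and n :: nat and F :: "int \<Rightarrow> 'a set" and p :: "nat \<Rightarrow> int"
    and R :: "'r ring" and G :: "('a, 'e, 'r) local_system"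
  assumes "Hausdorff_space X"
    and "filtered_space X n F"
    and "traditional_perversity p \<or> superperversity p"
    and "ring R"
    and "local_coefficient_system R (subtopology X (regular_part X n F)) G"
  shows "homotopically_fine TYPE('i) R X (IS_sheaf X n F p G)"
proof -
  interpret intersection_setting X n F p R G by (rule intersection_setting.intro) (fact assms)+
  show ?thesis by (rule homotopically_fine_IS_sheaf)
qed

end
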